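(* Let $\mathbb{K}$ be an algebraically closed field of characteristic zero, and let $X$ be a normal variety over $\mathbb{K}$ with finitely generated Cox ring. Then for every open subset $U \subseteq X$ the algebra $\Gamma(U,\mathcal{O})$ of regular functions on $U$ is a finitely generated $\mathbb{K}$-algebra.
   Context: Conventions: $\mathbb{K}$ is an algebraically closed field of characteristic zero; varieties are irreducible varieties over $\mathbb{K}$; $\mathcal{O}$ is the structure sheaf of $X$. Cox ring: let $X$ be a normal variety with finitely generated divisor class group $\mathrm{Cl}(X)$ and only constant invertible global functions, $\Gamma(X,\mathcal{O})^*=\mathbb{K}^*$. Choose a finitely generated subgroup $K$ of the group $\mathrm{WDiv}(X)$ of Weil divisors such that the projection $c\colon K \to \mathrm{Cl}(X)$ is surjective, and let $K^0 = \ker(c)$. Let $\mathcal{S} := \bigoplus_{D\in K}\mathcal{S}_D$ with $\mathcal{S}_D := \mathcal{O}_X(D)$ be the associated sheaf of divisorial $\mathcal{O}_X$-algebras, where for open $W \subseteq X$ the sections $\Gamma(W,\mathcal{O}_X(D))$ are $0$ and the nonzero rational functions $f$ with $(\mathrm{div}(f)+D)|_W \ge 0$, and multiplication of homogeneous sections is multiplication in $\mathbb{K}(X)$. Fix a homomorphism $\chi\colon K^0 \to \mathbb{K}(X)^*$ with $\mathrm{div}(\chi(E)) = E$ for all $E \in K^0$, and let $\mathcal{I}\subseteq\mathcal{S}$ be the sheaf of ideals locally generated by the sections $1-\chi(E)$, $E\in K^0$, where $\chi(E)$ is regarded as homogeneous of degree $-E$. The Cox sheaf is $\mathcal{R} :=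 \mathcal{S}/\mathcal{I}$ with projection $p\colon\mathcal{S}\to\mathcal{R}$, graded by $\mathrm{Cl}(X)$ via $\mathcal{R}_{[D]} := p\big(\bigoplus_{D'\in c^{-1}([D])}\mathcal{S}_{D'}\big)$. The Cox ring is $\mathcal{R}(X) := \Gamma(X,\mathcal{R})$; up to isomorphism it does not depend on the choices of $K$ and $\chi$. A normal variety "has finitely generated Cox ring" if its divisor class group is finitely generated, its invertible global functions are constant (so that the Cox ring is defined), and its Cox ring is finitely generated as a $\mathbb{K}$-algebra. *)

theory Defs
  imports
    "HOL-Analysis.Abstract_Topology"
    "HOL-Algebra.Free_Abelian_Groups"
    "HOL-Algebra.Generated_Groups"
    "HOL-Algebra.Generated_Rings"
    "HOL-Algebra.QuotRing"
    "HOL-Computational_Algebra.Polynomial"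
begin

section \<open>Spaces with functions\<close>

text \<open>
  Varieties are taken in the classical sense: a topological space together with a sheaf of
  \<open>'k\<close>-valued functions that is locally isomorphic to an affine variety. A section over an open
  set \<open>U\<close> is a function that is \<^term>\<open>undefined\<close> outside \<open>U\<close> (membership in
  \<^term>\<open>extensional U\<close>), so that sections over \<open>U\<close> are equal iff they agree on \<open>U\<close>. The values
  of \<open>reg\<close> at non-open sets are irrelevant.
\<close>

record ('x, 'k) fun_space =
  pts :: "'x topology"
  reg :: "'x set \<Rightarrow> ('x \<Rightarrow> 'k) set"

definition space_with_functions :: "('x, 'k::field) fun_space \<Rightarrow> bool" where
  "space_with_functions X \<longleftrightarrow>
     (\<forall>U. openin (pts X) U \<longrightarrow>
        reg X U \<subseteq> extensional U \<and>
        (\<forall>c. restrict (\<lambda>x. c) U \<in> reg X U) \<and>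
        (\<forall>f\<in>reg X U. \<forall>g\<in>reg X U.
           restrict (\<lambda>x. f x + g x) U \<in> reg X U \<and> restrict (\<lambda>x. f x * g x) U \<in> reg X U) \<and>
        (\<forall>V f. openin (pts X) V \<and> V \<subseteq> U \<and> f \<in> reg X U \<longrightarrow> restrict f V \<in> reg X V) \<and>
        (\<forall>f\<in>extensional U.
           (\<forall>x\<in>U. \<exists>V. openin (pts X) V \<and> x \<in> V \<and> V \<subseteq> U \<and> restrict f V \<in> reg X V)
             \<longrightarrow> f \<in> reg X U))"

definition space_morphism ::
    "('x, 'k) fun_space \<Rightarrow> ('y, 'k) fun_space \<Rightarrow> ('x \<Rightarrow> 'y) \<Rightarrow> bool" where
  "space_morphism X Y \<phi> \<longleftrightarrow>
     continuous_map (pts X) (pts Y) \<phi> \<and>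
     (\<forall>V. openin (pts Y) V \<longrightarrow> (\<forall>f\<in>reg Y V.
        restrict (\<lambda>x. f (\<phi> x)) {x\<in>topspace (pts X). \<phi> x \<in> V}
          \<in> reg X {x\<in>topspace (pts X). \<phi> x \<in> V}))"

definition spaces_isomorphic :: "('x, 'k) fun_space \<Rightarrow> ('y, 'k) fun_space \<Rightarrow> bool" where
  "spaces_isomorphic X Y \<longleftrightarrow>
     (\<exists>\<phi> \<psi>. space_morphism X Y \<phi> \<and> space_morphism Y X \<psi> \<and>
        (\<forall>x\<in>topspace (pts X). \<psi> (\<phi> x) = x) \<and> (\<forall>y\<in>topspace (pts Y). \<phi> (\<psi> y) = y))"

definition open_subspace :: "('x, 'k) fun_space \<Rightarrow> 'x set \<Rightarrow> ('x, 'k) fun_space" where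
  "open_subspace X U = \<lparr>pts = subtopology (pts X) U, reg = reg X\<rparr>"


section \<open>Affine varieties\<close>

definition affine_space :: "nat \<Rightarrow> (nat \<Rightarrow> 'k) set" where
  "affine_space n = ({..<n} \<rightarrow>\<^sub>E UNIV)"

text \<open>Over an infinite field these functions are the same as polynomials in \<open>n\<close> variables.\<close>

inductive_set poly_functions :: "nat \<Rightarrow> ((nat \<Rightarrow> 'k::field) \<Rightarrow> 'k) set" for n where
  poly_const: "(\<lambda>x. c) \<in> poly_functions n"
| poly_coord: "i < n \<Longrightarrow> (\<lambda>x. x i) \<in> poly_functions n"
| poly_add: "p \<in> poly_functions n \<Longrightarrow> q \<in> poly_functions n \<Longrightarrow> (\<lambda>x. p x + q x) \<in> poly_functions n"
| poly_mult: "p \<in> poly_functions n \<Longrightarrow> q \<in> poly_functions n \<Longrightarrow> (\<lambda>x. p x * q x) \<in> poly_functions n"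

definition zero_locus :: "nat \<Rightarrow> ((nat \<Rightarrow> 'k::field) \<Rightarrow> 'k) set \<Rightarrow> (nat \<Rightarrow> 'k) set" where
  "zero_locus n S = {x\<in>affine_space n. \<forall>p\<in>S. p x = 0}"

definition zariski_topology :: "nat \<Rightarrow> (nat \<Rightarrow> 'k::field) topology" where
  "zariski_topology n =
     topology_generated_by {affine_space n - zero_locus n S | S. S \<subseteq> poly_functions n}"

definition affine_model :: "nat \<Rightarrow> (nat \<Rightarrow> 'k::field) set \<Rightarrow> (nat \<Rightarrow> 'k, 'k) fun_space" where
  "affine_model n Z =
     \<lparr>pts = subtopology (zariski_topology n) Z,
      reg = (\<lambda>U. {f\<in>extensional U. \<forall>x\<in>U. \<exists>W p q.
               openin (subtopology (zariski_topology n) Z) W \<and> x \<in> W \<and> W \<subseteq> U \<and>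
               p \<in> poly_functions n \<and> q \<in> poly_functions n \<and>
               (\<forall>y\<in>W. q y \<noteq> 0 \<and> f y = p y / q y)})\<rparr>"

definition affine :: "('x, 'k::field) fun_space \<Rightarrow> bool" where
  "affine X \<longleftrightarrow>
     (\<exists>n S. S \<subseteq> poly_functions n \<and> spaces_isomorphic X (affine_model n (zero_locus n S)))"


section \<open>Varieties\<close>

definition affine_open :: "('x, 'k::field) fun_space \<Rightarrow> 'x set \<Rightarrow> bool" where
  "affine_open X U \<longleftrightarrow> openin (pts X) U \<and> affine (open_subspace X U)"

definition prevariety :: "('x, 'k::field) fun_space \<Rightarrow> bool" where
  "prevariety X \<longleftrightarrow>
     space_with_functions X \<and>
     (\<exists>\<U>. finite \<U> \<and> (\<forall>U\<in>\<U>. affine_open X U) \<and> \<Union>\<U> = topspace (pts X))"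

text \<open>
  The topology of the product prevariety \<open>X \<times> X\<close> (not the product topology): it is generated by
  the sets where a function \<open>\<Sum>\<^sub>i f\<^sub>i(x) g\<^sub>i(y)\<close> on \<open>U \<times> V\<close> does not vanish, where \<open>U\<close>, \<open>V\<close> are affine
  open and \<open>f\<^sub>i\<close>, \<open>g\<^sub>i\<close> are regular on \<open>U\<close>, \<open>V\<close>.
\<close>

definition square_topology :: "('x, 'k::field) fun_space \<Rightarrow> ('x \<times> 'x) topology" where
  "square_topology X = topology_generated_by
     {{(x, y). x \<in> U \<and> y \<in> V \<and> (\<Sum>i<m. f i x * g i y) \<noteq> 0} | U V f g (m::nat).
        affine_open X U \<and> affine_open X V \<and> (\<forall>i<m. f i \<in> reg X U \<and> g i \<in> reg X V)}"

definition separated :: "('x, 'k::field) fun_space \<Rightarrow> bool" where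
  "separated X \<longleftrightarrow> closedin (square_topology X) {(x, x) | x. x \<in> topspace (pts X)}"

definition irreducible_space :: "'x topology \<Rightarrow> bool" where
  "irreducible_space T \<longleftrightarrow>
     topspace T \<noteq> {} \<and>
     (\<forall>A B. closedin T A \<and> closedin T B \<and> A \<union> B = topspace T
        \<longrightarrow> A = topspace T \<or> B = topspace T)"

definition variety :: "('x, 'k::field) fun_space \<Rightarrow> bool" where
  "variety X \<longleftrightarrow> prevariety X \<and> separated X \<and> irreducible_space (pts X)"


section \<open>Algebras of regular functions\<close>

definition regular_ring :: "('x, 'k::field) fun_space \<Rightarrow> 'x set \<Rightarrow> ('x \<Rightarrow> 'k) ring" where
  "regular_ring X U =
     \<lparr>carrier = reg X U,
      monoid.mult = (\<lambda>f g. restrict (\<lambda>x. f x * g x) U),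
      one = restrict (\<lambda>x. 1) U,
      zero = restrict (\<lambda>x. 0) U,
      add = (\<lambda>f g. restrict (\<lambda>x. f x + g x) U)\<rparr>"

definition regular_const :: "'x set \<Rightarrow> 'k \<Rightarrow> 'x \<Rightarrow> 'k" where
  "regular_const U c = restrict (\<lambda>x. c) U"

text \<open>A \<open>'k\<close>-algebra is given by a ring \<open>R\<close> and its structure map \<open>\<iota>\<close> from \<open>'k\<close>.\<close>

definition fin_gen_algebra :: "('a, 'b) ring_scheme \<Rightarrow> ('k \<Rightarrow> 'a) \<Rightarrow> bool" where
  "fin_gen_algebra R \<iota> \<longleftrightarrow>
     (\<exists>S. finite S \<and> S \<subseteq> carrier R \<and> generate_ring R (range \<iota> \<union> S) = carrier R)"

definition fin_gen_group :: "('a, 'b) monoid_scheme \<Rightarrow> bool" where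
  "fin_gen_group G \<longleftrightarrow> (\<exists>S. finite S \<and> S \<subseteq> carrier G \<and> generate G S = carrier G)"

definition only_constant_units :: "('x, 'k::field) fun_space \<Rightarrow> bool" where
  "only_constant_units X \<longleftrightarrow>
     Units (regular_ring X (topspace (pts X))) = regular_const (topspace (pts X)) ` (UNIV - {0})"


section \<open>The function field and normality\<close>

text \<open>Rational functions are classes of pairs \<open>(U, f)\<close>, with \<open>(U, f) \<sim> (V, g)\<close> iff \<open>f = g\<close> on
  \<open>U \<inter> V\<close>.\<close>

type_synonym ('x, 'k) ratfun = "('x set \<times> ('x \<Rightarrow> 'k)) set"

definition rat_pairs :: "('x, 'k::field) fun_space \<Rightarrow> ('x set \<times> ('x \<Rightarrow> 'k)) set" where
  "rat_pairs X = {(U, f). openin (pts X) U \<and> U \<noteq> {} \<and> f \<in> reg X U}"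

definition rat_rel ::
    "('x, 'k::field) fun_space \<Rightarrow> (('x set \<times> ('x \<Rightarrow> 'k)) \<times> ('x set \<times> ('x \<Rightarrow> 'k))) set" where
  "rat_rel X =
     {((U, f), (V, g)). (U, f) \<in> rat_pairs X \<and> (V, g) \<in> rat_pairs X \<and> (\<forall>x\<in>U \<inter> V. f x = g x)}"

definition rat_class ::
    "('x, 'k::field) fun_space \<Rightarrow> 'x set \<Rightarrow> ('x \<Rightarrow> 'k) \<Rightarrow> ('x, 'k) ratfun" where
  "rat_class X U f = rat_rel X `` {(U, restrict f U)}"

definition rat_const :: "('x, 'k::field) fun_space \<Rightarrow> 'k \<Rightarrow> ('x, 'k) ratfun" where
  "rat_const X c = rat_class X (topspace (pts X)) (\<lambda>x. c)"

definition function_field :: "('x, 'k::field) fun_space \<Rightarrow> ('x, 'k) ratfun ring" where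
  "function_field X =
     \<lparr>carrier = rat_pairs X // rat_rel X,
      monoid.mult = (\<lambda>a b. \<Union>(U, f)\<in>a. \<Union>(V, g)\<in>b. rat_class X (U \<inter> V) (\<lambda>x. f x * g x)),
      one = rat_const X 1,
      zero = rat_const X 0,
      add = (\<lambda>a b. \<Union>(U, f)\<in>a. \<Union>(V, g)\<in>b. rat_class X (U \<inter> V) (\<lambda>x. f x + g x))\<rparr>"

text \<open>The local ring of \<open>X\<close> along an irreducible closed subset \<open>Y\<close>, as a subring of the function
  field; \<open>Y = {x}\<close> gives the stalk of the structure sheaf at the point \<open>x\<close>.\<close>

definition local_ring :: "('x, 'k::field) fun_space \<Rightarrow> 'x set \<Rightarrow> ('x, 'k) ratfun ring" where
  "local_ring X Y = (function_field X)
     \<lparr>carrier := {a\<in>carrier (function_field X). \<exists>(U, f)\<in>a. U \<inter> Y \<noteq> {}}\<rparr>"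

definition integrally_closed_in :: "('a, 'b) ring_scheme \<Rightarrow> 'a set \<Rightarrow> bool" where
  "integrally_closed_in F A \<longleftrightarrow>
     (\<forall>f\<in>carrier F. \<forall>(n::nat) a.
        (\<forall>i<n. a i \<in> A) \<and>
        f [^]\<^bsub>F\<^esub> n \<oplus>\<^bsub>F\<^esub> (\<Oplus>\<^bsub>F\<^esub>i\<in>{..<n}. a i \<otimes>\<^bsub>F\<^esub> f [^]\<^bsub>F\<^esub> i) = \<zero>\<^bsub>F\<^esub>
        \<longrightarrow> f \<in> A)"

definition normal_variety :: "('x, 'k::field) fun_space \<Rightarrow> bool" where
  "normal_variety X \<longleftrightarrow>
     variety X \<and>
     (\<forall>x\<in>topspace (pts X). integrally_closed_in (function_field X) (carrier (local_ring X {x})))"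


section \<open>Weil divisors and the divisor class group\<close>

definition prime_divisors :: "('x, 'k::field) fun_space \<Rightarrow> 'x set set" where
  "prime_divisors X =
     {Y. closedin (pts X) Y \<and> irreducible_space (subtopology (pts X) Y) \<and> Y \<noteq> topspace (pts X) \<and>
         (\<forall>Z. closedin (pts X) Z \<and> irreducible_space (subtopology (pts X) Z) \<and> Y \<subseteq> Z
            \<longrightarrow> Z = Y \<or> Z = topspace (pts X))}"

text \<open>
  On a normal variety the local ring along a prime divisor is a discrete valuation ring, and
  \<open>ord_at X Y f\<close> is the \<open>n\<close> with \<open>f = u t\<^sup>n\<close>, \<open>u\<close> a unit and \<open>t\<close> a uniformizer, i.e. a generator
  of the ideal of non-units.
\<close>

definition ord_at :: "('x, 'k::field) fun_space \<Rightarrow> 'x set \<Rightarrow> ('x, 'k) ratfun \<Rightarrow> int" where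
  "ord_at X Y f = (THE n. \<exists>u t.
     u \<in> Units (local_ring X Y) \<and> t \<in> carrier (local_ring X Y) \<and>
     PIdl\<^bsub>local_ring X Y\<^esub> t = carrier (local_ring X Y) - Units (local_ring X Y) \<and>
     f = u \<otimes>\<^bsub>function_field X\<^esub> t [^]\<^bsub>function_field X\<^esub> n)"

definition WDiv :: "('x, 'k::field) fun_space \<Rightarrow> ('x set \<Rightarrow>\<^sub>0 int) monoid" where
  "WDiv X = free_Abelian_group (prime_divisors X)"

text \<open>A nonzero rational function on a normal variety has nonzero order along only finitely many
  prime divisors, so that \<^const>\<open>Abs_poly_mapping\<close> is applied to a finitely supported function.\<close>

definition principal_div :: "('x, 'k::field) fun_space \<Rightarrow> ('x, 'k) ratfun \<Rightarrow> 'x set \<Rightarrow>\<^sub>0 int" where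
  "principal_div X f = Abs_poly_mapping (\<lambda>Y. if Y \<in> prime_divisors X then ord_at X Y f else 0)"

definition PDiv :: "('x, 'k::field) fun_space \<Rightarrow> ('x set \<Rightarrow>\<^sub>0 int) set" where
  "PDiv X = principal_div X ` (carrier (function_field X) - {\<zero>\<^bsub>function_field X\<^esub>})"

definition class_group :: "('x, 'k::field) fun_space \<Rightarrow> ('x set \<Rightarrow>\<^sub>0 int) set monoid" where
  "class_group X = WDiv X Mod PDiv X"

definition div_class :: "('x, 'k::field) fun_space \<Rightarrow> ('x set \<Rightarrow>\<^sub>0 int) \<Rightarrow> ('x set \<Rightarrow>\<^sub>0 int) set" where
  "div_class X D = PDiv X #>\<^bsub>WDiv X\<^esub> D"

text \<open>\<open>\<Gamma>(W, \<O>(D))\<close>; only meaningful for nonempty open \<open>W\<close>.\<close>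

definition div_sections ::
    "('x, 'k::field) fun_space \<Rightarrow> 'x set \<Rightarrow> ('x set \<Rightarrow>\<^sub>0 int) \<Rightarrow> ('x, 'k) ratfun set" where
  "div_sections X W D = {f\<in>carrier (function_field X).
     f = \<zero>\<^bsub>function_field X\<^esub> \<or>
     (\<forall>Y\<in>prime_divisors X. Y \<inter> W \<noteq> {} \<longrightarrow> Poly_Mapping.lookup (principal_div X f + D) Y \<ge> 0)}"


section \<open>The Cox sheaf and the Cox ring\<close>

text \<open>
  Elements of \<open>\<Oplus>\<^bsub>D\<in>K\<^esub> \<Gamma>(W, \<O>(D))\<close> are finitely supported families of rational functions indexed
  by divisors, vanishing at divisors outside \<open>K\<close>. Since the components are rational functions,
  the restriction maps between nonempty open sets are inclusions.
\<close>

type_synonym ('x, 'k) div_family = "('x set \<Rightarrow>\<^sub>0 int) \<Rightarrow> ('x, 'k) ratfun"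

definition family_support ::
    "('x, 'k::field) fun_space \<Rightarrow> ('x, 'k) div_family \<Rightarrow> ('x set \<Rightarrow>\<^sub>0 int) set" where
  "family_support X s = {D. s D \<noteq> \<zero>\<^bsub>function_field X\<^esub>}"

definition homogeneous ::
    "('x, 'k::field) fun_space \<Rightarrow> ('x set \<Rightarrow>\<^sub>0 int) \<Rightarrow> ('x, 'k) ratfun \<Rightarrow> ('x, 'k) div_family" where
  "homogeneous X D f = (\<lambda>D'. if D' = D then f else \<zero>\<^bsub>function_field X\<^esub>)"

definition family_ring ::
    "('x, 'k::field) fun_space \<Rightarrow> ('x, 'k) div_family set \<Rightarrow> ('x, 'k) div_family ring" where
  "family_ring X A =
     \<lparr>carrier = A,
      monoid.mult = (\<lambda>s t D. \<Oplus>\<^bsub>function_field X\<^esub>E\<in>family_support X s.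
                s E \<otimes>\<^bsub>function_field X\<^esub> t (D - E)),
      one = homogeneous X 0 \<one>\<^bsub>function_field X\<^esub>,
      zero = (\<lambda>D. \<zero>\<^bsub>function_field X\<^esub>),
      add = (\<lambda>s t D. s D \<oplus>\<^bsub>function_field X\<^esub> t D)\<rparr>"

definition div_algebra ::
    "('x, 'k::field) fun_space \<Rightarrow> ('x set \<Rightarrow>\<^sub>0 int) set \<Rightarrow> 'x set \<Rightarrow> ('x, 'k) div_family ring" where
  "div_algebra X K W = family_ring X
     {s. finite (family_support X s) \<and> family_support X s \<subseteq> K \<and>
         (\<forall>D\<in>K. s D \<in> div_sections X W D)}"

definition div_stalk ::
    "('x, 'k::field) fun_space \<Rightarrow> ('x set \<Rightarrow>\<^sub>0 int) set \<Rightarrow> 'x \<Rightarrow> ('x, 'k) div_family ring" where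
  "div_stalk X K x =
     family_ring X (\<Union>W\<in>{W. openin (pts X) W \<and> x \<in> W}. carrier (div_algebra X K W))"

definition principal_part ::
    "('x, 'k::field) fun_space \<Rightarrow> ('x set \<Rightarrow>\<^sub>0 int) set \<Rightarrow> ('x set \<Rightarrow>\<^sub>0 int) set" where
  "principal_part X K = {D\<in>K. div_class X D = \<one>\<^bsub>class_group X\<^esub>}"

text \<open>The data \<open>(K, \<chi>)\<close> from which a Cox sheaf is constructed.\<close>

definition cox_data ::
    "('x, 'k::field) fun_space \<Rightarrow> ('x set \<Rightarrow>\<^sub>0 int) set \<Rightarrow>
     (('x set \<Rightarrow>\<^sub>0 int) \<Rightarrow> ('x, 'k) ratfun) \<Rightarrow> bool" where
  "cox_data X K \<chi> \<longleftrightarrow>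
     subgroup K (WDiv X) \<and>
     fin_gen_group ((WDiv X)\<lparr>carrier := K\<rparr>) \<and>
     div_class X ` K = carrier (class_group X) \<and>
     \<chi> \<in> hom ((WDiv X)\<lparr>carrier := principal_part X K\<rparr>) (units_of (function_field X)) \<and>
     (\<forall>E\<in>principal_part X K. principal_div X (\<chi> E) = E)"

definition cox_relations ::
    "('x, 'k::field) fun_space \<Rightarrow> ('x set \<Rightarrow>\<^sub>0 int) set \<Rightarrow>
     (('x set \<Rightarrow>\<^sub>0 int) \<Rightarrow> ('x, 'k) ratfun) \<Rightarrow> 'x set \<Rightarrow> ('x, 'k) div_family set" where
  "cox_relations X K \<chi> W =
     {\<one>\<^bsub>div_algebra X K W\<^esub> \<ominus>\<^bsub>div_algebra X K W\<^esub> homogeneous X (- E) (\<chi> E) | E.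
        E \<in> principal_part X K}"

text \<open>Sections over \<open>W\<close> of the sheaf of ideals locally generated by the sections
  \<open>1 - \<chi>(E)\<close>, and its stalks.\<close>

definition cox_ideal ::
    "('x, 'k::field) fun_space \<Rightarrow> ('x set \<Rightarrow>\<^sub>0 int) set \<Rightarrow>
     (('x set \<Rightarrow>\<^sub>0 int) \<Rightarrow> ('x, 'k) ratfun) \<Rightarrow> 'x set \<Rightarrow> ('x, 'k) div_family set" where
  "cox_ideal X K \<chi> W =
     {s\<in>carrier (div_algebra X K W). \<forall>x\<in>W. \<exists>V. openin (pts X) V \<and> x \<in> V \<and> V \<subseteq> W \<and>
        s \<in> Idl\<^bsub>div_algebra X K V\<^esub> (cox_relations X K \<chi> V)}"

definition cox_ideal_stalk ::
    "('x, 'k::field) fun_space \<Rightarrow> ('x set \<Rightarrow>\<^sub>0 int) set \<Rightarrow>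
     (('x set \<Rightarrow>\<^sub>0 int) \<Rightarrow> ('x, 'k) ratfun) \<Rightarrow> 'x \<Rightarrow> ('x, 'k) div_family set" where
  "cox_ideal_stalk X K \<chi> x = (\<Union>W\<in>{W. openin (pts X) W \<and> x \<in> W}. cox_ideal X K \<chi> W)"

definition cox_stalk ::
    "('x, 'k::field) fun_space \<Rightarrow> ('x set \<Rightarrow>\<^sub>0 int) set \<Rightarrow>
     (('x set \<Rightarrow>\<^sub>0 int) \<Rightarrow> ('x, 'k) ratfun) \<Rightarrow> 'x \<Rightarrow> ('x, 'k) div_family set ring" where
  "cox_stalk X K \<chi> x = div_stalk X K x Quot cox_ideal_stalk X K \<chi> x"

text \<open>
  The quotient sheaf is the sheafification of the quotient presheaf: a section over \<open>U\<close> is a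
  family of elements of the stalks of the quotient that is locally induced by sections of the
  sheaf of divisorial algebras.
\<close>

definition cox_sheaf ::
    "('x, 'k::field) fun_space \<Rightarrow> ('x set \<Rightarrow>\<^sub>0 int) set \<Rightarrow>
     (('x set \<Rightarrow>\<^sub>0 int) \<Rightarrow> ('x, 'k) ratfun) \<Rightarrow> 'x set \<Rightarrow>
     ('x \<Rightarrow> ('x, 'k) div_family set) ring" where
  "cox_sheaf X K \<chi> U =
     \<lparr>carrier = {\<sigma>\<in>extensional U. \<forall>x\<in>U. \<exists>W s.
        openin (pts X) W \<and> x \<in> W \<and> W \<subseteq> U \<and> s \<in> carrier (div_algebra X K W) \<and>
        (\<forall>y\<in>W. \<sigma> y = cox_ideal_stalk X K \<chi> y +>\<^bsub>div_stalk X K y\<^esub> s)},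
      monoid.mult = (\<lambda>\<sigma> \<tau>. restrict (\<lambda>x. \<sigma> x \<otimes>\<^bsub>cox_stalk X K \<chi> x\<^esub> \<tau> x) U),
      one = restrict (\<lambda>x. \<one>\<^bsub>cox_stalk X K \<chi> x\<^esub>) U,
      zero = restrict (\<lambda>x. \<zero>\<^bsub>cox_stalk X K \<chi> x\<^esub>) U,
      add = (\<lambda>\<sigma> \<tau>. restrict (\<lambda>x. \<sigma> x \<oplus>\<^bsub>cox_stalk X K \<chi> x\<^esub> \<tau> x) U)\<rparr>"

definition cox_ring ::
    "('x, 'k::field) fun_space \<Rightarrow> ('x set \<Rightarrow>\<^sub>0 int) set \<Rightarrow>
     (('x set \<Rightarrow>\<^sub>0 int) \<Rightarrow> ('x, 'k) ratfun) \<Rightarrow> ('x \<Rightarrow> ('x, 'k) div_family set) ring" where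
  "cox_ring X K \<chi> = cox_sheaf X K \<chi> (topspace (pts X))"

definition cox_const ::
    "('x, 'k::field) fun_space \<Rightarrow> ('x set \<Rightarrow>\<^sub>0 int) set \<Rightarrow>
     (('x set \<Rightarrow>\<^sub>0 int) \<Rightarrow> ('x, 'k) ratfun) \<Rightarrow> 'k \<Rightarrow> 'x \<Rightarrow> ('x, 'k) div_family set" where
  "cox_const X K \<chi> c = restrict
     (\<lambda>x. cox_ideal_stalk X K \<chi> x +>\<^bsub>div_stalk X K x\<^esub> homogeneous X 0 (rat_const X c))
     (topspace (pts X))"

text \<open>The Cox ring is independent of the data \<open>(K, \<chi>)\<close> up to isomorphism of algebras, so it is
  enough to ask for one choice.\<close>

definition has_fin_gen_cox_ring :: "('x, 'k::field) fun_space \<Rightarrow> bool" where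
  "has_fin_gen_cox_ring X \<longleftrightarrow>
     fin_gen_group (class_group X) \<and> only_constant_units X \<and>
     (\<exists>K \<chi>. cox_data X K \<chi> \<and> fin_gen_algebra (cox_ring X K \<chi>) (cox_const X K \<chi>))"

end

theory Submission
  imports Defs "HOL-Library.Function_Algebras"
begin

text \<open>
  Let \<open>D\<^sub>U\<close> be the sum of the prime divisors contained in the complement of \<open>U\<close>, and write
  \<open>D\<^sub>U = div h + D\<close> with \<open>D \<in> K\<close>. By algebraic Hartogs, \<open>\<Gamma>(U, \<O>)\<close> is the union of the
  \<open>h\<^sup>n \<Gamma>(X, \<O>(n D))\<close>, i.e. the degree zero part of the localization of the Cox ring at the
  canonical section of \<open>D\<^sub>U\<close>. The sections of \<open>\<O>(n D)\<close> are combinations of monomials in the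
  finitely many homogeneous components of the generators of the Cox ring. So \<open>\<Gamma>(U, \<O>)\<close> is spanned by
  the monomials of principal degree in these components and \<open>h\<^sup>-\<^sup>1\<close>, and by Dickson's lemma
  finitely many of those generate.

  The geometry needed is that the local ring along a prime divisor is a discrete valuation ring and
  algebraic Hartogs. Both follow by considering, in a Noetherian normal local ring, a maximal ideal of
  the form \<open>{r. r g \<in> A}\<close> with \<open>g \<notin> A\<close>: it is prime, and by the Nullstellensatz it is the ideal of an
  irreducible closed set.
\<close>

section \<open>Commutative algebra of polynomial rings, up to the Nullstellensatz\<close>

section \<open>Polynomials over a subring\<close>

text \<open>Codimension one is never a height here: a prime divisor is just a maximal proper closed
  irreducible set. The conductor takes the place of Krull's principal ideal theorem, because over a
  normal Noetherian local ring a maximal ideal that is the conductor of some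
  \<open>g \<notin> A\<close> is forced to be principal. The second obstacle is that the Cox ring
  consists of sections of a sheafified quotient, that is, of families of cosets. It is examined
  through the map \<open>component D\<close>, which adds up all parts of degree in the class of
  \<open>D\<close> after moving them to degree \<open>D\<close> by \<open>\<chi>\<close>. This map
  kills the ideal of relations, so it reads off a rational function from a single coset, and as X is
  irreducible one stalk suffices for a global section. Finite generation in degree zero has the
  shape of Gordan's lemma. The principal divisors in \<open>K\<close> form a group, so exponent
  vectors of principal degree are closed under nonnegative differences, and subtracting a minimal
  vector never leaves the set.\<close>

definition subring_set :: "'a::comm_ring_1 set \<Rightarrow> bool" where
  "subring_set R \<longleftrightarrow> 1 \<in> R \<and> (\<forall>a\<in>R. \<forall>b\<in>R. a - b \<in> R \<and> a * b \<in> R)"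

text \<open>Rings and ideals are subsets of one type-class ring: the rings
  \<open>poly_functions n\<close> for all \<open>n\<close> then share a single type, and
  \<open>'a poly\<close> supplies the polynomials over each of them.\<close>

definition ideal_in :: "'a::comm_ring_1 set \<Rightarrow> 'a set \<Rightarrow> bool" where
  "ideal_in R I \<longleftrightarrow> I \<subseteq> R \<and> 0 \<in> I \<and> (\<forall>a\<in>I. \<forall>b\<in>I. a + b \<in> I) \<and> (\<forall>r\<in>R. \<forall>a\<in>I. r * a \<in> I)"

definition prime_in :: "'a::comm_ring_1 set \<Rightarrow> 'a set \<Rightarrow> bool" where
  "prime_in R P \<longleftrightarrow> ideal_in R P \<and> 1 \<notin> P \<and> (\<forall>a\<in>R. \<forall>b\<in>R. a * b \<in> P \<longrightarrow> a \<in> P \<or> b \<in> P)"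

definition noetherian_in :: "'a::comm_ring_1 set \<Rightarrow> bool" where
  "noetherian_in R \<longleftrightarrow>
     (\<forall>J::nat \<Rightarrow> 'a set. (\<forall>i. ideal_in R (J i)) \<and> (\<forall>i. J i \<subseteq> J (Suc i))
        \<longrightarrow> (\<exists>N. \<forall>m\<ge>N. J m = J N))"

lemma subring_setD:
  assumes "subring_set R"
  shows "1 \<in> R" "0 \<in> R" "a \<in> R \<Longrightarrow> - a \<in> R" "a \<in> R \<Longrightarrow> b \<in> R \<Longrightarrow> a + b \<in> R"
    "a \<in> R \<Longrightarrow> b \<in> R \<Longrightarrow> a - b \<in> R" "a \<in> R \<Longrightarrow> b \<in> R \<Longrightarrow> a * b \<in> R"
proof -
  have 1: "1 \<in> R" and d: "\<And>a b. a \<in> R \<Longrightarrow> b \<in> R \<Longrightarrow> a - b \<in> R"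
    and m: "\<And>a b. a \<in> R \<Longrightarrow> b \<in> R \<Longrightarrow> a * b \<in> R"
    using assms by (auto simp: subring_set_def)
  have 0: "0 \<in> R" using d[OF 1 1] by simp
  have n: "- a \<in> R" if "a \<in> R" for a using d[OF 0 that] by simp
  have "a + b \<in> R" if "a \<in> R" "b \<in> R" for a b using d[OF that(1) n[OF that(2)]] by simp
  then show "1 \<in> R" "0 \<in> R" "a \<in> R \<Longrightarrow> - a \<in> R" "a \<in> R \<Longrightarrow> b \<in> R \<Longrightarrow> a + b \<in> R"
    "a \<in> R \<Longrightarrow> b \<in> R \<Longrightarrow> a - b \<in> R" "a \<in> R \<Longrightarrow> b \<in> R \<Longrightarrow> a * b \<in> R"
    using 1 0 n d m by simp_all
qed

lemma ideal_inD:
  assumes "ideal_in R I"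
  shows "a \<in> I \<Longrightarrow> a \<in> R" "0 \<in> I" "a \<in> I \<Longrightarrow> b \<in> I \<Longrightarrow> a + b \<in> I"
    "r \<in> R \<Longrightarrow> a \<in> I \<Longrightarrow> r * a \<in> I" "r \<in> R \<Longrightarrow> a \<in> I \<Longrightarrow> a * r \<in> I"
  using assms by (auto simp: ideal_in_def mult.commute)

lemma ideal_in_diff:
  assumes "subring_set R" "ideal_in R I" "a \<in> I" "b \<in> I"
  shows "a - b \<in> I"
proof -
  have "- 1 * b \<in> I"
    using assms subring_setD(1,3) by (intro ideal_inD(4)[OF assms(2)]) auto
  with assms(3) have "a + (- 1 * b) \<in> I" by (rule ideal_inD(3)[OF assms(2)])
  then show ?thesis by simp
qed

lemma subring_set_power: "subring_set R \<Longrightarrow> a \<in> R \<Longrightarrow> a ^ n \<in> R"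
  by (induction n) (simp_all add: subring_setD)

lemma subring_set_sum: "subring_set R \<Longrightarrow> (\<And>i. i \<in> A \<Longrightarrow> f i \<in> R) \<Longrightarrow> sum f A \<in> R"
  by (induction A rule: infinite_finite_induct) (simp_all add: subring_setD)

lemma ideal_in_sum: "ideal_in R I \<Longrightarrow> (\<And>i. i \<in> A \<Longrightarrow> f i \<in> I) \<Longrightarrow> sum f A \<in> I"
  by (induction A rule: infinite_finite_induct) (simp_all add: ideal_inD)

definition polys_over :: "'a::comm_ring_1 set \<Rightarrow> 'a poly set" where
  "polys_over R = {p. \<forall>i. coeff p i \<in> R}"

text \<open>A degree bound that also measures the zero polynomial: \<open>deg_less 0 p\<close> means
  p = 0, so inductions on the bound start there without a special case.\<close>

definition deg_less :: "nat \<Rightarrow> 'a::zero poly \<Rightarrow> bool" where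
  "deg_less d p \<longleftrightarrow> (\<forall>i\<ge>d. coeff p i = 0)"

lemma deg_less_degree: "deg_less (Suc (degree p)) p"
  by (simp add: deg_less_def coeff_eq_0)

lemma deg_less_diff: "deg_less d p \<Longrightarrow> deg_less d q \<Longrightarrow> deg_less d (p - q)"
  for p q :: "'a::ab_group_add poly"
  by (simp add: deg_less_def)

lemma polys_over_monom: "subring_set R \<Longrightarrow> a \<in> R \<Longrightarrow> monom a n \<in> polys_over R"
  by (auto simp: polys_over_def subring_setD)

lemma polys_over_const: "subring_set R \<Longrightarrow> a \<in> R \<Longrightarrow> [:a:] \<in> polys_over R"
  by (auto simp: polys_over_def coeff_pCons subring_setD split: nat.splits)

lemma polys_over_smult: "subring_set R \<Longrightarrow> a \<in> R \<Longrightarrow> p \<in> polys_over R \<Longrightarrow> smult a p \<in> polys_over R"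
  by (auto simp: polys_over_def subring_setD)

lemma subring_set_polys_over:
  assumes "subring_set R"
  shows "subring_set (polys_over R)"
  unfolding subring_set_def polys_over_def
  by (auto simp: coeff_mult coeff_pCons subring_setD[OF assms] split: nat.splits
      intro!: subring_set_sum[OF assms])

lemma const_mult_monom: "[:a:] * monom 1 n = monom (a::'a::comm_ring_1) n"
  by (simp add: smult_monom)

lemma monom_in_ideal:
  assumes "subring_set R" "ideal_in (polys_over R) P" "[:a:] \<in> P"
  shows "monom a n \<in> P"
  using ideal_inD(5)[OF assms(2) polys_over_monom[OF assms(1) subring_setD(1)[OF assms(1)]] assms(3)]
  by (metis const_mult_monom)

lemma in_ideal_coeffs:
  assumes "subring_set R" "ideal_in (polys_over R) P" "\<And>i. [:coeff p i:] \<in> P"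
  shows "p \<in> P"
proof -
  have "(\<Sum>i\<le>degree p. monom (coeff p i) i) \<in> P"
    by (intro ideal_in_sum[OF assms(2)] monom_in_ideal[OF assms(1,2)] assms(3))
  then show ?thesis by (simp add: poly_as_sum_of_monoms)
qed

text \<open>A top term whose coefficient lies in P is itself in P and may be subtracted. As one
  coefficient stays outside P, this stops at a representative modulo P whose leading coefficient is
  nonzero modulo P.\<close>

lemma strip_leading_terms:
  assumes R: "subring_set R" and P: "ideal_in (polys_over R) P"
    and "p \<in> polys_over R" "deg_less m p" "[:coeff p j:] \<notin> P"
  shows "\<exists>q i. q \<in> polys_over R \<and> p - q \<in> P \<and> i < m \<and> deg_less (Suc i) q \<and> [:coeff q i:] \<notin> P"
  using assms(3-)
proof (induction m arbitrary: p)
  case 0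
  then show ?case using ideal_inD(2)[OF P] by (simp add: deg_less_def)
next
  case (Suc m)
  show ?case
  proof (cases "[:coeff p m:] \<in> P")
    case False
    then show ?thesis
      using Suc.prems ideal_inD(2)[OF P] by (intro exI[of _ p] exI[of _ m]) auto
  next
    case True
    let ?t = "monom (coeff p m) m"
    have t: "?t \<in> P" by (rule monom_in_ideal[OF R P True])
    have "coeff p m \<in> R" using Suc.prems by (auto simp: polys_over_def)
    then have p': "p - ?t \<in> polys_over R"
      using subring_setD(5)[OF subring_set_polys_over[OF R] Suc.prems(1) polys_over_monom[OF R]] by blast
    have dl: "deg_less m (p - ?t)"
      unfolding deg_less_def
    proof (intro allI impI)
      fix i assume "m \<le> i"
      then show "coeff (p - ?t) i = 0"
        using Suc.prems(2) by (cases "i = m") (auto simp: deg_less_def)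
    qed
    have "j \<noteq> m" using True Suc.prems(3) by auto
    then have "[:coeff (p - ?t) j:] \<notin> P" using Suc.prems(3) by simp
    from Suc.IH[OF p' dl this] obtain q i where q: "q \<in> polys_over R" "p - ?t - q \<in> P" "i < m"
      "deg_less (Suc i) q" "[:coeff q i:] \<notin> P" by blast
    have "p - q = (p - ?t - q) + ?t" by simp
    then have "p - q \<in> P" using ideal_inD(3)[OF P q(2) t] by metis
    then show ?thesis using q by (intro exI[of _ q] exI[of _ i]) auto
  qed
qed

text \<open>Division by g without inverting its leading coefficient: the dividend is multiplied by a
  power of it instead. The bound on the quotient is recorded because in the Nullstellensatz its
  degree must be compared with that of the dividend.\<close>

lemma pseudo_division:
  assumes R: "subring_set R" and g: "g \<in> polys_over R" "deg_less (Suc d) g"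
    and "h \<in> polys_over R" "deg_less m h"
  shows "\<exists>N q r. q \<in> polys_over R \<and> r \<in> polys_over R \<and> smult (coeff g d ^ N) h = q * g + r
     \<and> deg_less d r \<and> deg_less (m - d) q"
  using assms(4-)
proof (induction m arbitrary: h)
  case 0
  then have "h = 0" by (simp add: deg_less_def poly_eq_iff)
  then show ?case
    using subring_setD(2)[OF subring_set_polys_over[OF R]]
    by (intro exI[of _ 0] exI[of _ "0::'a poly"]) (auto simp: deg_less_def)
next
  case (Suc m)
  note PR = subring_set_polys_over[OF R]
  show ?case
  proof (cases "d \<le> m")
    case False
    then have "deg_less d h" using Suc.prems(2) by (auto simp: deg_less_def)
    then show ?thesis
      using Suc.prems subring_setD(2)[OF PR]
      by (intro exI[of _ 0] exI[of _ "0::'a poly"] exI[of _ h]) (auto simp: deg_less_def)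
  next
    case True
    let ?l = "coeff g d" and ?t = "monom (coeff h m) (m - d)"
    have l: "?l \<in> R" using g by (auto simp: polys_over_def)
    have c: "coeff h m \<in> R" using Suc.prems by (auto simp: polys_over_def)
    let ?h = "smult ?l h - ?t * g"
    have h: "?h \<in> polys_over R"
      by (intro subring_setD[OF PR] polys_over_smult[OF R] polys_over_monom[OF R] l c g Suc.prems)
    have dl: "deg_less m ?h"
      unfolding deg_less_def
    proof (intro allI impI)
      fix i assume i: "m \<le> i"
      have e: "coeff ?h i = ?l * coeff h i - coeff h m * coeff g (i - (m - d))"
        using i True by (auto simp: coeff_monom_mult)
      show "coeff ?h i = 0"
      proof (cases "i = m")
        case True
        then show ?thesis using e \<open>d \<le> m\<close> by (simp add: mult.commute)
      next
        case False
        then have "coeff h i = 0" "coeff g (i - (m - d)) = 0"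
          using i True Suc.prems(2) g(2) by (auto simp: deg_less_def)
        then show ?thesis using e by simp
      qed
    qed
    from Suc.IH[OF h dl] obtain N q r where *: "q \<in> polys_over R" "r \<in> polys_over R"
      "smult (?l ^ N) ?h = q * g + r" "deg_less d r" "deg_less (m - d) q" by blast
    let ?q = "q + smult (?l ^ N) ?t"
    have "smult (?l ^ Suc N) h = smult (?l ^ N) ?h + smult (?l ^ N) ?t * g"
      by (simp add: smult_diff_right mult.commute)
    also have "\<dots> = ?q * g + r" unfolding *(3) by (simp add: algebra_simps)
    finally have eq: "smult (?l ^ Suc N) h = ?q * g + r" .
    have q: "?q \<in> polys_over R"
      by (intro subring_setD[OF PR] polys_over_smult[OF R] polys_over_monom[OF R] *(1) c
          subring_set_power[OF R] l)
    have "deg_less (Suc m - d) ?q"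
      using *(5) True by (auto simp: deg_less_def)
    then show ?thesis using eq q *(2,4) by blast
  qed
qed

lemma poly_split_top:
  assumes "deg_less (Suc d) p"
  shows "deg_less d (p - monom (coeff p d) d)"
    "poly p x = coeff p d * x ^ d + poly (p - monom (coeff p d) d) (x::'a::comm_ring_1)"
  using assms by (auto simp: deg_less_def poly_monom dest: le_neq_trans)

subsection \<open>Hilbert's basis theorem\<close>

text \<open>The ring R[x] as the image of evaluation at x. The element x may be algebraic over R, so
  several polynomials can represent one element.\<close>

definition adjoin :: "'a::comm_ring_1 set \<Rightarrow> 'a \<Rightarrow> 'a set" where
  "adjoin R x = (\<lambda>p. poly p x) ` polys_over R"

lemma subring_set_adjoin:
  assumes "subring_set R"
  shows "subring_set (adjoin R x)"
proof -
  note PR = subring_set_polys_over[OF assms]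
  have "a - b \<in> adjoin R x \<and> a * b \<in> adjoin R x" if "a \<in> adjoin R x" "b \<in> adjoin R x" for a b
  proof -
    from that obtain p q where *: "p \<in> polys_over R" "q \<in> polys_over R" "a = poly p x" "b = poly q x"
      by (auto simp: adjoin_def)
    have "a - b \<in> adjoin R x"
      unfolding adjoin_def by (rule image_eqI[of _ _ "p - q"]) (simp_all add: * subring_setD(5)[OF PR])
    moreover have "a * b \<in> adjoin R x"
      unfolding adjoin_def by (rule image_eqI[of _ _ "p * q"]) (simp_all add: * subring_setD(6)[OF PR])
    ultimately show ?thesis ..
  qed
  moreover have "1 \<in> adjoin R x"
    unfolding adjoin_def by (rule image_eqI[of _ _ 1]) (simp_all add: subring_setD(1)[OF PR])
  ultimately show ?thesis unfolding subring_set_def by blast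
qed

lemma adjoin_incl: "subring_set R \<Longrightarrow> a \<in> R \<Longrightarrow> a \<in> adjoin R x"
  unfolding adjoin_def by (rule image_eqI[of _ _ "[:a:]"]) (auto intro: polys_over_const)

lemma adjoin_gen: "subring_set R \<Longrightarrow> x \<in> adjoin R x"
  unfolding adjoin_def
  by (rule image_eqI[of _ _ "monom 1 1"]) (simp_all add: polys_over_monom subring_setD poly_monom)

text \<open>The leading coefficients of a chain of ideals form a family of ideals of R that
  increases in two indices, the member of the chain and the degree; finitely many chains in R
  control all of it.\<close>

theorem hilbert_basis:
  assumes R: "subring_set R" and noeth: "noetherian_in R"
  shows "noetherian_in (adjoin R x)"
  unfolding noetherian_in_def
proof (intro allI impI)
  fix J :: "nat \<Rightarrow> 'a set"
  assume "(\<forall>i. ideal_in (adjoin R x) (J i)) \<and> (\<forall>i. J i \<subseteq> J (Suc i))"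
  then have J: "\<And>i. ideal_in (adjoin R x) (J i)" and inc: "\<And>i. J i \<subseteq> J (Suc i)" by auto
  have Jmono: "i \<le> j \<Longrightarrow> J i \<subseteq> J j" for i j by (rule lift_Suc_mono_le[of J]) (simp_all add: inc)
  note PR = subring_set_polys_over[OF R] and AR = subring_set_adjoin[OF R]
  \<comment> \<open>The coefficients of x^d that some presentation of an element of
    \<open>J k\<close> exhibits on top. Presentations are not unique, so \<open>L\<close> asks for
    one of them only.\<close>
  define L where "L k d = {a\<in>R. \<exists>p\<in>polys_over R. deg_less d p \<and> a * x ^ d + poly p x \<in> J k}" for k d
  have L: "ideal_in R (L k d)" for k d
    unfolding ideal_in_def
  proof (intro conjI ballI)
    show "L k d \<subseteq> R" by (auto simp: L_def)
    show "0 \<in> L k d"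
      using subring_setD(2)[OF PR] subring_setD(2)[OF R] ideal_inD(2)[OF J]
      by (auto simp: L_def deg_less_def intro!: bexI[of _ 0])
    fix a b assume "a \<in> L k d" "b \<in> L k d"
    then obtain p q where "a \<in> R" "b \<in> R" "p \<in> polys_over R" "q \<in> polys_over R" "deg_less d p"
      "deg_less d q" "a * x ^ d + poly p x \<in> J k" "b * x ^ d + poly q x \<in> J k"
      by (auto simp: L_def)
    then show "a + b \<in> L k d"
      using ideal_inD(3)[OF J, of "a * x ^ d + poly p x" k "b * x ^ d + poly q x"]
      by (auto simp: L_def deg_less_def algebra_simps subring_setD[OF R] subring_setD[OF PR] intro!: bexI[of _ "p + q"])
  next
    fix r a assume r: "r \<in> R" and "a \<in> L k d"
    then obtain p where "a \<in> R" "p \<in> polys_over R" "deg_less d p" "a * x ^ d + poly p x \<in> J k"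
      by (auto simp: L_def)
    then show "r * a \<in> L k d"
      using r ideal_inD(4)[OF J adjoin_incl[OF R r], of "a * x ^ d + poly p x" k]
      by (auto simp: L_def deg_less_def algebra_simps subring_setD[OF R] polys_over_smult[OF R] intro!: bexI[of _ "smult r p"])
  qed
  have Lk: "i \<le> j \<Longrightarrow> L i d \<subseteq> L j d" for i j d
    using Jmono by (fastforce simp: L_def)
  have "L k d \<subseteq> L k (Suc d)" for k d
  proof
    fix a assume "a \<in> L k d"
    then obtain p where p: "a \<in> R" "p \<in> polys_over R" "deg_less d p" "a * x ^ d + poly p x \<in> J k"
      by (auto simp: L_def)
    have "pCons 0 p \<in> polys_over R"
      using p(2) subring_setD(2)[OF R] by (auto simp: polys_over_def coeff_pCons split: nat.splits)
    moreover have "deg_less (Suc d) (pCons 0 p)"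
      using p(3) by (auto simp: deg_less_def coeff_pCons split: nat.splits)
    moreover have "a * x ^ Suc d + poly (pCons 0 p) x \<in> J k"
      using ideal_inD(4)[OF J adjoin_gen[OF R] p(4)] by (simp add: algebra_simps)
    ultimately show "a \<in> L k (Suc d)" using p(1) unfolding L_def by blast
  qed
  then have Ld: "d \<le> e \<Longrightarrow> L k d \<subseteq> L k e" for d e k
    by (rule lift_Suc_mono_le[of "L k"])
  \<comment> \<open>The diagonal stabilises at some \<open>N0\<close>, and monotonicity in both
    indices squeezes every column beyond \<open>N0\<close> between values on the diagonal. Only the
    finitely many columns up to \<open>N0\<close> need a bound of their own.\<close>
  have diag: "L k k \<subseteq> L (Suc k) (Suc k)" for k
    using Lk[of k "Suc k" k] Ld[of k "Suc k" "Suc k"] by auto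
  obtain N0 where N0: "\<And>m. m \<ge> N0 \<Longrightarrow> L m m = L N0 N0"
    using noeth[unfolded noetherian_in_def, rule_format, of "\<lambda>k. L k k"] L diag by auto
  have "\<exists>N. \<forall>m\<ge>N. L m d = L N d" for d
    using noeth[unfolded noetherian_in_def, rule_format, of "\<lambda>k. L k d"] L Lk[of _ "Suc _"] by auto
  then obtain Nd where Nd: "\<And>d m. m \<ge> Nd d \<Longrightarrow> L m d = L (Nd d) d" by metis
  define N where "N = Max (insert N0 (Nd ` {..N0}))"
  have NN: "N \<ge> N0" "d \<le> N0 \<Longrightarrow> N \<ge> Nd d" for d unfolding N_def by (rule Max_ge; simp)+
  have stab: "L m d = L N d" if "m \<ge> N" for m d
  proof (cases "d \<le> N0")
    case True
    then show ?thesis using Nd[of d m] Nd[of d N] NN(2)[OF True] that by simp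
  next
    case False
    have a: "L k d = L N0 N0" if "k \<ge> N0" for k
    proof
      show "L k d \<subseteq> L N0 N0"
        using Lk[of k "max k d" d] Ld[of d "max k d" "max k d"] N0[of "max k d"] that by auto
      show "L N0 N0 \<subseteq> L k d"
        using Lk[of N0 k N0] Ld[of N0 d k] that False by auto
    qed
    show ?thesis using a[of m] a[of N] NN(1) that by simp
  qed
  have "J m \<subseteq> J N" if m: "m \<ge> N" for m
  proof -
    \<comment> \<open>Induction on the degree bound: an element of \<open>J N\<close> with the same
      top coefficient is subtracted, which leaves an element of \<open>J m\<close> with a smaller
      bound.\<close>
    have "poly p x \<in> J N" if "p \<in> polys_over R" "deg_less d p" "poly p x \<in> J m" for p d
      using that
    proof (induction d arbitrary: p)
      case 0
      then have "p = 0" by (simp add: deg_less_def poly_eq_iff)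
      then show ?case using ideal_inD(2)[OF J] by simp
    next
      case (Suc d)
      let ?a = "coeff p d" and ?p = "p - monom (coeff p d) d"
      have a: "?a \<in> R" using Suc.prems by (simp add: polys_over_def)
      have p: "?p \<in> polys_over R"
        by (intro subring_setD[OF PR] polys_over_monom[OF R] a Suc.prems)
      note sp = poly_split_top[OF Suc.prems(2)]
      have "?a \<in> L m d"
        using a p sp(1) Suc.prems(3) unfolding L_def sp(2)[of x] by blast
      then obtain q where q: "q \<in> polys_over R" "deg_less d q" "?a * x ^ d + poly q x \<in> J N"
        unfolding stab[OF m] by (auto simp: L_def)
      have "poly p x - (?a * x ^ d + poly q x) \<in> J m"
        using q(3) Jmono[OF m] Suc.prems(3) by (intro ideal_in_diff[OF AR J]) auto
      moreover have "poly p x - (?a * x ^ d + poly q x) = poly (?p - q) x"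
        by (simp add: poly_monom)
      ultimately have "poly (?p - q) x \<in> J m" by metis
      moreover have "?p - q \<in> polys_over R" by (rule subring_setD(5)[OF PR p q(1)])
      moreover have "deg_less d (?p - q)" by (rule deg_less_diff[OF sp(1) q(2)])
      ultimately have "poly (?p - q) x \<in> J N" using Suc.IH by blast
      then have "poly (?p - q) x + (?a * x ^ d + poly q x) \<in> J N"
        using q(3) by (rule ideal_inD(3)[OF J])
      moreover have "poly (?p - q) x + (?a * x ^ d + poly q x) = poly p x"
        by (simp add: poly_monom)
      ultimately show ?case by metis
    qed
    then have gen: "poly p x \<in> J N" if "p \<in> polys_over R" "poly p x \<in> J m" for p
      using that deg_less_degree by blast
    show ?thesis
    proof
      fix y assume y: "y \<in> J m"
      then obtain p where "p \<in> polys_over R" "y = poly p x"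
        using ideal_inD(1)[OF J y] by (auto simp: adjoin_def)
      then show "y \<in> J N" using gen y by simp
    qed
  qed
  then show "\<exists>N. \<forall>m\<ge>N. J m = J N" using Jmono by blast
qed

subsection \<open>Rings of polynomial functions\<close>

lemma poly_functions_fun:
  shows "(\<lambda>x. c) \<in> poly_functions n" "p \<in> poly_functions n \<Longrightarrow> q \<in> poly_functions n \<Longrightarrow> p + q \<in> poly_functions n"
    "p \<in> poly_functions n \<Longrightarrow> q \<in> poly_functions n \<Longrightarrow> p * q \<in> poly_functions n"
  by (auto simp: plus_fun_def times_fun_def intro: poly_functions.intros)

lemma subring_set_poly_functions: "subring_set (poly_functions n)"
proof -
  have "a - b \<in> poly_functions n" if "a \<in> poly_functions n" "b \<in> poly_functions n" for a b
  proof -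
    have "a + (\<lambda>x. - 1) * b \<in> poly_functions n"
      by (intro poly_functions_fun that)
    moreover have "a + (\<lambda>x. - 1) * b = a - b" by (auto simp: fun_eq_iff)
    ultimately show ?thesis by metis
  qed
  moreover have "1 \<in> poly_functions n"
    using poly_functions_fun(1)[of 1] by (simp add: one_fun_def)
  ultimately show ?thesis by (auto simp: subring_set_def intro: poly_functions_fun)
qed

lemma poly_functions_mono: "p \<in> poly_functions m \<Longrightarrow> m \<le> n \<Longrightarrow> p \<in> poly_functions n"
  by (induction rule: poly_functions.induct) (auto intro: poly_functions.intros)

text \<open>One more variable is one adjoined element, so the basis theorem and the Nullstellensatz
  can both run by induction on \<open>n\<close> inside one ring of functions.\<close>

lemma poly_functions_Suc: "poly_functions (Suc n) = adjoin (poly_functions n) (\<lambda>x. x n)"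
  (is "?L = ?A")
proof
  note R = subring_set_poly_functions[of n]
  note A = subring_setD[OF subring_set_adjoin[OF R]]
  show "?L \<subseteq> ?A"
  proof
    fix p assume "p \<in> ?L"
    then show "p \<in> ?A"
    proof induction
      case (poly_const c)
      then show ?case by (intro adjoin_incl[OF R] poly_functions.intros)
    next
      case (poly_coord i)
      then show ?case
        by (cases "i = n") (simp_all add: adjoin_gen[OF R] adjoin_incl[OF R] poly_functions.intros)
    next
      case (poly_add p q)
      then show ?case using A(4)[of p _ q] by (simp add: plus_fun_def)
    next
      case (poly_mult p q)
      then show ?case using A(6)[of p _ q] by (simp add: times_fun_def)
    qed
  qed
  show "?A \<subseteq> ?L"
  proof
    fix f assume "f \<in> ?A"
    then obtain p where p: "p \<in> polys_over (poly_functions n)" "f = poly p (\<lambda>x. x n)"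
      by (auto simp: adjoin_def)
    note S = subring_set_poly_functions[of "Suc n"]
    have "coeff p i \<in> poly_functions (Suc n)" for i
      using p(1) by (auto simp: polys_over_def intro: poly_functions_mono[of _ n])
    then show "f \<in> ?L"
      unfolding p(2) poly_altdef
      by (intro subring_set_sum[OF S] subring_setD(6)[OF S] subring_set_power[OF S]) (auto intro: poly_coord)
  qed
qed

lemma poly_functions_0: "p \<in> poly_functions 0 \<Longrightarrow> \<exists>c. p = (\<lambda>x. c)"
  by (induction rule: poly_functions.induct) auto

theorem noetherian_poly_functions: "noetherian_in (poly_functions n :: ((nat \<Rightarrow> 'k::field) \<Rightarrow> 'k) set)"
proof (induction n)
  case 0
  show ?case
    unfolding noetherian_in_def
  proof (intro allI impI)
    fix J :: "nat \<Rightarrow> ((nat \<Rightarrow> 'k) \<Rightarrow> 'k) set"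
    assume a: "(\<forall>i. ideal_in (poly_functions 0) (J i)) \<and> (\<forall>i. J i \<subseteq> J (Suc i))"
    then have J: "\<And>i. ideal_in (poly_functions 0) (J i)" and inc: "\<And>i. J i \<subseteq> J (Suc i)" by auto
    have Jmono: "i \<le> j \<Longrightarrow> J i \<subseteq> J j" for i j by (rule lift_Suc_mono_le[of J]) (simp_all add: inc)
    show "\<exists>N. \<forall>m\<ge>N. J m = J N"
    \<comment> \<open>The constants form a field, so each ideal is zero or everything, and the chain
      can jump at most once.\<close>
    proof (cases "\<exists>k c. c \<noteq> 0 \<and> (\<lambda>x. c) \<in> J k")
      case True
      then obtain k c where c: "c \<noteq> 0" "(\<lambda>x. c) \<in> J k" by auto
      have "J m = poly_functions 0" if "m \<ge> k" for m
      proof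
        show "J m \<subseteq> poly_functions 0" using ideal_inD(1)[OF J] by blast
        show "poly_functions 0 \<subseteq> J m"
        proof
          fix p :: "(nat \<Rightarrow> 'k) \<Rightarrow> 'k" assume "p \<in> poly_functions 0"
          then obtain b where b: "p = (\<lambda>x. b)" using poly_functions_0 by blast
          have "(\<lambda>x. c) \<in> J m" using c(2) Jmono[OF that] by auto
          from ideal_inD(4)[OF J poly_functions_fun(1)[of "b / c"] this]
          show "p \<in> J m" using c(1) by (simp add: b times_fun_def)
        qed
      qed
      then show ?thesis by (metis order_refl)
    next
      case False
      have "J m = {0}" for m
      proof -
        have "p = 0" if "p \<in> J m" for p
          using False that ideal_inD(1)[OF J that] poly_functions_0[of p] by (auto simp: zero_fun_def)
        then show ?thesis using ideal_inD(2)[OF J] by blast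
      qed
      then show ?thesis by simp
    qed
  qed
next
  case (Suc n)
  show ?case
    unfolding poly_functions_Suc by (rule hilbert_basis[OF subring_set_poly_functions Suc])
qed

section \<open>The Nullstellensatz\<close>

text \<open>The maps in question evaluate functions at a point and are defined on the whole type, so
  the laws are asked everywhere and not just on a subring.\<close>

definition comm_ring_hom_fun :: "('a::comm_ring_1 \<Rightarrow> 'b::comm_ring_1) \<Rightarrow> bool" where
  "comm_ring_hom_fun \<eta> \<longleftrightarrow> \<eta> 0 = 0 \<and> \<eta> 1 = 1 \<and>
     (\<forall>a b. \<eta> (a + b) = \<eta> a + \<eta> b) \<and> (\<forall>a b. \<eta> (a * b) = \<eta> a * \<eta> b)"

lemma comm_ring_hom_funD:
  assumes "comm_ring_hom_fun \<eta>"
  shows "\<eta> 0 = 0" "\<eta> 1 = 1" "\<eta> (a + b) = \<eta> a + \<eta> b" "\<eta> (a * b) = \<eta> a * \<eta> b"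
    "\<eta> (a ^ n) = \<eta> a ^ n" "\<eta> (sum f A) = (\<Sum>i\<in>A. \<eta> (f i))"
proof -
  show h: "\<eta> 0 = 0" "\<eta> 1 = 1" "\<eta> (a + b) = \<eta> a + \<eta> b" "\<eta> (a * b) = \<eta> a * \<eta> b" for a b
    using assms by (auto simp: comm_ring_hom_fun_def)
  show "\<eta> (a ^ n) = \<eta> a ^ n" by (induction n) (simp_all add: h)
  show "\<eta> (sum f A) = (\<Sum>i\<in>A. \<eta> (f i))"
    by (induction A rule: infinite_finite_induct) (simp_all add: h)
qed

lemma map_poly_hom:
  assumes "comm_ring_hom_fun \<eta>"
  shows "map_poly \<eta> (p + q) = map_poly \<eta> p + map_poly \<eta> q"
    "map_poly \<eta> (p * q) = map_poly \<eta> p * map_poly \<eta> q"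
    "map_poly \<eta> (smult a p) = smult (\<eta> a) (map_poly \<eta> p)"
    "map_poly \<eta> [:a:] = [:\<eta> a:]"
proof -
  note H = comm_ring_hom_funD[OF assms] and C = coeff_map_poly[of \<eta>, OF comm_ring_hom_funD(1)[OF assms]]
  show "map_poly \<eta> (p + q) = map_poly \<eta> p + map_poly \<eta> q"
    "map_poly \<eta> (p * q) = map_poly \<eta> p * map_poly \<eta> q"
    "map_poly \<eta> (smult a p) = smult (\<eta> a) (map_poly \<eta> p)"
    by (rule poly_eqI, simp only: C H coeff_add coeff_mult coeff_smult)+
  show "map_poly \<eta> [:a:] = [:\<eta> a:]"
    by (rule poly_eqI) (simp add: C H(1) coeff_pCons split: nat.splits)
qed

lemma infinite_field_nonroot:
  assumes "(p :: 'k::{field, ring_char_0} poly) \<noteq> 0"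
  shows "\<exists>t. poly p t \<noteq> 0"
proof (rule ccontr)
  assume "\<not> ?thesis"
  then have "{t. poly p t = 0} = UNIV" by auto
  then show False using poly_roots_finite[OF assms] infinite_UNIV_char_0[where 'a='k] by simp
qed

text \<open>Elimination of one variable: a point \<eta> of the locus of the constants in P lifts to
  a zero t of P with f nonzero, as soon as \<open>\<eta> e\<close> is nonzero. It is a greatest
  common divisor argument over the fraction field of R modulo those constants, carried out by
  pseudo-division. If all elements of P have all their coefficients in P, then e is a coefficient of
  f and t is any non-root; otherwise t is a root of an element of P of least degree.\<close>

lemma point_extension:
  fixes R :: "'a::comm_ring_1 set"
  assumes R: "subring_set R" and prime: "prime_in (polys_over R) P"
    and f: "f \<in> polys_over R" "f \<notin> P"
  shows "\<exists>e\<in>R. [:e:] \<notin> P \<and>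
     (\<forall>\<eta>::'a \<Rightarrow> 'k::{alg_closed_field, field_char_0}.
        comm_ring_hom_fun \<eta> \<and> (\<forall>r\<in>R. [:r:] \<in> P \<longrightarrow> \<eta> r = 0) \<and> \<eta> e \<noteq> 0 \<longrightarrow>
        (\<exists>t. (\<forall>h\<in>P. poly (map_poly \<eta> h) t = 0) \<and> poly (map_poly \<eta> f) t \<noteq> 0))"
proof -
  note PR = subring_set_polys_over[OF R]
  have P: "ideal_in (polys_over R) P" and P1: "1 \<notin> P"
    and Pp: "\<And>a b. a \<in> polys_over R \<Longrightarrow> b \<in> polys_over R \<Longrightarrow> a * b \<in> P \<Longrightarrow> a \<in> P \<or> b \<in> P"
    using prime by (auto simp: prime_in_def)
  have Psub: "h \<in> P \<Longrightarrow> h \<in> polys_over R" for h using ideal_inD(1)[OF P] .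
  have cR: "p \<in> polys_over R \<Longrightarrow> coeff p i \<in> R" for p i by (simp add: polys_over_def)
  have kill: "map_poly \<eta> h = 0"
    if "comm_ring_hom_fun \<eta>" "\<forall>r\<in>R. [:r:] \<in> P \<longrightarrow> \<eta> r = 0" "h \<in> polys_over R" "\<And>i. [:coeff h i:] \<in> P"
    for \<eta> :: "'a \<Rightarrow> 'k" and h
    using that cR by (intro poly_eqI) (auto simp: coeff_map_poly comm_ring_hom_funD)
  have Pc: "[:a * b:] \<in> P \<Longrightarrow> [:a:] \<in> P \<or> [:b:] \<in> P" if "a \<in> R" "b \<in> R" for a b
    using Pp[OF polys_over_const[OF R that(1)] polys_over_const[OF R that(2)]] by (simp add: mult.commute)
  have Ppow: "[:a:] \<notin> P \<Longrightarrow> [:a ^ N:] \<notin> P" if "a \<in> R" for a N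
    using P1 Pc[OF that subring_set_power[OF R that]] by (induction N) (auto simp: one_pCons)
  have Psm: "q \<in> P" if "smult (a ^ N) q \<in> P" "a \<in> R" "[:a:] \<notin> P" "q \<in> polys_over R" for a N q
    using Pp[OF polys_over_const[OF R subring_set_power[OF R that(2)]] that(4), of N] Ppow[OF that(2,3), of N]
      that(1) by auto
  show ?thesis
  proof (cases "\<exists>g\<in>P. \<exists>i. [:coeff g i:] \<notin> P")
    case False
    obtain i where i: "[:coeff f i:] \<notin> P" using in_ideal_coeffs[OF R P] f(2) by blast
    have "\<exists>t. (\<forall>h\<in>P. poly (map_poly \<eta> h) t = 0) \<and> poly (map_poly \<eta> f) t \<noteq> 0"
      if "comm_ring_hom_fun \<eta>" "\<forall>r\<in>R. [:r:] \<in> P \<longrightarrow> \<eta> r = 0" "\<eta> (coeff f i) \<noteq> 0" for \<eta> :: "'a \<Rightarrow> 'k"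
    proof -
      have "coeff (map_poly \<eta> f) i \<noteq> 0" using that by (simp add: coeff_map_poly comm_ring_hom_funD)
      then have "map_poly \<eta> f \<noteq> 0" by auto
      then obtain t where "poly (map_poly \<eta> f) t \<noteq> 0" using infinite_field_nonroot by blast
      moreover have "map_poly \<eta> h = 0" if "h \<in> P" for h
        using kill[OF \<open>comm_ring_hom_fun \<eta>\<close> \<open>\<forall>r\<in>R. [:r:] \<in> P \<longrightarrow> \<eta> r = 0\<close> Psub[OF that]] False that by blast
      ultimately show ?thesis by auto
    qed
    then show ?thesis using i cR[OF f(1)] by blast
  next
    case True
    \<comment> \<open>\<open>D d\<close> says that P has an element of degree d with leading
      coefficient nonzero modulo P. For g of the least such degree, P consists of multiples of g up
      to powers of the leading coefficient of g and terms with coefficients in P.\<close>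
    define D where "D d \<longleftrightarrow> (\<exists>g\<in>P. deg_less (Suc d) g \<and> [:coeff g d:] \<notin> P)" for d
    have Dex: "\<exists>d. d < m \<and> D d" if hh: "h \<in> P" "deg_less m h" "[:coeff h i:] \<notin> P" for h m i
    proof -
      obtain q j where q: "q \<in> polys_over R" "h - q \<in> P" "j < m" "deg_less (Suc j) q" "[:coeff q j:] \<notin> P"
        using strip_leading_terms[OF R P Psub[OF hh(1)] hh(2,3)] by blast
      have "h - (h - q) \<in> P" by (rule ideal_in_diff[OF PR P hh(1) q(2)])
      then show ?thesis using q unfolding D_def by auto
    qed
    define d where "d = (LEAST d. D d)"
    obtain g0 i0 where "g0 \<in> P" "[:coeff g0 i0:] \<notin> P" using True by blast
    then have "\<exists>d. D d" using Dex[OF _ deg_less_degree] by blast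
    then have "D d" unfolding d_def by (rule LeastI_ex)
    then obtain g where g: "g \<in> P" "deg_less (Suc d) g" "[:coeff g d:] \<notin> P" by (auto simp: D_def)
    have low: "[:coeff h i:] \<in> P" if "h \<in> P" "deg_less d h" for h i
      using Dex[OF that] not_less_Least[of _ D] unfolding d_def by blast
    have d0: "d \<noteq> 0"
    proof
      assume "d = 0"
      then have "g = [:coeff g d:]"
        using g(2) by (intro poly_eqI) (auto simp: deg_less_def coeff_pCons split: nat.splits)
      then show False using g by auto
    qed
    let ?l = "coeff g d"
    have l: "?l \<in> R" using cR Psub[OF g(1)] by blast
    \<comment> \<open>The ideal generated by f and P. The aim is a constant w in it outside P: once
      \<open>\<eta>\<close> keeps w nonzero, f cannot vanish at a common zero of P.\<close>
    define J where "J = {w. \<exists>u i. u \<in> polys_over R \<and> i \<in> P \<and> w = u * f + i}"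
    have J1: "w - i \<in> J" if "w \<in> J" "i \<in> P" for w i
    proof -
      from that obtain u j where u: "u \<in> polys_over R" "j \<in> P" "w = u * f + j" by (auto simp: J_def)
      have "j - i \<in> P" by (rule ideal_in_diff[OF PR P u(2) that(2)])
      moreover have "w - i = u * f + (j - i)" using u(3) by simp
      ultimately show ?thesis using u(1) unfolding J_def by blast
    qed
    have J2: "i - a * w \<in> J" if "w \<in> J" "i \<in> P" "a \<in> polys_over R" for w i a
    proof -
      from that obtain u j where u: "u \<in> polys_over R" "j \<in> P" "w = u * f + j" by (auto simp: J_def)
      have "i - a * j \<in> P" by (intro ideal_in_diff[OF PR P that(2)] ideal_inD(4)[OF P that(3) u(2)])
      moreover have "i - a * w = (- (a * u)) * f + (i - a * j)" using u(3) by (simp add: algebra_simps)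
      moreover have "- (a * u) \<in> polys_over R" using that(3) u(1) by (simp add: subring_setD[OF PR])
      ultimately show ?thesis unfolding J_def by blast
    qed
    define M where "M m \<longleftrightarrow> (\<exists>w\<in>polys_over R. w \<in> J \<and> deg_less (Suc m) w \<and> [:coeff w m:] \<notin> P)" for m
    have Mex: "\<exists>m. m < b \<and> M m" if ww: "w \<in> J" "w \<notin> P" "w \<in> polys_over R" "deg_less b w" for w b
    proof -
      obtain i where "[:coeff w i:] \<notin> P" using in_ideal_coeffs[OF R P] ww(2) by blast
      then obtain q j where q: "q \<in> polys_over R" "w - q \<in> P" "j < b" "deg_less (Suc j) q" "[:coeff q j:] \<notin> P"
        using strip_leading_terms[OF R P ww(3,4)] by blast
      have "w - (w - q) \<in> J" by (rule J1[OF ww(1) q(2)])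
      then show ?thesis using q unfolding M_def by auto
    qed
    define m where "m = (LEAST m. M m)"
    \<comment> \<open>The remainder of f modulo g lies in \<open>J\<close> but not in P, so
      \<open>J\<close> has elements of degree below d that are nonzero modulo P. This gives
      \<open>m < d\<close>.\<close>
    obtain N q r where fd: "q \<in> polys_over R" "r \<in> polys_over R" "smult (?l ^ N) f = q * g + r" "deg_less d r"
      using pseudo_division[OF R Psub[OF g(1)] g(2) f(1) deg_less_degree] by blast
    have "r = [:?l ^ N:] * f + (- (q * g))" using fd(3) by simp
    moreover have "- (q * g) \<in> P"
      using ideal_in_diff[OF PR P ideal_inD(2)[OF P] ideal_inD(4)[OF P fd(1) g(1)]] by simp
    ultimately have rJ: "r \<in> J"
      using polys_over_const[OF R subring_set_power[OF R l]] unfolding J_def by blast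
    have "r \<notin> P"
    proof
      assume "r \<in> P"
      then have "smult (?l ^ N) f \<in> P"
        unfolding fd(3) by (intro ideal_inD(3)[OF P] ideal_inD(4)[OF P fd(1) g(1)])
      then show False using Psm[OF _ l g(3) f(1)] f(2) by blast
    qed
    from Mex[OF rJ this fd(2,4)] obtain m' where "m' < d" "M m'" by blast
    then have md: "m < d" and "M m"
      unfolding m_def using Least_le[of M m'] LeastI[of M m'] by auto
    then obtain w where w: "w \<in> polys_over R" "w \<in> J" "deg_less (Suc m) w" "[:coeff w m:] \<notin> P"
      by (auto simp: M_def)
    have wP: "w \<notin> P" using low[of w m] w(3,4) md by (auto simp: deg_less_def)
    let ?w = "coeff w m"
    have wR: "?w \<in> R" using cR[OF w(1)] .
    \<comment> \<open>Otherwise g divided by w leaves a remainder in \<open>J\<close> of degree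
      below m, which minimality puts into P. Then \<open>q * w\<close> and hence q lie in P; as q
      has degree below d, all its coefficients lie in P, which is impossible because the coefficient
      of \<open>q * w\<close> at d is \<open>?w ^ N * ?l\<close>.\<close>
    have "m = 0"
    proof (rule ccontr)
      assume m0: "m \<noteq> 0"
      obtain N q r where gd: "q \<in> polys_over R" "r \<in> polys_over R" "smult (?w ^ N) g = q * w + r"
        "deg_less m r" "deg_less (Suc d - m) q"
        using pseudo_division[OF R w(1,3) Psub[OF g(1)] g(2)] by blast
      have sg: "smult (?w ^ N) g \<in> P"
        using ideal_inD(4)[OF P polys_over_const[OF R subring_set_power[OF R wR]] g(1), of N] by simp
      have "r = smult (?w ^ N) g - q * w" using gd(3) by simp
      then have "r \<in> J" using J2[OF w(2) sg gd(1)] by simp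
      then have rP: "r \<in> P"
        using Mex[OF _ _ gd(2,4)] not_less_Least[of _ M] unfolding m_def by blast
      have "smult (?w ^ N) g - r \<in> P" by (rule ideal_in_diff[OF PR P sg rP])
      then have "q * w \<in> P" by (simp add: gd(3))
      then have "q \<in> P" using Pp[OF gd(1) w(1)] wP by blast
      moreover have "deg_less d q" using gd(5) m0 by (auto simp: deg_less_def)
      ultimately have qc: "[:coeff q i:] \<in> P" for i by (rule low)
      have "[:coeff (q * w) d:] = (\<Sum>i\<le>d. [:coeff q i:] * [:coeff w (d - i):])"
        by (simp add: coeff_mult poly_eq_iff coeff_pCons coeff_sum mult.commute split: nat.splits)
      also have "\<dots> \<in> P"
        by (intro ideal_in_sum[OF P] ideal_inD(5)[OF P] qc polys_over_const[OF R] cR[OF w(1)])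
      finally have "[:coeff (q * w) d:] \<in> P" .
      moreover have "coeff (q * w) d = ?w ^ N * ?l"
        using arg_cong[OF gd(3), of "\<lambda>p. coeff p d"] gd(4) md by (simp add: deg_less_def)
      ultimately have "[:?w ^ N * ?l:] \<in> P" by simp
      then show False using Pc[OF subring_set_power[OF R wR] l] Ppow[OF wR w(4)] g(3) by blast
    qed
    then have w0: "w = [:?w:]"
      using w(3) by (intro poly_eqI) (auto simp: deg_less_def coeff_pCons split: nat.splits)
    \<comment> \<open>The first factor keeps \<open>map_poly \<eta> g\<close> of degree at least
      \<open>d > 0\<close>, hence with a root; the second keeps the constant w nonzero, hence f
      nonzero at that root.\<close>
    let ?e = "?l * ?w"
    have "[:?e:] \<notin> P" using Pc[OF l wR] g(3) w(4) by blast
    moreover have "\<exists>t. (\<forall>h\<in>P. poly (map_poly \<eta> h) t = 0) \<and> poly (map_poly \<eta> f) t \<noteq> 0"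
      if \<eta>: "comm_ring_hom_fun \<eta>" "\<forall>r\<in>R. [:r:] \<in> P \<longrightarrow> \<eta> r = 0" "\<eta> ?e \<noteq> 0" for \<eta> :: "'a \<Rightarrow> 'k"
    proof -
      note H = comm_ring_hom_funD[OF \<eta>(1)] and MH = map_poly_hom[OF \<eta>(1)]
      have nz: "\<eta> ?l \<noteq> 0" "\<eta> ?w \<noteq> 0" using \<eta>(3) by (auto simp: H)
      have "coeff (map_poly \<eta> g) d \<noteq> 0" using nz by (simp add: coeff_map_poly H)
      then have "degree (map_poly \<eta> g) \<ge> d" by (rule le_degree)
      then obtain t where t: "poly (map_poly \<eta> g) t = 0"
        using alg_closed_imp_poly_has_root[of "map_poly \<eta> g"] d0 by auto
      have van: "poly (map_poly \<eta> h) t = 0" if hP: "h \<in> P" for h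
      proof -
        obtain N q r where hd: "q \<in> polys_over R" "r \<in> polys_over R" "smult (?l ^ N) h = q * g + r" "deg_less d r"
          using pseudo_division[OF R Psub[OF g(1)] g(2) Psub[OF hP] deg_less_degree] by blast
        have sP: "smult (?l ^ N) h \<in> P"
          using ideal_inD(4)[OF P polys_over_const[OF R subring_set_power[OF R l]] hP, of N] by simp
        have "smult (?l ^ N) h - q * g \<in> P"
          by (intro ideal_in_diff[OF PR P sP] ideal_inD(4)[OF P hd(1) g(1)])
        then have "r \<in> P" by (simp add: hd(3))
        then have "map_poly \<eta> r = 0" using kill[OF \<eta>(1,2) hd(2)] low hd(4) by blast
        then have "map_poly \<eta> (smult (?l ^ N) h) = map_poly \<eta> q * map_poly \<eta> g"
          unfolding hd(3) by (simp only: MH add_0_right)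
        then have "smult (\<eta> ?l ^ N) (map_poly \<eta> h) = map_poly \<eta> q * map_poly \<eta> g"
          by (simp only: MH(3) H(5))
        from arg_cong[OF this, of "\<lambda>p. poly p t"] show ?thesis using nz t by simp
      qed
      obtain u i where u: "i \<in> P" "w = u * f + i" using w(2) by (auto simp: J_def)
      have "map_poly \<eta> w = map_poly \<eta> u * map_poly \<eta> f + map_poly \<eta> i" unfolding u(2) by (simp only: MH)
      moreover have "map_poly \<eta> w = [:\<eta> ?w:]" using w0 MH(4) by metis
      ultimately have "[:\<eta> ?w:] = map_poly \<eta> u * map_poly \<eta> f + map_poly \<eta> i" by simp
      from arg_cong[OF this, of "\<lambda>p. poly p t"]
      have "\<eta> ?w = poly (map_poly \<eta> u) t * poly (map_poly \<eta> f) t + poly (map_poly \<eta> i) t"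
        by simp
      then have "poly (map_poly \<eta> f) t \<noteq> 0" using nz van[OF u(1)] by auto
      then show ?thesis using van by blast
    qed
    ultimately show ?thesis using subring_setD(6)[OF R l wR] by blast
  qed
qed

lemma poly_functions_fun_upd: "p \<in> poly_functions n \<Longrightarrow> n \<le> i \<Longrightarrow> p (a(i := t)) = p a"
  by (induction rule: poly_functions.induct) auto

lemma poly_fun_apply: "(poly p x) b = poly (map_poly (\<lambda>\<phi>. \<phi> b) p) (x b)"
  for p :: "('a \<Rightarrow> 'b::comm_ring_1) poly"
proof (induction p)
  case (pCons c p)
  have "map_poly (\<lambda>\<phi>. \<phi> b) (pCons c p) = pCons (c b) (map_poly (\<lambda>\<phi>. \<phi> b) p)"
    by (intro poly_eqI) (auto simp: coeff_map_poly coeff_pCons split: nat.splits)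
  then show ?case using pCons by simp
qed simp

text \<open>The point is built coordinate by coordinate, so that no change of coordinates is required.\<close>

theorem nullstellensatz_prime:
  fixes P :: "((nat \<Rightarrow> 'k::{alg_closed_field, field_char_0}) \<Rightarrow> 'k) set"
  assumes "prime_in (poly_functions n) P" "f \<in> poly_functions n" "f \<notin> P"
  shows "\<exists>a\<in>affine_space n. (\<forall>p\<in>P. p a = 0) \<and> f a \<noteq> 0"
  using assms
proof (induction n arbitrary: P f)
  case 0
  then have P: "ideal_in (poly_functions 0) P" and P1: "1 \<notin> P" by (auto simp: prime_in_def)
  have "p = 0" if pP: "p \<in> P" for p
  proof -
    obtain c where c: "p = (\<lambda>x. c)" using poly_functions_0 ideal_inD(1)[OF P pP] by blast
    have "c = 0"
    proof (rule ccontr)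
      assume "c \<noteq> 0"
      then have "(\<lambda>x. 1 / c) * p = 1" using c by (simp add: fun_eq_iff)
      then show False using P1 ideal_inD(4)[OF P poly_functions_fun(1) pP] by metis
    qed
    then show ?thesis using c by (simp add: fun_eq_iff)
  qed
  moreover obtain c where "f = (\<lambda>x. c)" using poly_functions_0 0 by blast
  moreover have "f \<noteq> 0" using 0 ideal_inD(2)[OF P] by auto
  ultimately show ?case by (auto simp: affine_space_def fun_eq_iff)
next
  case (Suc n)
  let ?R = "poly_functions n :: ((nat \<Rightarrow> 'k) \<Rightarrow> 'k) set" and ?X = "\<lambda>x. x n :: 'k"
  note R = subring_set_poly_functions[of n]
  note PR = subring_set_polys_over[OF R]
  have P: "ideal_in (poly_functions (Suc n)) P" and P1: "1 \<notin> P"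
    and Pp: "\<And>a b. a \<in> poly_functions (Suc n) \<Longrightarrow> b \<in> poly_functions (Suc n) \<Longrightarrow> a * b \<in> P \<Longrightarrow> a \<in> P \<or> b \<in> P"
    using Suc.prems(1) by (auto simp: prime_in_def)
  have ev: "p \<in> polys_over ?R \<Longrightarrow> poly p ?X \<in> poly_functions (Suc n)" for p
    unfolding poly_functions_Suc adjoin_def by blast
  \<comment> \<open>The preimage of P under evaluation of polynomials at the last coordinate, so
    that the elimination of one variable applies to it.\<close>
  define Q where "Q = {p\<in>polys_over ?R. poly p ?X \<in> P}"
  have Q: "prime_in (polys_over ?R) Q"
    unfolding prime_in_def ideal_in_def
  proof (intro conjI ballI impI)
    show "Q \<subseteq> polys_over ?R" by (auto simp: Q_def)
    show "0 \<in> Q" using subring_setD(2)[OF PR] ideal_inD(2)[OF P] by (simp add: Q_def)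
    show "1 \<notin> Q" using P1 by (simp add: Q_def)
    show "a + b \<in> Q" if "a \<in> Q" "b \<in> Q" for a b
      using that by (simp add: Q_def subring_setD(4)[OF PR] ideal_inD(3)[OF P])
    show "a * b \<in> Q" if "a \<in> polys_over ?R" "b \<in> Q" for a b
      using that by (simp add: Q_def subring_setD(6)[OF PR] ideal_inD(4)[OF P ev])
    show "a \<in> Q \<or> b \<in> Q" if "a \<in> polys_over ?R" "b \<in> polys_over ?R" "a * b \<in> Q" for a b
      using that Pp[OF ev ev] by (auto simp: Q_def)
  qed
  obtain F where F: "F \<in> polys_over ?R" "f = poly F ?X"
    using Suc.prems(2) unfolding poly_functions_Suc adjoin_def by blast
  then have "F \<notin> Q" using Suc.prems(3) by (simp add: Q_def)
  from point_extension[OF R Q F(1) this, where 'k='k] obtain e where e: "e \<in> ?R" "[:e:] \<notin> Q"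
    and ext: "\<And>\<eta>::_ \<Rightarrow> 'k. comm_ring_hom_fun \<eta> \<Longrightarrow> \<forall>r\<in>?R. [:r:] \<in> Q \<longrightarrow> \<eta> r = 0 \<Longrightarrow> \<eta> e \<noteq> 0 \<Longrightarrow>
      \<exists>t. (\<forall>h\<in>Q. poly (map_poly \<eta> h) t = 0) \<and> poly (map_poly \<eta> F) t \<noteq> 0"
    by blast
  have cQ: "[:r:] \<in> Q \<longleftrightarrow> r \<in> P" if "r \<in> ?R" for r
    using that by (simp add: Q_def polys_over_const[OF R])
  have sub: "r \<in> ?R \<Longrightarrow> r \<in> poly_functions (Suc n)" for r by (rule poly_functions_mono) auto
  \<comment> \<open>The induction hypothesis is applied to the contraction of P, with e in the role
    of f. This is why the statement carries a function that must not vanish.\<close>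
  have "prime_in ?R (?R \<inter> P)"
    unfolding prime_in_def ideal_in_def
    using ideal_inD[OF P] P1 Pp sub subring_setD[OF R] by auto
  moreover have "e \<notin> ?R \<inter> P" using e cQ by blast
  ultimately obtain a where a: "a \<in> affine_space n" "\<forall>p\<in>?R \<inter> P. p a = 0" "e a \<noteq> 0"
    using Suc.IH e(1) by blast
  obtain t where t: "\<forall>h\<in>Q. poly (map_poly (\<lambda>\<phi>. \<phi> a) h) t = 0" "poly (map_poly (\<lambda>\<phi>. \<phi> a) F) t \<noteq> 0"
    using ext[of "\<lambda>\<phi>. \<phi> a"] a cQ by (auto simp: comm_ring_hom_fun_def)
  let ?b = "a(n := t)"
  have "map_poly (\<lambda>\<phi>. \<phi> ?b) p = map_poly (\<lambda>\<phi>. \<phi> a) p" if "p \<in> polys_over ?R" for p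
  proof -
    have "coeff p i ?b = coeff p i a" for i
      using that poly_functions_fun_upd[of "coeff p i" n n] by (simp add: polys_over_def)
    then show ?thesis by (intro poly_eqI) (simp add: coeff_map_poly)
  qed
  then have evb: "(poly p ?X) ?b = poly (map_poly (\<lambda>\<phi>. \<phi> a) p) t" if "p \<in> polys_over ?R" for p
    using that by (simp add: poly_fun_apply)
  have "p ?b = 0" if p: "p \<in> P" for p
  proof -
    obtain h where "h \<in> polys_over ?R" "p = poly h ?X"
      using ideal_inD(1)[OF P p] unfolding poly_functions_Suc adjoin_def by blast
    then show ?thesis using evb t(1) p by (auto simp: Q_def)
  qed
  moreover have "f ?b \<noteq> 0" using evb[OF F(1)] F(2) t(2) by simp
  moreover have "?b \<in> affine_space (Suc n)"
    using a(1) by (auto simp: affine_space_def PiE_def Pi_def extensional_def)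
  ultimately show ?case by blast
qed

section \<open>Coordinates on varieties and irreducible sets\<close>

section \<open>Affine charts\<close>

text \<open>The isomorphism of V with a closed subset of affine space, rewritten as statements about
  X alone: principal open sets form a basis on V and regular functions are locally quotients of
  polynomials. In the last clause one q is both the denominator and the equation that cuts out the
  neighbourhood.\<close>

definition chart :: "('x, 'k::field) fun_space \<Rightarrow> 'x set \<Rightarrow> nat \<Rightarrow> ((nat \<Rightarrow> 'k) \<Rightarrow> 'k) set \<Rightarrow>
    ('x \<Rightarrow> nat \<Rightarrow> 'k) \<Rightarrow> bool" where
  "chart X V n S \<phi> \<longleftrightarrow>
     openin (pts X) V \<and> S \<subseteq> poly_functions n \<and> bij_betw \<phi> V (zero_locus n S) \<and>
     (\<forall>q\<in>poly_functions n. openin (pts X) {y\<in>V. q (\<phi> y) \<noteq> 0}) \<and>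
     (\<forall>W x. openin (pts X) W \<and> x \<in> W \<and> x \<in> V \<longrightarrow>
        (\<exists>q\<in>poly_functions n. q (\<phi> x) \<noteq> 0 \<and> {y\<in>V. q (\<phi> y) \<noteq> 0} \<subseteq> W)) \<and>
     (\<forall>p\<in>poly_functions n. \<forall>q\<in>poly_functions n.
        restrict (\<lambda>y. p (\<phi> y) / q (\<phi> y)) {y\<in>V. q (\<phi> y) \<noteq> 0} \<in> reg X {y\<in>V. q (\<phi> y) \<noteq> 0}) \<and>
     (\<forall>W f x. openin (pts X) W \<and> f \<in> reg X W \<and> x \<in> W \<and> x \<in> V \<longrightarrow>
        (\<exists>p\<in>poly_functions n. \<exists>q\<in>poly_functions n. q (\<phi> x) \<noteq> 0 \<and> {y\<in>V. q (\<phi> y) \<noteq> 0} \<subseteq> W \<and>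
           (\<forall>y\<in>V. q (\<phi> y) \<noteq> 0 \<longrightarrow> f y = p (\<phi> y) / q (\<phi> y))))"

lemma topspace_zariski: "topspace (zariski_topology n) = affine_space n"
proof -
  have "affine_space n - zero_locus n {\<lambda>x. 1 :: 'a} = affine_space n"
    by (auto simp: zero_locus_def)
  then have "affine_space n \<in> {affine_space n - zero_locus n S | S. S \<subseteq> (poly_functions n :: ((nat \<Rightarrow> 'a) \<Rightarrow> 'a) set)}"
    using poly_const[of 1 n] by (intro CollectI exI[of _ "{\<lambda>x. 1}"]) auto
  then show ?thesis
    by (auto simp: zariski_topology_def topology_generated_by_topspace)
qed

lemma zariski_basis:
  fixes a :: "nat \<Rightarrow> 'k::field"
  assumes "openin (zariski_topology n) T" "a \<in> T"
  shows "\<exists>q\<in>poly_functions n. q a \<noteq> 0 \<and> {z\<in>affine_space n. q z \<noteq> 0} \<subseteq> T"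
proof -
  have "generate_topology_on {affine_space n - zero_locus n S | S. S \<subseteq> (poly_functions n :: ((nat \<Rightarrow> 'k) \<Rightarrow> 'k) set)} T"
    using assms(1) by (simp add: zariski_topology_def openin_topology_generated_by_iff)
  then show ?thesis using assms(2)
  proof (induction rule: generate_topology_on.induct)
    case Empty
    then show ?case by simp
  next
    case (Int A B)
    then obtain p q where "p \<in> poly_functions n" "p a \<noteq> 0" "{z\<in>affine_space n. p z \<noteq> 0} \<subseteq> A"
      "q \<in> poly_functions n" "q a \<noteq> 0" "{z\<in>affine_space n. q z \<noteq> 0} \<subseteq> B" by auto
    then show ?case by (intro bexI[of _ "\<lambda>x. p x * q x"] poly_mult) auto
  next
    case (UN K)
    then obtain k where k: "k \<in> K" "a \<in> k" by auto
    then have "\<exists>q\<in>poly_functions n. q a \<noteq> 0 \<and> {z\<in>affine_space n. q z \<noteq> 0} \<subseteq> k" using UN.IH by blast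
    then show ?case using k by blast
  next
    case (Basis s)
    then obtain S where S: "S \<subseteq> (poly_functions n :: ((nat \<Rightarrow> 'k) \<Rightarrow> 'k) set)" "s = affine_space n - zero_locus n S"
      by auto
    then obtain p where p: "p \<in> S" "p a \<noteq> 0" using Basis.prems by (auto simp: zero_locus_def)
    have "{z\<in>affine_space n. p z \<noteq> 0} \<subseteq> s" using p S by (auto simp: zero_locus_def)
    then show ?case using p S by blast
  qed
qed

lemma zariski_open_nonvanishing:
  assumes "q \<in> poly_functions n"
  shows "openin (zariski_topology n) {z\<in>affine_space n. q z \<noteq> (0::'k::field)}"
proof -
  have "{z\<in>affine_space n. q z \<noteq> 0} = affine_space n - zero_locus n {q}" by (auto simp: zero_locus_def)
  then have "{z\<in>affine_space n. q z \<noteq> 0} \<in>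
      {affine_space n - zero_locus n S | S. S \<subseteq> (poly_functions n :: ((nat \<Rightarrow> 'k) \<Rightarrow> 'k) set)}"
    using assms by blast
  then show ?thesis unfolding zariski_topology_def by (rule topology_generated_by_Basis)
qed

lemma reg_affine_model:
  "f \<in> reg (affine_model n Z) U \<longleftrightarrow> f \<in> extensional U \<and> (\<forall>x\<in>U. \<exists>W p q.
     openin (pts (affine_model n Z)) W \<and> x \<in> W \<and> W \<subseteq> U \<and> p \<in> poly_functions n \<and> q \<in> poly_functions n \<and>
     (\<forall>y\<in>W. q y \<noteq> 0 \<and> f y = p y / q y))"
  by (simp add: affine_model_def)

lemma affine_open_chart:
  assumes X: "space_with_functions X" and aff: "affine_open X V"
  shows "\<exists>n S \<phi>. chart X V n S \<phi>"
proof -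
  have V: "openin (pts X) V" and "affine (open_subspace X V)" using aff by (auto simp: affine_open_def)
  then obtain n S where S: "S \<subseteq> poly_functions n"
    and iso: "spaces_isomorphic (open_subspace X V) (affine_model n (zero_locus n S))"
    by (auto simp: affine_def)
  define Z where "Z = zero_locus n S"
  let ?M = "affine_model n Z" and ?XV = "open_subspace X V"
  obtain \<phi> \<psi> where \<phi>: "space_morphism ?XV ?M \<phi>" and \<psi>: "space_morphism ?M ?XV \<psi>"
    and inv: "\<And>x. x \<in> topspace (pts ?XV) \<Longrightarrow> \<psi> (\<phi> x) = x" "\<And>y. y \<in> topspace (pts ?M) \<Longrightarrow> \<phi> (\<psi> y) = y"
    using iso unfolding spaces_isomorphic_def Z_def by blast
  have Zsub: "Z \<subseteq> affine_space n" by (auto simp: Z_def zero_locus_def)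
  have tV: "topspace (pts ?XV) = V"
    using openin_subset[OF V] by (auto simp: open_subspace_def)
  have tM: "topspace (pts ?M) = Z"
    using Zsub by (auto simp: affine_model_def topspace_zariski)
  have regV: "reg ?XV = reg X" by (simp add: open_subspace_def)
  have opV: "openin (pts ?XV) W \<longleftrightarrow> openin (pts X) W \<and> W \<subseteq> V" for W
    using openin_open_subtopology[OF V] by (simp add: open_subspace_def)
  have opM: "openin (pts ?M) W \<longleftrightarrow> (\<exists>T. openin (zariski_topology n) T \<and> W = T \<inter> Z)" for W
    by (simp add: affine_model_def openin_subtopology)
  have cont: "continuous_map (pts ?XV) (pts ?M) \<phi>" "continuous_map (pts ?M) (pts ?XV) \<psi>"
    using \<phi> \<psi> by (auto simp: space_morphism_def)
  have pV: "\<phi> y \<in> Z" if "y \<in> V" for y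
    using continuous_map_image_subset_topspace[OF cont(1)] that tV tM by auto
  have pZ: "\<psi> z \<in> V" if "z \<in> Z" for z
    using continuous_map_image_subset_topspace[OF cont(2)] that tV tM by auto
  have bij: "bij_betw \<phi> V Z"
    by (rule bij_betw_byWitness[of _ \<psi>]) (use inv tV tM pV pZ in auto)
  have DM: "openin (pts ?M) {z\<in>Z. q z \<noteq> 0}" if "q \<in> poly_functions n" for q
    unfolding opM using zariski_open_nonvanishing[OF that] Zsub by blast
  have open_D: "openin (pts X) {y\<in>V. q (\<phi> y) \<noteq> 0}" if "q \<in> poly_functions n" for q
  proof -
    have "openin (pts ?XV) {y\<in>topspace (pts ?XV). \<phi> y \<in> {z\<in>Z. q z \<noteq> 0}}"
      by (rule openin_continuous_map_preimage[OF cont(1) DM[OF that]])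
    moreover have "{y\<in>topspace (pts ?XV). \<phi> y \<in> {z\<in>Z. q z \<noteq> 0}} = {y\<in>V. q (\<phi> y) \<noteq> 0}"
      using pV tV by auto
    ultimately show ?thesis using opV by simp
  qed
  have basisM: "\<exists>q\<in>poly_functions n. q z \<noteq> 0 \<and> {z\<in>Z. q z \<noteq> 0} \<subseteq> W" if W: "openin (pts ?M) W" "z \<in> W" for W z
  proof -
    obtain T where "openin (zariski_topology n) T" "W = T \<inter> Z" using W opM by auto
    moreover obtain q where "q \<in> poly_functions n" "q z \<noteq> 0" "{z\<in>affine_space n. q z \<noteq> 0} \<subseteq> T"
      using zariski_basis[of n T z] calculation W(2) by blast
    ultimately show ?thesis using Zsub by (intro bexI[of _ q]) auto
  qed
  have pre: "openin (pts ?M) {z\<in>Z. \<psi> z \<in> W}" if "openin (pts X) W" "W \<subseteq> V" for W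
    using openin_continuous_map_preimage[OF cont(2), of W] that opV tM by simp
  have base: "\<exists>q\<in>poly_functions n. q (\<phi> x) \<noteq> 0 \<and> {y\<in>V. q (\<phi> y) \<noteq> 0} \<subseteq> W"
    if W: "openin (pts X) W" "x \<in> W" "x \<in> V" for W x
  proof -
    have "openin (pts ?M) {z\<in>Z. \<psi> z \<in> W \<inter> V}" using W V by (intro pre) auto
    moreover have "\<phi> x \<in> {z\<in>Z. \<psi> z \<in> W \<inter> V}" using W pV inv(1) tV by auto
    ultimately obtain q where q: "q \<in> poly_functions n" "q (\<phi> x) \<noteq> 0" "{z\<in>Z. q z \<noteq> 0} \<subseteq> {z\<in>Z. \<psi> z \<in> W \<inter> V}"
      using basisM by blast
    have "y \<in> W" if "y \<in> V" "q (\<phi> y) \<noteq> 0" for y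
    proof -
      have "\<psi> (\<phi> y) \<in> W" using q(3) that pV[of y] by blast
      then show ?thesis using inv(1)[of y] that tV by simp
    qed
    then show ?thesis using q by blast
  qed
  have quot: "restrict (\<lambda>y. p (\<phi> y) / q (\<phi> y)) {y\<in>V. q (\<phi> y) \<noteq> 0} \<in> reg X {y\<in>V. q (\<phi> y) \<noteq> 0}"
    if pq: "p \<in> poly_functions n" "q \<in> poly_functions n" for p q
  proof -
    let ?D = "{z\<in>Z. q z \<noteq> 0}"
    have "restrict (\<lambda>z. p z / q z) ?D \<in> reg ?M ?D"
      unfolding reg_affine_model
    proof (intro conjI ballI)
      fix x assume "x \<in> ?D"
      then show "\<exists>W p' q'. openin (pts ?M) W \<and> x \<in> W \<and> W \<subseteq> ?D \<and> p' \<in> poly_functions n \<and>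
          q' \<in> poly_functions n \<and> (\<forall>y\<in>W. q' y \<noteq> 0 \<and> restrict (\<lambda>z. p z / q z) ?D y = p' y / q' y)"
        using DM[OF pq(2)] pq by (intro exI[of _ ?D] exI[of _ p] exI[of _ q]) auto
    qed simp
    then have "restrict (\<lambda>x. restrict (\<lambda>z. p z / q z) ?D (\<phi> x)) {x\<in>topspace (pts ?XV). \<phi> x \<in> ?D}
        \<in> reg ?XV {x\<in>topspace (pts ?XV). \<phi> x \<in> ?D}"
      using \<phi> DM[OF pq(2)] unfolding space_morphism_def by blast
    moreover have "{x\<in>topspace (pts ?XV). \<phi> x \<in> ?D} = {y\<in>V. q (\<phi> y) \<noteq> 0}" using pV tV by auto
    moreover have "restrict (\<lambda>x. restrict (\<lambda>z. p z / q z) ?D (\<phi> x)) {y\<in>V. q (\<phi> y) \<noteq> 0} =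
        restrict (\<lambda>y. p (\<phi> y) / q (\<phi> y)) {y\<in>V. q (\<phi> y) \<noteq> 0}"
      using pV by (auto simp: restrict_def fun_eq_iff)
    ultimately show ?thesis using regV by simp
  qed
  have loc: "\<exists>p\<in>poly_functions n. \<exists>q\<in>poly_functions n. q (\<phi> x) \<noteq> 0 \<and> {y\<in>V. q (\<phi> y) \<noteq> 0} \<subseteq> W \<and>
           (\<forall>y\<in>V. q (\<phi> y) \<noteq> 0 \<longrightarrow> f y = p (\<phi> y) / q (\<phi> y))"
    if W: "openin (pts X) W" "f \<in> reg X W" "x \<in> W" "x \<in> V" for W f x
  proof -
    have WV: "openin (pts X) (W \<inter> V)" using W V by auto
    have "restrict f (W \<inter> V) \<in> reg ?XV (W \<inter> V)"
      using X W WV unfolding space_with_functions_def regV by blast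
    then have "restrict (\<lambda>z. restrict f (W \<inter> V) (\<psi> z)) {z\<in>topspace (pts ?M). \<psi> z \<in> W \<inter> V}
        \<in> reg ?M {z\<in>topspace (pts ?M). \<psi> z \<in> W \<inter> V}"
      using \<psi> WV opV[of "W \<inter> V"] unfolding space_morphism_def by blast
    moreover have x: "\<phi> x \<in> {z\<in>topspace (pts ?M). \<psi> z \<in> W \<inter> V}" using W pV inv(1) tV tM by auto
    moreover note x
    ultimately have "\<exists>W' p q. openin (pts ?M) W' \<and> \<phi> x \<in> W' \<and> W' \<subseteq> {z\<in>topspace (pts ?M). \<psi> z \<in> W \<inter> V} \<and>
        p \<in> poly_functions n \<and> q \<in> poly_functions n \<and> (\<forall>z\<in>W'. q z \<noteq> 0 \<and>
        restrict (\<lambda>z. restrict f (W \<inter> V) (\<psi> z)) {z\<in>topspace (pts ?M). \<psi> z \<in> W \<inter> V} z = p z / q z)"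
      unfolding reg_affine_model by blast
    then obtain W' p q where W': "openin (pts ?M) W'" "\<phi> x \<in> W'"
      "W' \<subseteq> {z\<in>topspace (pts ?M). \<psi> z \<in> W \<inter> V}" "p \<in> poly_functions n" "q \<in> poly_functions n"
      and eq: "\<And>z. z \<in> W' \<Longrightarrow> q z \<noteq> 0 \<and>
        restrict (\<lambda>z. restrict f (W \<inter> V) (\<psi> z)) {z\<in>topspace (pts ?M). \<psi> z \<in> W \<inter> V} z = p z / q z"
      by blast
    obtain q' where q': "q' \<in> poly_functions n" "q' (\<phi> x) \<noteq> 0" "{z\<in>Z. q' z \<noteq> 0} \<subseteq> W'"
      using basisM W' by blast
    have in_W: "y \<in> W \<and> f y = p (\<phi> y) / q (\<phi> y)" if "y \<in> V" "q' (\<phi> y) \<noteq> 0" for y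
    proof -
      have y: "\<phi> y \<in> W'" using that pV q' by auto
      then have "\<psi> (\<phi> y) \<in> W \<inter> V" "\<phi> y \<in> Z" using W'(3) tM by auto
      then show ?thesis using eq[OF y] inv(1)[of y] that tV tM by auto
    qed
    \<comment> \<open>Multiplying numerator and denominator by q' makes one function serve as
      denominator and as equation of the neighbourhood.\<close>
    then show ?thesis
      using W' q' eq[of "\<phi> x"]
      by (intro bexI[of _ "\<lambda>z. p z * q' z"] bexI[of _ "\<lambda>z. q z * q' z"] poly_mult) auto
  qed
  have "chart X V n S \<phi>"
    unfolding chart_def Z_def[symmetric]
    by (intro conjI ballI allI impI; (elim conjE)?;
        (rule V | rule S | rule bij | (rule open_D; assumption) | (rule base; assumption)
          | (rule quot; assumption) | (rule loc; assumption)))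
  then show ?thesis by blast
qed

section \<open>Varieties as spaces of functions\<close>

locale variety_space =
  fixes X :: "('x, 'k::{alg_closed_field, field_char_0}) fun_space"
  assumes variety: "variety X"
begin

abbreviation op :: "'x set \<Rightarrow> bool" where "op U \<equiv> openin (pts X) U"

lemma swf: "space_with_functions X"
  using variety by (simp add: variety_def prevariety_def)

lemma assumes U: "op U"
  shows reg_ext: "f \<in> reg X U \<Longrightarrow> f \<in> extensional U"
    and reg_const: "restrict (\<lambda>x. c) U \<in> reg X U"
    and reg_add: "f \<in> reg X U \<Longrightarrow> g \<in> reg X U \<Longrightarrow> restrict (\<lambda>x. f x + g x) U \<in> reg X U"
    and reg_mult: "f \<in> reg X U \<Longrightarrow> g \<in> reg X U \<Longrightarrow> restrict (\<lambda>x. f x * g x) U \<in> reg X U"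
    and reg_restrict: "op V \<Longrightarrow> V \<subseteq> U \<Longrightarrow> f \<in> reg X U \<Longrightarrow> restrict f V \<in> reg X V"
    and reg_glue: "f \<in> extensional U \<Longrightarrow>
      (\<And>x. x \<in> U \<Longrightarrow> \<exists>V. op V \<and> x \<in> V \<and> V \<subseteq> U \<and> restrict f V \<in> reg X V) \<Longrightarrow> f \<in> reg X U"
proof -
  note * = swf[unfolded space_with_functions_def, THEN spec, THEN mp, OF U]
  show "f \<in> reg X U \<Longrightarrow> f \<in> extensional U" using * by (elim conjE) auto
  show "restrict (\<lambda>x. c) U \<in> reg X U" using * by (elim conjE) simp
  show "f \<in> reg X U \<Longrightarrow> g \<in> reg X U \<Longrightarrow> restrict (\<lambda>x. f x + g x) U \<in> reg X U" using * by (elim conjE) simp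
  show "f \<in> reg X U \<Longrightarrow> g \<in> reg X U \<Longrightarrow> restrict (\<lambda>x. f x * g x) U \<in> reg X U" using * by (elim conjE) simp
  show "op V \<Longrightarrow> V \<subseteq> U \<Longrightarrow> f \<in> reg X U \<Longrightarrow> restrict f V \<in> reg X V" using * by (elim conjE) simp
  have "\<forall>f\<in>extensional U. (\<forall>x\<in>U. \<exists>V. op V \<and> x \<in> V \<and> V \<subseteq> U \<and> restrict f V \<in> reg X V) \<longrightarrow> f \<in> reg X U"
    using * by (elim conjE)
  then show "f \<in> extensional U \<Longrightarrow>
      (\<And>x. x \<in> U \<Longrightarrow> \<exists>V. op V \<and> x \<in> V \<and> V \<subseteq> U \<and> restrict f V \<in> reg X V) \<Longrightarrow> f \<in> reg X U"
    by simp
qed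

lemma finite_charts: "\<exists>\<U>. finite \<U> \<and> \<Union>\<U> = topspace (pts X) \<and> (\<forall>V\<in>\<U>. \<exists>n S \<phi>. chart X V n S \<phi>)"
proof -
  obtain \<U> where "finite \<U>" "\<forall>U\<in>\<U>. affine_open X U" "\<Union>\<U> = topspace (pts X)"
    using variety by (auto simp: variety_def prevariety_def)
  then show ?thesis using affine_open_chart[OF swf] by (intro exI[of _ \<U>]) simp
qed

lemma chart_at:
  assumes "x \<in> topspace (pts X)"
  obtains V n S \<phi> where "chart X V n S \<phi>" "x \<in> V"
proof -
  obtain \<U> where U: "\<Union>\<U> = topspace (pts X)" "\<forall>V\<in>\<U>. \<exists>n S \<phi>. chart X V n S \<phi>"
    using finite_charts by auto
  then obtain V where "V \<in> \<U>" "x \<in> V" using assms by auto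
  then show thesis using U(2) that by auto
qed

lemma chartD:
  assumes "chart X V n S \<phi>"
  shows "op V" "S \<subseteq> poly_functions n" "bij_betw \<phi> V (zero_locus n S)"
    "q \<in> poly_functions n \<Longrightarrow> op {y\<in>V. q (\<phi> y) \<noteq> 0}"
    "op W \<Longrightarrow> x \<in> W \<Longrightarrow> x \<in> V \<Longrightarrow> \<exists>q\<in>poly_functions n. q (\<phi> x) \<noteq> 0 \<and> {y\<in>V. q (\<phi> y) \<noteq> 0} \<subseteq> W"
    "p \<in> poly_functions n \<Longrightarrow> q \<in> poly_functions n \<Longrightarrow>
      restrict (\<lambda>y. p (\<phi> y) / q (\<phi> y)) {y\<in>V. q (\<phi> y) \<noteq> 0} \<in> reg X {y\<in>V. q (\<phi> y) \<noteq> 0}"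
    "op W \<Longrightarrow> f \<in> reg X W \<Longrightarrow> x \<in> W \<Longrightarrow> x \<in> V \<Longrightarrow>
        \<exists>p\<in>poly_functions n. \<exists>q\<in>poly_functions n. q (\<phi> x) \<noteq> 0 \<and> {y\<in>V. q (\<phi> y) \<noteq> 0} \<subseteq> W \<and>
           (\<forall>y\<in>V. q (\<phi> y) \<noteq> 0 \<longrightarrow> f y = p (\<phi> y) / q (\<phi> y))"
  using assms[unfolded chart_def] by (elim conjE; simp)+

lemma op_topspace: "op U \<Longrightarrow> U \<subseteq> topspace (pts X)"
  by (rule openin_subset)

lemma op_nonzero:
  assumes U: "op U" and f: "f \<in> reg X U"
  shows "op {x\<in>U. f x \<noteq> 0}"
proof (subst openin_subopen, intro ballI)
  fix x assume x: "x \<in> {x\<in>U. f x \<noteq> 0}"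
  then obtain V n S \<phi> where V: "chart X V n S \<phi>" "x \<in> V" using chart_at op_topspace[OF U] by blast
  obtain p q where pq: "p \<in> poly_functions n" "q \<in> poly_functions n" "q (\<phi> x) \<noteq> 0" "{y\<in>V. q (\<phi> y) \<noteq> 0} \<subseteq> U"
    "\<forall>y\<in>V. q (\<phi> y) \<noteq> 0 \<longrightarrow> f y = p (\<phi> y) / q (\<phi> y)"
    using chartD(7)[OF V(1) U f _ V(2)] x by blast
  have "op {y\<in>V. p (\<phi> y) * q (\<phi> y) \<noteq> 0}" using chartD(4)[OF V(1) poly_mult[OF pq(1,2)]] .
  moreover have "x \<in> {y\<in>V. p (\<phi> y) * q (\<phi> y) \<noteq> 0}" using x V pq by auto
  moreover have "{y\<in>V. p (\<phi> y) * q (\<phi> y) \<noteq> 0} \<subseteq> {x\<in>U. f x \<noteq> 0}" using pq by auto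
  ultimately show "\<exists>T. op T \<and> x \<in> T \<and> T \<subseteq> {x\<in>U. f x \<noteq> 0}" by blast
qed

lemma reg_inverse:
  assumes U: "op U" and f: "f \<in> reg X U" and nz: "\<And>x. x \<in> U \<Longrightarrow> f x \<noteq> 0"
  shows "restrict (\<lambda>x. 1 / f x) U \<in> reg X U"
proof (rule reg_glue[OF U])
  fix x assume x: "x \<in> U"
  then obtain V n S \<phi> where V: "chart X V n S \<phi>" "x \<in> V" using chart_at op_topspace[OF U] by blast
  obtain p q where pq: "p \<in> poly_functions n" "q \<in> poly_functions n" "q (\<phi> x) \<noteq> 0" "{y\<in>V. q (\<phi> y) \<noteq> 0} \<subseteq> U"
    "\<forall>y\<in>V. q (\<phi> y) \<noteq> 0 \<longrightarrow> f y = p (\<phi> y) / q (\<phi> y)"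
    using chartD(7)[OF V(1) U f x V(2)] by blast
  define W where "W = {y\<in>V. p (\<phi> y) * q (\<phi> y) \<noteq> 0}"
  have WU: "W \<subseteq> U" using pq by (auto simp: W_def)
  have 1: "op W" unfolding W_def using chartD(4)[OF V(1) poly_mult[OF pq(1,2)]] .
  \<comment> \<open>The inverse of f is written as q q / (p q), so that its denominator is the very
    function that defines \<open>W\<close>.\<close>
  have "restrict (\<lambda>y. q (\<phi> y) * q (\<phi> y) / (p (\<phi> y) * q (\<phi> y))) W \<in> reg X W"
    unfolding W_def using chartD(6)[OF V(1) poly_mult[OF pq(2,2)] poly_mult[OF pq(1,2)]] .
  moreover have "restrict (\<lambda>y. q (\<phi> y) * q (\<phi> y) / (p (\<phi> y) * q (\<phi> y))) W = restrict (restrict (\<lambda>x. 1 / f x) U) W"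
    using pq WU by (auto simp: restrict_def fun_eq_iff W_def)
  ultimately have "restrict (restrict (\<lambda>x. 1 / f x) U) W \<in> reg X W" by simp
  moreover have "x \<in> W" using x V pq nz[OF x] by (auto simp: W_def)
  ultimately show "\<exists>W. op W \<and> x \<in> W \<and> W \<subseteq> U \<and> restrict (restrict (\<lambda>x. 1 / f x) U) W \<in> reg X W"
    using 1 WU by blast
qed simp

end

text \<open>Irreducibility in terms of open sets of the ambient space. It applies directly to sets
  that are not closed, such as loci inside a chart.\<close>

definition irr_in :: "'x topology \<Rightarrow> 'x set \<Rightarrow> bool" where
  "irr_in T Y \<longleftrightarrow> Y \<noteq> {} \<and> Y \<subseteq> topspace T \<and>
     (\<forall>U V. openin T U \<and> openin T V \<and> U \<inter> Y \<noteq> {} \<and> V \<inter> Y \<noteq> {} \<longrightarrow> U \<inter> V \<inter> Y \<noteq> {})"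

lemma irreducible_space_iff_irr_in:
  assumes "Y \<subseteq> topspace T"
  shows "irreducible_space (subtopology T Y) \<longleftrightarrow> irr_in T Y"
proof
  have top: "topspace (subtopology T Y) = Y" using assms by auto
  assume irr: "irreducible_space (subtopology T Y)"
  show "irr_in T Y"
    unfolding irr_in_def
  proof (intro conjI allI impI)
    show "Y \<noteq> {}" using irr top by (auto simp: irreducible_space_def)
    show "Y \<subseteq> topspace T" by fact
    fix U V assume UV: "openin T U \<and> openin T V \<and> U \<inter> Y \<noteq> {} \<and> V \<inter> Y \<noteq> {}"
    have cl: "closedin (subtopology T Y) (Y - U)" if "openin T U" for U
      using that top by (auto simp: closedin_def openin_subtopology Int_commute)
    show "U \<inter> V \<inter> Y \<noteq> {}"
    proof
      assume "U \<inter> V \<inter> Y = {}"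
      then have "(Y - U) \<union> (Y - V) = topspace (subtopology T Y)" using top by auto
      then have "Y - U = Y \<or> Y - V = Y"
        using irr cl UV top unfolding irreducible_space_def by metis
      then show False using UV by auto
    qed
  qed
next
  have top: "topspace (subtopology T Y) = Y" using assms by auto
  assume irr: "irr_in T Y"
  show "irreducible_space (subtopology T Y)"
    unfolding irreducible_space_def top
  proof (intro conjI allI impI)
    show "Y \<noteq> {}" using irr by (simp add: irr_in_def)
    fix A B assume AB: "closedin (subtopology T Y) A \<and> closedin (subtopology T Y) B \<and> A \<union> B = Y"
    then obtain C D where CD: "closedin T C" "A = C \<inter> Y" "closedin T D" "B = D \<inter> Y"
      by (auto simp: closedin_subtopology)
    let ?U = "topspace T - C" and ?V = "topspace T - D"
    have o: "openin T ?U" "openin T ?V" using CD by (auto simp: closedin_def)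
    have "?U \<inter> ?V \<inter> Y = {}" using AB CD by auto
    then have "?U \<inter> Y = {} \<or> ?V \<inter> Y = {}" using irr o unfolding irr_in_def by blast
    then show "A = Y \<or> B = Y" using CD assms by auto
  qed
qed

lemma irr_in_closed_union:
  assumes "irr_in T Y" "closedin T A" "closedin T B" "Y \<subseteq> A \<union> B"
  shows "Y \<subseteq> A \<or> Y \<subseteq> B"
proof -
  let ?U = "topspace T - A" and ?V = "topspace T - B"
  have o: "openin T ?U" "openin T ?V" using assms by (auto simp: closedin_def)
  have "?U \<inter> ?V \<inter> Y = {}" using assms(4) by auto
  then have "?U \<inter> Y = {} \<or> ?V \<inter> Y = {}" using assms(1) o unfolding irr_in_def by blast
  then show ?thesis using assms(1) by (auto simp: irr_in_def)
qed

context variety_space begin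

lemma irr_in_X: "irr_in (pts X) (topspace (pts X))"
  using variety irreducible_space_iff_irr_in[of "topspace (pts X)" "pts X"]
  by (simp add: variety_def subtopology_topspace)

lemma op_Int_nonempty: "op U \<Longrightarrow> op V \<Longrightarrow> U \<noteq> {} \<Longrightarrow> V \<noteq> {} \<Longrightarrow> U \<inter> V \<noteq> {}"
  using irr_in_X op_topspace unfolding irr_in_def by (metis Int_absorb2 Int_assoc)

lemma irr_in_singleton: "x \<in> topspace (pts X) \<Longrightarrow> irr_in (pts X) {x}"
  by (auto simp: irr_in_def)

lemma prime_divisors_iff:
  "Y \<in> prime_divisors X \<longleftrightarrow> closedin (pts X) Y \<and> irr_in (pts X) Y \<and> Y \<noteq> topspace (pts X) \<and>
     (\<forall>Z. closedin (pts X) Z \<and> irr_in (pts X) Z \<and> Y \<subseteq> Z \<longrightarrow> Z = Y \<or> Z = topspace (pts X))"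
proof -
  have "irreducible_space (subtopology (pts X) Z) \<longleftrightarrow> irr_in (pts X) Z" if "closedin (pts X) Z" for Z
    using irreducible_space_iff_irr_in closedin_subset[OF that] by blast
  then show ?thesis unfolding prime_divisors_def by blast
qed

end

section \<open>Conductors and discrete valuation rings\<close>

section \<open>Noetherian local subrings of a field\<close>

text \<open>The counterpart of \<open>ideal_in\<close> for subsets of a ring record, since the
  function field is a record and not a type-class ring.\<close>

definition sub_ideal :: "('a, 'b) ring_scheme \<Rightarrow> 'a set \<Rightarrow> 'a set \<Rightarrow> bool" where
  "sub_ideal R A J \<longleftrightarrow> J \<subseteq> A \<and> \<zero>\<^bsub>R\<^esub> \<in> J \<and> (\<forall>a\<in>J. \<forall>b\<in>J. a \<oplus>\<^bsub>R\<^esub> b \<in> J) \<and>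
     (\<forall>r\<in>A. \<forall>a\<in>J. r \<otimes>\<^bsub>R\<^esub> a \<in> J)"

definition sub_noetherian :: "('a, 'b) ring_scheme \<Rightarrow> 'a set \<Rightarrow> bool" where
  "sub_noetherian R A \<longleftrightarrow>
     (\<forall>J::nat \<Rightarrow> 'a set. (\<forall>i. sub_ideal R A (J i)) \<and> (\<forall>i. J i \<subseteq> J (Suc i)) \<longrightarrow> (\<exists>N. \<forall>m\<ge>N. J m = J N))"

lemma sub_noetherianD:
  assumes "sub_noetherian R A" "\<And>i::nat. sub_ideal R A (J i)" "\<And>i. J i \<subseteq> J (Suc i)"
  obtains N where "J (Suc N) = J N"
proof -
  have "\<exists>N. \<forall>m\<ge>N. J m = J N"
    using assms(1)[unfolded sub_noetherian_def, THEN spec, of J] assms(2,3) by simp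
  then show thesis using that le_SucI by blast
qed

lemma sub_ideal_maximal:
  assumes noeth: "sub_noetherian R A" and F: "\<And>J. J \<in> \<F> \<Longrightarrow> sub_ideal R A J" and "J0 \<in> \<F>"
  obtains M where "M \<in> \<F>" "\<And>N. N \<in> \<F> \<Longrightarrow> M \<subseteq> N \<Longrightarrow> N = M"
proof (rule ccontr)
  assume "\<not> thesis"
  then have ex: "\<forall>M\<in>\<F>. \<exists>N. N \<in> \<F> \<and> M \<subset> N" using that by blast
  define nxt where "nxt M = (SOME N. N \<in> \<F> \<and> M \<subset> N)" for M
  have nxt: "nxt M \<in> \<F> \<and> M \<subset> nxt M" if "M \<in> \<F>" for M
    unfolding nxt_def by (rule someI_ex) (use ex that in blast)
  define J where "J n = (nxt ^^ n) J0" for n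
  have JF: "J n \<in> \<F>" for n
    by (induction n) (use assms(3) nxt in \<open>auto simp: J_def\<close>)
  have Jinc: "J n \<subset> J (Suc n)" for n using nxt[OF JF[of n]] by (simp add: J_def)
  obtain N where "J (Suc N) = J N"
    by (rule sub_noetherianD[OF noeth, of J]) (use F[OF JF] Jinc in auto)
  then show False using Jinc[of N] by simp
qed

text \<open>The ideal of denominators of g over A. For a subring A it is proper exactly when g is
  not in A.\<close>

definition conductor :: "('a, 'b) ring_scheme \<Rightarrow> 'a set \<Rightarrow> 'a \<Rightarrow> 'a set" where
  "conductor R A g = {r\<in>A. r \<otimes>\<^bsub>R\<^esub> g \<in> A}"

context field begin

lemma field_inv:
  assumes "a \<in> carrier R" "a \<noteq> \<zero>"
  shows "inv a \<in> carrier R" "a \<otimes> inv a = \<one>" "inv a \<otimes> a = \<one>" "inv a \<noteq> \<zero>"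
proof -
  have u: "a \<in> Units R" using assms by (simp add: field_Units)
  show 1: "inv a \<in> carrier R" "a \<otimes> inv a = \<one>" "inv a \<otimes> a = \<one>" using u by auto
  show "inv a \<noteq> \<zero>" using 1 assms by auto
qed

lemma field_mult_nonzero: "a \<in> carrier R \<Longrightarrow> b \<in> carrier R \<Longrightarrow> a \<noteq> \<zero> \<Longrightarrow> b \<noteq> \<zero> \<Longrightarrow> a \<otimes> b \<noteq> \<zero>"
  using integral by blast

lemma inv_eqI: "a \<in> carrier R \<Longrightarrow> b \<in> carrier R \<Longrightarrow> a \<otimes> b = \<one> \<Longrightarrow> inv a = b"
  using comm_inv_char by simp

lemma sub_ideal_conductor:
  assumes A: "subring A R" and g: "g \<in> carrier R"
  shows "sub_ideal R A (conductor R A g)"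
proof -
  note SA = subringE[OF A]
  have c: "a \<in> A \<Longrightarrow> a \<in> carrier R" for a using SA(1) by blast
  have "(a \<oplus> b) \<otimes> g \<in> A" if "a \<in> A" "b \<in> A" "a \<otimes> g \<in> A" "b \<otimes> g \<in> A" for a b
    using that g c SA(7) by (simp add: l_distr)
  moreover have "(r \<otimes> a) \<otimes> g \<in> A" if "a \<in> A" "r \<in> A" "a \<otimes> g \<in> A" for a r
    using that g c SA(6) by (simp add: m_assoc)
  ultimately show ?thesis
    using SA g by (auto simp: sub_ideal_def conductor_def)
qed

text \<open>The argument that produces associated primes. Among the conductors of multiples of g
  outside A take a maximal one, say of \<open>c \<otimes> g\<close>. If it contains
  \<open>a \<otimes> b\<close> but not b, then the conductor of
  \<open>b \<otimes> c \<otimes> g\<close> is again in the family and larger, hence equal to it, and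
  contains a.\<close>

lemma conductor_prime:
  assumes A: "subring A R" and noeth: "sub_noetherian R A" and g: "g \<in> carrier R" "g \<notin> A"
  obtains c where "c \<in> A" "c \<otimes> g \<notin> A"
    "\<And>a b. a \<in> A \<Longrightarrow> b \<in> A \<Longrightarrow> a \<otimes> b \<in> conductor R A (c \<otimes> g) \<Longrightarrow>
       a \<in> conductor R A (c \<otimes> g) \<or> b \<in> conductor R A (c \<otimes> g)"
proof -
  note SA = subringE[OF A]
  have car: "a \<in> A \<Longrightarrow> a \<in> carrier R" for a using SA(1) by blast
  let ?F = "{conductor R A (c \<otimes> g) | c. c \<in> A \<and> c \<otimes> g \<notin> A}"
  have F: "sub_ideal R A J" if "J \<in> ?F" for J
    using that sub_ideal_conductor[OF A] car g by auto
  have F0: "conductor R A (\<one> \<otimes> g) \<in> ?F" using SA(3) g by (intro CollectI exI[of _ \<one>]) simp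
  obtain M where M: "M \<in> ?F" "\<And>N. N \<in> ?F \<Longrightarrow> M \<subseteq> N \<Longrightarrow> N = M"
    by (rule sub_ideal_maximal[OF noeth F F0]) auto
  obtain c where c: "c \<in> A" "c \<otimes> g \<notin> A" "M = conductor R A (c \<otimes> g)" using M(1) by auto
  have "a \<in> M \<or> b \<in> M" if ab: "a \<in> A" "b \<in> A" "a \<otimes> b \<in> M" for a b
  proof (rule ccontr)
    assume n: "\<not> (a \<in> M \<or> b \<in> M)"
    let ?N = "conductor R A ((b \<otimes> c) \<otimes> g)"
    have "b \<otimes> (c \<otimes> g) \<notin> A" using n ab by (auto simp: c(3) conductor_def)
    then have "?N \<in> ?F" using ab c SA(6) car g by (intro CollectI exI[of _ "b \<otimes> c"]) (simp add: m_assoc)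
    moreover have "M \<subseteq> ?N"
    proof
      fix r assume r: "r \<in> M"
      then have "r \<in> A" "r \<otimes> (c \<otimes> g) \<in> A" by (auto simp: c(3) conductor_def)
      moreover have "r \<otimes> (b \<otimes> c \<otimes> g) = b \<otimes> (r \<otimes> (c \<otimes> g))"
        using \<open>r \<in> A\<close> ab c(1) car g by (simp add: m_assoc m_lcomm)
      ultimately show "r \<in> ?N" using ab SA(6) by (simp add: conductor_def)
    qed
    ultimately have "?N = M" by (rule M(2))
    moreover have "a \<otimes> (b \<otimes> c \<otimes> g) = a \<otimes> b \<otimes> (c \<otimes> g)"
      using ab c(1) car g by (simp add: m_assoc)
    then have "a \<in> ?N" using ab by (simp add: c(3) conductor_def)
    ultimately show False using n by simp
  qed
  then show thesis using that c by blast
qed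

text \<open>The powers of \<open>g\<close> span a submodule of the Noetherian module \<open>A b\<^sup>-\<^sup>1\<close>.\<close>

lemma integral_of_bounded_powers:
  assumes A: "subring A R" and noeth: "sub_noetherian R A" and g: "g \<in> carrier R"
    and b: "b \<in> carrier R" "b \<noteq> \<zero>" and pow: "\<And>i::nat. g [^] i \<otimes> b \<in> A"
  obtains n :: nat and a where "\<And>i. a i \<in> A" "g [^] n \<oplus> (\<Oplus>i\<in>{..<n}. a i \<otimes> g [^] i) = \<zero>"
proof -
  note SA = subringE[OF A]
  have car: "a \<in> A \<Longrightarrow> a \<in> carrier R" for a using SA(1) by blast
  define lc where "lc n c = (\<Oplus>i\<in>{..<n}. c i \<otimes> g [^] i)" for n :: nat and c :: "nat \<Rightarrow> 'a"
  have lc0: "lc 0 c = \<zero>" for c by (simp add: lc_def)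
  have lcS: "lc (Suc n) c = c n \<otimes> g [^] n \<oplus> lc n c" if "\<And>i. c i \<in> A" for c n
    unfolding lc_def lessThan_Suc using that car g by (subst finsum_insert) auto
  have lcc: "lc n c \<in> carrier R" if "\<And>i. c i \<in> A" for c n
    unfolding lc_def using that car g by (intro finsum_closed) auto
  have lc_add: "lc n (\<lambda>i. c i \<oplus> d i) = lc n c \<oplus> lc n d" if "\<And>i. c i \<in> A" "\<And>i. d i \<in> A" for n c d
  proof (induction n)
    case (Suc n)
    have "c n \<otimes> g [^] n \<in> carrier R" "d n \<otimes> g [^] n \<in> carrier R" using that car g by auto
    then show ?case
      using that SA(7) car g lcc[of c n] lcc[of d n]
      by (simp add: lcS Suc l_distr a_ac)
  qed (simp add: lc0)
  have lc_smult: "lc n (\<lambda>i. r \<otimes> c i) = r \<otimes> lc n c" if "\<And>i. c i \<in> A" "r \<in> A" for n c r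
  proof (induction n)
    case (Suc n)
    then show ?case using that SA(6) car g lcc[of c n] by (simp add: lcS r_distr m_assoc)
  qed (use that car in \<open>simp add: lc0\<close>)
  have lcb: "lc n c \<otimes> b \<in> A" if "\<And>i. c i \<in> A" for n c
  proof (induction n)
    case (Suc n)
    have "c n \<otimes> (g [^] n \<otimes> b) \<in> A" using that pow SA(6) by blast
    then show ?case
      using that car g b Suc lcc[of c n] SA(7) by (simp add: lcS l_distr m_assoc)
  qed (use SA b in \<open>simp add: lc0\<close>)
  define J where "J n = {lc n c \<otimes> b | c. \<forall>i. c i \<in> A}" for n
  have "sub_ideal R A (J n)" for n
    unfolding sub_ideal_def
  proof (intro conjI ballI)
    show "J n \<subseteq> A" using lcb by (auto simp: J_def)
    have "lc n (\<lambda>i. \<zero> \<otimes> \<zero>) \<otimes> b = \<zero>"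
      using lc_smult[of "\<lambda>i. \<zero>" \<zero> n] lcc[of "\<lambda>i. \<zero>" n] SA(2) b by simp
    then show "\<zero> \<in> J n" using SA(2) unfolding J_def by (intro CollectI exI[of _ "\<lambda>i. \<zero> \<otimes> \<zero>"]) auto
    fix x y assume "x \<in> J n" "y \<in> J n"
    then obtain c d where cd: "\<And>i. c i \<in> A" "\<And>i. d i \<in> A" "x = lc n c \<otimes> b" "y = lc n d \<otimes> b"
      by (auto simp: J_def)
    then have "x \<oplus> y = lc n (\<lambda>i. c i \<oplus> d i) \<otimes> b"
      using lcc[of c n] lcc[of d n] b by (simp add: lc_add l_distr)
    then show "x \<oplus> y \<in> J n"
      using cd SA(7) unfolding J_def by (intro CollectI exI[of _ "\<lambda>i. c i \<oplus> d i"]) auto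
  next
    fix r x assume r: "r \<in> A" and "x \<in> J n"
    then obtain c where c: "\<And>i. c i \<in> A" "x = lc n c \<otimes> b" by (auto simp: J_def)
    then have "r \<otimes> x = lc n (\<lambda>i. r \<otimes> c i) \<otimes> b"
      using r car[OF r] lcc[of c n] b by (simp add: lc_smult m_assoc)
    then show "r \<otimes> x \<in> J n"
      using c r SA(6) unfolding J_def by (intro CollectI exI[of _ "\<lambda>i. r \<otimes> c i"]) auto
  qed
  moreover have "J n \<subseteq> J (Suc n)" for n
  proof
    fix x assume "x \<in> J n"
    then obtain c where c: "\<And>i. c i \<in> A" "x = lc n c \<otimes> b" by (auto simp: J_def)
    let ?c = "\<lambda>i. if i < n then c i else \<zero>"
    have cA: "?c i \<in> A" for i using c SA(2) by simp
    have "lc n ?c = lc n c" unfolding lc_def using c car g by (intro finsum_cong') auto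
    then have "lc (Suc n) ?c = lc n c" using lcS[OF cA, of n] lcc[of c n] c g by simp
    then show "x \<in> J (Suc n)" unfolding J_def using c cA by (intro CollectI exI[of _ ?c]) auto
  qed
  ultimately obtain N where N: "J (Suc N) = J N" by (rule sub_noetherianD[OF noeth]) auto
  \<comment> \<open>The coefficient vector of \<open>g [^] N\<close>. As \<open>J\<close> has
    stopped growing at N, this power times b is a combination of lower powers times b, and b
    cancels.\<close>
  let ?e = "\<lambda>i::nat. if i = N then \<one> else \<zero>"
  have eA: "?e i \<in> A" for i using SA(2,3) by simp
  have "lc N ?e = (\<Oplus>i\<in>{..<N}. \<zero>)" unfolding lc_def using g by (intro finsum_cong') auto
  then have "lc (Suc N) ?e = g [^] N" using lcS[OF eA, of N] g by simp
  then have "g [^] N \<otimes> b \<in> J (Suc N)" unfolding J_def using eA by (intro CollectI exI[of _ ?e]) auto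
  then obtain c where c: "\<And>i. c i \<in> A" "g [^] N \<otimes> b = lc N c \<otimes> b" unfolding N by (auto simp: J_def)
  then have eq: "g [^] N = lc N c" using m_rcancel[of b "g [^] N" "lc N c"] b g lcc[of c N] by simp
  have m1: "\<ominus> \<one> \<in> A" using SA(3,5) by blast
  have "lc N (\<lambda>i. \<ominus> \<one> \<otimes> c i) = \<ominus> \<one> \<otimes> lc N c" using lc_smult[OF c(1) m1] .
  also have "\<dots> = \<ominus> lc N c" using lcc[OF c(1), of N] by (simp add: l_minus)
  finally have "g [^] N \<oplus> lc N (\<lambda>i. \<ominus> \<one> \<otimes> c i) = \<zero>"
    using lcc[OF c(1), of N] eq r_neg by simp
  moreover have "\<And>i. \<ominus> \<one> \<otimes> c i \<in> A" using c m1 SA(6) by blast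
  ultimately show thesis using that[of "\<lambda>i. \<ominus> \<one> \<otimes> c i" N] unfolding lc_def by blast
qed

text \<open>A dichotomy for the conductor m of g, which is the maximal ideal. Either m is stable
  under multiplication by g; then all \<open>g [^] i \<otimes> b\<close> lie in A, so g is integral
  over A and normality contradicts \<open>g \<notin> A\<close>. Or some t in m has
  \<open>t \<otimes> g\<close> outside m, hence a unit with inverse s, and then
  \<open>p = (p \<otimes> g) \<otimes> s \<otimes> t\<close> for every p in m.\<close>

lemma conductor_principal:
  assumes A: "subring A R" and noeth: "sub_noetherian R A" and int: "integrally_closed_in R A"
    and g: "g \<in> carrier R" "g \<notin> A"
    and units: "\<And>r. r \<in> A \<Longrightarrow> r \<notin> conductor R A g \<Longrightarrow> \<exists>s\<in>A. r \<otimes> s = \<one>"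
    and b: "b \<in> conductor R A g" "b \<noteq> \<zero>"
  obtains t where "t \<in> conductor R A g" "\<And>p. p \<in> conductor R A g \<Longrightarrow> \<exists>r\<in>A. p = r \<otimes> t"
proof -
  note SA = subringE[OF A]
  have car: "a \<in> A \<Longrightarrow> a \<in> carrier R" for a using SA(1) by blast
  let ?m = "conductor R A g"
  have mA: "p \<in> ?m \<Longrightarrow> p \<in> A" "p \<in> ?m \<Longrightarrow> p \<otimes> g \<in> A" for p by (auto simp: conductor_def)
  have "\<exists>p\<in>?m. p \<otimes> g \<notin> ?m"
  proof (rule ccontr)
    assume "\<not> ?thesis"
    then have st: "p \<otimes> g \<in> ?m" if "p \<in> ?m" for p using that by blast
    have "g [^] i \<otimes> b \<in> ?m" for i :: nat
    proof (induction i)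
      case 0
      then show ?case using b mA car by simp
    next
      case (Suc i)
      have "g [^] Suc i \<otimes> b = (g [^] i \<otimes> b) \<otimes> g"
        using g b mA(1) car by (simp add: m_ac)
      then show ?case using st[OF Suc] by simp
    qed
    then have "g [^] i \<otimes> b \<in> A" for i :: nat using mA by blast
    then obtain n :: nat and a where "\<And>i. a i \<in> A" "g [^] n \<oplus> (\<Oplus>i\<in>{..<n}. a i \<otimes> g [^] i) = \<zero>"
      using integral_of_bounded_powers[OF A noeth g(1) _ b(2)] b mA(1) car by metis
    then show False using int g unfolding integrally_closed_in_def by blast
  qed
  then obtain t where t: "t \<in> ?m" "t \<otimes> g \<notin> ?m" by blast
  then obtain s where s: "s \<in> A" "t \<otimes> g \<otimes> s = \<one>" using units[of "t \<otimes> g"] mA by blast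
  have "\<exists>r\<in>A. p = r \<otimes> t" if p: "p \<in> ?m" for p
  proof -
    have tc: "t \<in> carrier R" "p \<in> carrier R" "s \<in> carrier R" using t p s mA car by auto
    have "p = p \<otimes> (t \<otimes> g \<otimes> s)" using s tc by simp
    also have "\<dots> = (p \<otimes> g) \<otimes> s \<otimes> t" using tc g by (simp add: m_ac)
    finally show ?thesis using mA[OF p] s SA(6) by blast
  qed
  then show thesis using that t by blast
qed

text \<open>Divide a by t as long as the quotient is not a unit. If this went on forever, the
  principal ideals of the successive quotients would form an ascending chain, and its becoming
  stationary would put \<open>inv t\<close> into A.\<close>

lemma uniformizer_factorization:
  assumes A: "subring A R" and noeth: "sub_noetherian R A"
    and t: "t \<in> A" "t \<noteq> \<zero>" "inv t \<notin> A"
    and loc: "\<And>r. r \<in> A \<Longrightarrow> (\<exists>s\<in>A. r \<otimes> s = \<one>) \<or> (\<exists>s\<in>A. r = s \<otimes> t)"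
    and a: "a \<in> A" "a \<noteq> \<zero>"
  obtains n :: nat and u v where "u \<in> A" "v \<in> A" "u \<otimes> v = \<one>" "a = u \<otimes> t [^] n"
proof (rule ccontr)
  assume "\<not> thesis"
  then have no: "\<not> (u \<in> A \<and> v \<in> A \<and> u \<otimes> v = \<one> \<and> a = u \<otimes> t [^] n)" for u v and n :: nat
    using that by blast
  note SA = subringE[OF A]
  have car: "x \<in> A \<Longrightarrow> x \<in> carrier R" for x using SA(1) by blast
  have tc: "t \<in> carrier R" "inv t \<in> carrier R" "t \<otimes> inv t = \<one>" "inv t \<otimes> t = \<one>" using field_inv[of t] t car by auto
  have ac: "a \<in> carrier R" using a car by blast
  define f where "f n = a \<otimes> inv t [^] n" for n :: nat
  have fc: "f n \<in> carrier R" for n using tc ac by (simp add: f_def)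
  have fS: "f (Suc n) = f n \<otimes> inv t" for n using tc ac by (simp add: f_def m_assoc)
  have fS': "f (Suc n) \<otimes> t = f n" for n using tc fc[of n] by (simp add: fS m_assoc)
  have fa: "f n \<otimes> t [^] n = a" for n
  proof (induction n)
    case (Suc n)
    have "f (Suc n) \<otimes> t [^] Suc n = (f (Suc n) \<otimes> t) \<otimes> t [^] n"
      using tc fc[of "Suc n"] by (simp add: m_ac)
    then show ?case using fS' Suc by simp
  qed (use ac in \<open>simp add: f_def\<close>)
  have fA: "f n \<in> A" for n
  proof (induction n)
    case 0
    then show ?case using a ac by (simp add: f_def)
  next
    case (Suc n)
    have "\<not> (\<exists>s\<in>A. f n \<otimes> s = \<one>)" using no[of "f n" _ n] fa Suc by metis
    then obtain s where s: "s \<in> A" "f n = s \<otimes> t" using loc[OF Suc] by blast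
    then have "f (Suc n) = s" using tc car by (simp add: fS m_assoc)
    then show ?case using s by simp
  qed
  define J where "J n = {r \<otimes> f n | r. r \<in> A}" for n
  have "sub_ideal R A (J n)" for n
    unfolding sub_ideal_def
  proof (intro conjI ballI)
    show "J n \<subseteq> A" using fA SA(6) by (auto simp: J_def)
    show "\<zero> \<in> J n" using SA(2) fc[of n] unfolding J_def by (intro CollectI exI[of _ \<zero>]) simp
    fix x y assume "x \<in> J n" "y \<in> J n"
    then obtain r s where "r \<in> A" "s \<in> A" "x = r \<otimes> f n" "y = s \<otimes> f n" by (auto simp: J_def)
    then show "x \<oplus> y \<in> J n"
      using SA(7) fc[of n] car unfolding J_def by (intro CollectI exI[of _ "r \<oplus> s"]) (simp add: l_distr)
  next
    fix s x assume "s \<in> A" "x \<in> J n"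
    moreover from this obtain r where "r \<in> A" "x = r \<otimes> f n" by (auto simp: J_def)
    ultimately show "s \<otimes> x \<in> J n"
      using SA(6) fc[of n] car unfolding J_def by (intro CollectI exI[of _ "s \<otimes> r"]) (simp add: m_assoc)
  qed
  moreover have "J n \<subseteq> J (Suc n)" for n
  proof
    fix x assume "x \<in> J n"
    then obtain r where r: "r \<in> A" "x = r \<otimes> f n" by (auto simp: J_def)
    then have "x = (r \<otimes> t) \<otimes> f (Suc n)"
      using fS'[of n] fc[of "Suc n"] tc car by (simp add: m_ac)
    then show "x \<in> J (Suc n)" using r t SA(6) unfolding J_def by blast
  qed
  ultimately obtain N where N: "J (Suc N) = J N" by (rule sub_noetherianD[OF noeth]) auto
  have "\<one> \<otimes> f (Suc N) \<in> J (Suc N)" using SA(3) unfolding J_def by blast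
  then obtain r where r: "r \<in> A" "f (Suc N) = r \<otimes> f N" unfolding N using fc[of "Suc N"] by (auto simp: J_def)
  have nz: "f N \<noteq> \<zero>" using fa[of N] a tc by auto
  have "f N \<otimes> inv t = f N \<otimes> r" using r fS[of N] fc[of N] car by (simp add: m_comm)
  then have "inv t = r" using m_lcancel[OF nz, of "inv t" r] fc[of N] tc car r by simp
  then show False using r t by simp
qed

end

section \<open>Rational functions and their local rings along irreducible sets\<close>

section \<open>The function field\<close>

context variety_space begin

text \<open>The function f is arbitrary outside U and only its restriction is a section. Pointwise
  expressions can then be formed and moved to smaller open sets without carrying restrictions
  along.\<close>

definition regular_on :: "'x set \<Rightarrow> ('x \<Rightarrow> 'k) \<Rightarrow> bool" where
  "regular_on U f \<longleftrightarrow> op U \<and> U \<noteq> {} \<and> restrict f U \<in> reg X U"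

lemma restrict_eqI: "(\<And>x. x \<in> U \<Longrightarrow> f x = g x) \<Longrightarrow> restrict f U = restrict g U"
  by (auto simp: restrict_def)

lemma regular_onD: "regular_on U f \<Longrightarrow> op U" "regular_on U f \<Longrightarrow> U \<noteq> {}"
    "regular_on U f \<Longrightarrow> restrict f U \<in> reg X U"
  by (auto simp: regular_on_def)

lemma regular_onI: "op U \<Longrightarrow> U \<noteq> {} \<Longrightarrow> f \<in> reg X U \<Longrightarrow> regular_on U f"
  using reg_ext[of U f] by (simp add: regular_on_def extensional_restrict)

lemma regular_on_const: "op U \<Longrightarrow> U \<noteq> {} \<Longrightarrow> regular_on U (\<lambda>x. c)"
  by (simp add: regular_on_def reg_const)

lemma regular_on_mono:
  assumes "regular_on U f" "op V" "V \<noteq> {}" "V \<subseteq> U"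
  shows "regular_on V f"
proof -
  have "restrict (restrict f U) V \<in> reg X V"
    by (rule reg_restrict[OF regular_onD(1)[OF assms(1)] assms(2,4) regular_onD(3)[OF assms(1)]])
  moreover have "restrict (restrict f U) V = restrict f V"
    by (rule restrict_eqI) (use assms(4) in auto)
  ultimately show ?thesis using assms by (simp add: regular_on_def)
qed

lemma regular_on_Int:
  assumes "regular_on U f" "regular_on V g"
  shows "regular_on (U \<inter> V) f" "regular_on (U \<inter> V) g" "op (U \<inter> V)" "U \<inter> V \<noteq> {}"
proof -
  show W: "op (U \<inter> V)" "U \<inter> V \<noteq> {}"
    using assms[THEN regular_onD(1)] assms[THEN regular_onD(2)] op_Int_nonempty by auto
  show "regular_on (U \<inter> V) f" "regular_on (U \<inter> V) g"
    by (rule regular_on_mono[OF assms(1) W] regular_on_mono[OF assms(2) W]; simp)+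
qed

lemma regular_on_add:
  assumes "regular_on U f" "regular_on U g"
  shows "regular_on U (\<lambda>x. f x + g x)"
proof -
  have "restrict (\<lambda>x. restrict f U x + restrict g U x) U \<in> reg X U"
    by (rule reg_add[OF regular_onD(1)[OF assms(1)] assms[THEN regular_onD(3)]])
  moreover have "restrict (\<lambda>x. restrict f U x + restrict g U x) U = restrict (\<lambda>x. f x + g x) U"
    by (rule restrict_eqI) simp
  ultimately show ?thesis using assms by (simp add: regular_on_def)
qed

lemma regular_on_mult:
  assumes "regular_on U f" "regular_on U g"
  shows "regular_on U (\<lambda>x. f x * g x)"
proof -
  have "restrict (\<lambda>x. restrict f U x * restrict g U x) U \<in> reg X U"
    by (rule reg_mult[OF regular_onD(1)[OF assms(1)] assms[THEN regular_onD(3)]])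
  moreover have "restrict (\<lambda>x. restrict f U x * restrict g U x) U = restrict (\<lambda>x. f x * g x) U"
    by (rule restrict_eqI) simp
  ultimately show ?thesis using assms by (simp add: regular_on_def)
qed

lemma regular_on_uminus: "regular_on U f \<Longrightarrow> regular_on U (\<lambda>x. - f x)"
  using regular_on_mult[OF regular_on_const[of U "- 1"], of f] by (simp add: regular_on_def)

lemma regular_on_diff: "regular_on U f \<Longrightarrow> regular_on U g \<Longrightarrow> regular_on U (\<lambda>x. f x - g x)"
  using regular_on_add[OF _ regular_on_uminus, of U f g] by simp

lemma regular_on_inverse:
  assumes "regular_on U f" "\<And>x. x \<in> U \<Longrightarrow> f x \<noteq> 0"
  shows "regular_on U (\<lambda>x. 1 / f x)"
proof -
  have "restrict (\<lambda>x. 1 / restrict f U x) U \<in> reg X U"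
    using assms(2) by (intro reg_inverse[OF regular_onD(1)[OF assms(1)] regular_onD(3)[OF assms(1)]]) simp
  moreover have "restrict (\<lambda>x. 1 / restrict f U x) U = restrict (\<lambda>x. 1 / f x) U"
    by (rule restrict_eqI) simp
  ultimately show ?thesis using assms by (simp add: regular_on_def)
qed

lemma op_nonvanishing:
  assumes "regular_on U f"
  shows "op {x\<in>U. f x \<noteq> 0}"
proof -
  have "op {x\<in>U. restrict f U x \<noteq> 0}" by (rule op_nonzero[OF regular_onD(1)[OF assms] regular_onD(3)[OF assms]])
  moreover have "{x\<in>U. restrict f U x \<noteq> 0} = {x\<in>U. f x \<noteq> 0}" by auto
  ultimately show ?thesis by simp
qed

text \<open>Identity principle: the locus where f and g differ is open, and if it were nonempty it
  would meet W by irreducibility.\<close>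

lemma regular_eq_dense:
  assumes "regular_on U f" "regular_on U g" "op W" "W \<noteq> {}" "W \<subseteq> U" "\<And>x. x \<in> W \<Longrightarrow> f x = g x" "x \<in> U"
  shows "f x = g x"
proof (rule ccontr)
  assume "f x \<noteq> g x"
  let ?D = "{x\<in>U. f x - g x \<noteq> 0}"
  have "op ?D" by (rule op_nonvanishing[OF regular_on_diff[OF assms(1,2)]])
  moreover have "?D \<noteq> {}" using \<open>f x \<noteq> g x\<close> assms(7) by auto
  ultimately have "?D \<inter> W \<noteq> {}" using op_Int_nonempty assms(3,4) by blast
  then show False using assms(6) by auto
qed

lemma equiv_rat_rel: "equiv (rat_pairs X) (rat_rel X)"
proof (rule equivI)
  show "rat_rel X \<subseteq> rat_pairs X \<times> rat_pairs X" by (auto simp: rat_rel_def)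
  show "refl_on (rat_pairs X) (rat_rel X)" by (auto simp: refl_on_def rat_rel_def)
  show "sym (rat_rel X)" by (auto simp: sym_def rat_rel_def)
  show "trans (rat_rel X)"
  proof (rule transI)
    fix a b c assume ab: "(a, b) \<in> rat_rel X" and bc: "(b, c) \<in> rat_rel X"
    obtain U f V g W h where e: "a = (U, f)" "b = (V, g)" "c = (W, h)" by (metis surj_pair)
    have p: "op U" "U \<noteq> {}" "f \<in> reg X U" "op V" "V \<noteq> {}" "op W" "W \<noteq> {}" "h \<in> reg X W"
      and fg: "\<forall>x\<in>U \<inter> V. f x = g x" and gh: "\<forall>x\<in>V \<inter> W. g x = h x"
      using ab bc e by (auto simp: rat_rel_def rat_pairs_def)
    have UW: "op (U \<inter> W)" "U \<inter> W \<noteq> {}" using p op_Int_nonempty by auto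
    then have "U \<inter> W \<inter> V \<noteq> {}" "op (U \<inter> W \<inter> V)" using p op_Int_nonempty by auto
    moreover have "regular_on (U \<inter> W) f" "regular_on (U \<inter> W) h"
      using p UW by (auto intro: regular_on_mono[OF regular_onI])
    ultimately have "f x = h x" if "x \<in> U \<inter> W" for x
      using regular_eq_dense[of "U \<inter> W" f h "U \<inter> W \<inter> V" x] fg gh that by auto
    then show "(a, c) \<in> rat_rel X" using e p by (auto simp: rat_rel_def rat_pairs_def)
  qed
qed

lemma rat_pairs_restrict: "regular_on U f \<Longrightarrow> (U, restrict f U) \<in> rat_pairs X"
  by (simp add: regular_on_def rat_pairs_def)

lemma rat_class_eq_iff:
  assumes "regular_on U f" "regular_on V g"
  shows "rat_class X U f = rat_class X V g \<longleftrightarrow> (\<forall>x\<in>U \<inter> V. f x = g x)"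
proof -
  have "rat_class X U f = rat_class X V g \<longleftrightarrow> ((U, restrict f U), (V, restrict g V)) \<in> rat_rel X"
    unfolding rat_class_def
    by (rule eq_equiv_class_iff[OF equiv_rat_rel]) (use assms rat_pairs_restrict in auto)
  also have "\<dots> \<longleftrightarrow> (\<forall>x\<in>U \<inter> V. f x = g x)"
    using assms[THEN rat_pairs_restrict] by (auto simp: rat_rel_def)
  finally show ?thesis .
qed

lemma rat_class_eqI:
  assumes "regular_on U f" "regular_on V g" "op W" "W \<noteq> {}" "W \<subseteq> U \<inter> V" "\<And>x. x \<in> W \<Longrightarrow> f x = g x"
  shows "rat_class X U f = rat_class X V g"
  unfolding rat_class_eq_iff[OF assms(1,2)]
proof
  fix x assume x: "x \<in> U \<inter> V"
  show "f x = g x"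
    by (rule regular_eq_dense[OF regular_on_Int(1,2)[OF assms(1,2)] assms(3-6) x])
qed

lemma rat_class_mono:
  assumes "regular_on U f" "op W" "W \<noteq> {}" "W \<subseteq> U"
  shows "rat_class X W f = rat_class X U f"
  using assms by (intro rat_class_eqI[of _ _ _ _ W]) (auto intro: regular_on_mono)

lemma rat_class_mem_iff:
  "regular_on U f \<Longrightarrow> (V, g) \<in> rat_class X U f \<longleftrightarrow> op V \<and> V \<noteq> {} \<and> g \<in> reg X V \<and> (\<forall>x\<in>U \<inter> V. f x = g x)"
  using rat_pairs_restrict[of U f] by (auto simp: rat_class_def rat_rel_def rat_pairs_def)

lemma carrier_function_field: "carrier (function_field X) = {rat_class X U f | U f. regular_on U f}"
proof -
  have "rat_pairs X // rat_rel X = {rat_class X U f | U f. regular_on U f}"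
  proof (rule subset_antisym; rule subsetI)
    fix a assume "a \<in> rat_pairs X // rat_rel X"
    then obtain U f where U: "(U, f) \<in> rat_pairs X" "a = rat_rel X `` {(U, f)}"
      by (auto simp: quotient_def)
    then have "restrict f U = f" using reg_ext[of U f] by (auto simp: rat_pairs_def extensional_restrict)
    then have "a = rat_class X U f" using U by (simp add: rat_class_def)
    moreover have "regular_on U f" using U by (intro regular_onI) (auto simp: rat_pairs_def)
    ultimately show "a \<in> {rat_class X U f | U f. regular_on U f}" by blast
  next
    fix a assume "a \<in> {rat_class X U f | U f. regular_on U f}"
    then show "a \<in> rat_pairs X // rat_rel X"
      using rat_pairs_restrict by (auto simp: quotient_def rat_class_def)
  qed
  then show ?thesis by (simp add: function_field_def)
qed

lemma rat_class_carrier: "regular_on U f \<Longrightarrow> rat_class X U f \<in> carrier (function_field X)"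
  using carrier_function_field by blast

lemma function_field_rep:
  assumes "a \<in> carrier (function_field X)"
  obtains U f where "regular_on U f" "a = rat_class X U f"
  using assms carrier_function_field by blast

lemma UN_eq_const: "A \<noteq> {} \<Longrightarrow> (\<And>x. x \<in> A \<Longrightarrow> f x = C) \<Longrightarrow> (\<Union>x\<in>A. f x) = C"
  by auto

text \<open>The operations are defined as unions over all representatives. Every term of the union
  is the same class, so the union is that class. The abstract operation h covers sum and product at
  once.\<close>

lemma rat_class_op:
  assumes f: "regular_on U f" and g: "regular_on V g"
    and cl: "\<And>W f g. regular_on W f \<Longrightarrow> regular_on W g \<Longrightarrow> regular_on W (\<lambda>x. h (f x) (g x))"
  shows "(\<Union>(U', f')\<in>rat_class X U f. \<Union>(V', g')\<in>rat_class X V g. rat_class X (U' \<inter> V') (\<lambda>x. h (f' x) (g' x)))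
    = rat_class X (U \<inter> V) (\<lambda>x. h (f x) (g x))"
proof -
  have ne: "rat_class X U f \<noteq> {}" if "regular_on U f" for U f
    using rat_class_mem_iff[OF that, of U "restrict f U"] that by (auto simp: regular_on_def)
  have reg: "regular_on (U \<inter> V) (\<lambda>x. h (f x) (g x))" if "regular_on U f" "regular_on V g" for U V f g
    by (rule cl[OF regular_on_Int(1,2)[OF that]])
  have "rat_class X (U' \<inter> V') (\<lambda>x. h (f' x) (g' x)) = rat_class X (U \<inter> V) (\<lambda>x. h (f x) (g x))"
    if "(U', f') \<in> rat_class X U f" "(V', g') \<in> rat_class X V g" for U' f' V' g'
  proof -
    have *: "regular_on U' f'" "\<forall>x\<in>U \<inter> U'. f x = f' x" "regular_on V' g'" "\<forall>x\<in>V \<inter> V'. g x = g' x"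
      using that rat_class_mem_iff[OF f] rat_class_mem_iff[OF g] regular_onI by auto
    show ?thesis
      unfolding rat_class_eq_iff[OF reg[OF *(1,3)] reg[OF f g]] using * by auto
  qed
  then show ?thesis
    using ne[OF f] ne[OF g] by (intro UN_eq_const) (auto split: prod.splits intro!: UN_eq_const)
qed

lemma
  assumes "regular_on U f" "regular_on V g"
  shows function_field_mult:
      "rat_class X U f \<otimes>\<^bsub>function_field X\<^esub> rat_class X V g = rat_class X (U \<inter> V) (\<lambda>x. f x * g x)"
    and function_field_add:
      "rat_class X U f \<oplus>\<^bsub>function_field X\<^esub> rat_class X V g = rat_class X (U \<inter> V) (\<lambda>x. f x + g x)"
  by (simp only: function_field_def monoid.select_convs ring.select_convs,
      rule rat_class_op[OF assms] regular_on_mult regular_on_add, erule regular_on_mult regular_on_add, assumption)+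

lemma function_field_mult_same:
  "regular_on U f \<Longrightarrow> regular_on U g \<Longrightarrow>
    rat_class X U f \<otimes>\<^bsub>function_field X\<^esub> rat_class X U g = rat_class X U (\<lambda>x. f x * g x)"
  using function_field_mult[of U f U g] by simp

lemma function_field_add_same:
  "regular_on U f \<Longrightarrow> regular_on U g \<Longrightarrow>
    rat_class X U f \<oplus>\<^bsub>function_field X\<^esub> rat_class X U g = rat_class X U (\<lambda>x. f x + g x)"
  using function_field_add[of U f U g] by simp

lemma topspace_ne: "topspace (pts X) \<noteq> {}"
  using irr_in_X by (simp add: irr_in_def)

lemma rat_const_eq: "op U \<Longrightarrow> U \<noteq> {} \<Longrightarrow> rat_const X c = rat_class X U (\<lambda>x. c)"
  unfolding rat_const_def
  using op_topspace topspace_ne by (intro rat_class_mono[symmetric] regular_on_const) auto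

lemma function_field_one: "\<one>\<^bsub>function_field X\<^esub> = rat_const X 1"
  and function_field_zero: "\<zero>\<^bsub>function_field X\<^esub> = rat_const X 0"
  by (simp_all add: function_field_def)

lemma rat_const_carrier: "rat_const X c \<in> carrier (function_field X)"
  unfolding rat_const_def using topspace_ne by (intro rat_class_carrier regular_on_const) auto

text \<open>Once classes live on a common open set, the field laws become pointwise identities in
  the ground field.\<close>

lemma common_domain2:
  assumes "a \<in> carrier (function_field X)" "b \<in> carrier (function_field X)"
  obtains W f g where "regular_on W f" "regular_on W g" "a = rat_class X W f" "b = rat_class X W g"
proof -
  obtain U f V g where *: "regular_on U f" "a = rat_class X U f" "regular_on V g" "b = rat_class X V g"
    using assms function_field_rep by metis
  note I = regular_on_Int[OF *(1,3)]
  show thesis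
    by (rule that[OF I(1,2)])
      (use * rat_class_mono[OF *(1) I(3,4)] rat_class_mono[OF *(3) I(3,4)] in auto)
qed

lemma common_domain3:
  assumes "a \<in> carrier (function_field X)" "b \<in> carrier (function_field X)" "c \<in> carrier (function_field X)"
  obtains W f g h where "regular_on W f" "regular_on W g" "regular_on W h"
    "a = rat_class X W f" "b = rat_class X W g" "c = rat_class X W h"
proof -
  obtain U f g where 1: "regular_on U f" "regular_on U g" "a = rat_class X U f" "b = rat_class X U g"
    using common_domain2 assms(1,2) by blast
  obtain V h where 2: "regular_on V h" "c = rat_class X V h" using function_field_rep assms(3) by blast
  note I = regular_on_Int[OF 1(1) 2(1)] regular_on_Int(1)[OF 1(2) 2(1)]
  show thesis
    by (rule that[OF I(1,5,2)])
      (use 1 2 rat_class_mono[OF 1(1) I(3,4)] rat_class_mono[OF 1(2) I(3,4)] rat_class_mono[OF 2(1) I(3,4)] in auto)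
qed

lemma rat_class_zero_iff:
  assumes "regular_on U f"
  shows "rat_class X U f = \<zero>\<^bsub>function_field X\<^esub> \<longleftrightarrow> (\<forall>x\<in>U. f x = 0)"
  using rat_class_eq_iff[OF assms regular_on_const[of U 0]] assms
    rat_const_eq[of U 0] by (simp add: function_field_zero regular_onD)

lemma rat_class_nonzero_inverse:
  assumes "regular_on U f" "x \<in> U" "f x \<noteq> 0"
  shows "regular_on {x\<in>U. f x \<noteq> 0} (\<lambda>x. 1 / f x)"
    "rat_class X U f \<otimes>\<^bsub>function_field X\<^esub> rat_class X {x\<in>U. f x \<noteq> 0} (\<lambda>x. 1 / f x) = \<one>\<^bsub>function_field X\<^esub>"
proof -
  let ?W = "{x\<in>U. f x \<noteq> 0}"
  have W: "op ?W" "?W \<noteq> {}" using op_nonvanishing assms by auto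
  have fW: "regular_on ?W f" using assms W by (auto intro: regular_on_mono)
  show r: "regular_on ?W (\<lambda>x. 1 / f x)" by (rule regular_on_inverse[OF fW]) simp
  have "rat_class X U f = rat_class X ?W f"
    using rat_class_mono[OF assms(1) W] by auto
  then have "rat_class X U f \<otimes>\<^bsub>function_field X\<^esub> rat_class X ?W (\<lambda>x. 1 / f x) =
      rat_class X ?W (\<lambda>x. f x * (1 / f x))"
    by (simp add: function_field_mult_same[OF fW r])
  also have "\<dots> = rat_class X ?W (\<lambda>x. 1)"
    by (rule rat_class_eqI[OF regular_on_mult[OF fW r] regular_on_const[OF W] W]) auto
  also have "\<dots> = \<one>\<^bsub>function_field X\<^esub>" using rat_const_eq[OF W] by (simp add: function_field_one)
  finally show "rat_class X U f \<otimes>\<^bsub>function_field X\<^esub> rat_class X ?W (\<lambda>x. 1 / f x) = \<one>\<^bsub>function_field X\<^esub>" .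
qed

lemma field_function_field: "field (function_field X)"
proof -
  let ?F = "function_field X"
  note same = function_field_mult_same function_field_add_same
  note regs = regular_on_mult regular_on_add regular_on_const regular_on_uminus
  have const: "rat_const X c = rat_class X W (\<lambda>x. c)" "regular_on W (\<lambda>x. c)" if "regular_on W f" for c W f
    using that rat_const_eq regular_on_const regular_onD by auto
  have closed: "a \<otimes>\<^bsub>?F\<^esub> b \<in> carrier ?F" "a \<oplus>\<^bsub>?F\<^esub> b \<in> carrier ?F"
    if ab: "a \<in> carrier ?F" "b \<in> carrier ?F" for a b
    by (rule common_domain2[OF ab]; simp add: same rat_class_carrier regs)+
  have comm: "a \<otimes>\<^bsub>?F\<^esub> b = b \<otimes>\<^bsub>?F\<^esub> a" "a \<oplus>\<^bsub>?F\<^esub> b = b \<oplus>\<^bsub>?F\<^esub> a"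
    if ab: "a \<in> carrier ?F" "b \<in> carrier ?F" for a b
    by (rule common_domain2[OF ab]; simp add: same mult.commute add.commute)+
  have assoc: "(a \<otimes>\<^bsub>?F\<^esub> b) \<otimes>\<^bsub>?F\<^esub> c = a \<otimes>\<^bsub>?F\<^esub> (b \<otimes>\<^bsub>?F\<^esub> c)"
    "(a \<oplus>\<^bsub>?F\<^esub> b) \<oplus>\<^bsub>?F\<^esub> c = a \<oplus>\<^bsub>?F\<^esub> (b \<oplus>\<^bsub>?F\<^esub> c)"
    "(a \<oplus>\<^bsub>?F\<^esub> b) \<otimes>\<^bsub>?F\<^esub> c = a \<otimes>\<^bsub>?F\<^esub> c \<oplus>\<^bsub>?F\<^esub> b \<otimes>\<^bsub>?F\<^esub> c"
    if abc: "a \<in> carrier ?F" "b \<in> carrier ?F" "c \<in> carrier ?F" for a b c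
    by (rule common_domain3[OF abc]; simp add: same regs mult.assoc add.assoc distrib_right)+
  have unit: "\<one>\<^bsub>?F\<^esub> \<otimes>\<^bsub>?F\<^esub> a = a" "\<zero>\<^bsub>?F\<^esub> \<oplus>\<^bsub>?F\<^esub> a = a" if aF: "a \<in> carrier ?F" for a
    by (rule function_field_rep[OF aF]; simp add: function_field_one function_field_zero same const)+
  have one: "\<one>\<^bsub>?F\<^esub> \<in> carrier ?F" "\<zero>\<^bsub>?F\<^esub> \<in> carrier ?F"
    by (simp_all add: function_field_one function_field_zero rat_const_carrier)
  have neg: "\<exists>b\<in>carrier ?F. b \<oplus>\<^bsub>?F\<^esub> a = \<zero>\<^bsub>?F\<^esub>" if aF: "a \<in> carrier ?F" for a
  proof -
    obtain U f where f: "regular_on U f" "a = rat_class X U f" by (rule function_field_rep[OF aF])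
    then have "rat_class X U (\<lambda>x. - f x) \<oplus>\<^bsub>?F\<^esub> a = \<zero>\<^bsub>?F\<^esub>"
      using const(1)[OF f(1), of 0] by (simp add: same regs function_field_zero)
    then show ?thesis using rat_class_carrier[OF regular_on_uminus[OF f(1)]] by blast
  qed
  have "abelian_group ?F"
    by (rule abelian_groupI) (use closed comm assoc unit one neg in auto)
  moreover have "comm_monoid ?F"
    by (rule comm_monoidI) (use closed comm assoc unit one in auto)
  ultimately have cr: "cring ?F" by (rule cringI) (use assoc in auto)
  have "\<one>\<^bsub>?F\<^esub> \<noteq> \<zero>\<^bsub>?F\<^esub>"
    using rat_class_zero_iff[OF regular_on_const[of "topspace (pts X)" 1]] topspace_ne
    by (simp add: function_field_one rat_const_def)
  have "Units ?F = carrier ?F - {\<zero>\<^bsub>?F\<^esub>}"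
  proof
    show "Units ?F \<subseteq> carrier ?F - {\<zero>\<^bsub>?F\<^esub>}"
    proof
      fix a assume a: "a \<in> Units ?F"
      then obtain b where b: "a \<in> carrier ?F" "b \<in> carrier ?F" "a \<otimes>\<^bsub>?F\<^esub> b = \<one>\<^bsub>?F\<^esub>"
        by (auto simp: Units_def)
      have "\<zero>\<^bsub>?F\<^esub> \<otimes>\<^bsub>?F\<^esub> b = \<zero>\<^bsub>?F\<^esub>" 
      proof -
        interpret cring ?F by (rule cr)
        show ?thesis by (rule l_null[OF b(2)])
      qed
      then have "a \<noteq> \<zero>\<^bsub>?F\<^esub>" using b(3) \<open>\<one>\<^bsub>?F\<^esub> \<noteq> \<zero>\<^bsub>?F\<^esub>\<close> by metis
      then show "a \<in> carrier ?F - {\<zero>\<^bsub>?F\<^esub>}" using b(1) by blast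
    qed
    show "carrier ?F - {\<zero>\<^bsub>?F\<^esub>} \<subseteq> Units ?F"
    proof
      fix a assume a: "a \<in> carrier ?F - {\<zero>\<^bsub>?F\<^esub>}"
      then obtain U f where f: "regular_on U f" "a = rat_class X U f" using function_field_rep by blast
      then obtain x where x: "x \<in> U" "f x \<noteq> 0" using a rat_class_zero_iff by blast
      note i = rat_class_nonzero_inverse[OF f(1) x]
      show "a \<in> Units ?F"
        unfolding Units_def
        using a i(2) rat_class_carrier[OF i(1)] comm(1)[OF _ rat_class_carrier[OF i(1)], of a] f(2) by blast
    qed
  qed
  then show ?thesis by (rule cring.cring_fieldI[OF cr])
qed

end

sublocale variety_space \<subseteq> F: field "function_field X"
  by (rule field_function_field)

section \<open>Local rings\<close>

context variety_space begin

abbreviation FF :: "('x, 'k) ratfun ring" where "FF \<equiv> function_field X"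

abbreviation OY :: "'x set \<Rightarrow> ('x, 'k) ratfun set" where "OY Y \<equiv> carrier (local_ring X Y)"

abbreviation irr :: "'x set \<Rightarrow> bool" where "irr \<equiv> irr_in (pts X)"

lemma OY_def: "OY Y = {a\<in>carrier FF. \<exists>(U, f)\<in>a. U \<inter> Y \<noteq> {}}"
  by (simp add: local_ring_def)

lemma OY_memI: "regular_on U f \<Longrightarrow> U \<inter> Y \<noteq> {} \<Longrightarrow> rat_class X U f \<in> OY Y"
proof -
  assume f: "regular_on U f" and ne: "U \<inter> Y \<noteq> {}"
  have "(U, restrict f U) \<in> rat_class X U f"
    unfolding rat_class_mem_iff[OF f] using f by (simp add: regular_on_def)
  then show ?thesis unfolding OY_def using rat_class_carrier[OF f] ne by blast
qed

lemma OY_memE: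
  assumes "a \<in> OY Y"
  obtains U f where "regular_on U f" "U \<inter> Y \<noteq> {}" "a = rat_class X U f"
proof -
  obtain V g where Vg: "a \<in> carrier FF" "(V, g) \<in> a" "V \<inter> Y \<noteq> {}" using assms by (auto simp: OY_def)
  obtain U f where f: "regular_on U f" "a = rat_class X U f" using function_field_rep Vg(1) by blast
  have g: "op V" "V \<noteq> {}" "g \<in> reg X V" "\<forall>x\<in>U \<inter> V. f x = g x"
    using Vg(2) unfolding f(2) rat_class_mem_iff[OF f(1)] by auto
  then have gr: "regular_on V g" by (intro regular_onI)
  have "a = rat_class X V g" using rat_class_eq_iff[OF f(1) gr] g(4) f(2) by simp
  then show thesis using that gr Vg(3) by blast
qed

lemma OY_carrier: "a \<in> OY Y \<Longrightarrow> a \<in> carrier FF"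
  by (simp add: OY_def)

lemma OY_mono: "Y \<subseteq> Z \<Longrightarrow> OY Y \<subseteq> OY Z"
  unfolding OY_def by blast

text \<open>The whole space plays the part of the generic point, so statements about local rings
  specialise to the function field.\<close>

lemma OY_topspace: "OY (topspace (pts X)) = carrier FF"
proof
  show "OY (topspace (pts X)) \<subseteq> carrier FF" using OY_carrier by blast
  show "carrier FF \<subseteq> OY (topspace (pts X))"
  proof
    fix a assume "a \<in> carrier FF"
    then obtain U f where f: "regular_on U f" "a = rat_class X U f" using function_field_rep by blast
    then have "U \<inter> topspace (pts X) \<noteq> {}" using op_topspace[of U] regular_onD by blast
    then show "a \<in> OY (topspace (pts X))" using OY_memI f by blast
  qed
qed

lemma irrD:
  assumes "irr Y"
  shows "Y \<noteq> {}" "Y \<subseteq> topspace (pts X)"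
    "op U \<Longrightarrow> op V \<Longrightarrow> U \<inter> Y \<noteq> {} \<Longrightarrow> V \<inter> Y \<noteq> {} \<Longrightarrow> U \<inter> V \<inter> Y \<noteq> {}"
  using assms unfolding irr_in_def by blast+

lemma function_field_uminus: "regular_on U f \<Longrightarrow> \<ominus>\<^bsub>FF\<^esub> rat_class X U f = rat_class X U (\<lambda>x. - f x)"
  using rat_const_eq[of U 0]
  by (intro F.minus_equality)
    (simp_all add: function_field_add_same regular_on_uminus rat_class_carrier function_field_zero regular_onD)

lemma rat_const_OY: "irr Y \<Longrightarrow> rat_const X c \<in> OY Y"
  unfolding rat_const_def
  by (rule OY_memI) (use irrD[of Y] topspace_ne in \<open>auto intro: regular_on_const\<close>)

lemma subring_OY:
  assumes "irr Y"
  shows "subring (OY Y) FF"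
proof (rule F.subringI)
  show "OY Y \<subseteq> carrier FF" using OY_carrier by blast
  show "\<one>\<^bsub>FF\<^esub> \<in> OY Y" using rat_const_OY[OF assms] by (simp add: function_field_one)
  show "\<ominus>\<^bsub>FF\<^esub> a \<in> OY Y" if "a \<in> OY Y" for a
    using that by (elim OY_memE) (simp add: function_field_uminus OY_memI regular_on_uminus)
  fix a b assume "a \<in> OY Y" "b \<in> OY Y"
  then obtain U f V g where *: "regular_on U f" "U \<inter> Y \<noteq> {}" "a = rat_class X U f"
    "regular_on V g" "V \<inter> Y \<noteq> {}" "b = rat_class X V g" by (metis OY_memE)
  note I = regular_on_Int[OF *(1,4)]
  have "U \<inter> V \<inter> Y \<noteq> {}" using irrD(3)[OF assms regular_onD(1)[OF *(1)] regular_onD(1)[OF *(4)] *(2,5)] .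
  then show "a \<otimes>\<^bsub>FF\<^esub> b \<in> OY Y" "a \<oplus>\<^bsub>FF\<^esub> b \<in> OY Y"
    unfolding *(3,6) function_field_mult[OF *(1,4)] function_field_add[OF *(1,4)]
    using OY_memI regular_on_mult[OF I(1,2)] regular_on_add[OF I(1,2)] by auto
qed

text \<open>For irreducible Y this is the maximal ideal of the local ring along Y, expressed with
  the operations of the function field so that the ring record does not change.\<close>

definition nonunits :: "'x set \<Rightarrow> ('x, 'k) ratfun set" where
  "nonunits Y = {a\<in>OY Y. \<forall>b\<in>OY Y. a \<otimes>\<^bsub>FF\<^esub> b \<noteq> \<one>\<^bsub>FF\<^esub>}"

text \<open>The inverse of f is regular on the nonvanishing locus of f, so it belongs to the local
  ring along Y as soon as that locus meets Y. Conversely an inverse along Y excludes zeros at some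
  point of Y in the common domain.\<close>

lemma nonunits_iff:
  assumes Y: "irr Y" and f: "regular_on U f" "U \<inter> Y \<noteq> {}"
  shows "rat_class X U f \<in> nonunits Y \<longleftrightarrow> (\<forall>x\<in>U \<inter> Y. f x = 0)"
proof
  assume nu: "rat_class X U f \<in> nonunits Y"
  show "\<forall>x\<in>U \<inter> Y. f x = 0"
  proof (rule ccontr)
    assume "\<not> ?thesis"
    then obtain x where x: "x \<in> U" "x \<in> Y" "f x \<noteq> 0" by blast
    note i = rat_class_nonzero_inverse[OF f(1) x(1,3)]
    have "rat_class X {x\<in>U. f x \<noteq> 0} (\<lambda>x. 1 / f x) \<in> OY Y"
      by (rule OY_memI[OF i(1)]) (use x in auto)
    then show False using i(2) nu by (auto simp: nonunits_def)
  qed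
next
  assume van: "\<forall>x\<in>U \<inter> Y. f x = 0"
  have "rat_class X U f \<otimes>\<^bsub>FF\<^esub> b \<noteq> \<one>\<^bsub>FF\<^esub>" if b: "b \<in> OY Y" for b
  proof
    assume eq: "rat_class X U f \<otimes>\<^bsub>FF\<^esub> b = \<one>\<^bsub>FF\<^esub>"
    obtain V g where g: "regular_on V g" "V \<inter> Y \<noteq> {}" "b = rat_class X V g" using b by (rule OY_memE)
    note I = regular_on_Int[OF f(1) g(1)]
    have "rat_class X (U \<inter> V) (\<lambda>x. f x * g x) = rat_class X (U \<inter> V) (\<lambda>x. 1)"
      using eq rat_const_eq[OF I(3,4)] by (simp add: g(3) function_field_mult[OF f(1) g(1)] function_field_one)
    then have "\<forall>x\<in>U \<inter> V. f x * g x = 1"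
      unfolding rat_class_eq_iff[OF regular_on_mult[OF I(1,2)] regular_on_const[OF I(3,4)]] by simp
    moreover obtain x where "x \<in> U \<inter> V" "x \<in> Y"
      using irrD(3)[OF Y regular_onD(1)[OF f(1)] regular_onD(1)[OF g(1)] f(2) g(2)] by blast
    ultimately show False using van by (metis IntD1 IntI mult_zero_left zero_neq_one)
  qed
  then show "rat_class X U f \<in> nonunits Y" using OY_memI[OF f] by (simp add: nonunits_def)
qed

lemma nonunits_sub: "a \<in> nonunits Y \<Longrightarrow> a \<in> OY Y"
  by (simp add: nonunits_def)

lemma zero_nonunit: "irr Y \<Longrightarrow> \<zero>\<^bsub>FF\<^esub> \<in> nonunits Y"
proof -
  assume Y: "irr Y"
  have "\<zero>\<^bsub>FF\<^esub> \<otimes>\<^bsub>FF\<^esub> b \<noteq> \<one>\<^bsub>FF\<^esub>" if "b \<in> OY Y" for b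
    using F.l_null[OF OY_carrier[OF that]] F.one_not_zero by metis
  then show ?thesis using subringE(2)[OF subring_OY[OF Y]] by (simp add: nonunits_def)
qed

lemma nonunit_mult:
  assumes Y: "irr Y" and "a \<in> nonunits Y" "b \<in> OY Y"
  shows "b \<otimes>\<^bsub>FF\<^esub> a \<in> nonunits Y"
proof -
  note S = subringE[OF subring_OY[OF Y]]
  have "b \<otimes>\<^bsub>FF\<^esub> a \<otimes>\<^bsub>FF\<^esub> c \<noteq> \<one>\<^bsub>FF\<^esub>" if c: "c \<in> OY Y" for c
  proof -
    have "a \<otimes>\<^bsub>FF\<^esub> (b \<otimes>\<^bsub>FF\<^esub> c) \<noteq> \<one>\<^bsub>FF\<^esub>" using assms S(6) c by (simp add: nonunits_def)
    moreover have "a \<in> carrier FF" "b \<in> carrier FF" "c \<in> carrier FF"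
      using assms c OY_carrier nonunits_sub by blast+
    then have "a \<otimes>\<^bsub>FF\<^esub> (b \<otimes>\<^bsub>FF\<^esub> c) = b \<otimes>\<^bsub>FF\<^esub> a \<otimes>\<^bsub>FF\<^esub> c"
      by (simp add: F.m_ac)
    ultimately show ?thesis by simp
  qed
  then show ?thesis using S(6)[OF assms(3) nonunits_sub[OF assms(2)]] by (simp add: nonunits_def)
qed

text \<open>Polynomial functions on a chart as rational functions. Ideals of local rings are pulled
  back along this map to the Noetherian ring \<open>poly_functions n\<close>.\<close>

definition ev :: "'x set \<Rightarrow> ('x \<Rightarrow> nat \<Rightarrow> 'k) \<Rightarrow> ((nat \<Rightarrow> 'k) \<Rightarrow> 'k) \<Rightarrow> ('x, 'k) ratfun" where
  "ev V \<phi> p = rat_class X V (\<lambda>y. p (\<phi> y))"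

context
  fixes V n S \<phi>
  assumes ch: "chart X V n S \<phi>" and ne: "V \<noteq> {}"
begin

lemma regular_on_chart: "p \<in> poly_functions n \<Longrightarrow> regular_on V (\<lambda>y. p (\<phi> y))"
  using chartD(6)[OF ch _ poly_const[of 1], of p] chartD(1)[OF ch] ne by (simp add: regular_on_def)

lemma ev_carrier: "p \<in> poly_functions n \<Longrightarrow> ev V \<phi> p \<in> carrier FF"
  unfolding ev_def by (rule rat_class_carrier[OF regular_on_chart])

lemma ev_OY: "p \<in> poly_functions n \<Longrightarrow> V \<inter> Y \<noteq> {} \<Longrightarrow> ev V \<phi> p \<in> OY Y"
  unfolding ev_def by (rule OY_memI[OF regular_on_chart])

lemma ev_hom:
  assumes "p \<in> poly_functions n" "q \<in> poly_functions n"
  shows "ev V \<phi> (p + q) = ev V \<phi> p \<oplus>\<^bsub>FF\<^esub> ev V \<phi> q" "ev V \<phi> (p * q) = ev V \<phi> p \<otimes>\<^bsub>FF\<^esub> ev V \<phi> q"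
  using function_field_add_same[OF assms[THEN regular_on_chart]]
    function_field_mult_same[OF assms[THEN regular_on_chart]]
  by (simp_all add: ev_def)

lemma ev_one: "ev V \<phi> 1 = \<one>\<^bsub>FF\<^esub>" and ev_zero: "ev V \<phi> 0 = \<zero>\<^bsub>FF\<^esub>"
  using rat_const_eq[OF chartD(1)[OF ch] ne] by (simp_all add: ev_def function_field_one function_field_zero)

lemma ev_zero_iff: "p \<in> poly_functions n \<Longrightarrow> ev V \<phi> p = \<zero>\<^bsub>FF\<^esub> \<longleftrightarrow> (\<forall>y\<in>V. p (\<phi> y) = 0)"
  unfolding ev_def by (rule rat_class_zero_iff[OF regular_on_chart])

lemma ev_nonunit_iff:
  "irr Y \<Longrightarrow> V \<inter> Y \<noteq> {} \<Longrightarrow> p \<in> poly_functions n \<Longrightarrow>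
    ev V \<phi> p \<in> nonunits Y \<longleftrightarrow> (\<forall>y\<in>V \<inter> Y. p (\<phi> y) = 0)"
  unfolding ev_def by (rule nonunits_iff[OF _ regular_on_chart])

text \<open>The local ring along Y is the localisation of the coordinate ring at the prime ideal of
  functions vanishing on Y, stated with the denominator cleared.\<close>

lemma chart_fraction:
  assumes Y: "irr Y" and VY: "V \<inter> Y \<noteq> {}" and a: "a \<in> OY Y"
  obtains p q where "p \<in> poly_functions n" "q \<in> poly_functions n" "ev V \<phi> q \<notin> nonunits Y"
    "a \<otimes>\<^bsub>FF\<^esub> ev V \<phi> q = ev V \<phi> p"
proof -
  obtain U f where f: "regular_on U f" "U \<inter> Y \<noteq> {}" "a = rat_class X U f" using a by (rule OY_memE)
  have V: "op V" by (rule chartD(1)[OF ch])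
  obtain x where x: "x \<in> U" "x \<in> V" "x \<in> Y"
    using irrD(3)[OF Y regular_onD(1)[OF f(1)] V f(2) VY] by blast
  obtain p q where pq: "p \<in> poly_functions n" "q \<in> poly_functions n" "q (\<phi> x) \<noteq> 0" "{y\<in>V. q (\<phi> y) \<noteq> 0} \<subseteq> U"
    "\<forall>y\<in>V. q (\<phi> y) \<noteq> 0 \<longrightarrow> restrict f U y = p (\<phi> y) / q (\<phi> y)"
    using chartD(7)[OF ch regular_onD(1)[OF f(1)] regular_onD(3)[OF f(1)] x(1,2)] by blast
  let ?D = "{y\<in>V. q (\<phi> y) \<noteq> 0}"
  note rp = regular_on_chart[OF pq(1)] and rq = regular_on_chart[OF pq(2)]
  have "a \<otimes>\<^bsub>FF\<^esub> ev V \<phi> q = rat_class X (U \<inter> V) (\<lambda>y. f y * q (\<phi> y))"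
    unfolding ev_def f(3) by (rule function_field_mult[OF f(1) rq])
  also have "\<dots> = ev V \<phi> p"
    unfolding ev_def
  proof (rule rat_class_eqI[OF regular_on_mult[OF regular_on_Int(1,2)[OF f(1) rq]] rp])
    show "op ?D" by (rule chartD(4)[OF ch pq(2)])
    show "?D \<noteq> {}" using x pq(3) by blast
    show "?D \<subseteq> U \<inter> V \<inter> V" using pq(4) by blast
    show "f y * q (\<phi> y) = p (\<phi> y)" if "y \<in> ?D" for y
    proof -
      have "y \<in> U" "restrict f U y = p (\<phi> y) / q (\<phi> y)" using that pq(4,5) by auto
      then show ?thesis using that by simp
    qed
  qed
  finally have "a \<otimes>\<^bsub>FF\<^esub> ev V \<phi> q = ev V \<phi> p" .
  moreover have "ev V \<phi> q \<notin> nonunits Y"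
    unfolding ev_nonunit_iff[OF Y VY pq(2)] using x pq(3) by blast
  ultimately show thesis using that pq by blast
qed

text \<open>An ideal of a localisation is determined by its contraction, so a chain stops as soon as
  its pullback to \<open>poly_functions n\<close> does.\<close>

lemma sub_noetherian_OY:
  assumes Y: "irr Y" and VY: "V \<inter> Y \<noteq> {}"
  shows "sub_noetherian FF (OY Y)"
  unfolding sub_noetherian_def
proof (intro allI impI, elim conjE)
  fix J :: "nat \<Rightarrow> ('x, 'k) ratfun set"
  assume J: "\<forall>i. sub_ideal FF (OY Y) (J i)" and inc: "\<forall>i. J i \<subseteq> J (Suc i)"
  have JD: "J i \<subseteq> OY Y" "\<zero>\<^bsub>FF\<^esub> \<in> J i" "a \<in> J i \<Longrightarrow> b \<in> J i \<Longrightarrow> a \<oplus>\<^bsub>FF\<^esub> b \<in> J i"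
    "r \<in> OY Y \<Longrightarrow> a \<in> J i \<Longrightarrow> r \<otimes>\<^bsub>FF\<^esub> a \<in> J i" for i a b r
    using J unfolding sub_ideal_def by blast+
  define I where "I i = {p\<in>poly_functions n. ev V \<phi> p \<in> J i}" for i
  note R = subring_setD[OF subring_set_poly_functions[of n]]
  have "ideal_in (poly_functions n) (I i)" for i
    unfolding ideal_in_def I_def using R JD(2-4)[where i=i] ev_OY[OF _ VY]
    by (auto simp: ev_hom ev_zero)
  moreover have "I i \<subseteq> I (Suc i)" for i using inc by (auto simp: I_def)
  ultimately obtain N where N: "\<forall>m\<ge>N. I m = I N"
    using noetherian_poly_functions[of n, unfolded noetherian_in_def, THEN spec, of I] by auto
  have mono: "i \<le> j \<Longrightarrow> J i \<subseteq> J j" for i j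
    by (rule lift_Suc_mono_le[of J]) (use inc in simp_all)
  have "J m \<subseteq> J N" if m: "N \<le> m" for m
  proof
    fix a assume a: "a \<in> J m"
    then have aO: "a \<in> OY Y" using JD(1) by blast
    obtain p q where pq: "p \<in> poly_functions n" "q \<in> poly_functions n" "ev V \<phi> q \<notin> nonunits Y"
      "a \<otimes>\<^bsub>FF\<^esub> ev V \<phi> q = ev V \<phi> p" by (rule chart_fraction[OF Y VY aO])
    have qO: "ev V \<phi> q \<in> OY Y" by (rule ev_OY[OF pq(2) VY])
    then obtain b where b: "b \<in> OY Y" "ev V \<phi> q \<otimes>\<^bsub>FF\<^esub> b = \<one>\<^bsub>FF\<^esub>"
      using pq(3) by (auto simp: nonunits_def)
    have car: "a \<in> carrier FF" "b \<in> carrier FF" "ev V \<phi> q \<in> carrier FF" "ev V \<phi> p \<in> carrier FF"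
      using aO b qO OY_carrier ev_carrier[OF pq(1)] by auto
    have "ev V \<phi> q \<otimes>\<^bsub>FF\<^esub> a \<in> J m" by (rule JD(4)[OF qO a])
    then have "p \<in> I m" using pq car by (simp add: I_def F.m_comm)
    then have "ev V \<phi> p \<in> J N" using N m by (auto simp: I_def)
    then have "b \<otimes>\<^bsub>FF\<^esub> ev V \<phi> p \<in> J N" by (rule JD(4)[OF b(1)])
    moreover have "b \<otimes>\<^bsub>FF\<^esub> ev V \<phi> p = a \<otimes>\<^bsub>FF\<^esub> (ev V \<phi> q \<otimes>\<^bsub>FF\<^esub> b)"
      using car by (simp add: pq(4)[symmetric] F.m_ac)
    ultimately show "a \<in> J N" using b(2) car by simp
  qed
  then show "\<exists>N. \<forall>m\<ge>N. J m = J N" using mono by blast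
qed

text \<open>By the Nullstellensatz, \<open>Y\<^sub>0\<close> determines the prime ideal \<open>P\<close>.\<close>

lemma prime_locus:
  assumes Z: "irr Z" and VZ: "V \<inter> Z \<noteq> {}" and P: "sub_ideal FF (OY Z) P" and P1: "\<one>\<^bsub>FF\<^esub> \<notin> P"
    and Pp: "\<forall>a\<in>OY Z. \<forall>b\<in>OY Z. a \<otimes>\<^bsub>FF\<^esub> b \<in> P \<longrightarrow> a \<in> P \<or> b \<in> P"
  defines "Y0 \<equiv> {y\<in>V. \<forall>p\<in>poly_functions n. ev V \<phi> p \<in> P \<longrightarrow> p (\<phi> y) = 0}"
  shows "irr Y0" "V \<inter> Z \<subseteq> Y0" "p \<in> poly_functions n \<Longrightarrow> (\<forall>y\<in>Y0. p (\<phi> y) = 0) \<longleftrightarrow> ev V \<phi> p \<in> P"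
proof -
  note R = subring_setD[OF subring_set_poly_functions[of n]]
  have PD: "P \<subseteq> OY Z" "\<zero>\<^bsub>FF\<^esub> \<in> P" "a \<in> P \<Longrightarrow> b \<in> P \<Longrightarrow> a \<oplus>\<^bsub>FF\<^esub> b \<in> P"
    "r \<in> OY Z \<Longrightarrow> a \<in> P \<Longrightarrow> r \<otimes>\<^bsub>FF\<^esub> a \<in> P" for a b r
    using P unfolding sub_ideal_def by blast+
  \<comment> \<open>A proper ideal contains no unit, so its members vanish on Z where they are
    defined; this puts \<open>V \<inter> Z\<close> inside \<open>Y0\<close>.\<close>
  have Pnu: "a \<in> nonunits Z" if "a \<in> P" for a
  proof -
    have "a \<otimes>\<^bsub>FF\<^esub> b \<noteq> \<one>\<^bsub>FF\<^esub>" if "b \<in> OY Z" for b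
      using PD(4)[OF that \<open>a \<in> P\<close>] P1 PD(1) \<open>a \<in> P\<close> that OY_carrier F.m_comm[of a b] by auto
    then show ?thesis using that PD(1) by (auto simp: nonunits_def)
  qed
  define Q where "Q = {p\<in>poly_functions n. ev V \<phi> p \<in> P}"
  have Q: "prime_in (poly_functions n) Q"
    unfolding prime_in_def ideal_in_def Q_def
    using R PD(2-4) P1 ev_OY[OF _ VZ] Pp by (auto simp: ev_hom ev_zero ev_one)
  have null: "\<exists>y\<in>Y0. q (\<phi> y) \<noteq> 0" if q: "q \<in> poly_functions n" "q \<notin> Q" for q
  proof -
    obtain a where a: "a \<in> affine_space n" "\<forall>p\<in>Q. p a = 0" "q a \<noteq> 0"
      using nullstellensatz_prime[OF Q q] by blast
    \<comment> \<open>The equations of the embedded chart belong to the pulled-back prime, so the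
      point supplied by the Nullstellensatz lies on the embedded variety and comes from a point of
      V.\<close>
    have "s \<in> Q" if "s \<in> S" for s
    proof -
      have s: "s \<in> poly_functions n" using that chartD(2)[OF ch] by blast
      have "\<phi> y \<in> zero_locus n S" if "y \<in> V" for y using chartD(3)[OF ch] that by (auto simp: bij_betw_def)
      then have "\<forall>y\<in>V. s (\<phi> y) = 0" using \<open>s \<in> S\<close> by (auto simp: zero_locus_def)
      then show ?thesis using ev_zero_iff[OF s] PD(2) s by (simp add: Q_def)
    qed
    then have "a \<in> zero_locus n S" using a by (auto simp: zero_locus_def)
    then obtain y where y: "y \<in> V" "a = \<phi> y" using chartD(3)[OF ch] by (auto simp: bij_betw_def)
    then have "y \<in> Y0" using a(2) by (auto simp: Y0_def Q_def)
    then show ?thesis using a(3) y by blast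
  qed
  show "(\<forall>y\<in>Y0. p (\<phi> y) = 0) \<longleftrightarrow> ev V \<phi> p \<in> P" if "p \<in> poly_functions n" for p
    using null[OF that] that by (auto simp: Y0_def Q_def)
  show "V \<inter> Z \<subseteq> Y0"
    using Pnu ev_nonunit_iff[OF Z VZ] unfolding Y0_def by blast
  then have "Y0 \<noteq> {}" using VZ by blast
  moreover have "Y0 \<subseteq> topspace (pts X)" using op_topspace[OF chartD(1)[OF ch]] by (auto simp: Y0_def)
  moreover have "A \<inter> B \<inter> Y0 \<noteq> {}" if A: "op A" "A \<inter> Y0 \<noteq> {}" and B: "op B" "B \<inter> Y0 \<noteq> {}" for A B
  proof -
    have ex: "\<exists>q\<in>poly_functions n. q \<notin> Q \<and> {y\<in>V. q (\<phi> y) \<noteq> 0} \<subseteq> A" if "op A" "A \<inter> Y0 \<noteq> {}" for A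
    proof -
      obtain x where x: "x \<in> A" "x \<in> Y0" using \<open>A \<inter> Y0 \<noteq> {}\<close> by blast
      then have "x \<in> V" by (simp add: Y0_def)
      then obtain q where "q \<in> poly_functions n" "q (\<phi> x) \<noteq> 0" "{y\<in>V. q (\<phi> y) \<noteq> 0} \<subseteq> A"
        using chartD(5)[OF ch \<open>op A\<close> x(1)] by blast
      moreover have "q \<notin> Q" using calculation(2) x(2) by (auto simp: Y0_def Q_def)
      ultimately show ?thesis by blast
    qed
    obtain q where q: "q \<in> poly_functions n" "q \<notin> Q" "{y\<in>V. q (\<phi> y) \<noteq> 0} \<subseteq> A" using ex[OF A] by blast
    obtain r where r: "r \<in> poly_functions n" "r \<notin> Q" "{y\<in>V. r (\<phi> y) \<noteq> 0} \<subseteq> B" using ex[OF B] by blast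
    \<comment> \<open>Here primality becomes irreducibility: a product of two functions outside
      \<open>Q\<close> is outside \<open>Q\<close>, hence nonzero at some point of
      \<open>Y0\<close>.\<close>
    have "q * r \<notin> Q" using q r Q unfolding prime_in_def by blast
    then obtain y where "y \<in> Y0" "(q * r) (\<phi> y) \<noteq> 0" using null[OF R(6)[OF q(1) r(1)]] by blast
    moreover have "y \<in> V" using calculation(1) by (simp add: Y0_def)
    ultimately show ?thesis using q(3) r(3) by auto
  qed
  ultimately show "irr Y0" unfolding irr_in_def by blast
qed

end

lemma chart_meeting:
  assumes "irr Y"
  obtains V n S \<phi> where "chart X V n S \<phi>" "V \<noteq> {}" "V \<inter> Y \<noteq> {}"
proof -
  obtain x where x: "x \<in> Y" "x \<in> topspace (pts X)" using irrD(1,2)[OF assms] by blast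
  obtain V n S \<phi> where "chart X V n S \<phi>" "x \<in> V" using chart_at[OF x(2)] by blast
  then show thesis using that x by blast
qed

lemma noetherian_OY: "irr Y \<Longrightarrow> sub_noetherian FF (OY Y)"
  by (rule chart_meeting[of Y]) (auto intro: sub_noetherian_OY)

lemma subset_closure_of_Int:
  assumes "irr Y" "op V" "V \<inter> Y \<noteq> {}"
  shows "Y \<subseteq> pts X closure_of (V \<inter> Y)"
proof
  fix y assume y: "y \<in> Y"
  have "\<exists>z. z \<in> V \<inter> Y \<and> z \<in> T" if "y \<in> T \<and> op T" for T
    using irrD(3)[OF assms(1) _ assms(2) _ assms(3), of T] that y by auto
  then show "y \<in> pts X closure_of (V \<inter> Y)"
    using irrD(2)[OF assms(1)] y by (auto simp: in_closure_of)
qed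

lemma op_Int_closure_iff: "op U \<Longrightarrow> U \<inter> pts X closure_of Y = {} \<longleftrightarrow> U \<inter> Y = {}"
  by (rule openin_Int_closure_of_eq_empty)

lemma irr_closure:
  assumes "irr Y"
  shows "irr (pts X closure_of Y)"
proof -
  have "U \<inter> V \<inter> pts X closure_of Y \<noteq> {}"
    if "op U" "op V" "U \<inter> pts X closure_of Y \<noteq> {}" "V \<inter> pts X closure_of Y \<noteq> {}" for U V
    using that irrD(3)[OF assms, of U V] op_Int_closure_iff[of U Y] op_Int_closure_iff[of V Y]
      op_Int_closure_iff[of "U \<inter> V" Y] by blast
  moreover have "Y \<subseteq> pts X closure_of Y" using irrD(2)[OF assms] by (rule closure_of_subset)
  ultimately show ?thesis
    using irrD(1)[OF assms] closure_of_subset_topspace[of "pts X" Y] unfolding irr_in_def by blast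
qed

text \<open>An open set meets Y iff it meets the closure of Y. A locus that is closed only in a
  chart may thus be replaced by its closure in X.\<close>

lemma local_ring_closure: "local_ring X (pts X closure_of Y) = local_ring X Y"
proof -
  have "op U" if "a \<in> carrier FF" "(U, f) \<in> a" for a U f
    using that by (elim function_field_rep) (auto simp: rat_class_mem_iff)
  then have "OY (pts X closure_of Y) = OY Y"
    unfolding OY_def using op_Int_closure_iff by (intro Collect_cong conj_cong) (auto, blast+)
  then show ?thesis by (simp add: local_ring_def)
qed

end

section \<open>Codimension one on a normal variety: uniformizers and extension of functions\<close>

section \<open>Prime divisors and discrete valuations\<close>

locale normal_space = variety_space X for X :: "('x, 'k::{alg_closed_field, field_char_0}) fun_space" +
  assumes normal: "normal_variety X"
begin

text \<open>Normality is given at points. The finitely many coefficients are regular on a common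
  open set meeting Y, so the equation has coefficients in the local ring at one point x of Y, and
  \<open>OY {x}\<close> is contained in \<open>OY Y\<close>.\<close>

lemma integrally_closed_OY:
  assumes Y: "irr Y"
  shows "integrally_closed_in FF (OY Y)"
  unfolding integrally_closed_in_def
proof (intro ballI allI impI, elim conjE)
  fix f :: "('x, 'k) ratfun" and n :: nat and a
  assume f: "f \<in> carrier FF" and a: "\<forall>i<n. a i \<in> OY Y"
    and eq: "f [^]\<^bsub>FF\<^esub> n \<oplus>\<^bsub>FF\<^esub> (\<Oplus>\<^bsub>FF\<^esub>i\<in>{..<n}. a i \<otimes>\<^bsub>FF\<^esub> f [^]\<^bsub>FF\<^esub> i) = \<zero>\<^bsub>FF\<^esub>"
  have "\<exists>W. op W \<and> W \<inter> Y \<noteq> {} \<and> (\<forall>x\<in>W. \<forall>i<m. a i \<in> OY {x})" if "m \<le> n" for m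
    using that
  proof (induction m)
    case 0
    show ?case using irrD[OF Y] by (intro exI[of _ "topspace (pts X)"]) auto
  next
    case (Suc m)
    then obtain W where W: "op W" "W \<inter> Y \<noteq> {}" "\<forall>x\<in>W. \<forall>i<m. a i \<in> OY {x}" by auto
    have "a m \<in> OY Y" using a Suc.prems by simp
    then obtain U g where g: "regular_on U g" "U \<inter> Y \<noteq> {}" "a m = rat_class X U g" by (rule OY_memE)
    have "a m \<in> OY {x}" if "x \<in> U" for x unfolding g(3) using OY_memI[OF g(1)] that by blast
    moreover have "op (W \<inter> U)" using W(1) regular_onD(1)[OF g(1)] by auto
    moreover have "W \<inter> U \<inter> Y \<noteq> {}" using irrD(3)[OF Y W(1) regular_onD(1)[OF g(1)] W(2) g(2)] .
    ultimately show ?case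
      using W(3) by (intro exI[of _ "W \<inter> U"]) (auto simp: less_Suc_eq)
  qed
  from this[of n] obtain W where W: "W \<inter> Y \<noteq> {}" "\<forall>x\<in>W. \<forall>i<n. a i \<in> OY {x}" by auto
  then obtain x where x: "x \<in> Y" "\<forall>i<n. a i \<in> OY {x}" by blast
  then have "integrally_closed_in FF (OY {x})"
    using normal irrD(2)[OF Y] unfolding normal_variety_def by blast
  then have "f \<in> OY {x}" using f x(2) eq unfolding integrally_closed_in_def by blast
  then show "f \<in> OY Y" using OY_mono[of "{x}" Y] x(1) by blast
qed

text \<open>That t is nonzero excludes the case in which the local ring is the whole function
  field.\<close>

definition uniformizer :: "'x set \<Rightarrow> ('x, 'k) ratfun \<Rightarrow> bool" where
  "uniformizer Y t \<longleftrightarrow> t \<in> OY Y \<and> t \<noteq> \<zero>\<^bsub>FF\<^esub> \<and> nonunits Y = {r \<otimes>\<^bsub>FF\<^esub> t | r. r \<in> OY Y}"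

lemma field_fraction:
  assumes ch: "chart X V n S \<phi>" and ne: "V \<noteq> {}" and g: "g \<in> carrier FF"
  obtains p q where "p \<in> poly_functions n" "q \<in> poly_functions n" "ev V \<phi> q \<noteq> \<zero>\<^bsub>FF\<^esub>"
    "ev V \<phi> q \<otimes>\<^bsub>FF\<^esub> g = ev V \<phi> p"
proof -
  have gT: "g \<in> OY (topspace (pts X))" using g by (simp add: OY_topspace)
  have VT: "V \<inter> topspace (pts X) \<noteq> {}" using op_topspace[OF chartD(1)[OF ch]] ne by blast
  obtain p q where pq: "p \<in> poly_functions n" "q \<in> poly_functions n" "ev V \<phi> q \<notin> nonunits (topspace (pts X))"
    "g \<otimes>\<^bsub>FF\<^esub> ev V \<phi> q = ev V \<phi> p"
    by (rule chart_fraction[OF ch ne irr_in_X VT gT])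
  have "ev V \<phi> q \<noteq> \<zero>\<^bsub>FF\<^esub>" using pq(3) zero_nonunit[OF irr_in_X] by metis
  then show thesis using that[OF pq(1,2)] pq(4) F.m_comm[OF g ev_carrier[OF ch ne pq(2)]] by simp
qed

text \<open>Members of the conductor are nonunits because g is not in the ring, so with the
  hypothesis the conductor is the maximal ideal. A denominator of g in a chart is the nonzero member
  by which the powers of g are bounded.\<close>

lemma conductor_uniformizer:
  assumes Y: "irr Y" and g: "g \<in> carrier FF" "g \<notin> OY Y" and sub: "nonunits Y \<subseteq> conductor FF (OY Y) g"
  shows "\<exists>t. uniformizer Y t"
proof -
  note A = subring_OY[OF Y]
  note SA = subringE[OF A]
  have cond: "conductor FF (OY Y) g \<subseteq> nonunits Y"
  proof
    fix r assume r: "r \<in> conductor FF (OY Y) g"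
    then have rO: "r \<in> OY Y" "r \<otimes>\<^bsub>FF\<^esub> g \<in> OY Y" by (auto simp: conductor_def)
    have "r \<otimes>\<^bsub>FF\<^esub> b \<noteq> \<one>\<^bsub>FF\<^esub>" if b: "b \<in> OY Y" for b
    proof
      assume eq: "r \<otimes>\<^bsub>FF\<^esub> b = \<one>\<^bsub>FF\<^esub>"
      have car: "r \<in> carrier FF" "b \<in> carrier FF" using rO b OY_carrier by blast+
      have "b \<otimes>\<^bsub>FF\<^esub> (r \<otimes>\<^bsub>FF\<^esub> g) = (r \<otimes>\<^bsub>FF\<^esub> b) \<otimes>\<^bsub>FF\<^esub> g" using car g by (simp add: F.m_ac)
      then have "b \<otimes>\<^bsub>FF\<^esub> (r \<otimes>\<^bsub>FF\<^esub> g) = g" using eq g by simp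
      then show False using SA(6)[OF b rO(2)] g(2) by simp
    qed
    then show "r \<in> nonunits Y" using rO by (simp add: nonunits_def)
  qed
  then have eq: "nonunits Y = conductor FF (OY Y) g" using sub by blast
  obtain V n S \<phi> where ch: "chart X V n S \<phi>" "V \<noteq> {}" "V \<inter> Y \<noteq> {}" by (rule chart_meeting[OF Y])
  obtain p q where pq: "p \<in> poly_functions n" "q \<in> poly_functions n" "ev V \<phi> q \<noteq> \<zero>\<^bsub>FF\<^esub>"
    "ev V \<phi> q \<otimes>\<^bsub>FF\<^esub> g = ev V \<phi> p"
    by (rule field_fraction[OF ch(1,2) g(1)])
  have b: "ev V \<phi> q \<in> conductor FF (OY Y) g"
    using ev_OY[OF ch(1,2) _ ch(3)] pq by (simp add: conductor_def)
  have units: "\<exists>s\<in>OY Y. r \<otimes>\<^bsub>FF\<^esub> s = \<one>\<^bsub>FF\<^esub>" if "r \<in> OY Y" "r \<notin> conductor FF (OY Y) g" for r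
    using that unfolding eq[symmetric] nonunits_def by blast
  obtain t where t: "t \<in> conductor FF (OY Y) g"
    "\<And>p. p \<in> conductor FF (OY Y) g \<Longrightarrow> \<exists>r\<in>OY Y. p = r \<otimes>\<^bsub>FF\<^esub> t"
    using F.conductor_principal[OF A noetherian_OY[OF Y] integrally_closed_OY[OF Y] g units b pq(3)] by blast
  have tn: "t \<in> nonunits Y" using t(1) eq by simp
  obtain r where "r \<in> OY Y" "ev V \<phi> q = r \<otimes>\<^bsub>FF\<^esub> t" using t(2)[OF b] by blast
  then have "t \<noteq> \<zero>\<^bsub>FF\<^esub>" using pq(3) F.r_null[OF OY_carrier, of r Y] by metis
  moreover have "nonunits Y = {r \<otimes>\<^bsub>FF\<^esub> t | r. r \<in> OY Y}"
    using t(2) nonunit_mult[OF Y tn] unfolding eq by blast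
  ultimately show ?thesis using nonunits_sub[OF tn] unfolding uniformizer_def by blast
qed

lemma prime_divisorsD:
  assumes "Y \<in> prime_divisors X"
  shows "closedin (pts X) Y" "irr Y" "Y \<noteq> topspace (pts X)"
    "closedin (pts X) Z \<Longrightarrow> irr Z \<Longrightarrow> Y \<subseteq> Z \<Longrightarrow> Z = Y \<or> Z = topspace (pts X)"
  using assms unfolding prime_divisors_iff by blast+

lemma closure_not_topspace:
  assumes "chart X V n S \<phi>" "V \<noteq> {}" "p \<in> poly_functions n" "ev V \<phi> p \<noteq> \<zero>\<^bsub>FF\<^esub>"
    "\<forall>y\<in>Y. p (\<phi> y) = 0"
  shows "pts X closure_of Y \<noteq> topspace (pts X)"
proof
  assume eq: "pts X closure_of Y = topspace (pts X)"
  have D: "op {y\<in>V. p (\<phi> y) \<noteq> 0}" by (rule chartD(4)[OF assms(1,3)])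
  have "{y\<in>V. p (\<phi> y) \<noteq> 0} \<noteq> {}" using assms(4) ev_zero_iff[OF assms(1-3)] by blast
  then have "{y\<in>V. p (\<phi> y) \<noteq> 0} \<inter> pts X closure_of Y \<noteq> {}" using eq op_topspace[OF D] by blast
  then show False using op_Int_closure_iff[OF D] assms(5) by blast
qed

lemma nonzero_vanishing:
  assumes ch: "chart X V n S \<phi>" and ne: "V \<noteq> {}" and Y: "closedin (pts X) Y" "Y \<noteq> topspace (pts X)"
  obtains q where "q \<in> poly_functions n" "ev V \<phi> q \<noteq> \<zero>\<^bsub>FF\<^esub>" "\<forall>y\<in>V \<inter> Y. q (\<phi> y) = 0"
proof -
  have o: "op (topspace (pts X) - Y)" using Y(1) by (simp add: closedin_def)
  have "topspace (pts X) - Y \<noteq> {}" using Y closedin_subset by blast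
  then obtain x where x: "x \<in> topspace (pts X) - Y" "x \<in> V"
    using op_Int_nonempty[OF o chartD(1)[OF ch] _ ne] by blast
  obtain q where q: "q \<in> poly_functions n" "q (\<phi> x) \<noteq> 0" "{y\<in>V. q (\<phi> y) \<noteq> 0} \<subseteq> topspace (pts X) - Y"
    using chartD(5)[OF ch o x] by blast
  then show thesis using that[of q] ev_zero_iff[OF ch ne q(1)] x(2) by blast
qed

text \<open>A maximal proper conductor is prime, and by the Nullstellensatz its locus is a closed set
  containing \<open>Y\<close>; so it is the ideal of all non-units, as \<open>Y\<close> has codimension one.\<close>

theorem prime_divisor_uniformizer:
  assumes Yp: "Y \<in> prime_divisors X"
  shows "\<exists>t. uniformizer Y t"
proof -
  note Y = prime_divisorsD[OF Yp]
  note A = subring_OY[OF Y(2)]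
  note SA = subringE[OF A]
  obtain V n S \<phi> where ch: "chart X V n S \<phi>" "V \<noteq> {}" "V \<inter> Y \<noteq> {}" by (rule chart_meeting[OF Y(2)])
  obtain q where q: "q \<in> poly_functions n" "ev V \<phi> q \<noteq> \<zero>\<^bsub>FF\<^esub>" "\<forall>y\<in>V \<inter> Y. q (\<phi> y) = 0"
    by (rule nonzero_vanishing[OF ch(1,2) Y(1,3)])
  define b where "b = ev V \<phi> q"
  have bn: "b \<in> nonunits Y" unfolding b_def using ev_nonunit_iff[OF ch(1,2) Y(2) ch(3) q(1)] q(3) by blast
  have bO: "b \<in> OY Y" by (rule nonunits_sub[OF bn])
  have b: "b \<in> carrier FF" "b \<noteq> \<zero>\<^bsub>FF\<^esub>" using OY_carrier[OF bO] q(2) by (auto simp: b_def)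
  note bi = F.field_inv[OF b]
  \<comment> \<open>Since b vanishes on Y, its inverse is not in the local ring along Y; this is the
    element from which a maximal proper conductor is obtained.\<close>
  have "inv\<^bsub>FF\<^esub> b \<notin> OY Y" using bn bi(2) by (auto simp: nonunits_def)
  from F.conductor_prime[OF A noetherian_OY[OF Y(2)] bi(1) this] obtain c
    where c: "c \<in> OY Y" "c \<otimes>\<^bsub>FF\<^esub> inv\<^bsub>FF\<^esub> b \<notin> OY Y"
    and Pp: "\<And>x y. x \<in> OY Y \<Longrightarrow> y \<in> OY Y \<Longrightarrow> x \<otimes>\<^bsub>FF\<^esub> y \<in> conductor FF (OY Y) (c \<otimes>\<^bsub>FF\<^esub> inv\<^bsub>FF\<^esub> b) \<Longrightarrow>
       x \<in> conductor FF (OY Y) (c \<otimes>\<^bsub>FF\<^esub> inv\<^bsub>FF\<^esub> b) \<or> y \<in> conductor FF (OY Y) (c \<otimes>\<^bsub>FF\<^esub> inv\<^bsub>FF\<^esub> b)"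
    by metis
  define g where "g = c \<otimes>\<^bsub>FF\<^esub> inv\<^bsub>FF\<^esub> b"
  have cc: "c \<in> carrier FF" using c(1) OY_carrier by blast
  have g: "g \<in> carrier FF" "g \<notin> OY Y" using c cc bi by (auto simp: g_def)
  let ?P = "conductor FF (OY Y) g"
  have P: "sub_ideal FF (OY Y) ?P" by (rule F.sub_ideal_conductor[OF A g(1)])
  have P1: "\<one>\<^bsub>FF\<^esub> \<notin> ?P" using g by (simp add: conductor_def)
  have bP: "b \<in> ?P"
  proof -
    have "b \<otimes>\<^bsub>FF\<^esub> g = c \<otimes>\<^bsub>FF\<^esub> (b \<otimes>\<^bsub>FF\<^esub> inv\<^bsub>FF\<^esub> b)" 
      unfolding g_def by (rule F.m_lcomm[OF b(1) cc bi(1)])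
    then show ?thesis using bi cc c(1) bO by (simp add: conductor_def)
  qed
  have Pp': "\<forall>x\<in>OY Y. \<forall>y\<in>OY Y. x \<otimes>\<^bsub>FF\<^esub> y \<in> ?P \<longrightarrow> x \<in> ?P \<or> y \<in> ?P"
    using Pp unfolding g_def by blast
  define Y0 where "Y0 = {y\<in>V. \<forall>p\<in>poly_functions n. ev V \<phi> p \<in> ?P \<longrightarrow> p (\<phi> y) = 0}"
  note locus = prime_locus[OF ch(1,2) Y(2) ch(3) P P1 Pp', folded Y0_def]
  let ?Y = "pts X closure_of Y0"
  have "Y \<subseteq> pts X closure_of (V \<inter> Y)" by (rule subset_closure_of_Int[OF Y(2) chartD(1)[OF ch(1)] ch(3)])
  also have "\<dots> \<subseteq> ?Y" by (rule closure_of_mono[OF locus(2)])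
  finally have "Y \<subseteq> ?Y" .
  moreover have "?Y \<noteq> topspace (pts X)"
    using bP locus(3)[OF q(1)] by (intro closure_not_topspace[OF ch(1,2) q(1,2)]) (simp add: b_def)
  \<comment> \<open>\<open>?Y\<close> is closed, irreducible, proper and contains Y, so the
    maximality in the definition of a prime divisor applies.\<close>
  ultimately have "?Y = Y" using Y(4)[of ?Y] irr_closure[OF locus(1)] by simp
  then have Y0Y: "Y0 \<subseteq> V \<inter> Y"
    using closure_of_subset[OF irrD(2)[OF locus(1)]] by (auto simp: Y0_def)
  \<comment> \<open>A nonunit is a fraction whose numerator vanishes on \<open>V \<inter> Y\<close>
    and so on \<open>Y0\<close>. By the Nullstellensatz the numerator lies in \<open>?P\<close>, and
    the denominator is invertible.\<close>
  have "nonunits Y \<subseteq> ?P"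
  proof
    fix a assume a: "a \<in> nonunits Y"
    then have aO: "a \<in> OY Y" by (rule nonunits_sub)
    obtain p r where pr: "p \<in> poly_functions n" "r \<in> poly_functions n" "ev V \<phi> r \<notin> nonunits Y"
      "a \<otimes>\<^bsub>FF\<^esub> ev V \<phi> r = ev V \<phi> p"
      by (rule chart_fraction[OF ch(1,2) Y(2) ch(3) aO])
    have rO: "ev V \<phi> r \<in> OY Y" by (rule ev_OY[OF ch(1,2) pr(2) ch(3)])
    then obtain s where s: "s \<in> OY Y" "ev V \<phi> r \<otimes>\<^bsub>FF\<^esub> s = \<one>\<^bsub>FF\<^esub>" using pr(3) by (auto simp: nonunits_def)
    have car: "a \<in> carrier FF" "s \<in> carrier FF" "ev V \<phi> r \<in> carrier FF" using aO rO s OY_carrier by blast+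
    have "ev V \<phi> r \<otimes>\<^bsub>FF\<^esub> a \<in> nonunits Y" by (rule nonunit_mult[OF Y(2) a rO])
    then have "ev V \<phi> p \<in> nonunits Y" using pr(4) car by (simp add: F.m_comm)
    then have "\<forall>y\<in>Y0. p (\<phi> y) = 0" using ev_nonunit_iff[OF ch(1,2) Y(2) ch(3) pr(1)] Y0Y by blast
    then have "ev V \<phi> p \<in> ?P" using locus(3)[OF pr(1)] by blast
    then have "s \<otimes>\<^bsub>FF\<^esub> ev V \<phi> p \<in> ?P" using P s(1) unfolding sub_ideal_def by blast
    moreover have "s \<otimes>\<^bsub>FF\<^esub> ev V \<phi> p = a \<otimes>\<^bsub>FF\<^esub> (ev V \<phi> r \<otimes>\<^bsub>FF\<^esub> s)"
      unfolding pr(4)[symmetric] using car by (simp add: F.m_ac)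
    ultimately show "a \<in> ?P" using s car by simp
  qed
  then show ?thesis by (rule conductor_uniformizer[OF Y(2) g])
qed

lemma uniformizer_inv_notin:
  assumes "irr Y" "uniformizer Y t"
  shows "inv\<^bsub>FF\<^esub> t \<notin> OY Y"
proof -
  have t: "t \<in> carrier FF" "t \<noteq> \<zero>\<^bsub>FF\<^esub>" using assms OY_carrier unfolding uniformizer_def by blast+
  have "\<one>\<^bsub>FF\<^esub> \<otimes>\<^bsub>FF\<^esub> t \<in> nonunits Y"
    using assms subringE(3)[OF subring_OY] unfolding uniformizer_def by blast
  then show ?thesis using F.field_inv[OF t] t by (auto simp: nonunits_def)
qed

lemma uniformizer_factor:
  assumes Y: "irr Y" and t: "uniformizer Y t" and a: "a \<in> OY Y" "a \<noteq> \<zero>\<^bsub>FF\<^esub>"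
  obtains n :: nat and u v where "u \<in> OY Y" "v \<in> OY Y" "u \<otimes>\<^bsub>FF\<^esub> v = \<one>\<^bsub>FF\<^esub>" "a = u \<otimes>\<^bsub>FF\<^esub> t [^]\<^bsub>FF\<^esub> n"
proof -
  have t': "t \<in> OY Y" "t \<noteq> \<zero>\<^bsub>FF\<^esub>" "nonunits Y = {r \<otimes>\<^bsub>FF\<^esub> t | r. r \<in> OY Y}"
    using t by (auto simp: uniformizer_def)
  have loc: "(\<exists>s\<in>OY Y. r \<otimes>\<^bsub>FF\<^esub> s = \<one>\<^bsub>FF\<^esub>) \<or> (\<exists>s\<in>OY Y. r = s \<otimes>\<^bsub>FF\<^esub> t)" if "r \<in> OY Y" for r
  proof (cases "r \<in> nonunits Y")
    case True
    then show ?thesis unfolding t'(3) by blast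
  next
    case False
    then show ?thesis using that unfolding nonunits_def by blast
  qed
  show thesis
    by (rule F.uniformizer_factorization[OF subring_OY[OF Y] noetherian_OY[OF Y] t'(1,2)
          uniformizer_inv_notin[OF Y t] loc a that])
qed

text \<open>Algebraic Hartogs: a maximal conductor in the local ring at \<open>x\<close> defines a prime divisor
  through \<open>x\<close> along which \<open>g\<close> is not regular.\<close>

theorem hartogs:
  assumes g: "g \<in> carrier FF" and x: "x \<in> topspace (pts X)"
    and pd: "\<And>Y. Y \<in> prime_divisors X \<Longrightarrow> x \<in> Y \<Longrightarrow> g \<in> OY Y"
  shows "g \<in> OY {x}"
proof (rule ccontr)
  assume gx: "g \<notin> OY {x}"
  note Z = irr_in_singleton[OF x]
  note A = subring_OY[OF Z]
  obtain V n S \<phi> where ch: "chart X V n S \<phi>" "V \<noteq> {}" "V \<inter> {x} \<noteq> {}" by (rule chart_meeting[OF Z])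
  from F.conductor_prime[OF A noetherian_OY[OF Z] g gx] obtain c
    where c: "c \<in> OY {x}" "c \<otimes>\<^bsub>FF\<^esub> g \<notin> OY {x}"
    and Pp: "\<And>y z. y \<in> OY {x} \<Longrightarrow> z \<in> OY {x} \<Longrightarrow> y \<otimes>\<^bsub>FF\<^esub> z \<in> conductor FF (OY {x}) (c \<otimes>\<^bsub>FF\<^esub> g) \<Longrightarrow>
       y \<in> conductor FF (OY {x}) (c \<otimes>\<^bsub>FF\<^esub> g) \<or> z \<in> conductor FF (OY {x}) (c \<otimes>\<^bsub>FF\<^esub> g)"
    by metis
  define g' where "g' = c \<otimes>\<^bsub>FF\<^esub> g"
  have cc: "c \<in> carrier FF" using c(1) OY_carrier by blast
  have g': "g' \<in> carrier FF" "g' \<notin> OY {x}" using c cc g by (auto simp: g'_def)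
  let ?P = "conductor FF (OY {x}) g'"
  have P: "sub_ideal FF (OY {x}) ?P" by (rule F.sub_ideal_conductor[OF A g'(1)])
  have P1: "\<one>\<^bsub>FF\<^esub> \<notin> ?P" using g' by (simp add: conductor_def)
  have Pp': "\<forall>y\<in>OY {x}. \<forall>z\<in>OY {x}. y \<otimes>\<^bsub>FF\<^esub> z \<in> ?P \<longrightarrow> y \<in> ?P \<or> z \<in> ?P"
    using Pp unfolding g'_def by blast
  define Y0 where "Y0 = {y\<in>V. \<forall>p\<in>poly_functions n. ev V \<phi> p \<in> ?P \<longrightarrow> p (\<phi> y) = 0}"
  note locus = prime_locus[OF ch(1,2) Z ch(3) P P1 Pp', folded Y0_def]
  note Y0 = locus(1)
  have xY0: "x \<in> Y0" using locus(2) ch(3) by blast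
  have VY0: "V \<inter> Y0 \<noteq> {}" "Y0 \<subseteq> V" using xY0 by (auto simp: Y0_def)
  have Ox: "OY {x} \<subseteq> OY Y0" using xY0 by (intro OY_mono) blast
  note B = subring_OY[OF Y0]
  note SB = subringE[OF B]
  have evx: "p \<in> poly_functions n \<Longrightarrow> ev V \<phi> p \<in> OY {x}" for p by (rule ev_OY[OF ch(1,2) _ ch(3)])
  \<comment> \<open>In effect \<open>OY Y0\<close> is the localisation of \<open>OY {x}\<close> at
    the prime \<open>?P\<close>, and on polynomial functions its maximal ideal agrees with
    \<open>?P\<close>.\<close>
  have nu: "ev V \<phi> p \<in> nonunits Y0 \<longleftrightarrow> ev V \<phi> p \<in> ?P" if "p \<in> poly_functions n" for p
    using ev_nonunit_iff[OF ch(1,2) Y0 VY0(1) that] locus(3)[OF that] VY0(2) by (simp add: Int_absorb1)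
  have g'Y0: "g' \<notin> OY Y0"
  proof
    assume "g' \<in> OY Y0"
    then obtain p q where pq: "p \<in> poly_functions n" "q \<in> poly_functions n" "ev V \<phi> q \<notin> nonunits Y0"
      "g' \<otimes>\<^bsub>FF\<^esub> ev V \<phi> q = ev V \<phi> p"
      by (rule chart_fraction[OF ch(1,2) Y0 VY0(1)])
    have "ev V \<phi> q \<in> ?P"
      using evx[OF pq(2)] evx[OF pq(1)] pq(4) F.m_comm[OF g'(1) ev_carrier[OF ch(1,2) pq(2)]]
      by (simp add: conductor_def)
    then show False using pq(3) nu[OF pq(2)] by blast
  qed
  have "nonunits Y0 \<subseteq> conductor FF (OY Y0) g'"
  proof
    fix a assume a: "a \<in> nonunits Y0"
    then have aO: "a \<in> OY Y0" by (rule nonunits_sub)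
    obtain p r where pr: "p \<in> poly_functions n" "r \<in> poly_functions n" "ev V \<phi> r \<notin> nonunits Y0"
      "a \<otimes>\<^bsub>FF\<^esub> ev V \<phi> r = ev V \<phi> p"
      by (rule chart_fraction[OF ch(1,2) Y0 VY0(1) aO])
    have rO: "ev V \<phi> r \<in> OY Y0" by (rule ev_OY[OF ch(1,2) pr(2) VY0(1)])
    then obtain s where s: "s \<in> OY Y0" "ev V \<phi> r \<otimes>\<^bsub>FF\<^esub> s = \<one>\<^bsub>FF\<^esub>" using pr(3) by (auto simp: nonunits_def)
    have car: "a \<in> carrier FF" "s \<in> carrier FF" "ev V \<phi> r \<in> carrier FF" using aO rO s OY_carrier by blast+
    have "ev V \<phi> r \<otimes>\<^bsub>FF\<^esub> a \<in> nonunits Y0" by (rule nonunit_mult[OF Y0 a rO])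
    then have "ev V \<phi> p \<in> ?P" using pr(4) car nu[OF pr(1)] by (simp add: F.m_comm)
    then have "ev V \<phi> p \<otimes>\<^bsub>FF\<^esub> g' \<in> OY Y0" using Ox by (auto simp: conductor_def)
    then have "s \<otimes>\<^bsub>FF\<^esub> (ev V \<phi> p \<otimes>\<^bsub>FF\<^esub> g') \<in> OY Y0" by (rule SB(6)[OF s(1)])
    moreover have "s \<otimes>\<^bsub>FF\<^esub> (ev V \<phi> p \<otimes>\<^bsub>FF\<^esub> g') = (ev V \<phi> r \<otimes>\<^bsub>FF\<^esub> s) \<otimes>\<^bsub>FF\<^esub> (a \<otimes>\<^bsub>FF\<^esub> g')"
      unfolding pr(4)[symmetric] using car g'(1) by (simp add: F.m_ac)
    ultimately show "a \<in> conductor FF (OY Y0) g'" using s car g'(1) aO by (simp add: conductor_def)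
  qed
  then obtain t where t: "uniformizer Y0 t" using conductor_uniformizer[OF Y0 g'(1) g'Y0] by blast
  define Y where "Y = pts X closure_of Y0"
  have Y: "irr Y" "closedin (pts X) Y" unfolding Y_def using irr_closure[OF Y0] by auto
  have Y0Y: "Y0 \<subseteq> Y" unfolding Y_def by (rule closure_of_subset[OF irrD(2)[OF Y0]])
  \<comment> \<open>This is where codimension one comes from. A nonzero function h vanishing on a
    larger proper closed irreducible Z' is a unit times a power of t, so t is a nonunit along Z'.
    Polynomial functions in \<open>?P\<close> are multiples of t and therefore vanish on Z' too, so
    \<open>V \<inter> Z'\<close> is contained in \<open>Y0\<close>.\<close>
  have max: "Z' = Y \<or> Z' = topspace (pts X)" if Z': "closedin (pts X) Z'" "irr Z'" "Y \<subseteq> Z'" for Z'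
  proof (rule ccontr)
    assume contra: "\<not> ?thesis"
    note SC = subringE[OF subring_OY[OF Z'(2)]]
    have VZ: "V \<inter> Z' \<noteq> {}" using VY0 Y0Y Z'(3) by blast
    have OZ: "OY Y0 \<subseteq> OY Z'" using Y0Y Z'(3) by (intro OY_mono) blast
    obtain h where h: "h \<in> poly_functions n" "ev V \<phi> h \<noteq> \<zero>\<^bsub>FF\<^esub>" "\<forall>y\<in>V \<inter> Z'. h (\<phi> y) = 0"
      using nonzero_vanishing[OF ch(1,2) Z'(1)] contra by blast
    have hn: "ev V \<phi> h \<in> nonunits Z'" using ev_nonunit_iff[OF ch(1,2) Z'(2) VZ h(1)] h(3) by blast
    obtain k :: nat and u v where uv: "u \<in> OY Y0" "v \<in> OY Y0" "u \<otimes>\<^bsub>FF\<^esub> v = \<one>\<^bsub>FF\<^esub>"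
      "ev V \<phi> h = u \<otimes>\<^bsub>FF\<^esub> t [^]\<^bsub>FF\<^esub> k"
      by (rule uniformizer_factor[OF Y0 t ev_OY[OF ch(1,2) h(1) VY0(1)] h(2)])
    have tO: "t \<in> OY Y0" "t \<in> carrier FF" using t OY_carrier unfolding uniformizer_def by blast+
    have car: "u \<in> carrier FF" "v \<in> carrier FF" using uv OY_carrier by blast+
    have tn: "t \<in> nonunits Z'"
    proof (rule ccontr)
      assume "t \<notin> nonunits Z'"
      then obtain s where s: "s \<in> OY Z'" "t \<otimes>\<^bsub>FF\<^esub> s = \<one>\<^bsub>FF\<^esub>" using tO OZ unfolding nonunits_def by blast
      have sc: "s \<in> carrier FF" using s OY_carrier by blast
      have pow: "s [^]\<^bsub>FF\<^esub> k \<in> OY Z'" by (induction k) (use SC s in auto)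
      have "v \<otimes>\<^bsub>FF\<^esub> s [^]\<^bsub>FF\<^esub> k \<in> OY Z'" using SC(6) pow uv(2) OZ by blast
      moreover have "ev V \<phi> h \<otimes>\<^bsub>FF\<^esub> (v \<otimes>\<^bsub>FF\<^esub> s [^]\<^bsub>FF\<^esub> k) = \<one>\<^bsub>FF\<^esub>"
      proof -
        have "t [^]\<^bsub>FF\<^esub> k \<in> carrier FF" "s [^]\<^bsub>FF\<^esub> k \<in> carrier FF" using tO(2) sc by auto
        then have "u \<otimes>\<^bsub>FF\<^esub> t [^]\<^bsub>FF\<^esub> k \<otimes>\<^bsub>FF\<^esub> (v \<otimes>\<^bsub>FF\<^esub> s [^]\<^bsub>FF\<^esub> k) =
            (u \<otimes>\<^bsub>FF\<^esub> v) \<otimes>\<^bsub>FF\<^esub> (t [^]\<^bsub>FF\<^esub> k \<otimes>\<^bsub>FF\<^esub> s [^]\<^bsub>FF\<^esub> k)"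
          using car by (simp add: F.m_ac)
        also have "\<dots> = \<one>\<^bsub>FF\<^esub> \<otimes>\<^bsub>FF\<^esub> (t \<otimes>\<^bsub>FF\<^esub> s) [^]\<^bsub>FF\<^esub> k"
          unfolding uv(3) F.nat_pow_distrib[OF tO(2) sc] ..
        finally show ?thesis unfolding uv(4) s(2) by simp
      qed
      ultimately show False using hn unfolding nonunits_def by blast
    qed
    have "V \<inter> Z' \<subseteq> Y0"
    proof
      fix y assume y: "y \<in> V \<inter> Z'"
      have "p (\<phi> y) = 0" if p: "p \<in> poly_functions n" "ev V \<phi> p \<in> ?P" for p
      proof -
        have "ev V \<phi> p \<in> nonunits Y0" using nu[OF p(1)] p(2) by blast
        then obtain r where r: "r \<in> OY Y0" "ev V \<phi> p = r \<otimes>\<^bsub>FF\<^esub> t" using t unfolding uniformizer_def by blast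
        have "r \<otimes>\<^bsub>FF\<^esub> t \<in> nonunits Z'" using nonunit_mult[OF Z'(2) tn] r(1) OZ by blast
        then show ?thesis using ev_nonunit_iff[OF ch(1,2) Z'(2) VZ p(1)] r(2) y by auto
      qed
      then show "y \<in> Y0" using y unfolding Y0_def by blast
    qed
    then have "pts X closure_of (V \<inter> Z') \<subseteq> Y" unfolding Y_def by (rule closure_of_mono)
    then have "Z' \<subseteq> Y" using subset_closure_of_Int[OF Z'(2) chartD(1)[OF ch(1)] VZ] by blast
    then show False using contra Z'(3) by blast
  qed
  obtain p q where pq: "p \<in> poly_functions n" "q \<in> poly_functions n" "ev V \<phi> q \<noteq> \<zero>\<^bsub>FF\<^esub>"
    "ev V \<phi> q \<otimes>\<^bsub>FF\<^esub> g' = ev V \<phi> p"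
    by (rule field_fraction[OF ch(1,2) g'(1)])
  have "ev V \<phi> q \<in> ?P" using evx[OF pq(1)] evx[OF pq(2)] pq(4) by (simp add: conductor_def)
  then have "\<forall>y\<in>Y0. q (\<phi> y) = 0" using locus(3)[OF pq(2)] by blast
  then have "Y \<noteq> topspace (pts X)" unfolding Y_def by (rule closure_not_topspace[OF ch(1,2) pq(2,3)])
  then have "Y \<in> prime_divisors X" unfolding prime_divisors_iff using Y max by blast
  then have "g \<in> OY Y" using pd xY0 Y0Y by blast
  \<comment> \<open>\<open>Y\<close> is a prime divisor through x, so g is regular along it;
    returning from the closure to \<open>Y0\<close> and multiplying by c contradicts
    \<open>g'Y0\<close>.\<close>
  then have "g \<in> OY Y0" unfolding Y_def local_ring_closure .
  then have "c \<otimes>\<^bsub>FF\<^esub> g \<in> OY Y0" using SB(6) c(1) Ox by blast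
  then show False using g'Y0 by (simp add: g'_def)
qed

end

section \<open>Divisors of rational functions and the sheaves O(D)\<close>

section \<open>Orders of vanishing and sections of divisorial sheaves\<close>

context field begin

text \<open>Integer powers in the group of units and in the ring coincide, so the exponent laws of
  the group carry over to the function field.\<close>

lemma int_pow_units_of:
  assumes "x \<in> Units R"
  shows "x [^]\<^bsub>units_of R\<^esub> (n::int) = x [^] n"
proof -
  have "x [^] k \<in> Units R" for k :: nat
    using assms by (rule Units_pow_closed)
  then have "inv\<^bsub>units_of R\<^esub> (x [^] k) = inv (x [^] k)" for k :: nat by (rule units_of_inv)
  then show ?thesis
    unfolding int_pow_def2[of "units_of R"] int_pow_def2[of R] units_of_pow[OF assms] by (rule if_cong[OF refl]) (rule refl)
qed

lemma int_pow_facts: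
  assumes t: "t \<in> carrier R" "t \<noteq> \<zero>"
  shows "t [^] (m::int) \<in> carrier R" "t [^] m \<noteq> \<zero>" "t [^] (m + n) = t [^] m \<otimes> t [^] n"
    "inv (t [^] m) = t [^] (- m)"
proof -
  interpret G: comm_group "units_of R" by (rule units_comm_group)
  have u: "t \<in> Units R" using t by (simp add: field_Units)
  then have uG: "t \<in> carrier (units_of R)" by (simp add: units_of_carrier)
  have "t [^]\<^bsub>units_of R\<^esub> k \<in> Units R" for k :: int
    using G.int_pow_closed[OF uG] by (simp add: units_of_carrier)
  then have c: "t [^] k \<in> Units R" for k :: int by (simp add: int_pow_units_of[OF u])
  then show "t [^] m \<in> carrier R" "t [^] m \<noteq> \<zero>" by (auto simp: field_Units)
  show "t [^] (m + n) = t [^] m \<otimes> t [^] n"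
    using G.int_pow_mult[OF uG, of m n] by (simp add: int_pow_units_of[OF u] units_of_mult)
  show "inv (t [^] m) = t [^] (- m)"
    using G.int_pow_neg[OF uG, of m] by (simp add: int_pow_units_of[OF u] units_of_inv c)
qed

lemma int_pow_mult_distrib_field:
  assumes "a \<in> carrier R" "a \<noteq> \<zero>" "b \<in> carrier R" "b \<noteq> \<zero>"
  shows "(a \<otimes> b) [^] (n::int) = a [^] n \<otimes> b [^] n"
proof -
  interpret G: comm_group "units_of R" by (rule units_comm_group)
  have u: "a \<in> Units R" "b \<in> Units R" "a \<otimes> b \<in> Units R"
    using assms by (auto simp: field_Units integral_iff)
  then have "(a \<otimes> b) [^]\<^bsub>units_of R\<^esub> n = a [^]\<^bsub>units_of R\<^esub> n \<otimes>\<^bsub>units_of R\<^esub> b [^]\<^bsub>units_of R\<^esub> n"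
    using G.int_pow_distrib[of a b n] by (simp add: units_of_carrier units_of_mult)
  then show ?thesis by (simp add: int_pow_units_of u units_of_mult)
qed

end

context normal_space begin

definition UO :: "'x set \<Rightarrow> ('x, 'k) ratfun set" where
  "UO Y = {a\<in>OY Y. \<exists>b\<in>OY Y. a \<otimes>\<^bsub>FF\<^esub> b = \<one>\<^bsub>FF\<^esub>}"

lemma UO_nonunits: "UO Y = OY Y - nonunits Y"
  by (auto simp: UO_def nonunits_def)

lemma UO_carrier: "u \<in> UO Y \<Longrightarrow> u \<in> carrier FF" "u \<in> UO Y \<Longrightarrow> u \<noteq> \<zero>\<^bsub>FF\<^esub>" "u \<in> UO Y \<Longrightarrow> u \<in> OY Y"
proof -
  assume u: "u \<in> UO Y"
  then show 1: "u \<in> carrier FF" "u \<in> OY Y" using OY_carrier unfolding UO_def by blast+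
  obtain b where b: "b \<in> OY Y" "u \<otimes>\<^bsub>FF\<^esub> b = \<one>\<^bsub>FF\<^esub>" using u by (auto simp: UO_def)
  then show "u \<noteq> \<zero>\<^bsub>FF\<^esub>" using F.l_null[OF OY_carrier[OF b(1)]] F.one_not_zero by metis
qed

lemma UO_inv:
  assumes "u \<in> UO Y"
  shows "inv\<^bsub>FF\<^esub> u \<in> UO Y"
proof -
  obtain b where b: "b \<in> OY Y" "u \<otimes>\<^bsub>FF\<^esub> b = \<one>\<^bsub>FF\<^esub>" using assms by (auto simp: UO_def)
  have car: "u \<in> carrier FF" "b \<in> carrier FF" "u \<in> OY Y" using UO_carrier[OF assms] OY_carrier[OF b(1)] by auto
  have "inv\<^bsub>FF\<^esub> u = b" by (rule F.inv_eqI[OF car(1,2) b(2)])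
  moreover have "b \<otimes>\<^bsub>FF\<^esub> u = \<one>\<^bsub>FF\<^esub>" using b(2) F.m_comm[OF car(1,2)] by simp
  ultimately show ?thesis using b(1) car(3) unfolding UO_def by blast
qed

lemma UO_mult:
  assumes Y: "irr Y" and "u \<in> UO Y" "v \<in> UO Y"
  shows "u \<otimes>\<^bsub>FF\<^esub> v \<in> UO Y"
proof -
  note S = subringE(6)[OF subring_OY[OF Y]]
  have c: "u \<in> OY Y" "v \<in> OY Y" "inv\<^bsub>FF\<^esub> u \<in> OY Y" "inv\<^bsub>FF\<^esub> v \<in> OY Y"
    using assms UO_inv UO_carrier(3) by blast+
  note u = F.field_inv[OF UO_carrier(1,2)[OF assms(2)]] and v = F.field_inv[OF UO_carrier(1,2)[OF assms(3)]]
  have "u \<otimes>\<^bsub>FF\<^esub> v \<otimes>\<^bsub>FF\<^esub> (inv\<^bsub>FF\<^esub> u \<otimes>\<^bsub>FF\<^esub> inv\<^bsub>FF\<^esub> v) = (u \<otimes>\<^bsub>FF\<^esub> inv\<^bsub>FF\<^esub> u) \<otimes>\<^bsub>FF\<^esub> (v \<otimes>\<^bsub>FF\<^esub> inv\<^bsub>FF\<^esub> v)"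
    using u(1) v(1) UO_carrier(1)[OF assms(2)] UO_carrier(1)[OF assms(3)] by (simp add: F.m_ac)
  also have "\<dots> = \<one>\<^bsub>FF\<^esub>" unfolding u(2) v(2) by simp
  finally show ?thesis using S c unfolding UO_def by blast
qed

lemma UO_int_pow:
  assumes Y: "irr Y" and u: "u \<in> UO Y"
  shows "u [^]\<^bsub>FF\<^esub> (n::int) \<in> UO Y"
proof -
  have "u [^]\<^bsub>FF\<^esub> k \<in> UO Y" for k :: nat
  proof (induction k)
    case 0
    have "\<one>\<^bsub>FF\<^esub> \<in> OY Y" using subringE(3)[OF subring_OY[OF Y]] .
    then show ?case unfolding UO_def by force
  next
    case (Suc k)
    then show ?case using UO_mult[OF Y _ u] by simp
  qed
  then have "u [^]\<^bsub>FF\<^esub> nat n \<in> UO Y" "inv\<^bsub>FF\<^esub> (u [^]\<^bsub>FF\<^esub> nat (- n)) \<in> UO Y" using UO_inv by blast+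
  then show ?thesis unfolding int_pow_def2[of FF] by (simp only: split: if_split) simp
qed

lemma Units_local_ring: "Units (local_ring X Y) = UO Y"
proof -
  have "x \<otimes>\<^bsub>FF\<^esub> a = a \<otimes>\<^bsub>FF\<^esub> x" if "a \<in> OY Y" "x \<in> OY Y" for a x
    using F.m_comm that OY_carrier by blast
  then have "(\<exists>x\<in>OY Y. x \<otimes>\<^bsub>FF\<^esub> a = \<one>\<^bsub>FF\<^esub> \<and> a \<otimes>\<^bsub>FF\<^esub> x = \<one>\<^bsub>FF\<^esub>) = (\<exists>b\<in>OY Y. a \<otimes>\<^bsub>FF\<^esub> b = \<one>\<^bsub>FF\<^esub>)"
    if "a \<in> OY Y" for a
    by (intro bex_cong refl) (simp add: that)
  moreover have "monoid.mult (local_ring X Y) = monoid.mult FF" "\<one>\<^bsub>local_ring X Y\<^esub> = \<one>\<^bsub>FF\<^esub>"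
    by (simp_all add: local_ring_def)
  ultimately show ?thesis unfolding Units_def UO_def by (intro Collect_cong conj_cong refl) simp
qed

lemma uniformizerD:
  assumes "uniformizer Y t"
  shows "t \<in> OY Y" "t \<in> carrier FF" "t \<noteq> \<zero>\<^bsub>FF\<^esub>" "a \<in> nonunits Y \<longleftrightarrow> (\<exists>r\<in>OY Y. a = r \<otimes>\<^bsub>FF\<^esub> t)"
  using assms OY_carrier unfolding uniformizer_def by blast+

text \<open>Matches \<open>uniformizer\<close> with the clause on t in the definition of
  \<open>ord_at\<close>. That t is nonzero is recovered from \<open>t0\<close>, by which the
  nonunits contain a nonzero element.\<close>

lemma uniformizer_iff:
  assumes Y: "irr Y" and t0: "uniformizer Y t0"
  shows "uniformizer Y t \<longleftrightarrow> t \<in> carrier (local_ring X Y) \<and>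
     PIdl\<^bsub>local_ring X Y\<^esub> t = carrier (local_ring X Y) - Units (local_ring X Y)"
proof -
  have p: "PIdl\<^bsub>local_ring X Y\<^esub> t = {r \<otimes>\<^bsub>FF\<^esub> t | r. r \<in> OY Y}"
    by (simp add: cgenideal_def local_ring_def)
  have n: "carrier (local_ring X Y) - Units (local_ring X Y) = nonunits Y"
    unfolding Units_local_ring UO_nonunits using nonunits_sub by blast
  have "t \<noteq> \<zero>\<^bsub>FF\<^esub>" if gen: "{r \<otimes>\<^bsub>FF\<^esub> t | r. r \<in> OY Y} = nonunits Y"
  proof
    assume "t = \<zero>\<^bsub>FF\<^esub>"
    have "\<one>\<^bsub>FF\<^esub> \<otimes>\<^bsub>FF\<^esub> t0 \<in> nonunits Y"
      using t0 subringE(3)[OF subring_OY[OF Y]] unfolding uniformizer_def by blast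
    then obtain r where "r \<in> OY Y" "\<one>\<^bsub>FF\<^esub> \<otimes>\<^bsub>FF\<^esub> t0 = r \<otimes>\<^bsub>FF\<^esub> \<zero>\<^bsub>FF\<^esub>" using gen \<open>t = \<zero>\<^bsub>FF\<^esub>\<close> by blast
    then have "t0 = \<zero>\<^bsub>FF\<^esub>" using F.r_null[OF OY_carrier] F.l_one[OF uniformizerD(2)[OF t0]] by metis
    then show False using uniformizerD(3)[OF t0] by simp
  qed
  then show ?thesis unfolding p n uniformizer_def by auto
qed

text \<open>Write f as a fraction of polynomial functions on a chart; numerator and denominator are
  each a unit times a power of t, and the exponents are subtracted.\<close>

lemma uniformizer_factor_field:
  assumes Y: "irr Y" and t: "uniformizer Y t" and f: "f \<in> carrier FF" "f \<noteq> \<zero>\<^bsub>FF\<^esub>"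
  obtains n :: int and u where "u \<in> UO Y" "f = u \<otimes>\<^bsub>FF\<^esub> t [^]\<^bsub>FF\<^esub> n"
proof -
  note t' = uniformizerD(2,3)[OF t]
  note ip = F.int_pow_facts[OF t']
  have fac: "\<exists>u\<in>UO Y. \<exists>n::int. a = u \<otimes>\<^bsub>FF\<^esub> t [^]\<^bsub>FF\<^esub> n" if a: "a \<in> OY Y" "a \<noteq> \<zero>\<^bsub>FF\<^esub>" for a
  proof -
    obtain n :: nat and u v where "u \<in> OY Y" "v \<in> OY Y" "u \<otimes>\<^bsub>FF\<^esub> v = \<one>\<^bsub>FF\<^esub>" "a = u \<otimes>\<^bsub>FF\<^esub> t [^]\<^bsub>FF\<^esub> n"
      by (rule uniformizer_factor[OF Y t a])
    then show ?thesis
      by (intro bexI[of _ u] exI[of _ "int n"]) (auto simp: int_pow_int UO_def)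
  qed
  obtain V n S \<phi> where ch: "chart X V n S \<phi>" "V \<noteq> {}" "V \<inter> Y \<noteq> {}" by (rule chart_meeting[OF Y])
  obtain p q where pq: "p \<in> poly_functions n" "q \<in> poly_functions n" "ev V \<phi> q \<noteq> \<zero>\<^bsub>FF\<^esub>"
    "ev V \<phi> q \<otimes>\<^bsub>FF\<^esub> f = ev V \<phi> p"
    by (rule field_fraction[OF ch(1,2) f(1)])
  have q: "ev V \<phi> q \<in> OY Y" "ev V \<phi> q \<in> carrier FF" "ev V \<phi> p \<in> OY Y"
    using ev_OY[OF ch(1,2) _ ch(3)] ev_carrier[OF ch(1,2)] pq by auto
  have "ev V \<phi> p \<noteq> \<zero>\<^bsub>FF\<^esub>" using F.field_mult_nonzero[OF q(2) f(1) pq(3) f(2)] pq(4) by simp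
  then obtain u k where u: "u \<in> UO Y" "ev V \<phi> p = u \<otimes>\<^bsub>FF\<^esub> t [^]\<^bsub>FF\<^esub> (k::int)" using fac[OF q(3)] by blast
  obtain v m where v: "v \<in> UO Y" "ev V \<phi> q = v \<otimes>\<^bsub>FF\<^esub> t [^]\<^bsub>FF\<^esub> (m::int)" using fac[OF q(1) pq(3)] by blast
  note uc = UO_carrier[OF u(1)] and vc = UO_carrier[OF v(1)]
  note vi = F.field_inv[OF vc(1,2)]
  let ?w = "u \<otimes>\<^bsub>FF\<^esub> inv\<^bsub>FF\<^esub> v"
  have w: "?w \<in> UO Y" by (rule UO_mult[OF Y u(1) UO_inv[OF v(1)]])
  have "ev V \<phi> q \<otimes>\<^bsub>FF\<^esub> (?w \<otimes>\<^bsub>FF\<^esub> t [^]\<^bsub>FF\<^esub> (k - m)) =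
      u \<otimes>\<^bsub>FF\<^esub> (v \<otimes>\<^bsub>FF\<^esub> inv\<^bsub>FF\<^esub> v) \<otimes>\<^bsub>FF\<^esub> (t [^]\<^bsub>FF\<^esub> m \<otimes>\<^bsub>FF\<^esub> t [^]\<^bsub>FF\<^esub> (k - m))"
    unfolding v(2) using uc(1) vc(1) vi(1) ip(1) by (simp add: F.m_ac)
  also have "\<dots> = ev V \<phi> p" unfolding vi(2) ip(3)[symmetric] using u(2) uc(1) ip(1) by simp
  finally have "ev V \<phi> q \<otimes>\<^bsub>FF\<^esub> (?w \<otimes>\<^bsub>FF\<^esub> t [^]\<^bsub>FF\<^esub> (k - m)) = ev V \<phi> q \<otimes>\<^bsub>FF\<^esub> f" using pq(4) by simp
  then have "f = ?w \<otimes>\<^bsub>FF\<^esub> t [^]\<^bsub>FF\<^esub> (k - m)"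
    using F.m_lcancel[OF pq(3) q(2), of "?w \<otimes>\<^bsub>FF\<^esub> t [^]\<^bsub>FF\<^esub> (k - m)" f] f(1) UO_carrier(1)[OF w] ip(1) by simp
  then show thesis using that w by blast
qed

text \<open>A ring element times a positive power of t is a multiple of t and hence a nonunit. A
  negative exponent is excluded by multiplying back, which would turn u into a nonunit.\<close>

lemma uniformizer_pow_unit:
  assumes Y: "irr Y" and t: "uniformizer Y t" and u: "u \<in> UO Y"
  shows "u \<otimes>\<^bsub>FF\<^esub> t [^]\<^bsub>FF\<^esub> (n::int) \<in> OY Y \<longleftrightarrow> 0 \<le> n" "u \<otimes>\<^bsub>FF\<^esub> t [^]\<^bsub>FF\<^esub> n \<in> UO Y \<longleftrightarrow> n = 0"
proof -
  note t' = uniformizerD[OF t]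
  note ip = F.int_pow_facts[OF t'(2,3)]
  note S = subringE[OF subring_OY[OF Y]]
  note uc = UO_carrier[OF u] and ui = F.field_inv[OF UO_carrier(1,2)[OF u]]
  have tk: "t [^]\<^bsub>FF\<^esub> k \<in> OY Y" for k :: nat by (induction k) (use S t'(1) in auto)
  have tn: "t [^]\<^bsub>FF\<^esub> k \<in> OY Y" if "0 \<le> k" for k :: int
    unfolding int_pow_def2[of FF] using tk[of "nat k"] that by simp
  have pos: "a \<otimes>\<^bsub>FF\<^esub> t [^]\<^bsub>FF\<^esub> k \<in> nonunits Y" if "0 < k" "a \<in> OY Y" for k :: int and a
  proof -
    have a: "a \<in> carrier FF" using that OY_carrier by blast
    have "t [^]\<^bsub>FF\<^esub> (1::int) = t" unfolding int_pow_def2[of FF] using t'(2) by simp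
    then have "a \<otimes>\<^bsub>FF\<^esub> t [^]\<^bsub>FF\<^esub> k = (a \<otimes>\<^bsub>FF\<^esub> t [^]\<^bsub>FF\<^esub> (k - 1)) \<otimes>\<^bsub>FF\<^esub> t"
      using ip(3)[of "k - 1" 1] a ip(1) t'(2) by (simp add: F.m_assoc)
    then show ?thesis unfolding t'(4) using S(6)[OF that(2) tn[of "k - 1"]] that(1) by auto
  qed
  show 1: "u \<otimes>\<^bsub>FF\<^esub> t [^]\<^bsub>FF\<^esub> n \<in> OY Y \<longleftrightarrow> 0 \<le> n"
  proof
    assume "0 \<le> n"
    then show "u \<otimes>\<^bsub>FF\<^esub> t [^]\<^bsub>FF\<^esub> n \<in> OY Y" using S(6) tn uc(3) by blast
  next
    assume O: "u \<otimes>\<^bsub>FF\<^esub> t [^]\<^bsub>FF\<^esub> n \<in> OY Y"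
    show "0 \<le> n"
    proof (rule ccontr)
      assume "\<not> 0 \<le> n"
      then have "(u \<otimes>\<^bsub>FF\<^esub> t [^]\<^bsub>FF\<^esub> n) \<otimes>\<^bsub>FF\<^esub> t [^]\<^bsub>FF\<^esub> (- n) \<in> nonunits Y" using pos[OF _ O, of "- n"] by simp
      moreover have "(u \<otimes>\<^bsub>FF\<^esub> t [^]\<^bsub>FF\<^esub> n) \<otimes>\<^bsub>FF\<^esub> t [^]\<^bsub>FF\<^esub> (- n) = u"
        using ip(3)[of n "- n", symmetric] uc(1) ip(1) by (simp add: F.m_assoc)
      ultimately show False using u by (simp add: UO_nonunits)
    qed
  qed
  show "u \<otimes>\<^bsub>FF\<^esub> t [^]\<^bsub>FF\<^esub> n \<in> UO Y \<longleftrightarrow> n = 0"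
  proof
    assume "n = 0"
    then show "u \<otimes>\<^bsub>FF\<^esub> t [^]\<^bsub>FF\<^esub> n \<in> UO Y" using u uc by simp
  next
    assume U: "u \<otimes>\<^bsub>FF\<^esub> t [^]\<^bsub>FF\<^esub> n \<in> UO Y"
    then have "0 \<le> n" using 1 UO_carrier(3) by blast
    moreover have "\<not> 0 < n" using pos[OF _ uc(3), of n] U by (auto simp: UO_nonunits)
    ultimately show "n = 0" by simp
  qed
qed

text \<open>The description in \<open>ord_at\<close> ranges over all uniformizers as well as all
  units. Two uniformizers divide each other, so they differ by a unit factor, whose power is
  absorbed into the unit without changing the exponent.\<close>

lemma ord_at_eqI:
  assumes Yp: "Y \<in> prime_divisors X" and t: "uniformizer Y t" and u: "u \<in> UO Y"
    and f: "f = u \<otimes>\<^bsub>FF\<^esub> t [^]\<^bsub>FF\<^esub> (n::int)"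
  shows "ord_at X Y f = n"
proof -
  note Y = prime_divisorsD(2)[OF Yp]
  have eq: "ord_at X Y f = (THE n::int. \<exists>u t. u \<in> UO Y \<and> uniformizer Y t \<and> f = u \<otimes>\<^bsub>FF\<^esub> t [^]\<^bsub>FF\<^esub> n)"
    unfolding ord_at_def Units_local_ring uniformizer_iff[OF Y t] by (simp add: conj_assoc Units_local_ring)
  show ?thesis
    unfolding eq
  proof (rule the_equality)
    show "\<exists>u t. u \<in> UO Y \<and> uniformizer Y t \<and> f = u \<otimes>\<^bsub>FF\<^esub> t [^]\<^bsub>FF\<^esub> n" using t u f by blast
    fix m :: int assume "\<exists>u t. u \<in> UO Y \<and> uniformizer Y t \<and> f = u \<otimes>\<^bsub>FF\<^esub> t [^]\<^bsub>FF\<^esub> m"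
    then obtain v s where v: "v \<in> UO Y" "uniformizer Y s" "f = v \<otimes>\<^bsub>FF\<^esub> s [^]\<^bsub>FF\<^esub> m" by blast
    note t' = uniformizerD[OF t] and s' = uniformizerD[OF v(2)]
    note S = subringE[OF subring_OY[OF Y]]
    have gen: "a \<in> nonunits Y" if "uniformizer Y a" for a
      using that S(3) F.l_one[OF uniformizerD(2)[OF that]] uniformizerD(4)[OF that, of a] by metis
    obtain w where w: "w \<in> OY Y" "s = w \<otimes>\<^bsub>FF\<^esub> t" using gen[OF v(2)] t'(4) by blast
    obtain w' where w': "w' \<in> OY Y" "t = w' \<otimes>\<^bsub>FF\<^esub> s" using gen[OF t] s'(4) by blast
    have wc: "w \<in> carrier FF" "w' \<in> carrier FF" using w w' OY_carrier by blast+
    have "t \<otimes>\<^bsub>FF\<^esub> (w \<otimes>\<^bsub>FF\<^esub> w') = w' \<otimes>\<^bsub>FF\<^esub> (w \<otimes>\<^bsub>FF\<^esub> t)" using wc t'(2) by (simp add: F.m_ac)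
    also have "\<dots> = t \<otimes>\<^bsub>FF\<^esub> \<one>\<^bsub>FF\<^esub>" using w(2) w'(2) t'(2) by simp
    finally have "w \<otimes>\<^bsub>FF\<^esub> w' = \<one>\<^bsub>FF\<^esub>" using F.m_lcancel[OF t'(3,2), of "w \<otimes>\<^bsub>FF\<^esub> w'" "\<one>\<^bsub>FF\<^esub>"] wc by simp
    then have wU: "w \<in> UO Y" using w w' by (auto simp: UO_def)
    note wn = UO_carrier[OF wU] and vn = UO_carrier[OF v(1)] and un = UO_carrier[OF u]
    have vw: "v \<otimes>\<^bsub>FF\<^esub> w [^]\<^bsub>FF\<^esub> m \<in> UO Y" by (rule UO_mult[OF Y v(1) UO_int_pow[OF Y wU]])
    note vwc = UO_carrier[OF vw]
    note ip = F.int_pow_facts[OF t'(2,3)] and ipw = F.int_pow_facts[OF wn(1,2)]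
    have "f = (v \<otimes>\<^bsub>FF\<^esub> w [^]\<^bsub>FF\<^esub> m) \<otimes>\<^bsub>FF\<^esub> t [^]\<^bsub>FF\<^esub> m"
      unfolding v(3) w(2) F.int_pow_mult_distrib_field[OF wn(1,2) t'(2,3)]
      using vn(1) ip(1) ipw(1) by (simp add: F.m_assoc)
    then have e: "u \<otimes>\<^bsub>FF\<^esub> t [^]\<^bsub>FF\<^esub> n = (v \<otimes>\<^bsub>FF\<^esub> w [^]\<^bsub>FF\<^esub> m) \<otimes>\<^bsub>FF\<^esub> t [^]\<^bsub>FF\<^esub> m" using f by simp
    have "u \<otimes>\<^bsub>FF\<^esub> t [^]\<^bsub>FF\<^esub> (n - m) = (u \<otimes>\<^bsub>FF\<^esub> t [^]\<^bsub>FF\<^esub> n) \<otimes>\<^bsub>FF\<^esub> t [^]\<^bsub>FF\<^esub> (- m)"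
      using ip(3)[of n "- m"] un(1) ip(1) by (simp add: F.m_assoc)
    also have "\<dots> = v \<otimes>\<^bsub>FF\<^esub> w [^]\<^bsub>FF\<^esub> m"
      unfolding e using ip(3)[of m "- m", symmetric] vwc(1) ip(1) by (simp add: F.m_assoc)
    finally have "u \<otimes>\<^bsub>FF\<^esub> t [^]\<^bsub>FF\<^esub> (n - m) \<in> UO Y" using vw by simp
    then show "m = n" using uniformizer_pow_unit(2)[OF Y t u] by simp
  qed
qed

lemma ord_at_factor:
  assumes Yp: "Y \<in> prime_divisors X" and t: "uniformizer Y t" and f: "f \<in> carrier FF" "f \<noteq> \<zero>\<^bsub>FF\<^esub>"
  obtains u where "u \<in> UO Y" "f = u \<otimes>\<^bsub>FF\<^esub> t [^]\<^bsub>FF\<^esub> ord_at X Y f"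
proof -
  obtain n :: int and u where "u \<in> UO Y" "f = u \<otimes>\<^bsub>FF\<^esub> t [^]\<^bsub>FF\<^esub> n"
    by (rule uniformizer_factor_field[OF prime_divisorsD(2)[OF Yp] t f])
  then show thesis using that ord_at_eqI[OF Yp t] by metis
qed

lemma ord_at_mult:
  assumes Yp: "Y \<in> prime_divisors X" and f: "f \<in> carrier FF" "f \<noteq> \<zero>\<^bsub>FF\<^esub>" and g: "g \<in> carrier FF" "g \<noteq> \<zero>\<^bsub>FF\<^esub>"
  shows "ord_at X Y (f \<otimes>\<^bsub>FF\<^esub> g) = ord_at X Y f + ord_at X Y g"
proof -
  note Y = prime_divisorsD(2)[OF Yp]
  obtain t where t: "uniformizer Y t" using prime_divisor_uniformizer[OF Yp] by blast
  note ip = F.int_pow_facts[OF uniformizerD(2,3)[OF t]]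
  obtain u where u: "u \<in> UO Y" "f = u \<otimes>\<^bsub>FF\<^esub> t [^]\<^bsub>FF\<^esub> ord_at X Y f" by (rule ord_at_factor[OF Yp t f])
  obtain v where v: "v \<in> UO Y" "g = v \<otimes>\<^bsub>FF\<^esub> t [^]\<^bsub>FF\<^esub> ord_at X Y g" by (rule ord_at_factor[OF Yp t g])
  have "f \<otimes>\<^bsub>FF\<^esub> g = (u \<otimes>\<^bsub>FF\<^esub> t [^]\<^bsub>FF\<^esub> ord_at X Y f) \<otimes>\<^bsub>FF\<^esub> (v \<otimes>\<^bsub>FF\<^esub> t [^]\<^bsub>FF\<^esub> ord_at X Y g)"
    using u(2) v(2) by simp
  also have "\<dots> = (u \<otimes>\<^bsub>FF\<^esub> v) \<otimes>\<^bsub>FF\<^esub> t [^]\<^bsub>FF\<^esub> (ord_at X Y f + ord_at X Y g)"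
    unfolding ip(3) using UO_carrier(1)[OF u(1)] UO_carrier(1)[OF v(1)] ip(1) by (simp add: F.m_ac)
  finally show ?thesis by (rule ord_at_eqI[OF Yp t UO_mult[OF Y u(1) v(1)]])
qed

text \<open>Turns an inequality of orders into membership in a ring. Membership is preserved by sums
  in f, which takes the place of the valuation inequality for sums.\<close>

lemma ord_at_nonneg_iff:
  assumes Yp: "Y \<in> prime_divisors X" and t: "uniformizer Y t" and f: "f \<in> carrier FF" "f \<noteq> \<zero>\<^bsub>FF\<^esub>"
  shows "0 \<le> ord_at X Y f + d \<longleftrightarrow> f \<otimes>\<^bsub>FF\<^esub> t [^]\<^bsub>FF\<^esub> d \<in> OY Y"
proof -
  note Y = prime_divisorsD(2)[OF Yp]
  note ip = F.int_pow_facts[OF uniformizerD(2,3)[OF t]]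
  obtain u where u: "u \<in> UO Y" "f = u \<otimes>\<^bsub>FF\<^esub> t [^]\<^bsub>FF\<^esub> ord_at X Y f" by (rule ord_at_factor[OF Yp t f])
  have "f \<otimes>\<^bsub>FF\<^esub> t [^]\<^bsub>FF\<^esub> d = (u \<otimes>\<^bsub>FF\<^esub> t [^]\<^bsub>FF\<^esub> ord_at X Y f) \<otimes>\<^bsub>FF\<^esub> t [^]\<^bsub>FF\<^esub> d" using u(2) by simp
  also have "\<dots> = u \<otimes>\<^bsub>FF\<^esub> t [^]\<^bsub>FF\<^esub> (ord_at X Y f + d)"
    unfolding ip(3) using UO_carrier(1)[OF u(1)] ip(1) by (simp add: F.m_assoc)
  finally show ?thesis using uniformizer_pow_unit(1)[OF Y t u(1)] by simp
qed

lemma ord_at_unit: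
  assumes Yp: "Y \<in> prime_divisors X" and f: "regular_on U f" "x \<in> U" "x \<in> Y" "f x \<noteq> 0"
  shows "ord_at X Y (rat_class X U f) = 0"
proof -
  note Y = prime_divisorsD(2)[OF Yp]
  obtain t where t: "uniformizer Y t" using prime_divisor_uniformizer[OF Yp] by blast
  have "rat_class X U f \<in> UO Y"
    using OY_memI[OF f(1), of Y] nonunits_iff[OF Y f(1)] f by (auto simp: UO_nonunits)
  then show ?thesis
    by (rule ord_at_eqI[OF Yp t]) (use rat_class_carrier[OF f(1)] in simp)
qed

end

section \<open>Noetherian topology of a variety and finiteness of divisors\<close>

context variety_space begin

text \<open>On a chart a closed set is recovered from the polynomial functions that vanish on it, so
  a descending chain becomes an ascending chain of ideals; finiteness of the cover gives one index
  for all charts.\<close>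

lemma closed_chain_stationary:
  assumes C: "\<And>i::nat. closedin (pts X) (C i)" "\<And>i. C (Suc i) \<subseteq> C i"
  shows "\<exists>i. C (Suc i) = C i"
proof -
  obtain \<U> where U: "finite \<U>" "\<Union>\<U> = topspace (pts X)" "\<forall>V\<in>\<U>. \<exists>n S \<phi>. chart X V n S \<phi>"
    using finite_charts by auto
  have "\<forall>\<^sub>F m in sequentially. C (Suc m) \<inter> V = C m \<inter> V" if VU: "V \<in> \<U>" for V
  proof -
    obtain n S \<phi> where ch: "chart X V n S \<phi>" using U(3) VU by blast
    note R = subring_setD[OF subring_set_poly_functions[of n]]
    define I where "I m = {p\<in>poly_functions n. \<forall>y\<in>C m \<inter> V. p (\<phi> y) = 0}" for m
    have "ideal_in (poly_functions n) (I m)" for m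
      unfolding ideal_in_def I_def using R by auto
    moreover have "I m \<subseteq> I (Suc m)" for m using C(2)[of m] by (auto simp: I_def)
    ultimately obtain N where N: "\<forall>m\<ge>N. I m = I N"
      using noetherian_poly_functions[of n, unfolded noetherian_in_def, THEN spec, of I] by auto
    have rec: "C m \<inter> V = {y\<in>V. \<forall>p\<in>I m. p (\<phi> y) = 0}" for m
    proof (rule subset_antisym; rule subsetI)
      fix y assume "y \<in> C m \<inter> V"
      then show "y \<in> {y\<in>V. \<forall>p\<in>I m. p (\<phi> y) = 0}" by (simp add: I_def)
    next
      fix y assume y: "y \<in> {y\<in>V. \<forall>p\<in>I m. p (\<phi> y) = 0}"
      show "y \<in> C m \<inter> V"
      proof (rule ccontr)
        assume n: "y \<notin> C m \<inter> V"
        have o: "op (topspace (pts X) - C m)" using C(1)[of m] by (simp add: closedin_def)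
        have "y \<in> topspace (pts X) - C m" "y \<in> V" using y n op_topspace[OF chartD(1)[OF ch]] by auto
        from chartD(5)[OF ch o this] obtain q where q: "q \<in> poly_functions n" "q (\<phi> y) \<noteq> 0"
          "{y\<in>V. q (\<phi> y) \<noteq> 0} \<subseteq> topspace (pts X) - C m" by blast
        then have "q \<in> I m" unfolding I_def by blast
        then show False using q(2) y by blast
      qed
    qed
    have "C (Suc m) \<inter> V = C m \<inter> V" if "m \<ge> N" for m
    proof -
      have "I (Suc m) = I N" "I m = I N" using N that le_SucI by blast+
      then show ?thesis unfolding rec by simp
    qed
    then show ?thesis unfolding eventually_sequentially by blast
  qed
  then have "\<forall>\<^sub>F m in sequentially. \<forall>V\<in>\<U>. C (Suc m) \<inter> V = C m \<inter> V"
    using U(1) by (intro eventually_ball_finite) auto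
  then obtain m where m: "\<forall>V\<in>\<U>. C (Suc m) \<inter> V = C m \<inter> V" unfolding eventually_sequentially by blast
  have "C m \<subseteq> \<Union>\<U>" using U(2) closedin_subset[OF C(1)] by blast
  then have "C m \<subseteq> C (Suc m)" using m by blast
  then show ?thesis using C(2) by blast
qed

text \<open>Noetherian induction: a counterexample is reducible and is the union of two smaller
  closed sets, one of which is again a counterexample. Iteration gives a strictly descending
  chain.\<close>

lemma closed_components:
  assumes "closedin (pts X) C"
  shows "\<exists>\<A>. finite \<A> \<and> (\<forall>A\<in>\<A>. closedin (pts X) A \<and> irr A) \<and> \<Union>\<A> = C"
proof (rule ccontr)
  define good where "good C \<longleftrightarrow> (\<exists>\<A>. finite \<A> \<and> (\<forall>A\<in>\<A>. closedin (pts X) A \<and> irr A) \<and> \<Union>\<A> = C)" for C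
  assume "\<not> (\<exists>\<A>. finite \<A> \<and> (\<forall>A\<in>\<A>. closedin (pts X) A \<and> irr A) \<and> \<Union>\<A> = C)"
  then have bad0: "\<not> good C" by (simp add: good_def)
  have step: "\<exists>B. closedin (pts X) B \<and> \<not> good B \<and> B \<subset> A" if A: "closedin (pts X) A" "\<not> good A" for A
  proof -
    have "good {}" unfolding good_def by (intro exI[of _ "{}"]) simp
    then have "A \<noteq> {}" using A(2) by blast
    moreover have "\<not> irr A" using A unfolding good_def by (metis finite.emptyI finite.insertI ccpo_Sup_singleton singletonD)
    ultimately obtain U V where UV: "op U" "op V" "U \<inter> A \<noteq> {}" "V \<inter> A \<noteq> {}" "U \<inter> V \<inter> A = {}"
      using closedin_subset[OF A(1)] unfolding irr_in_def by blast
    have cl: "closedin (pts X) (A - U)" "closedin (pts X) (A - V)"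
      using A(1) UV(1,2) by (auto intro: closedin_diff)
    have un: "A = (A - U) \<union> (A - V)" using UV(5) by blast
    have "\<not> (good (A - U) \<and> good (A - V))"
    proof
      assume "good (A - U) \<and> good (A - V)"
      then obtain \<A> \<B> where "finite \<A>" "\<forall>A\<in>\<A>. closedin (pts X) A \<and> irr A" "\<Union>\<A> = A - U"
        "finite \<B>" "\<forall>A\<in>\<B>. closedin (pts X) A \<and> irr A" "\<Union>\<B> = A - V" by (auto simp: good_def)
      then have "good A" unfolding good_def using un by (intro exI[of _ "\<A> \<union> \<B>"]) auto
      then show False using A(2) by simp
    qed
    then show ?thesis using cl UV(3,4) by blast
  qed
  define nxt where "nxt A = (SOME B. closedin (pts X) B \<and> \<not> good B \<and> B \<subset> A)" for A
  have nxt: "closedin (pts X) (nxt A) \<and> \<not> good (nxt A) \<and> nxt A \<subset> A" if "closedin (pts X) A" "\<not> good A" for A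
    unfolding nxt_def by (rule someI_ex[OF step[OF that]])
  define S where "S n = (nxt ^^ n) C" for n
  have S: "closedin (pts X) (S n) \<and> \<not> good (S n)" for n
    by (induction n) (use assms bad0 nxt in \<open>auto simp: S_def\<close>)
  have "S (Suc n) \<subset> S n" for n using nxt[of "S n"] S[of n] by (simp add: S_def)
  then show False using closed_chain_stationary[of S] S by blast
qed

lemma irr_subset_Union:
  assumes "irr Y" "finite \<A>" "\<forall>A\<in>\<A>. closedin (pts X) A" "Y \<subseteq> \<Union>\<A>"
  shows "\<exists>A\<in>\<A>. Y \<subseteq> A"
  using assms(2-)
proof (induction \<A>)
  case empty
  then show ?case using irrD(1)[OF assms(1)] by simp
next
  case (insert A \<A>)
  have "closedin (pts X) (\<Union>\<A>)" using insert by (intro closedin_Union) auto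
  then have "Y \<subseteq> A \<or> Y \<subseteq> \<Union>\<A>"
    using irr_in_closed_union[OF assms(1), of A "\<Union>\<A>"] insert.prems by simp
  then show ?case using insert by blast
qed

end

context normal_space begin

text \<open>Such a divisor lies in one of the finitely many irreducible pieces of the complement of
  W, and by its maximality it is that piece.\<close>

lemma finite_prime_divisors_missing:
  assumes W: "op W" "W \<noteq> {}"
  shows "finite {Y\<in>prime_divisors X. Y \<inter> W = {}}"
proof -
  let ?C = "topspace (pts X) - W"
  have "closedin (pts X) ?C" using W(1) by (simp add: openin_closedin_eq)
  then obtain \<A> where A: "finite \<A>" "\<forall>A\<in>\<A>. closedin (pts X) A \<and> irr A" "\<Union>\<A> = ?C"
    using closed_components by meson
  have "Y \<in> \<A>" if Y: "Y \<in> prime_divisors X" "Y \<inter> W = {}" for Y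
  proof -
    note D = prime_divisorsD[OF Y(1)]
    have "Y \<subseteq> \<Union>\<A>" using A(3) irrD(2)[OF D(2)] Y(2) by blast
    then obtain B where B: "B \<in> \<A>" "Y \<subseteq> B" using irr_subset_Union[OF D(2) A(1)] A(2) by blast
    moreover have "B \<noteq> topspace (pts X)" using B(1) A(3) W op_topspace[OF W(1)] by blast
    ultimately show ?thesis using D(4)[of B] A(2) by blast
  qed
  then show ?thesis using A(1) by (blast intro: finite_subset)
qed

text \<open>A nonzero f is represented by a function without zeros on some nonempty open set, so its
  order can be nonzero only along the finitely many divisors missing that set. This is the finite
  support that \<open>Abs_poly_mapping\<close> requires.\<close>

lemma lookup_principal_div:
  assumes f: "f \<in> carrier FF" "f \<noteq> \<zero>\<^bsub>FF\<^esub>"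
  shows "Poly_Mapping.lookup (principal_div X f) Y = (if Y \<in> prime_divisors X then ord_at X Y f else 0)"
proof -
  obtain U g where g: "regular_on U g" "f = rat_class X U g" using function_field_rep[OF f(1)] by blast
  then obtain x where x: "x \<in> U" "g x \<noteq> 0" using f(2) rat_class_zero_iff by blast
  let ?W = "{x\<in>U. g x \<noteq> 0}"
  have "op ?W" "?W \<noteq> {}" using op_nonvanishing[OF g(1)] x by auto
  then have "finite {Y\<in>prime_divisors X. Y \<inter> ?W = {}}" by (rule finite_prime_divisors_missing)
  moreover have "{Y. (if Y \<in> prime_divisors X then ord_at X Y f else 0) \<noteq> 0} \<subseteq> {Y\<in>prime_divisors X. Y \<inter> ?W = {}}"
    using ord_at_unit[OF _ g(1)] g(2) by (auto split: if_splits)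
  ultimately have "finite {Y. (if Y \<in> prime_divisors X then ord_at X Y f else 0) \<noteq> 0}"
    by (rule finite_subset[rotated])
  then show ?thesis unfolding principal_div_def by (simp add: Poly_Mapping.lookup_Abs_poly_mapping)
qed

lemma principal_div_mult:
  assumes "f \<in> carrier FF" "f \<noteq> \<zero>\<^bsub>FF\<^esub>" "g \<in> carrier FF" "g \<noteq> \<zero>\<^bsub>FF\<^esub>"
  shows "principal_div X (f \<otimes>\<^bsub>FF\<^esub> g) = principal_div X f + principal_div X g"
  using assms F.field_mult_nonzero[OF assms(1,3,2,4)]
  by (intro poly_mapping_eqI) (simp add: lookup_principal_div lookup_add ord_at_mult)

lemma principal_div_one: "principal_div X \<one>\<^bsub>FF\<^esub> = 0"
  using principal_div_mult[of "\<one>\<^bsub>FF\<^esub>" "\<one>\<^bsub>FF\<^esub>"] by simp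

lemma principal_div_inv:
  assumes "f \<in> carrier FF" "f \<noteq> \<zero>\<^bsub>FF\<^esub>"
  shows "principal_div X (inv\<^bsub>FF\<^esub> f) = - principal_div X f"
proof -
  note i = F.field_inv[OF assms]
  have "principal_div X f + principal_div X (inv\<^bsub>FF\<^esub> f) = 0"
    using principal_div_mult[OF assms i(1,4)] i(2) principal_div_one by simp
  then show ?thesis by (simp add: eq_neg_iff_add_eq_0 add.commute)
qed

text \<open>In this form the zero section is no exception, and closure under sums and products is
  inherited from the rings \<open>OY Y\<close>.\<close>

lemma div_sections_iff:
  "f \<in> div_sections X W D \<longleftrightarrow> f \<in> carrier FF \<and>
    (\<forall>Y\<in>prime_divisors X. Y \<inter> W \<noteq> {} \<longrightarrow>
      (\<forall>t. uniformizer Y t \<longrightarrow> f \<otimes>\<^bsub>FF\<^esub> t [^]\<^bsub>FF\<^esub> Poly_Mapping.lookup D Y \<in> OY Y))"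
proof (cases "f \<in> carrier FF \<and> f \<noteq> \<zero>\<^bsub>FF\<^esub>")
  case True
  then have f: "f \<in> carrier FF" "f \<noteq> \<zero>\<^bsub>FF\<^esub>" by auto
  have "0 \<le> Poly_Mapping.lookup (principal_div X f + D) Y \<longleftrightarrow>
      (\<forall>t. uniformizer Y t \<longrightarrow> f \<otimes>\<^bsub>FF\<^esub> t [^]\<^bsub>FF\<^esub> Poly_Mapping.lookup D Y \<in> OY Y)"
    if Y: "Y \<in> prime_divisors X" for Y
  proof -
    have "0 \<le> Poly_Mapping.lookup (principal_div X f + D) Y \<longleftrightarrow> 0 \<le> ord_at X Y f + Poly_Mapping.lookup D Y"
      using Y by (simp add: lookup_add lookup_principal_div[OF f])
    then show ?thesis using ord_at_nonneg_iff[OF Y _ f] prime_divisor_uniformizer[OF Y] by blast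
  qed
  then show ?thesis using f unfolding div_sections_def by blast
next
  case False
  have "\<zero>\<^bsub>FF\<^esub> \<otimes>\<^bsub>FF\<^esub> t [^]\<^bsub>FF\<^esub> n \<in> OY Y" if "Y \<in> prime_divisors X" "uniformizer Y t" for Y t and n :: int
    using F.l_null[OF F.int_pow_facts(1)[OF uniformizerD(2,3)[OF that(2)]]]
      subringE(2)[OF subring_OY[OF prime_divisorsD(2)[OF that(1)]]] by simp
  then show ?thesis using False unfolding div_sections_def by auto
qed

lemma div_sections_carrier: "f \<in> div_sections X W D \<Longrightarrow> f \<in> carrier FF"
  by (simp add: div_sections_def)

lemma div_sections_zero: "\<zero>\<^bsub>FF\<^esub> \<in> div_sections X W D"
  by (simp add: div_sections_def)

lemma div_sections_add:
  assumes "f \<in> div_sections X W D" "g \<in> div_sections X W D"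
  shows "f \<oplus>\<^bsub>FF\<^esub> g \<in> div_sections X W D"
  unfolding div_sections_iff
proof (intro conjI ballI allI impI)
  have c: "f \<in> carrier FF" "g \<in> carrier FF" using assms div_sections_carrier by blast+
  then show "f \<oplus>\<^bsub>FF\<^esub> g \<in> carrier FF" by simp
  fix Y t assume Y: "Y \<in> prime_divisors X" "Y \<inter> W \<noteq> {}" and t: "uniformizer Y t"
  let ?t = "t [^]\<^bsub>FF\<^esub> Poly_Mapping.lookup D Y"
  have "f \<otimes>\<^bsub>FF\<^esub> ?t \<in> OY Y" "g \<otimes>\<^bsub>FF\<^esub> ?t \<in> OY Y" using assms Y t unfolding div_sections_iff by blast+
  then have "f \<otimes>\<^bsub>FF\<^esub> ?t \<oplus>\<^bsub>FF\<^esub> g \<otimes>\<^bsub>FF\<^esub> ?t \<in> OY Y"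
    by (rule subringE(7)[OF subring_OY[OF prime_divisorsD(2)[OF Y(1)]]])
  then show "(f \<oplus>\<^bsub>FF\<^esub> g) \<otimes>\<^bsub>FF\<^esub> ?t \<in> OY Y"
    using F.l_distr[OF c F.int_pow_facts(1)[OF uniformizerD(2,3)[OF t]]] by simp
qed

lemma div_sections_mult:
  assumes "f \<in> div_sections X W D" "g \<in> div_sections X W E"
  shows "f \<otimes>\<^bsub>FF\<^esub> g \<in> div_sections X W (D + E)"
  unfolding div_sections_iff
proof (intro conjI ballI allI impI)
  have c: "f \<in> carrier FF" "g \<in> carrier FF" using assms div_sections_carrier by blast+
  then show "f \<otimes>\<^bsub>FF\<^esub> g \<in> carrier FF" by simp
  fix Y t assume Y: "Y \<in> prime_divisors X" "Y \<inter> W \<noteq> {}" and t: "uniformizer Y t"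
  let ?d = "Poly_Mapping.lookup D Y" and ?e = "Poly_Mapping.lookup E Y"
  note ip = F.int_pow_facts[OF uniformizerD(2,3)[OF t]]
  have "f \<otimes>\<^bsub>FF\<^esub> t [^]\<^bsub>FF\<^esub> ?d \<in> OY Y" "g \<otimes>\<^bsub>FF\<^esub> t [^]\<^bsub>FF\<^esub> ?e \<in> OY Y"
    using assms Y t unfolding div_sections_iff by blast+
  then have "(f \<otimes>\<^bsub>FF\<^esub> t [^]\<^bsub>FF\<^esub> ?d) \<otimes>\<^bsub>FF\<^esub> (g \<otimes>\<^bsub>FF\<^esub> t [^]\<^bsub>FF\<^esub> ?e) \<in> OY Y"
    by (rule subringE(6)[OF subring_OY[OF prime_divisorsD(2)[OF Y(1)]]])
  moreover have "(f \<otimes>\<^bsub>FF\<^esub> t [^]\<^bsub>FF\<^esub> ?d) \<otimes>\<^bsub>FF\<^esub> (g \<otimes>\<^bsub>FF\<^esub> t [^]\<^bsub>FF\<^esub> ?e) =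
      f \<otimes>\<^bsub>FF\<^esub> g \<otimes>\<^bsub>FF\<^esub> t [^]\<^bsub>FF\<^esub> Poly_Mapping.lookup (D + E) Y"
    unfolding lookup_add ip(3) using c ip(1) by (simp add: F.m_ac)
  ultimately show "f \<otimes>\<^bsub>FF\<^esub> g \<otimes>\<^bsub>FF\<^esub> t [^]\<^bsub>FF\<^esub> Poly_Mapping.lookup (D + E) Y \<in> OY Y" by simp
qed

lemma div_sections_const: "rat_const X c \<in> div_sections X W 0"
  unfolding div_sections_iff
proof (intro conjI ballI allI impI)
  show "rat_const X c \<in> carrier FF" by (rule rat_const_carrier)
  fix Y t assume Y: "Y \<in> prime_divisors X"
  show "rat_const X c \<otimes>\<^bsub>FF\<^esub> t [^]\<^bsub>FF\<^esub> Poly_Mapping.lookup (0 :: 'x set \<Rightarrow>\<^sub>0 int) Y \<in> OY Y"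
    using rat_const_OY[OF prime_divisorsD(2)[OF Y], of c] rat_const_carrier by simp
qed

lemma div_sections_uminus:
  assumes "f \<in> div_sections X W D"
  shows "\<ominus>\<^bsub>FF\<^esub> f \<in> div_sections X W D"
proof -
  have c: "f \<in> carrier FF" using assms div_sections_carrier by blast
  have "regular_on (topspace (pts X)) (\<lambda>x. 1)" using topspace_ne by (intro regular_on_const) auto
  then have "\<ominus>\<^bsub>FF\<^esub> \<one>\<^bsub>FF\<^esub> = rat_const X (- 1)"
    unfolding function_field_one rat_const_def by (rule function_field_uminus)
  moreover have "rat_const X (- 1) \<otimes>\<^bsub>FF\<^esub> f \<in> div_sections X W (0 + D)"
    by (rule div_sections_mult[OF div_sections_const assms])
  moreover have "\<ominus>\<^bsub>FF\<^esub> \<one>\<^bsub>FF\<^esub> \<otimes>\<^bsub>FF\<^esub> f = \<ominus>\<^bsub>FF\<^esub> f" using c by (simp add: F.l_minus)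
  ultimately show ?thesis by simp
qed

lemma div_sections_mono: "W' \<subseteq> W \<Longrightarrow> div_sections X W D \<subseteq> div_sections X W' D"
  unfolding div_sections_def by blast

lemma div_sections_Union:
  "(\<And>W. W \<in> \<W> \<Longrightarrow> f \<in> div_sections X W D) \<Longrightarrow> f \<in> carrier FF \<Longrightarrow> f \<in> div_sections X (\<Union>\<W>) D"
  unfolding div_sections_def by blast

lemma principal_in_div_sections:
  assumes "f \<in> carrier FF" "f \<noteq> \<zero>\<^bsub>FF\<^esub>"
    "\<And>Y. Y \<in> prime_divisors X \<Longrightarrow> Y \<inter> W \<noteq> {} \<Longrightarrow> 0 \<le> Poly_Mapping.lookup (principal_div X f + D) Y"
  shows "f \<in> div_sections X W D"
  using assms unfolding div_sections_def by blast

lemma lookup_principal_div_regular: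
  assumes f: "regular_on U f" and nz: "rat_class X U f \<noteq> \<zero>\<^bsub>FF\<^esub>" and Y: "Y \<in> prime_divisors X" "Y \<inter> U \<noteq> {}"
  shows "0 \<le> Poly_Mapping.lookup (principal_div X (rat_class X U f)) Y"
proof -
  note fc = rat_class_carrier[OF f]
  obtain t where t: "uniformizer Y t" using prime_divisor_uniformizer[OF Y(1)] by blast
  have "rat_class X U f \<otimes>\<^bsub>FF\<^esub> t [^]\<^bsub>FF\<^esub> (0::int) \<in> OY Y"
    using OY_memI[OF f, of Y] Y(2) fc by (simp add: Int_commute)
  then have "0 \<le> ord_at X Y (rat_class X U f)"
    using ord_at_nonneg_iff[OF Y(1) t fc nz, of 0] by simp
  then show ?thesis using lookup_principal_div[OF fc nz] Y(1) by simp
qed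

text \<open>Hartogs puts g into the stalk at every point of U. The regular representatives around
  the points agree on overlaps because they have the same class, so they glue.\<close>

lemma div_sections_zero_regular:
  assumes U: "op U" "U \<noteq> {}" and g: "g \<in> div_sections X U 0"
  obtains f where "f \<in> reg X U" "g = rat_class X U f"
proof -
  have gc: "g \<in> carrier FF" using g div_sections_carrier by blast
  have "g \<in> OY {x}" if x: "x \<in> U" for x
  proof (rule hartogs[OF gc])
    show "x \<in> topspace (pts X)" using op_topspace[OF U(1)] x by blast
    fix Y assume Y: "Y \<in> prime_divisors X" "x \<in> Y"
    obtain t where t: "uniformizer Y t" using prime_divisor_uniformizer[OF Y(1)] by blast
    have "Y \<inter> U \<noteq> {}" using x Y(2) by blast
    then have "g \<otimes>\<^bsub>FF\<^esub> t [^]\<^bsub>FF\<^esub> Poly_Mapping.lookup (0 :: 'x set \<Rightarrow>\<^sub>0 int) Y \<in> OY Y"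
      using g[unfolded div_sections_iff] Y(1) t by blast
    then have "g \<otimes>\<^bsub>FF\<^esub> t [^]\<^bsub>FF\<^esub> (0::int) \<in> OY Y" unfolding lookup_zero .
    then show "g \<in> OY Y" using gc by simp
  qed
  have ex: "\<forall>x\<in>U. \<exists>W h. regular_on W h \<and> x \<in> W \<and> g = rat_class X W h"
  proof
    fix x assume "x \<in> U"
    with \<open>\<And>x. x \<in> U \<Longrightarrow> g \<in> OY {x}\<close> have "g \<in> OY {x}" .
    then obtain W h where "regular_on W h" "W \<inter> {x} \<noteq> {}" "g = rat_class X W h" by (rule OY_memE)
    then show "\<exists>W h. regular_on W h \<and> x \<in> W \<and> g = rat_class X W h" by blast
  qed
  then obtain W h where Wh: "\<And>x. x \<in> U \<Longrightarrow> regular_on (W x) (h x) \<and> x \<in> W x \<and> g = rat_class X (W x) (h x)"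
    by metis
  \<comment> \<open>The value at x is taken from the representative chosen at x itself; by
    \<open>fh\<close> any other representative defined at the point gives the same value.\<close>
  define f where "f = restrict (\<lambda>x. h x x) U"
  have fh: "f y = h x y" if "x \<in> U" "y \<in> U" "y \<in> W x" for x y
  proof -
    have r: "regular_on (W y) (h y)" "regular_on (W x) (h x)" "y \<in> W y" using Wh that by blast+
    have "rat_class X (W y) (h y) = rat_class X (W x) (h x)" using Wh[OF that(1)] Wh[OF that(2)] by simp
    then have "h y y = h x y" using r(3) that(3) unfolding rat_class_eq_iff[OF r(1,2)] by blast
    then show ?thesis using that(2) by (simp add: f_def)
  qed
  have "f \<in> reg X U"
  proof (rule reg_glue[OF U(1)])
    show "f \<in> extensional U" by (simp add: f_def)
    fix x assume x: "x \<in> U"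
    let ?V = "W x \<inter> U"
    have "op (W x)" using Wh[OF x] regular_onD(1) by blast
    then have V: "op ?V" "x \<in> ?V" using Wh[OF x] x U(1) by auto
    have "?V \<noteq> {}" using V(2) by blast
    then have "regular_on ?V (h x)" by (rule regular_on_mono[OF conjunct1[OF Wh[OF x]] V(1) _ Int_lower1])
    then have "restrict (h x) ?V \<in> reg X ?V" by (rule regular_onD(3))
    moreover have "restrict (h x) ?V = restrict f ?V" by (rule restrict_eqI) (use fh x in auto)
    ultimately show "\<exists>V. op V \<and> x \<in> V \<and> V \<subseteq> U \<and> restrict f V \<in> reg X V" using V by (intro exI[of _ ?V]) auto
  qed
  moreover obtain x where x: "x \<in> U" using U(2) by blast
  have r: "regular_on (W x) (h x)" "g = rat_class X (W x) (h x)" using Wh[OF x] by blast+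
  have "rat_class X (W x) (h x) = rat_class X U f"
    unfolding rat_class_eq_iff[OF r(1) regular_onI[OF U calculation]] using fh[OF x] by auto
  ultimately show thesis using that[of f] r(2) by simp
qed

end

section \<open>The graded algebra of divisorial sections and its components\<close>

section \<open>Algebras of divisorial families\<close>

context normal_space begin

abbreviation supp :: "('x, 'k) div_family \<Rightarrow> ('x set \<Rightarrow>\<^sub>0 int) set" where
  "supp \<equiv> family_support X"

abbreviation hmg :: "('x set \<Rightarrow>\<^sub>0 int) \<Rightarrow> ('x, 'k) ratfun \<Rightarrow> ('x, 'k) div_family" where
  "hmg \<equiv> homogeneous X"

text \<open>The operations of \<open>family_ring X A\<close> do not depend on A. Named separately,
  they serve the sections over every open set and every stalk.\<close>

definition fzero :: "('x, 'k) div_family" where "fzero = (\<lambda>D. \<zero>\<^bsub>FF\<^esub>)"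

definition fadd :: "('x, 'k) div_family \<Rightarrow> ('x, 'k) div_family \<Rightarrow> ('x, 'k) div_family" where
  "fadd s t = (\<lambda>D. s D \<oplus>\<^bsub>FF\<^esub> t D)"

definition fneg :: "('x, 'k) div_family \<Rightarrow> ('x, 'k) div_family" where
  "fneg s = (\<lambda>D. \<ominus>\<^bsub>FF\<^esub> s D)"

definition fmul :: "('x, 'k) div_family \<Rightarrow> ('x, 'k) div_family \<Rightarrow> ('x, 'k) div_family" where
  "fmul s t = (\<lambda>D. \<Oplus>\<^bsub>FF\<^esub>E\<in>supp s. s E \<otimes>\<^bsub>FF\<^esub> t (D - E))"

lemma family_ring_simps:
  "carrier (family_ring X A) = A"
  "monoid.mult (family_ring X A) = fmul" "\<one>\<^bsub>family_ring X A\<^esub> = hmg 0 \<one>\<^bsub>FF\<^esub>"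
  "\<zero>\<^bsub>family_ring X A\<^esub> = fzero" "add (family_ring X A) = fadd"
  by (auto simp: family_ring_def fmul_def fadd_def fzero_def fun_eq_iff)

lemma supp_iff: "D \<in> supp s \<longleftrightarrow> s D \<noteq> \<zero>\<^bsub>FF\<^esub>"
  by (simp add: family_support_def)

text \<open>Sums run over supports, and supports change under addition and multiplication; this
  compares such sums on a common finite index set.\<close>

lemma finsum_superset:
  assumes "finite B" "A \<subseteq> B" "\<And>i. i \<in> B - A \<Longrightarrow> h i = \<zero>\<^bsub>FF\<^esub>" "\<And>i. i \<in> B \<Longrightarrow> h i \<in> carrier FF"
  shows "(\<Oplus>\<^bsub>FF\<^esub>i\<in>A. h i) = (\<Oplus>\<^bsub>FF\<^esub>i\<in>B. h i)"
  by (rule F.add.finprod_mono_neutral_cong_left) (use assms in auto)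

lemma finsum_single:
  assumes "finite B" "j \<in> B" "\<And>i. i \<in> B \<Longrightarrow> i \<noteq> j \<Longrightarrow> h i = \<zero>\<^bsub>FF\<^esub>" "h j \<in> carrier FF"
  shows "(\<Oplus>\<^bsub>FF\<^esub>i\<in>B. h i) = h j"
proof -
  have "(\<Oplus>\<^bsub>FF\<^esub>i\<in>{j}. h i) = (\<Oplus>\<^bsub>FF\<^esub>i\<in>B. h i)"
    by (rule finsum_superset) (use assms in \<open>auto, metis F.zero_closed\<close>)
  moreover have "(\<Oplus>\<^bsub>FF\<^esub>i\<in>{j}. h i) = h j \<oplus>\<^bsub>FF\<^esub> (\<Oplus>\<^bsub>FF\<^esub>i\<in>{}. h i)"
    by (rule F.finsum_insert) (use assms(4) in auto)
  ultimately show ?thesis using assms(4) by simp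
qed

end

locale cox_space = normal_space X for X :: "('x, 'k::{alg_closed_field, field_char_0}) fun_space" +
  fixes K :: "('x set \<Rightarrow>\<^sub>0 int) set" and \<chi> :: "('x set \<Rightarrow>\<^sub>0 int) \<Rightarrow> ('x, 'k) ratfun"
  assumes cox_data: "cox_data X K \<chi>"
begin

lemma K_closed:
  shows K_zero: "0 \<in> K" and K_add: "D \<in> K \<Longrightarrow> E \<in> K \<Longrightarrow> D + E \<in> K"
    and K_uminus: "D \<in> K \<Longrightarrow> - D \<in> K" and K_keys: "D \<in> K \<Longrightarrow> Poly_Mapping.keys D \<subseteq> prime_divisors X"
proof -
  have sg: "subgroup K (WDiv X)" using cox_data by (simp add: cox_data_def)
  interpret S: subgroup K "free_Abelian_group (prime_divisors X)" using sg by (simp add: WDiv_def)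
  show "0 \<in> K" using S.one_closed by simp
  show "D \<in> K \<Longrightarrow> E \<in> K \<Longrightarrow> D + E \<in> K" using S.m_closed[of D E] by simp
  show k: "D \<in> K \<Longrightarrow> Poly_Mapping.keys D \<subseteq> prime_divisors X" using S.mem_carrier[of D] by simp
  show "D \<in> K \<Longrightarrow> - D \<in> K" using S.m_inv_closed[of D] k by simp
qed

lemma K_diff: "D \<in> K \<Longrightarrow> E \<in> K \<Longrightarrow> D - E \<in> K"
  using K_add[of D "- E"] K_uminus by simp

lemma PDiv_closed:
  shows "0 \<in> PDiv X" "P \<in> PDiv X \<Longrightarrow> Q \<in> PDiv X \<Longrightarrow> P + Q \<in> PDiv X" "P \<in> PDiv X \<Longrightarrow> - P \<in> PDiv X"
proof -
  show "0 \<in> PDiv X"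
    unfolding PDiv_def by (rule image_eqI[of _ _ "\<one>\<^bsub>FF\<^esub>"]) (simp_all add: principal_div_one)
  show "P + Q \<in> PDiv X" if PQ: "P \<in> PDiv X" "Q \<in> PDiv X"
  proof -
    obtain f g where fg: "f \<in> carrier FF" "f \<noteq> \<zero>\<^bsub>FF\<^esub>" "P = principal_div X f"
      "g \<in> carrier FF" "g \<noteq> \<zero>\<^bsub>FF\<^esub>" "Q = principal_div X g" using PQ unfolding PDiv_def by blast
    have "P + Q = principal_div X (f \<otimes>\<^bsub>FF\<^esub> g)" using principal_div_mult fg by simp
    then show ?thesis
      unfolding PDiv_def
      by (rule image_eqI) (simp add: fg(1,4) F.field_mult_nonzero[OF fg(1,4,2,5)])
  qed
  show "- P \<in> PDiv X" if PP: "P \<in> PDiv X"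
  proof -
    obtain f where f: "f \<in> carrier FF" "f \<noteq> \<zero>\<^bsub>FF\<^esub>" "P = principal_div X f" using PP unfolding PDiv_def by blast
    show ?thesis
      unfolding PDiv_def using F.field_inv[OF f(1,2)] principal_div_inv[OF f(1,2)] f(3)
      by (intro image_eqI[of _ _ "inv\<^bsub>FF\<^esub> f"]) auto
  qed
qed

lemma div_class_eq: "div_class X D = {P + D | P. P \<in> PDiv X}"
  by (auto simp: div_class_def r_coset_def WDiv_def)

definition K0 :: "('x set \<Rightarrow>\<^sub>0 int) set" where "K0 = principal_part X K"

lemma K0_iff: "D \<in> K0 \<longleftrightarrow> D \<in> K \<and> D \<in> PDiv X"
proof -
  have "div_class X D = PDiv X \<longleftrightarrow> D \<in> PDiv X"
  proof
    assume "div_class X D = PDiv X"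
    moreover have "0 + D \<in> div_class X D" unfolding div_class_eq using PDiv_closed(1) by blast
    ultimately show "D \<in> PDiv X" by simp
  next
    assume D: "D \<in> PDiv X"
    show "div_class X D = PDiv X"
    proof (rule subset_antisym; rule subsetI)
      fix P assume "P \<in> div_class X D"
      then show "P \<in> PDiv X" unfolding div_class_eq using PDiv_closed(2) D by blast
    next
      fix P assume P: "P \<in> PDiv X"
      have "P + - D \<in> PDiv X" using PDiv_closed(2)[OF P PDiv_closed(3)[OF D]] .
      moreover have "P = (P + - D) + D" by simp
      ultimately show "P \<in> div_class X D" unfolding div_class_eq by blast
    qed
  qed
  then show ?thesis by (simp add: K0_def principal_part_def class_group_def)
qed

lemma K0_closed:
  shows K0_zero: "0 \<in> K0" and K0_add: "D \<in> K0 \<Longrightarrow> E \<in> K0 \<Longrightarrow> D + E \<in> K0"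
    and K0_uminus: "D \<in> K0 \<Longrightarrow> - D \<in> K0" and K0_K: "D \<in> K0 \<Longrightarrow> D \<in> K"
  using K_zero K_add K_uminus PDiv_closed by (auto simp: K0_iff)

lemma K0_diff: "D \<in> K0 \<Longrightarrow> E \<in> K0 \<Longrightarrow> D - E \<in> K0"
  using K0_add[of D "- E"] K0_uminus by simp

lemma chi_facts:
  shows chi_carrier: "E \<in> K0 \<Longrightarrow> \<chi> E \<in> carrier FF" and chi_nonzero: "E \<in> K0 \<Longrightarrow> \<chi> E \<noteq> \<zero>\<^bsub>FF\<^esub>"
    and chi_add: "D \<in> K0 \<Longrightarrow> E \<in> K0 \<Longrightarrow> \<chi> (D + E) = \<chi> D \<otimes>\<^bsub>FF\<^esub> \<chi> E"
    and chi_div: "E \<in> K0 \<Longrightarrow> principal_div X (\<chi> E) = E"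
proof -
  have h: "\<chi> \<in> hom ((WDiv X)\<lparr>carrier := K0\<rparr>) (units_of FF)" and d: "\<forall>E\<in>K0. principal_div X (\<chi> E) = E"
    using cox_data by (auto simp: cox_data_def K0_def)
  have "\<chi> E \<in> Units FF" if "E \<in> K0" for E
    using h that by (auto simp: hom_def units_of_carrier)
  then show "E \<in> K0 \<Longrightarrow> \<chi> E \<in> carrier FF" "E \<in> K0 \<Longrightarrow> \<chi> E \<noteq> \<zero>\<^bsub>FF\<^esub>"
    by (auto simp: F.field_Units)
  show "D \<in> K0 \<Longrightarrow> E \<in> K0 \<Longrightarrow> \<chi> (D + E) = \<chi> D \<otimes>\<^bsub>FF\<^esub> \<chi> E"
    using h by (auto simp: hom_def units_of_mult WDiv_def free_Abelian_group_def)
  show "E \<in> K0 \<Longrightarrow> principal_div X (\<chi> E) = E" using d by blast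
qed

lemma chi_zero: "\<chi> 0 = \<one>\<^bsub>FF\<^esub>"
proof -
  note c = chi_carrier[OF K0_zero]
  have "\<chi> 0 \<otimes>\<^bsub>FF\<^esub> \<chi> 0 = \<chi> 0 \<otimes>\<^bsub>FF\<^esub> \<one>\<^bsub>FF\<^esub>" using chi_add[OF K0_zero K0_zero] c by simp
  then show ?thesis using F.m_lcancel[OF chi_nonzero[OF K0_zero] c c] by simp
qed

text \<open>The divisor of \<open>\<chi> E\<close> is exactly E, so \<open>\<chi> E\<close> is a
  section of O(-E) without zeros, over any W.\<close>

lemma chi_div_sections: "E \<in> K0 \<Longrightarrow> \<chi> E \<in> div_sections X W (- E)"
  by (rule principal_in_div_sections) (simp_all add: chi_carrier chi_nonzero chi_div)

definition DA :: "'x set \<Rightarrow> ('x, 'k) div_family set" where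
  "DA W = {s. finite (supp s) \<and> supp s \<subseteq> K \<and> (\<forall>D\<in>K. s D \<in> div_sections X W D)}"

lemma div_algebra_eq: "div_algebra X K W = family_ring X (DA W)"
  by (simp add: div_algebra_def DA_def)

lemma DA_D:
  assumes "s \<in> DA W"
  shows "finite (supp s)" "supp s \<subseteq> K" "D \<in> K \<Longrightarrow> s D \<in> div_sections X W D" "s D \<in> carrier FF"
proof -
  show 1: "finite (supp s)" "supp s \<subseteq> K" "D \<in> K \<Longrightarrow> s D \<in> div_sections X W D"
    using assms by (auto simp: DA_def)
  show "s D \<in> carrier FF"
  proof (cases "D \<in> K")
    case True
    then show ?thesis using 1(3) div_sections_carrier by blast
  next
    case False
    then have "s D = \<zero>\<^bsub>FF\<^esub>" using 1(2) supp_iff by blast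
    then show ?thesis by simp
  qed
qed

lemma DA_mono: "W' \<subseteq> W \<Longrightarrow> DA W \<subseteq> DA W'"
  unfolding DA_def using div_sections_mono[of W' W] by blast

text \<open>No divisor meets the empty set, so \<open>DA {}\<close> consists of all finitely
  supported families of rational functions indexed by K. It is the common algebra for computations
  that do not involve regularity over W.\<close>

lemma DA_empty: "s \<in> DA W \<Longrightarrow> s \<in> DA {}"
  using DA_mono[of "{}" W] by blast

lemma DA_hmg: "D \<in> K \<Longrightarrow> f \<in> div_sections X W D \<Longrightarrow> hmg D f \<in> DA W"
proof -
  assume D: "D \<in> K" and f: "f \<in> div_sections X W D"
  have "supp (hmg D f) \<subseteq> {D}" by (auto simp: family_support_def homogeneous_def)
  moreover from this have "finite (supp (hmg D f))" by (rule finite_subset) simp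
  ultimately show ?thesis
    using D f div_sections_zero by (auto simp: DA_def homogeneous_def)
qed

lemma DA_fzero: "fzero \<in> DA W"
  using div_sections_zero by (auto simp: DA_def fzero_def family_support_def)

lemma supp_fadd: "supp (fadd s t) \<subseteq> supp s \<union> supp t"
proof
  fix D assume "D \<in> supp (fadd s t)"
  then have "s D \<oplus>\<^bsub>FF\<^esub> t D \<noteq> \<zero>\<^bsub>FF\<^esub>" by (simp add: supp_iff fadd_def)
  then have "s D \<noteq> \<zero>\<^bsub>FF\<^esub> \<or> t D \<noteq> \<zero>\<^bsub>FF\<^esub>" using F.l_zero[OF F.zero_closed] by metis
  then show "D \<in> supp s \<union> supp t" by (simp add: supp_iff)
qed

lemma DA_fadd:
  assumes "s \<in> DA W" "t \<in> DA W"
  shows "fadd s t \<in> DA W"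
proof -
  note sub = supp_fadd[of s t]
  then have "finite (supp (fadd s t))" using DA_D(1)[OF assms(1)] DA_D(1)[OF assms(2)] by (simp add: finite_subset)
  moreover have "supp (fadd s t) \<subseteq> K" using sub DA_D(2)[OF assms(1)] DA_D(2)[OF assms(2)] by blast
  moreover have "fadd s t D \<in> div_sections X W D" if "D \<in> K" for D
    unfolding fadd_def by (rule div_sections_add[OF DA_D(3)[OF assms(1) that] DA_D(3)[OF assms(2) that]])
  ultimately show ?thesis by (simp add: DA_def)
qed

lemma DA_fneg:
  assumes "s \<in> DA W"
  shows "fneg s \<in> DA W"
proof -
  have "supp (fneg s) \<subseteq> supp s"
  proof
    fix D assume "D \<in> supp (fneg s)"
    then show "D \<in> supp s" unfolding supp_iff fneg_def by (metis F.minus_zero)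
  qed
  moreover have "fneg s D \<in> div_sections X W D" if "D \<in> K" for D
    unfolding fneg_def by (rule div_sections_uminus[OF DA_D(3)[OF assms that]])
  ultimately show ?thesis using DA_D(1,2)[OF assms] by (auto simp: DA_def intro: finite_subset)
qed

text \<open>Peels off one homogeneous component at a time, so statements compatible with addition
  are to be checked on \<open>hmg D f\<close> only.\<close>

lemma DA_induct [consumes 1, case_names zero add]:
  assumes "s \<in> DA W" "P fzero"
    and step: "\<And>D f s. D \<in> K \<Longrightarrow> f \<in> div_sections X W D \<Longrightarrow> s \<in> DA W \<Longrightarrow> P s \<Longrightarrow> P (fadd (hmg D f) s)"
  shows "P s"
proof -
  have "\<forall>s. s \<in> DA W \<and> supp s = A \<longrightarrow> P s" if "finite A" for A
    using that
  proof (induction A rule: finite_induct)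
    case empty
    have "s = fzero" if "supp s = {}" for s using that by (auto simp: family_support_def fzero_def)
    then show ?case using assms(2) by blast
  next
    case (insert D A)
    show ?case
    proof (intro allI impI, elim conjE)
      fix s assume s: "s \<in> DA W" "supp s = insert D A"
      have D: "D \<in> K" using DA_D(2)[OF s(1)] s(2) by blast
      define s' where "s' = s(D := \<zero>\<^bsub>FF\<^esub>)"
      have "supp s' = A" using s(2) insert.hyps(2) by (auto simp: s'_def family_support_def)
      moreover have "s' \<in> DA W"
        using DA_D[OF s(1)] insert.hyps(1) s(2) div_sections_zero \<open>supp s' = A\<close>
        unfolding DA_def by (auto simp: s'_def)
      ultimately have "P (fadd (hmg D (s D)) s')"
        using insert.IH step[OF D DA_D(3)[OF s(1) D]] by blast
      moreover have "fadd (hmg D (s D)) s' = s"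
        using DA_D(4)[OF s(1)] by (auto simp: fadd_def homogeneous_def s'_def fun_eq_iff)
      ultimately show "P s" by simp
    qed
  qed
  then show ?thesis using assms(1) DA_D(1) by blast
qed

lemma fmul_superset:
  assumes "s \<in> DA {}" "t \<in> DA {}" "finite B" "supp s \<subseteq> B"
  shows "fmul s t D = (\<Oplus>\<^bsub>FF\<^esub>E\<in>B. s E \<otimes>\<^bsub>FF\<^esub> t (D - E))"
  unfolding fmul_def
proof (rule finsum_superset[OF assms(3,4)])
  fix E assume "E \<in> B - supp s"
  then have "s E = \<zero>\<^bsub>FF\<^esub>" using supp_iff by blast
  then show "s E \<otimes>\<^bsub>FF\<^esub> t (D - E) = \<zero>\<^bsub>FF\<^esub>" using DA_D(4)[OF assms(2)] by simp
qed (simp add: DA_D(4)[OF assms(1)] DA_D(4)[OF assms(2)])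

lemma fmul_hmg:
  assumes a: "a \<in> carrier FF" and G: "G \<in> K" and t: "t \<in> DA {}"
  shows "fmul (hmg G a) t = (\<lambda>D. a \<otimes>\<^bsub>FF\<^esub> t (D - G))"
proof
  fix D
  have h: "hmg G a \<in> DA {}" using DA_hmg[OF G, of a "{}"] a by (simp add: div_sections_def)
  have "fmul (hmg G a) t D = (\<Oplus>\<^bsub>FF\<^esub>E\<in>{G}. hmg G a E \<otimes>\<^bsub>FF\<^esub> t (D - E))"
    by (rule fmul_superset[OF h t]) (auto simp: family_support_def homogeneous_def)
  also have "\<dots> = hmg G a G \<otimes>\<^bsub>FF\<^esub> t (D - G)"
    by (rule finsum_single) (use a DA_D(4)[OF t] in \<open>auto simp: homogeneous_def\<close>)
  finally show "fmul (hmg G a) t D = a \<otimes>\<^bsub>FF\<^esub> t (D - G)" by (simp add: homogeneous_def)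
qed

lemma fmul_fzero: "t \<in> DA {} \<Longrightarrow> fmul fzero t = fzero"
  by (auto simp: fmul_def fzero_def family_support_def fun_eq_iff)

lemma fmul_fadd:
  assumes s: "s \<in> DA {}" and s': "s' \<in> DA {}" and t: "t \<in> DA {}"
  shows "fmul (fadd s s') t = fadd (fmul s t) (fmul s' t)"
proof
  fix D
  let ?B = "supp s \<union> supp s'"
  have B: "finite ?B" using DA_D(1)[OF s] DA_D(1)[OF s'] by simp
  note sub = supp_fadd[of s s']
  note c = DA_D(4)[OF s] DA_D(4)[OF s'] DA_D(4)[OF t]
  have "fmul (fadd s s') t D = (\<Oplus>\<^bsub>FF\<^esub>E\<in>?B. s E \<otimes>\<^bsub>FF\<^esub> t (D - E) \<oplus>\<^bsub>FF\<^esub> s' E \<otimes>\<^bsub>FF\<^esub> t (D - E))"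
    unfolding fmul_superset[OF DA_fadd[OF s s'] t B sub] by (simp add: fadd_def F.l_distr c)
  also have "\<dots> = (\<Oplus>\<^bsub>FF\<^esub>E\<in>?B. s E \<otimes>\<^bsub>FF\<^esub> t (D - E)) \<oplus>\<^bsub>FF\<^esub> (\<Oplus>\<^bsub>FF\<^esub>E\<in>?B. s' E \<otimes>\<^bsub>FF\<^esub> t (D - E))"
    by (rule F.finsum_addf) (auto simp: c)
  also have "\<dots> = fmul s t D \<oplus>\<^bsub>FF\<^esub> fmul s' t D"
    using fmul_superset[OF s t B] fmul_superset[OF s' t B] by simp
  finally show "fmul (fadd s s') t D = fadd (fmul s t) (fmul s' t) D" by (simp add: fadd_def)
qed

lemma supp_shift:
  assumes "a \<in> carrier FF"
  shows "supp (\<lambda>D. a \<otimes>\<^bsub>FF\<^esub> t (D - G)) \<subseteq> (\<lambda>E. E + G) ` supp t"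
proof
  fix D assume "D \<in> supp (\<lambda>D. a \<otimes>\<^bsub>FF\<^esub> t (D - G))"
  then have "a \<otimes>\<^bsub>FF\<^esub> t (D - G) \<noteq> \<zero>\<^bsub>FF\<^esub>" unfolding supp_iff .
  then have "t (D - G) \<noteq> \<zero>\<^bsub>FF\<^esub>" using F.r_null[OF assms] by metis
  then show "D \<in> (\<lambda>E. E + G) ` supp t" by (intro image_eqI[of _ _ "D - G"]) (simp_all add: supp_iff)
qed

lemma fmul_hmg_DA:
  assumes G: "G \<in> K" and a: "a \<in> div_sections X W G" and t: "t \<in> DA W"
  shows "(\<lambda>D. a \<otimes>\<^bsub>FF\<^esub> t (D - G)) \<in> DA W"
proof -
  have ac: "a \<in> carrier FF" using a div_sections_carrier by blast
  have "supp (\<lambda>D. a \<otimes>\<^bsub>FF\<^esub> t (D - G)) \<subseteq> (\<lambda>E. E + G) ` supp t" by (rule supp_shift[OF ac])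
  then have "finite (supp (\<lambda>D. a \<otimes>\<^bsub>FF\<^esub> t (D - G)))" "supp (\<lambda>D. a \<otimes>\<^bsub>FF\<^esub> t (D - G)) \<subseteq> K"
    using DA_D(1,2)[OF t] K_add[OF _ G] by (auto intro: finite_subset)
  moreover have "a \<otimes>\<^bsub>FF\<^esub> t (D - G) \<in> div_sections X W D" if "D \<in> K" for D
    using div_sections_mult[OF a DA_D(3)[OF t K_diff[OF that G]]] by simp
  ultimately show ?thesis by (simp add: DA_def)
qed

lemma DA_fmul:
  assumes "s \<in> DA W" "t \<in> DA W"
  shows "fmul s t \<in> DA W"
  using assms(1)
proof (induction rule: DA_induct)
  case zero
  show ?case using fmul_fzero[OF DA_empty[OF assms(2)]] DA_fzero by simp
next
  case (add D f s)
  have f: "f \<in> carrier FF" using add(2) div_sections_carrier by blast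
  have "fmul (fadd (hmg D f) s) t = fadd (fmul (hmg D f) t) (fmul s t)"
    by (rule fmul_fadd) (use add DA_hmg assms(2) DA_empty in blast)+
  then show ?case
    using add DA_fadd fmul_hmg[OF f add(1) DA_empty[OF assms(2)]] fmul_hmg_DA[OF add(1,2) assms(2)] by simp
qed

lemma hmg_DA_empty: "a \<in> carrier FF \<Longrightarrow> G \<in> K \<Longrightarrow> hmg G a \<in> DA {}"
  using DA_hmg[of G a "{}"] by (simp add: div_sections_def)

lemma fadd_assoc: "s \<in> DA {} \<Longrightarrow> t \<in> DA {} \<Longrightarrow> u \<in> DA {} \<Longrightarrow> fadd (fadd s t) u = fadd s (fadd t u)"
  by (auto simp: fadd_def fun_eq_iff DA_D(4) F.a_assoc)

lemma fadd_comm: "s \<in> DA {} \<Longrightarrow> t \<in> DA {} \<Longrightarrow> fadd s t = fadd t s"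
  by (auto simp: fadd_def fun_eq_iff DA_D(4) F.a_comm)

lemma fmul_assoc_hmg:
  assumes a: "a \<in> carrier FF" and G: "G \<in> K" and t: "t \<in> DA {}" and u: "u \<in> DA {}"
  shows "fmul (fmul (hmg G a) t) u = fmul (hmg G a) (fmul t u)"
proof
  fix D
  note h = hmg_DA_empty[OF a G]
  have ht: "fmul (hmg G a) t \<in> DA {}" by (rule DA_fmul[OF h t])
  let ?B = "(\<lambda>E. E + G) ` supp t"
  have "supp (fmul (hmg G a) t) \<subseteq> ?B" unfolding fmul_hmg[OF a G t] by (rule supp_shift[OF a])
  then have "fmul (fmul (hmg G a) t) u D = (\<Oplus>\<^bsub>FF\<^esub>E\<in>?B. fmul (hmg G a) t E \<otimes>\<^bsub>FF\<^esub> u (D - E))"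
    using DA_D(1)[OF t] by (intro fmul_superset[OF ht u]) auto
  also have "\<dots> = (\<Oplus>\<^bsub>FF\<^esub>E\<in>supp t. fmul (hmg G a) t (E + G) \<otimes>\<^bsub>FF\<^esub> u (D - (E + G)))"
    by (rule F.finsum_reindex) (auto simp: DA_D(4)[OF ht] DA_D(4)[OF u] inj_on_def)
  also have "\<dots> = (\<Oplus>\<^bsub>FF\<^esub>E\<in>supp t. a \<otimes>\<^bsub>FF\<^esub> (t E \<otimes>\<^bsub>FF\<^esub> u (D - G - E)))"
    by (intro F.finsum_cong' refl)
      (auto simp: fmul_hmg[OF a G t] DA_D(4)[OF t] DA_D(4)[OF u] a F.m_assoc algebra_simps)
  also have "\<dots> = a \<otimes>\<^bsub>FF\<^esub> (\<Oplus>\<^bsub>FF\<^esub>E\<in>supp t. t E \<otimes>\<^bsub>FF\<^esub> u (D - G - E))"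
    using DA_D(1)[OF t] a DA_D(4)[OF t] DA_D(4)[OF u] by (intro F.finsum_rdistr[symmetric]) auto
  also have "\<dots> = fmul (hmg G a) (fmul t u) D"
    unfolding fmul_hmg[OF a G DA_fmul[OF t u]] by (simp add: fmul_def)
  finally show "fmul (fmul (hmg G a) t) u D = fmul (hmg G a) (fmul t u) D" .
qed

lemma fmul_assoc:
  assumes "s \<in> DA {}" "t \<in> DA {}" "u \<in> DA {}"
  shows "fmul (fmul s t) u = fmul s (fmul t u)"
  using assms(1)
proof (induction rule: DA_induct)
  case zero
  show ?case using fmul_fzero assms DA_fmul by simp
next
  case (add D f s)
  have f: "f \<in> carrier FF" using add(2) div_sections_carrier by blast
  have h: "hmg D f \<in> DA {}" by (rule DA_hmg[OF add(1,2)])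
  show ?case
    using add assms h fmul_assoc_hmg[OF f add(1) assms(2,3)] by (simp add: fmul_fadd DA_fmul)
qed

lemma fmul_comm_hmg:
  assumes a: "a \<in> carrier FF" and G: "G \<in> K" and t: "t \<in> DA {}"
  shows "fmul t (hmg G a) = fmul (hmg G a) t"
proof
  fix D
  let ?B = "insert (D - G) (supp t)"
  have "fmul t (hmg G a) D = (\<Oplus>\<^bsub>FF\<^esub>E\<in>?B. t E \<otimes>\<^bsub>FF\<^esub> hmg G a (D - E))"
    using DA_D(1)[OF t] by (intro fmul_superset[OF t hmg_DA_empty[OF a G]]) auto
  also have "\<dots> = t (D - G) \<otimes>\<^bsub>FF\<^esub> hmg G a (D - (D - G))"
    using DA_D(1)[OF t] DA_D(4)[OF t] a by (intro finsum_single) (auto simp: homogeneous_def)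
  also have "\<dots> = fmul (hmg G a) t D"
    unfolding fmul_hmg[OF a G t] using DA_D(4)[OF t] a by (simp add: homogeneous_def F.m_comm)
  finally show "fmul t (hmg G a) D = fmul (hmg G a) t D" .
qed

lemma fmul_fadd_right:
  assumes s: "s \<in> DA {}" and t: "t \<in> DA {}" and u: "u \<in> DA {}"
  shows "fmul s (fadd t u) = fadd (fmul s t) (fmul s u)"
proof
  fix D
  note c = DA_D(4)[OF s] DA_D(4)[OF t] DA_D(4)[OF u]
  have "fmul s (fadd t u) D = (\<Oplus>\<^bsub>FF\<^esub>E\<in>supp s. s E \<otimes>\<^bsub>FF\<^esub> t (D - E) \<oplus>\<^bsub>FF\<^esub> s E \<otimes>\<^bsub>FF\<^esub> u (D - E))"
    by (simp add: fmul_def fadd_def F.r_distr c)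
  also have "\<dots> = fmul s t D \<oplus>\<^bsub>FF\<^esub> fmul s u D"
    unfolding fmul_def by (rule F.finsum_addf) (auto simp: c)
  finally show "fmul s (fadd t u) D = fadd (fmul s t) (fmul s u) D" by (simp add: fadd_def)
qed

lemma fmul_comm:
  assumes "s \<in> DA {}" "t \<in> DA {}"
  shows "fmul s t = fmul t s"
  using assms(1)
proof (induction rule: DA_induct)
  case zero
  have "fmul t fzero = fzero"
    using DA_D(4)[OF assms(2)] by (simp add: fmul_def fzero_def fun_eq_iff F.add.finprod_one_eqI)
  then show ?case using fmul_fzero assms by simp
next
  case (add D f s)
  have f: "f \<in> carrier FF" using add(2) div_sections_carrier by blast
  show ?case
    using add assms fmul_comm_hmg[OF f add(1) assms(2)]
    by (simp add: fmul_fadd fmul_fadd_right hmg_DA_empty[OF f])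
qed

lemma one_DA: "hmg 0 \<one>\<^bsub>FF\<^esub> \<in> DA W"
  using div_sections_const[of 1] by (intro DA_hmg K_zero) (simp add: function_field_one)

text \<open>The ring laws hold in \<open>DA {}\<close>, so for the sections over W and for the stalk
  at a point only closure under the operations is left.\<close>

lemma cring_family_ring:
  assumes "A \<subseteq> DA {}" "fzero \<in> A" "hmg 0 \<one>\<^bsub>FF\<^esub> \<in> A"
    "\<And>s t. s \<in> A \<Longrightarrow> t \<in> A \<Longrightarrow> fadd s t \<in> A" "\<And>s t. s \<in> A \<Longrightarrow> t \<in> A \<Longrightarrow> fmul s t \<in> A"
    "\<And>s. s \<in> A \<Longrightarrow> fneg s \<in> A"
  shows "cring (family_ring X A)"
proof -
  have sub: "s \<in> DA {}" if "s \<in> A" for s using assms(1) that by blast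
  have z: "fadd fzero s = s" if "s \<in> A" for s
    using DA_D(4)[OF sub[OF that]] by (simp add: fadd_def fzero_def)
  have n: "fadd (fneg s) s = fzero" if "s \<in> A" for s
    using DA_D(4)[OF sub[OF that]] by (simp add: fadd_def fzero_def fneg_def F.l_neg)
  have o: "fmul (hmg 0 \<one>\<^bsub>FF\<^esub>) s = s" if "s \<in> A" for s
    using fmul_hmg[OF F.one_closed K_zero sub[OF that]] DA_D(4)[OF sub[OF that]] by simp
  have "abelian_group (family_ring X A)"
  proof (rule abelian_groupI, unfold family_ring_simps)
    show "\<exists>t\<in>A. fadd t s = fzero" if "s \<in> A" for s using assms(6)[OF that] n[OF that] by metis
    show "fadd (fadd s t) u = fadd s (fadd t u)" if "s \<in> A" "t \<in> A" "u \<in> A" for s t u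
      by (rule fadd_assoc[OF that[THEN sub]])
    show "fadd s t = fadd t s" if "s \<in> A" "t \<in> A" for s t
      by (rule fadd_comm[OF that[THEN sub]])
  qed (simp_all add: assms(2,4) z)
  moreover have "comm_monoid (family_ring X A)"
    by (rule comm_monoidI, unfold family_ring_simps) 
      (simp_all add: assms(3,5) o fmul_assoc[OF sub sub sub], rule fmul_comm[OF sub sub])
  ultimately show ?thesis
    by (rule cringI, unfold family_ring_simps) (simp add: sub fmul_fadd)
qed

lemma cring_div_algebra: "cring (div_algebra X K W)"
  unfolding div_algebra_eq
  by (rule cring_family_ring) (use DA_empty DA_fzero one_DA DA_fadd DA_fmul DA_fneg in auto)

definition DS :: "'x \<Rightarrow> ('x, 'k) div_family set" where
  "DS x = (\<Union>W\<in>{W. op W \<and> x \<in> W}. DA W)"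

lemma div_stalk_eq: "div_stalk X K x = family_ring X (DS x)"
  by (simp add: div_stalk_def DS_def div_algebra_eq family_ring_simps)

lemma DS_I: "op W \<Longrightarrow> x \<in> W \<Longrightarrow> s \<in> DA W \<Longrightarrow> s \<in> DS x"
  by (auto simp: DS_def)

lemma DS_empty: "s \<in> DS x \<Longrightarrow> s \<in> DA {}"
  using DA_empty by (auto simp: DS_def)

lemma DS_common:
  assumes "s \<in> DS x" "t \<in> DS x"
  obtains W where "op W" "x \<in> W" "s \<in> DA W" "t \<in> DA W"
proof -
  obtain U V where "op U" "x \<in> U" "s \<in> DA U" "op V" "x \<in> V" "t \<in> DA V" using assms by (auto simp: DS_def)
  then show thesis
    using that[of "U \<inter> V"] DA_mono[of "U \<inter> V" U] DA_mono[of "U \<inter> V" V] by auto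
qed

lemma cring_div_stalk:
  assumes "x \<in> topspace (pts X)"
  shows "cring (div_stalk X K x)"
  unfolding div_stalk_eq
proof (rule cring_family_ring)
  show "DS x \<subseteq> DA {}" using DS_empty by blast
  show "fzero \<in> DS x" "hmg 0 \<one>\<^bsub>FF\<^esub> \<in> DS x"
    using assms DA_fzero one_DA by (auto intro: DS_I[of "topspace (pts X)"])
  show "fadd s t \<in> DS x" "fmul s t \<in> DS x" if "s \<in> DS x" "t \<in> DS x" for s t
    using DS_common[OF that] DA_fadd DA_fmul DS_I by metis+
  show "fneg s \<in> DS x" if "s \<in> DS x" for s
    using that DA_fneg by (auto simp: DS_def)
qed

text \<open>The \<open>D\<close>-component of a family modulo the relations \<open>\<chi> E = 1\<close>.\<close>

definition component :: "('x set \<Rightarrow>\<^sub>0 int) \<Rightarrow> ('x, 'k) div_family \<Rightarrow> ('x, 'k) ratfun" where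
  "component D s = (\<Oplus>\<^bsub>FF\<^esub>G\<in>supp s. if G - D \<in> K0 then s G \<otimes>\<^bsub>FF\<^esub> \<chi> (G - D) else \<zero>\<^bsub>FF\<^esub>)"

lemma comp_superset:
  assumes s: "s \<in> DA {}" and "finite B" "supp s \<subseteq> B"
  shows "component D s = (\<Oplus>\<^bsub>FF\<^esub>G\<in>B. if G - D \<in> K0 then s G \<otimes>\<^bsub>FF\<^esub> \<chi> (G - D) else \<zero>\<^bsub>FF\<^esub>)"
  unfolding component_def
proof (rule finsum_superset[OF assms(2,3)])
  fix G assume "G \<in> B - supp s"
  then have "s G = \<zero>\<^bsub>FF\<^esub>" using supp_iff by blast
  then show "(if G - D \<in> K0 then s G \<otimes>\<^bsub>FF\<^esub> \<chi> (G - D) else \<zero>\<^bsub>FF\<^esub>) = \<zero>\<^bsub>FF\<^esub>"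
    using chi_carrier by simp
qed (simp add: DA_D(4)[OF s] chi_carrier)

lemma comp_carrier: "s \<in> DA {} \<Longrightarrow> component D s \<in> carrier FF"
  unfolding component_def by (intro F.finsum_closed) (auto simp: DA_D(4) chi_carrier)

lemma comp_hmg:
  assumes "a \<in> carrier FF" "G \<in> K"
  shows "component D (hmg G a) = (if G - D \<in> K0 then a \<otimes>\<^bsub>FF\<^esub> \<chi> (G - D) else \<zero>\<^bsub>FF\<^esub>)"
proof -
  let ?h = "\<lambda>H. if H - D \<in> K0 then hmg G a H \<otimes>\<^bsub>FF\<^esub> \<chi> (H - D) else \<zero>\<^bsub>FF\<^esub>"
  have "component D (hmg G a) = (\<Oplus>\<^bsub>FF\<^esub>H\<in>{G}. ?h H)"
    by (rule comp_superset[OF hmg_DA_empty[OF assms]]) (auto simp: family_support_def homogeneous_def)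
  also have "\<dots> = ?h G"
    by (rule finsum_single) (use assms chi_carrier in \<open>auto simp: homogeneous_def\<close>)
  finally show ?thesis by (simp add: homogeneous_def)
qed

lemma comp_fzero: "component D fzero = \<zero>\<^bsub>FF\<^esub>"
  by (simp add: component_def fzero_def family_support_def)

lemma comp_fadd:
  assumes s: "s \<in> DA {}" and t: "t \<in> DA {}"
  shows "component D (fadd s t) = component D s \<oplus>\<^bsub>FF\<^esub> component D t"
proof -
  let ?B = "supp s \<union> supp t"
  have B: "finite ?B" using DA_D(1)[OF s] DA_D(1)[OF t] by simp
  note sub = supp_fadd[of s t]
  let ?h = "\<lambda>s G. if G - D \<in> K0 then s G \<otimes>\<^bsub>FF\<^esub> \<chi> (G - D) else \<zero>\<^bsub>FF\<^esub>"
  note c = DA_D(4)[OF s] DA_D(4)[OF t] chi_carrier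
  have "component D (fadd s t) = (\<Oplus>\<^bsub>FF\<^esub>G\<in>?B. ?h (fadd s t) G)"
    by (rule comp_superset[OF DA_fadd[OF s t] B sub])
  also have "\<dots> = (\<Oplus>\<^bsub>FF\<^esub>G\<in>?B. ?h s G \<oplus>\<^bsub>FF\<^esub> ?h t G)"
    by (intro F.finsum_cong' refl) (auto simp: c fadd_def F.l_distr)
  also have "\<dots> = (\<Oplus>\<^bsub>FF\<^esub>G\<in>?B. ?h s G) \<oplus>\<^bsub>FF\<^esub> (\<Oplus>\<^bsub>FF\<^esub>G\<in>?B. ?h t G)"
    by (rule F.finsum_addf) (auto simp: c)
  also have "\<dots> = component D s \<oplus>\<^bsub>FF\<^esub> component D t"
    using comp_superset[OF s B] comp_superset[OF t B] by simp
  finally show ?thesis .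
qed

lemma comp_hmg_fmul:
  assumes a: "a \<in> carrier FF" and G: "G \<in> K" and t: "t \<in> DA {}"
  shows "component D (fmul (hmg G a) t) = a \<otimes>\<^bsub>FF\<^esub> component (D - G) t"
proof -
  let ?u = "fmul (hmg G a) t"
  have u: "?u \<in> DA {}" by (rule DA_fmul[OF hmg_DA_empty[OF a G] t])
  let ?B = "(\<lambda>E. E + G) ` supp t"
  let ?h = "\<lambda>G. if G - D \<in> K0 then ?u G \<otimes>\<^bsub>FF\<^esub> \<chi> (G - D) else \<zero>\<^bsub>FF\<^esub>"
  let ?g = "\<lambda>H. if H - (D - G) \<in> K0 then t H \<otimes>\<^bsub>FF\<^esub> \<chi> (H - (D - G)) else \<zero>\<^bsub>FF\<^esub>"
  note c = DA_D(4)[OF t] DA_D(4)[OF u] chi_carrier a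
  have "supp ?u \<subseteq> ?B" unfolding fmul_hmg[OF a G t] by (rule supp_shift[OF a])
  then have "component D ?u = (\<Oplus>\<^bsub>FF\<^esub>E\<in>?B. ?h E)"
    using DA_D(1)[OF t] by (intro comp_superset[OF u]) auto
  also have "\<dots> = (\<Oplus>\<^bsub>FF\<^esub>H\<in>supp t. ?h (H + G))"
    by (rule F.finsum_reindex) (auto simp: c inj_on_def)
  also have "\<dots> = (\<Oplus>\<^bsub>FF\<^esub>H\<in>supp t. a \<otimes>\<^bsub>FF\<^esub> ?g H)"
  proof (intro F.finsum_cong' refl)
    fix H assume "H \<in> supp t"
    have eq: "H + G - D = H - (D - G)" by simp
    show "?h (H + G) = a \<otimes>\<^bsub>FF\<^esub> ?g H"
      unfolding eq using c by (simp add: fmul_hmg[OF a G t] F.m_assoc)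
  qed (use c in auto)
  also have "\<dots> = a \<otimes>\<^bsub>FF\<^esub> (\<Oplus>\<^bsub>FF\<^esub>H\<in>supp t. ?g H)"
    using DA_D(1)[OF t] c by (intro F.finsum_rdistr[symmetric]) auto
  finally show ?thesis by (simp add: component_def)
qed

text \<open>D and D + E represent the same class, and by multiplicativity of \<open>\<chi>\<close>
  the two ways of moving a part of s into these degrees differ by the factor
  \<open>\<chi> E\<close>.\<close>

lemma comp_shift:
  assumes s: "s \<in> DA {}" and E: "E \<in> K0"
  shows "component D s = component (D + E) s \<otimes>\<^bsub>FF\<^esub> \<chi> E"
  using s
proof (induction rule: DA_induct)
  case zero
  show ?case using chi_carrier[OF E] by (simp add: comp_fzero)
next
  case (add G f s)
  have f: "f \<in> carrier FF" using add(2) div_sections_carrier by blast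
  note h = hmg_DA_empty[OF f add(1)]
  have m: "G - D \<in> K0 \<longleftrightarrow> G - (D + E) \<in> K0"
    using K0_diff[OF _ E, of "G - D"] K0_add[OF _ E, of "G - (D + E)"] by (auto simp: diff_diff_eq)
  have "\<chi> (G - D) = \<chi> (G - (D + E)) \<otimes>\<^bsub>FF\<^esub> \<chi> E" if "G - (D + E) \<in> K0"
    using chi_add[OF that E] by simp
  then have "component D (hmg G f) = component (D + E) (hmg G f) \<otimes>\<^bsub>FF\<^esub> \<chi> E"
    unfolding comp_hmg[OF f add(1)] m using f chi_carrier E by (simp add: F.m_assoc)
  then show ?case
    using comp_fadd[OF h add(3)] add(4) comp_carrier[OF h] comp_carrier[OF add(3)] chi_carrier[OF E]
    by (simp add: F.l_distr)
qed

text \<open>Moving a part from degree G to degree D multiplies it by \<open>\<chi> (G - D)\<close>,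
  a section of O(D - G), so the product is a section of O(D) over the same W.\<close>

lemma comp_div_sections:
  assumes s: "s \<in> DA W" and D: "D \<in> K"
  shows "component D s \<in> div_sections X W D"
  using s
proof (induction rule: DA_induct)
  case zero
  show ?case by (simp add: comp_fzero div_sections_zero)
next
  case (add G f s)
  have f: "f \<in> carrier FF" using add(2) div_sections_carrier by blast
  have "component D (hmg G f) \<in> div_sections X W D"
  proof (cases "G - D \<in> K0")
    case True
    have "f \<otimes>\<^bsub>FF\<^esub> \<chi> (G - D) \<in> div_sections X W (G + - (G - D))"
      by (rule div_sections_mult[OF add(2) chi_div_sections[OF True]])
    then show ?thesis using True by (simp add: comp_hmg[OF f add(1)])
  qed (simp add: comp_hmg[OF f add(1)] div_sections_zero)
  then show ?case
    using comp_fadd[OF hmg_DA_empty[OF f add(1)] DA_empty[OF add(3)]] add(4) div_sections_add by simp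
qed

end

section \<open>The quotient by the relations, its stalks and its global sections\<close>

section \<open>The Cox sheaf\<close>

context cox_space begin

lemma family_ring_uminus:
  assumes cr: "cring (family_ring X A)" and A: "A \<subseteq> DA {}" and s: "s \<in> A" "fneg s \<in> A"
  shows "\<ominus>\<^bsub>family_ring X A\<^esub> s = fneg s"
proof -
  interpret cring "family_ring X A" by (rule cr)
  have sD: "s \<in> DA {}" using A s(1) by blast
  have "fadd (fneg s) s = fzero"
    using DA_D(4)[OF sD] by (simp add: fadd_def fneg_def fzero_def F.l_neg)
  then show ?thesis
    using s by (intro minus_equality) (simp_all add: family_ring_simps)
qed

lemma ideal_family_ring:
  assumes cr: "cring (family_ring X A)" and A: "A \<subseteq> DA {}" and neg: "\<And>s. s \<in> A \<Longrightarrow> fneg s \<in> A"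
    and I: "I \<subseteq> A" "fzero \<in> I" "\<And>s t. s \<in> I \<Longrightarrow> t \<in> I \<Longrightarrow> fadd s t \<in> I" "\<And>s. s \<in> I \<Longrightarrow> fneg s \<in> I"
    "\<And>s t. s \<in> I \<Longrightarrow> t \<in> A \<Longrightarrow> fmul t s \<in> I"
  shows "ideal I (family_ring X A)"
proof (rule idealI)
  interpret cring "family_ring X A" by (rule cr)
  show "ring (family_ring X A)" by (rule ring_axioms)
  show "subgroup I (add_monoid (family_ring X A))"
  proof (rule subgroup.intro)
    show "inv\<^bsub>add_monoid (family_ring X A)\<^esub> s \<in> I" if "s \<in> I" for s
      using family_ring_uminus[OF cr A, of s] neg[of s] I(1,4) that unfolding a_inv_def by auto
  qed (use I in \<open>auto simp: family_ring_simps\<close>)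
  show l: "t \<otimes>\<^bsub>family_ring X A\<^esub> s \<in> I" if "s \<in> I" "t \<in> carrier (family_ring X A)" for s t
    using I(5) that by (simp add: family_ring_simps)
  show "s \<otimes>\<^bsub>family_ring X A\<^esub> t \<in> I" if "s \<in> I" "t \<in> carrier (family_ring X A)" for s t
    using l[OF that] m_comm[OF _ that(2), of s] I(1) that(1) by (auto simp: family_ring_simps)
qed

text \<open>The differences 1 - \<chi>(E) as explicit families. They are sections over every open
  set, so one set of generators serves all of them.\<close>

definition rels :: "('x, 'k) div_family set" where
  "rels = {fadd (hmg 0 \<one>\<^bsub>FF\<^esub>) (fneg (hmg (- E) (\<chi> E))) | E. E \<in> K0}"

lemma chi_hmg_DA: "E \<in> K0 \<Longrightarrow> hmg (- E) (\<chi> E) \<in> DA W"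
  by (rule DA_hmg[OF K_uminus[OF K0_K] chi_div_sections])

lemma rels_DA: "rels \<subseteq> DA W"
  using DA_fadd[OF one_DA DA_fneg[OF chi_hmg_DA]] by (auto simp: rels_def)

lemma DA_sub_empty: "DA W \<subseteq> DA {}"
  using DA_empty by blast

lemma cox_relations_eq: "cox_relations X K \<chi> W = rels"
proof -
  have "\<one>\<^bsub>div_algebra X K W\<^esub> \<ominus>\<^bsub>div_algebra X K W\<^esub> hmg (- E) (\<chi> E) =
      fadd (hmg 0 \<one>\<^bsub>FF\<^esub>) (fneg (hmg (- E) (\<chi> E)))" if "E \<in> K0" for E
    using family_ring_uminus[OF cring_div_algebra[unfolded div_algebra_eq] DA_sub_empty
        chi_hmg_DA[OF that] DA_fneg[OF chi_hmg_DA[OF that]], of W]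
    by (simp add: div_algebra_eq a_minus_def family_ring_simps)
  then show ?thesis unfolding cox_relations_def rels_def K0_def by (intro Collect_cong) metis
qed

lemma comp_fneg:
  assumes "s \<in> DA {}"
  shows "component D (fneg s) = \<ominus>\<^bsub>FF\<^esub> component D s"
proof -
  have "fadd (fneg s) s = fzero"
    using DA_D(4)[OF assms] by (simp add: fadd_def fneg_def fzero_def F.l_neg)
  then have "component D (fneg s) \<oplus>\<^bsub>FF\<^esub> component D s = \<zero>\<^bsub>FF\<^esub>"
    using comp_fadd[OF DA_fneg[OF assms] assms, of D] comp_fzero by simp
  then show ?thesis
    using F.minus_equality[of "component D (fneg s)" "component D s"] comp_carrier assms DA_fneg[OF assms] by simp
qed

lemma comp_rels:
  assumes "r \<in> rels"
  shows "component D r = \<zero>\<^bsub>FF\<^esub>"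
proof -
  obtain E where E: "E \<in> K0" "r = fadd (hmg 0 \<one>\<^bsub>FF\<^esub>) (fneg (hmg (- E) (\<chi> E)))" using assms by (auto simp: rels_def)
  have m: "- E - D \<in> K0 \<longleftrightarrow> 0 - D \<in> K0"
  proof -
    have "- E - D + E = 0 - D" "0 - D - E = - E - D" by simp_all
    then show ?thesis using K0_add[OF _ E(1), of "- E - D"] K0_diff[OF _ E(1), of "0 - D"] by metis
  qed
  have "\<chi> (0 - D) = \<chi> E \<otimes>\<^bsub>FF\<^esub> \<chi> (- E - D)" if "- E - D \<in> K0"
    using chi_add[OF E(1) that] by simp
  then have "component D (hmg 0 \<one>\<^bsub>FF\<^esub>) = component D (hmg (- E) (\<chi> E))"
    unfolding comp_hmg[OF F.one_closed K_zero] comp_hmg[OF chi_carrier[OF E(1)] K_uminus[OF K0_K[OF E(1)]]]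
    using m chi_carrier[OF E(1)] chi_carrier[of "- E - D"] by (cases "0 - D \<in> K0") simp_all
  then have "component D r = component D (hmg (- E) (\<chi> E)) \<oplus>\<^bsub>FF\<^esub> \<ominus>\<^bsub>FF\<^esub> component D (hmg (- E) (\<chi> E))"
    unfolding E(2) comp_fadd[OF one_DA DA_fneg[OF chi_hmg_DA[OF E(1)]]] comp_fneg[OF chi_hmg_DA[OF E(1)]] by simp
  then show ?thesis using F.r_neg[OF comp_carrier[OF chi_hmg_DA[OF E(1)]]] by simp
qed

abbreviation relideal :: "'x set \<Rightarrow> ('x, 'k) div_family set" where
  "relideal V \<equiv> Idl\<^bsub>div_algebra X K V\<^esub> rels"

lemma relideal_ideal: "ideal (relideal V) (div_algebra X K V)"
proof -
  interpret cring "div_algebra X K V" by (rule cring_div_algebra)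
  show ?thesis
    by (rule genideal_ideal) (simp add: div_algebra_eq family_ring_simps rels_DA)
qed

lemma relideal_minimal:
  assumes "ideal I (div_algebra X K V)" "rels \<subseteq> I"
  shows "relideal V \<subseteq> I"
proof -
  interpret cring "div_algebra X K V" by (rule cring_div_algebra)
  show ?thesis by (rule genideal_minimal[OF assms])
qed

lemma relideal_closed:
  shows relideal_DA: "s \<in> relideal V \<Longrightarrow> s \<in> DA V"
    and relideal_zero: "fzero \<in> relideal V"
    and relideal_add: "s \<in> relideal V \<Longrightarrow> t \<in> relideal V \<Longrightarrow> fadd s t \<in> relideal V"
    and relideal_neg: "s \<in> relideal V \<Longrightarrow> fneg s \<in> relideal V"
    and relideal_mult: "s \<in> relideal V \<Longrightarrow> t \<in> DA V \<Longrightarrow> fmul t s \<in> relideal V"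
    and relideal_rels: "rels \<subseteq> relideal V"
proof -
  interpret cring "div_algebra X K V" by (rule cring_div_algebra)
  interpret I: ideal "relideal V" "div_algebra X K V" by (rule relideal_ideal)
  show d: "s \<in> relideal V \<Longrightarrow> s \<in> DA V" for s
    using I.Icarr[of s] by (simp add: div_algebra_eq family_ring_simps)
  show "fzero \<in> relideal V" using I.zero_closed by (simp add: div_algebra_eq family_ring_simps)
  show "s \<in> relideal V \<Longrightarrow> t \<in> relideal V \<Longrightarrow> fadd s t \<in> relideal V"
    using I.a_closed[of s t] by (simp add: div_algebra_eq family_ring_simps)
  show "s \<in> relideal V \<Longrightarrow> fneg s \<in> relideal V"
    using I.a_inv_closed[of s]
      family_ring_uminus[OF cring_div_algebra[unfolded div_algebra_eq] DA_sub_empty d DA_fneg[OF d], of s]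
    by (simp add: div_algebra_eq)
  show "s \<in> relideal V \<Longrightarrow> t \<in> DA V \<Longrightarrow> fmul t s \<in> relideal V"
    using I.I_l_closed[of s t] by (simp add: div_algebra_eq family_ring_simps)
  show "rels \<subseteq> relideal V"
    by (rule genideal_self) (simp add: div_algebra_eq family_ring_simps rels_DA)
qed

lemma relideal_mono:
  assumes "V' \<subseteq> V"
  shows "relideal V \<subseteq> relideal V'"
proof -
  let ?I = "{s\<in>DA V. s \<in> relideal V'}"
  have sub: "s \<in> DA V \<Longrightarrow> s \<in> DA V'" for s using DA_mono[OF assms] by blast
  have "ideal ?I (div_algebra X K V)"
    unfolding div_algebra_eq[of V]
    by (rule ideal_family_ring[OF cring_div_algebra[unfolded div_algebra_eq] DA_sub_empty DA_fneg])
      (use sub relideal_closed DA_fzero DA_fadd DA_fneg DA_fmul in auto)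
  then have "relideal V \<subseteq> ?I" by (rule relideal_minimal) (use rels_DA relideal_rels in blast)
  then show ?thesis by blast
qed

lemma comp_fmul_zero:
  assumes t: "t \<in> DA {}" and s: "s \<in> DA {}" "\<And>D. D \<in> K \<Longrightarrow> component D s = \<zero>\<^bsub>FF\<^esub>" and D: "D \<in> K"
  shows "component D (fmul t s) = \<zero>\<^bsub>FF\<^esub>"
  using t
proof (induction rule: DA_induct)
  case zero
  show ?case using fmul_fzero[OF s(1)] comp_fzero by simp
next
  case (add G f u)
  have f: "f \<in> carrier FF" using add(2) div_sections_carrier by blast
  note h = hmg_DA_empty[OF f add(1)]
  have "component D (fmul (hmg G f) s) = \<zero>\<^bsub>FF\<^esub>"
    using comp_hmg_fmul[OF f add(1) s(1)] s(2)[OF K_diff[OF D add(1)]] f by simp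
  then show ?case
    using add(4) fmul_fadd[OF h add(3) s(1)] comp_fadd[OF DA_fmul[OF h s(1)] DA_fmul[OF add(3) s(1)], of D] by simp
qed

text \<open>The families with all components zero form an ideal, and it contains the relations.
  Components are therefore well defined on the quotient.\<close>

lemma comp_relideal:
  assumes "s \<in> relideal V" "D \<in> K"
  shows "component D s = \<zero>\<^bsub>FF\<^esub>"
proof -
  let ?I = "{s\<in>DA V. \<forall>D\<in>K. component D s = \<zero>\<^bsub>FF\<^esub>}"
  have sub: "s \<in> DA V \<Longrightarrow> s \<in> DA {}" for s by (rule DA_empty)
  have "ideal ?I (div_algebra X K V)"
    unfolding div_algebra_eq[of V]
  proof (rule ideal_family_ring[OF cring_div_algebra[unfolded div_algebra_eq] DA_sub_empty DA_fneg])
    show "fadd s t \<in> ?I" if "s \<in> ?I" "t \<in> ?I" for s t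
      using that DA_fadd comp_fadd[OF sub sub] by simp
    show "fneg s \<in> ?I" if "s \<in> ?I" for s
      using that DA_fneg comp_fneg[OF sub] by simp
    show "fmul t s \<in> ?I" if "s \<in> ?I" "t \<in> DA V" for s t
      using that DA_fmul comp_fmul_zero[OF sub sub] by simp
  qed (auto simp: DA_fzero comp_fzero)
  then have "relideal V \<subseteq> ?I" by (rule relideal_minimal) (use rels_DA comp_rels in blast)
  then show ?thesis using assms by blast
qed

definition IS :: "'x \<Rightarrow> ('x, 'k) div_family set" where "IS x = cox_ideal_stalk X K \<chi> x"

text \<open>On germs the condition of lying locally in the ideal is absorbed by shrinking the
  neighbourhood.\<close>

lemma IS_iff: "s \<in> IS x \<longleftrightarrow> (\<exists>V. op V \<and> x \<in> V \<and> s \<in> relideal V)"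
proof
  assume "s \<in> IS x"
  then obtain W where "op W" "x \<in> W" "s \<in> cox_ideal X K \<chi> W" by (auto simp: IS_def cox_ideal_stalk_def)
  then show "\<exists>V. op V \<and> x \<in> V \<and> s \<in> relideal V" unfolding cox_ideal_def cox_relations_eq by blast
next
  assume "\<exists>V. op V \<and> x \<in> V \<and> s \<in> relideal V"
  then obtain V where V: "op V" "x \<in> V" "s \<in> relideal V" by blast
  then have "s \<in> cox_ideal X K \<chi> V"
    unfolding cox_ideal_def cox_relations_eq using relideal_DA[OF V(3)]
    by (auto simp: div_algebra_eq family_ring_simps)
  then show "s \<in> IS x" using V unfolding IS_def cox_ideal_stalk_def by blast
qed

lemma IS_DS: "s \<in> IS x \<Longrightarrow> s \<in> DS x"
  using IS_iff DS_I relideal_DA by blast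

lemma comp_IS: "s \<in> IS x \<Longrightarrow> D \<in> K \<Longrightarrow> component D s = \<zero>\<^bsub>FF\<^esub>"
  using IS_iff comp_relideal by blast

lemma ideal_IS:
  assumes x: "x \<in> topspace (pts X)"
  shows "ideal (IS x) (div_stalk X K x)"
  unfolding div_stalk_eq
proof (rule ideal_family_ring[OF cring_div_stalk[OF x, unfolded div_stalk_eq]])
  show "DS x \<subseteq> DA {}" using DS_empty by blast
  show "fneg s \<in> DS x" if "s \<in> DS x" for s using that DA_fneg by (auto simp: DS_def)
  show "IS x \<subseteq> DS x" using IS_DS by blast
  show "fzero \<in> IS x"
    unfolding IS_iff using x relideal_zero by (intro exI[of _ "topspace (pts X)"]) simp
  show "fadd s t \<in> IS x" if st: "s \<in> IS x" "t \<in> IS x" for s t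
  proof -
    obtain U V where "op U" "x \<in> U" "s \<in> relideal U" "op V" "x \<in> V" "t \<in> relideal V"
      using st unfolding IS_iff by blast
    moreover from this have "s \<in> relideal (U \<inter> V)" "t \<in> relideal (U \<inter> V)"
      using relideal_mono[of "U \<inter> V" U] relideal_mono[of "U \<inter> V" V] by auto
    then have "fadd s t \<in> relideal (U \<inter> V)" by (rule relideal_add)
    ultimately show ?thesis unfolding IS_iff by (intro exI[of _ "U \<inter> V"]) auto
  qed
  show "fneg s \<in> IS x" if "s \<in> IS x" for s
    using that relideal_neg unfolding IS_iff by blast
  show "fmul t s \<in> IS x" if st: "s \<in> IS x" "t \<in> DS x" for s t
  proof -
    obtain U V where *: "op U" "x \<in> U" "s \<in> relideal U" "op V" "x \<in> V" "t \<in> DA V"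
      using st unfolding IS_iff DS_def by blast
    have "fmul t s \<in> relideal (U \<inter> V)"
      using relideal_mono[of "U \<inter> V" U] DA_mono[of "U \<inter> V" V] * by (intro relideal_mult) auto
    then show ?thesis unfolding IS_iff using * by (intro exI[of _ "U \<inter> V"]) auto
  qed
qed

definition rcos :: "'x \<Rightarrow> ('x, 'k) div_family \<Rightarrow> ('x, 'k) div_family set" where
  "rcos x s = IS x +>\<^bsub>div_stalk X K x\<^esub> s"

abbreviation CS :: "'x \<Rightarrow> ('x, 'k) div_family set ring" where "CS x \<equiv> cox_stalk X K \<chi> x"

lemma ring_CS:
  assumes "x \<in> topspace (pts X)"
  shows "ring (CS x)"
  unfolding cox_stalk_def IS_def[symmetric] by (rule ideal.quotient_is_ring[OF ideal_IS[OF assms]])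

lemma rcos_hom:
  assumes x: "x \<in> topspace (pts X)" and s: "s \<in> DS x" and t: "t \<in> DS x"
  shows "rcos x s \<in> carrier (CS x)" "rcos x (fadd s t) = rcos x s \<oplus>\<^bsub>CS x\<^esub> rcos x t"
    "rcos x (fmul s t) = rcos x s \<otimes>\<^bsub>CS x\<^esub> rcos x t" "rcos x (fneg s) = \<ominus>\<^bsub>CS x\<^esub> rcos x s"
    "rcos x (hmg 0 \<one>\<^bsub>FF\<^esub>) = \<one>\<^bsub>CS x\<^esub>" "s \<in> rcos x s"
proof -
  note cr = cring_div_stalk[OF x]
  interpret I: ideal "IS x" "div_stalk X K x" by (rule ideal_IS[OF x])
  interpret H: ring_hom_cring "div_stalk X K x" "CS x" "rcos x"
    unfolding cox_stalk_def IS_def[symmetric] rcos_def using I.rcos_ring_hom_cring[OF cr] .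
  have c: "s \<in> carrier (div_stalk X K x)" "t \<in> carrier (div_stalk X K x)"
    using s t by (simp_all add: div_stalk_eq family_ring_simps)
  have op: "monoid.mult (div_stalk X K x) = fmul" "add (div_stalk X K x) = fadd"
    "\<one>\<^bsub>div_stalk X K x\<^esub> = hmg 0 \<one>\<^bsub>FF\<^esub>"
    by (simp_all add: div_stalk_eq family_ring_simps)
  show "rcos x s \<in> carrier (CS x)" using H.hom_closed c by blast
  show "rcos x (fadd s t) = rcos x s \<oplus>\<^bsub>CS x\<^esub> rcos x t" using H.hom_add[OF c] by (simp add: op)
  show "rcos x (fmul s t) = rcos x s \<otimes>\<^bsub>CS x\<^esub> rcos x t" using H.hom_mult[OF c] by (simp add: op)
  show "rcos x (hmg 0 \<one>\<^bsub>FF\<^esub>) = \<one>\<^bsub>CS x\<^esub>" using H.hom_one by (simp add: op)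
  show "s \<in> rcos x s" unfolding rcos_def by (rule I.a_rcos_self[OF c(1)])
  have "fneg s \<in> DS x" using s DA_fneg by (auto simp: DS_def)
  then have "\<ominus>\<^bsub>div_stalk X K x\<^esub> s = fneg s"
    using family_ring_uminus[OF cr[unfolded div_stalk_eq] _ s] DS_empty by (auto simp: div_stalk_eq)
  then show "rcos x (fneg s) = \<ominus>\<^bsub>CS x\<^esub> rcos x s" using H.hom_a_inv[OF c(1)] by simp
qed

lemma rcos_mem:
  assumes "t \<in> rcos x s" "s \<in> DS x"
  shows "D \<in> K \<Longrightarrow> component D t = component D s"
proof -
  assume D: "D \<in> K"
  obtain i where i: "i \<in> IS x" "t = fadd i s"
    using assms(1) unfolding rcos_def a_r_coset_def' by (auto simp: div_stalk_eq family_ring_simps)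
  show "component D t = component D s"
    using comp_fadd[OF DS_empty[OF IS_DS[OF i(1)]] DS_empty[OF assms(2)], of D] comp_IS[OF i(1) D]
      comp_carrier[OF DS_empty[OF assms(2)]] i(2) by simp
qed

text \<open>Components depend only on the coset, so they can be read off from the value of a section
  of the Cox sheaf at a single point.\<close>

lemma rcos_eq_comp:
  assumes x: "x \<in> topspace (pts X)" and "rcos x s = rcos x t" "s \<in> DS x" "t \<in> DS x" "D \<in> K"
  shows "component D s = component D t"
  using rcos_mem[of s x t D] rcos_hom(6)[OF x assms(3,3)] assms by simp

abbreviation TX :: "'x set" where "TX \<equiv> topspace (pts X)"

abbreviation CR :: "('x \<Rightarrow> ('x, 'k) div_family set) ring" where "CR \<equiv> cox_ring X K \<chi>"

lemma cox_ring_simps: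
  "carrier CR = {\<sigma>\<in>extensional TX. \<forall>x\<in>TX. \<exists>W s. op W \<and> x \<in> W \<and> W \<subseteq> TX \<and> s \<in> DA W \<and> (\<forall>y\<in>W. \<sigma> y = rcos y s)}"
  "monoid.mult CR = (\<lambda>\<sigma> \<tau>. restrict (\<lambda>x. \<sigma> x \<otimes>\<^bsub>CS x\<^esub> \<tau> x) TX)"
  "\<one>\<^bsub>CR\<^esub> = restrict (\<lambda>x. \<one>\<^bsub>CS x\<^esub>) TX"
  "\<zero>\<^bsub>CR\<^esub> = restrict (\<lambda>x. \<zero>\<^bsub>CS x\<^esub>) TX"
  "add CR = (\<lambda>\<sigma> \<tau>. restrict (\<lambda>x. \<sigma> x \<oplus>\<^bsub>CS x\<^esub> \<tau> x) TX)"
  by (auto simp: cox_ring_def cox_sheaf_def div_algebra_eq family_ring_simps rcos_def IS_def)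

lemma cox_ring_local:
  assumes "\<sigma> \<in> carrier CR" "x \<in> TX"
  obtains W s where "op W" "x \<in> W" "s \<in> DA W" "\<forall>y\<in>W. \<sigma> y = rcos y s"
proof -
  have "\<exists>W s. op W \<and> x \<in> W \<and> W \<subseteq> TX \<and> s \<in> DA W \<and> (\<forall>y\<in>W. \<sigma> y = rcos y s)"
    using assms unfolding cox_ring_simps(1) by simp
  then obtain W s where "op W" "x \<in> W" "s \<in> DA W" "\<forall>y\<in>W. \<sigma> y = rcos y s" by (elim exE conjE) simp
  then show thesis by (intro that[of W s]) simp_all
qed

lemma cox_ring_stalk:
  assumes "\<sigma> \<in> carrier CR" "x \<in> TX"
  obtains s where "s \<in> DS x" "\<sigma> x = rcos x s"
  using cox_ring_local[OF assms] DS_I by metis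

text \<open>\<open>generate_ring\<close> closes under additive inverses, and in \<open>CR\<close>
  the inverse is a definite description. The candidate is built pointwise; that it is an inverse,
  and the only one, is checked stalk by stalk.\<close>

lemma cox_ring_uminus:
  assumes \<sigma>: "\<sigma> \<in> carrier CR"
  shows "\<ominus>\<^bsub>CR\<^esub> \<sigma> = restrict (\<lambda>x. \<ominus>\<^bsub>CS x\<^esub> \<sigma> x) TX"
proof -
  let ?\<tau> = "restrict (\<lambda>x. \<ominus>\<^bsub>CS x\<^esub> \<sigma> x) TX"
  have stalk: "\<tau> x \<in> carrier (CS x)" if \<tau>: "\<tau> \<in> carrier CR" and x: "x \<in> TX" for \<tau> x
    by (rule cox_ring_stalk[OF \<tau> x]) (use rcos_hom(1)[OF x] in simp)
  have \<tau>: "?\<tau> \<in> carrier CR"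
    unfolding cox_ring_simps
  proof (intro CollectI conjI ballI)
    fix x assume x: "x \<in> TX"
    obtain W s where W: "op W" "x \<in> W" "s \<in> DA W" "\<forall>y\<in>W. \<sigma> y = rcos y s"
      by (rule cox_ring_local[OF \<sigma> x])
    have "?\<tau> y = rcos y (fneg s)" if "y \<in> W" for y
    proof -
      have y: "y \<in> TX" using that op_topspace[OF W(1)] by blast
      have s: "s \<in> DS y" by (rule DS_I[OF W(1) that W(3)])
      show ?thesis using rcos_hom(4)[OF y s s] W(4)[rule_format, OF that] y by simp
    qed
    then show "\<exists>W s. op W \<and> x \<in> W \<and> W \<subseteq> TX \<and> s \<in> DA W \<and> (\<forall>y\<in>W. ?\<tau> y = rcos y s)"
      using W(1-3) op_topspace[OF W(1)] DA_fneg[OF W(3)] by blast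
  qed simp
  have eq: "\<ominus>\<^bsub>CR\<^esub> \<sigma> = (THE \<tau>. \<tau> \<in> carrier CR \<and> \<sigma> \<oplus>\<^bsub>CR\<^esub> \<tau> = \<zero>\<^bsub>CR\<^esub> \<and> \<tau> \<oplus>\<^bsub>CR\<^esub> \<sigma> = \<zero>\<^bsub>CR\<^esub>)"
    by (simp add: a_inv_def m_inv_def)
  show ?thesis
    unfolding eq
  proof (rule the_equality)
    have "\<sigma> \<oplus>\<^bsub>CR\<^esub> ?\<tau> = \<zero>\<^bsub>CR\<^esub>" "?\<tau> \<oplus>\<^bsub>CR\<^esub> \<sigma> = \<zero>\<^bsub>CR\<^esub>"
      unfolding cox_ring_simps
      by (rule restrict_eqI; simp add: abelian_group.r_neg[OF ring.is_abelian_group[OF ring_CS]]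
          abelian_group.l_neg[OF ring.is_abelian_group[OF ring_CS]] stalk[OF \<sigma>])+
    then show "?\<tau> \<in> carrier CR \<and> \<sigma> \<oplus>\<^bsub>CR\<^esub> ?\<tau> = \<zero>\<^bsub>CR\<^esub> \<and> ?\<tau> \<oplus>\<^bsub>CR\<^esub> \<sigma> = \<zero>\<^bsub>CR\<^esub>" using \<tau> by blast
    fix \<rho> assume \<rho>: "\<rho> \<in> carrier CR \<and> \<sigma> \<oplus>\<^bsub>CR\<^esub> \<rho> = \<zero>\<^bsub>CR\<^esub> \<and> \<rho> \<oplus>\<^bsub>CR\<^esub> \<sigma> = \<zero>\<^bsub>CR\<^esub>"
    have "\<rho> x = \<ominus>\<^bsub>CS x\<^esub> \<sigma> x" if x: "x \<in> TX" for x
    proof -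
      have "restrict (\<lambda>x. \<rho> x \<oplus>\<^bsub>CS x\<^esub> \<sigma> x) TX x = restrict (\<lambda>x. \<zero>\<^bsub>CS x\<^esub>) TX x"
        using \<rho> unfolding cox_ring_simps(4,5) by metis
      then have "\<rho> x \<oplus>\<^bsub>CS x\<^esub> \<sigma> x = \<zero>\<^bsub>CS x\<^esub>" using x by simp
      then show ?thesis
        using abelian_group.minus_equality[OF ring.is_abelian_group[OF ring_CS[OF x]], of "\<rho> x" "\<sigma> x"]
          stalk[OF conjunct1[OF \<rho>] x] stalk[OF \<sigma> x] by simp
    qed
    moreover have "\<rho> \<in> extensional TX" using \<rho> unfolding cox_ring_simps(1) by blast
    ultimately show "\<rho> = ?\<tau>" by (intro extensionalityI[of _ TX]) simp_all
  qed
qed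

text \<open>The components of a section do not depend on the point, as \<open>X\<close> is irreducible.\<close>

lemma comp_global:
  assumes \<sigma>: "\<sigma> \<in> carrier CR" and x0: "x0 \<in> TX" and s: "s \<in> DS x0" "\<sigma> x0 = rcos x0 s" and D: "D \<in> K"
  shows "component D s \<in> div_sections X TX D"
proof -
  obtain W0 s0 where W0: "op W0" "x0 \<in> W0" "s0 \<in> DA W0" "\<forall>y\<in>W0. \<sigma> y = rcos y s0"
    by (rule cox_ring_local[OF \<sigma> x0])
  have e0: "component D s = component D s0"
    by (rule rcos_eq_comp[OF x0 _ s(1) DS_I[OF W0(1-3)] D]) (use s(2) W0(2,4) in simp)
  \<comment> \<open>Being a section of O(D) is a local condition, so it is enough that the open sets
    on which it holds cover X.\<close>
  let ?W = "{W. op W \<and> component D s \<in> div_sections X W D}"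
  have "component D s \<in> div_sections X (\<Union>?W) D"
    by (rule div_sections_Union) (use comp_carrier[OF DS_empty[OF s(1)]] in auto)
  moreover have "TX \<subseteq> \<Union>?W"
  proof
    fix x assume x: "x \<in> TX"
    obtain W t where W: "op W" "x \<in> W" "t \<in> DA W" "\<forall>y\<in>W. \<sigma> y = rcos y t"
      by (rule cox_ring_local[OF \<sigma> x])
    obtain y where y: "y \<in> W" "y \<in> W0" using op_Int_nonempty[OF W(1) W0(1)] W(2) W0(2) by blast
    have yT: "y \<in> TX" using y(1) op_topspace[OF W(1)] by blast
    have "component D t = component D s0"
      by (rule rcos_eq_comp[OF yT _ DS_I[OF W(1) y(1) W(3)] DS_I[OF W0(1) y(2) W0(3)] D])
        (use W(4)[rule_format, OF y(1)] W0(4)[rule_format, OF y(2)] in simp)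
    then have "component D s \<in> div_sections X W D" using comp_div_sections[OF W(3) D] e0 by simp
    then show "x \<in> \<Union>?W" using W(1,2) by blast
  qed
  ultimately show ?thesis using div_sections_mono by blast
qed

lemma homogeneous_section:
  assumes "D \<in> K" "f \<in> div_sections X TX D"
  shows "restrict (\<lambda>x. rcos x (hmg D f)) TX \<in> carrier CR"
  unfolding cox_ring_simps using DA_hmg[OF assms] by auto

text \<open>Projection onto one degree, the class of G, of the grading by the class group;
  \<open>coproj\<close> collects the other classes.\<close>

definition proj :: "('x set \<Rightarrow>\<^sub>0 int) \<Rightarrow> ('x, 'k) div_family \<Rightarrow> ('x, 'k) div_family" where
  "proj G s = (\<lambda>H. if H - G \<in> K0 then s H else \<zero>\<^bsub>FF\<^esub>)"

definition coproj :: "('x set \<Rightarrow>\<^sub>0 int) \<Rightarrow> ('x, 'k) div_family \<Rightarrow> ('x, 'k) div_family" where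
  "coproj G s = (\<lambda>H. if H - G \<in> K0 then \<zero>\<^bsub>FF\<^esub> else s H)"

lemma proj_DA:
  assumes "s \<in> DA {}"
  shows "proj G s \<in> DA {}" "coproj G s \<in> DA {}" "fadd (proj G s) (coproj G s) = s"
    "supp (coproj G s) = {H\<in>supp s. H - G \<notin> K0}"
proof -
  have "supp (proj G s) \<subseteq> supp s" by (auto simp: proj_def family_support_def)
  moreover show c: "supp (coproj G s) = {H\<in>supp s. H - G \<notin> K0}"
    by (auto simp: coproj_def family_support_def split: if_splits)
  moreover have "u D \<in> div_sections X {} D" if "u D \<in> carrier FF" for u D
    using that by (simp add: div_sections_def)
  ultimately show "proj G s \<in> DA {}" "coproj G s \<in> DA {}"
    using DA_D[OF assms] unfolding DA_def by (auto simp: proj_def coproj_def div_sections_zero intro: finite_subset)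
  show "fadd (proj G s) (coproj G s) = s"
    using DA_D(4)[OF assms] by (auto simp: fadd_def proj_def coproj_def fun_eq_iff)
qed

text \<open>The quotient is graded by the class group: a factor concentrated in the class of G pairs
  only with the part of t in the class of D - G.\<close>

lemma comp_proj_fmul:
  assumes s: "s \<in> DA {}" and t: "t \<in> DA {}"
  shows "component D (fmul (proj G s) t) = component G s \<otimes>\<^bsub>FF\<^esub> component (D - G) t"
  using s
proof (induction rule: DA_induct)
  case zero
  have "proj G fzero = fzero" by (simp add: proj_def fzero_def)
  then show ?case using fmul_fzero[OF t] comp_fzero comp_carrier[OF t] by simp
next
  case (add H f u)
  have f: "f \<in> carrier FF" using add(2) div_sections_carrier by blast
  note h = hmg_DA_empty[OF f add(1)]
  have pa: "proj G (fadd (hmg H f) u) = fadd (proj G (hmg H f)) (proj G u)"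
    by (auto simp: proj_def fadd_def fun_eq_iff)
  have "component D (fmul (proj G (hmg H f)) t) = component G (hmg H f) \<otimes>\<^bsub>FF\<^esub> component (D - G) t"
  proof (cases "H - G \<in> K0")
    case True
    then have "proj G (hmg H f) = hmg H f" by (auto simp: proj_def homogeneous_def fun_eq_iff)
    then have "component D (fmul (proj G (hmg H f)) t) = f \<otimes>\<^bsub>FF\<^esub> component (D - H) t"
      using comp_hmg_fmul[OF f add(1) t] by simp
    also have "component (D - H) t = component (D - G) t \<otimes>\<^bsub>FF\<^esub> \<chi> (H - G)"
      using comp_shift[OF t True, of "D - H"] by simp
    also have "f \<otimes>\<^bsub>FF\<^esub> \<dots> = f \<otimes>\<^bsub>FF\<^esub> \<chi> (H - G) \<otimes>\<^bsub>FF\<^esub> component (D - G) t"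
      using f comp_carrier[OF t] chi_carrier[OF True] by (simp add: F.m_ac)
    finally show ?thesis using True by (simp add: comp_hmg[OF f add(1)])
  next
    case False
    then have "proj G (hmg H f) = fzero" by (auto simp: proj_def homogeneous_def fun_eq_iff fzero_def)
    then show ?thesis using False fmul_fzero[OF t] comp_fzero comp_carrier[OF t] by (simp add: comp_hmg[OF f add(1)])
  qed
  then show ?case
    unfolding pa fmul_fadd[OF proj_DA(1)[OF h] proj_DA(1)[OF add(3)] t]
      comp_fadd[OF DA_fmul[OF proj_DA(1)[OF h] t] DA_fmul[OF proj_DA(1)[OF add(3)] t]]
      comp_fadd[OF h add(3)] add(4)
    using comp_carrier[OF h] comp_carrier[OF add(3)] comp_carrier[OF t] by (simp add: F.l_distr)
qed

lemma comp_coproj: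
  assumes s: "s \<in> DA {}"
  shows "component E (coproj G s) = (if E - G \<in> K0 then \<zero>\<^bsub>FF\<^esub> else component E s)"
proof -
  let ?h = "\<lambda>s H. if H - E \<in> K0 then s H \<otimes>\<^bsub>FF\<^esub> \<chi> (H - E) else \<zero>\<^bsub>FF\<^esub>"
  note c = DA_D(4)[OF s] chi_carrier
  have e: "component E (coproj G s) = (\<Oplus>\<^bsub>FF\<^esub>H\<in>supp s. ?h (coproj G s) H)"
    by (rule comp_superset[OF proj_DA(2)[OF s] DA_D(1)[OF s]]) (use proj_DA(4)[OF s] in blast)
  show ?thesis
  proof (cases "E - G \<in> K0")
    case True
    have "?h (coproj G s) H = \<zero>\<^bsub>FF\<^esub>" for H
      using K0_add[OF _ True, of "H - E"] chi_carrier by (simp add: coproj_def)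
    then show ?thesis using True e by simp
  next
    case False
    have "H - G \<notin> K0" if "H - E \<in> K0" for H
      using K0_diff[OF _ that, of "H - G"] False by auto
    then have "?h (coproj G s) H = ?h s H" for H by (simp add: coproj_def)
    then show ?thesis using False e by (simp add: component_def)
  qed
qed

text \<open>The component of a product is a sum, over the classes occurring in s, of products of
  components. Removing one class of s at a time shrinks its support and leaves the components in the
  other classes unchanged. The family M is abstract here and becomes a span of monomials
  later.\<close>

lemma comp_fmul_mem:
  assumes M0: "\<And>D. \<zero>\<^bsub>FF\<^esub> \<in> M D" and Madd: "\<And>D x y. x \<in> M D \<Longrightarrow> y \<in> M D \<Longrightarrow> x \<oplus>\<^bsub>FF\<^esub> y \<in> M D"
    and Mmult: "\<And>D E x y. D \<in> K \<Longrightarrow> E \<in> K \<Longrightarrow> x \<in> M D \<Longrightarrow> y \<in> M E \<Longrightarrow> x \<otimes>\<^bsub>FF\<^esub> y \<in> M (D + E)"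
    and t: "t \<in> DA {}" "\<And>D. D \<in> K \<Longrightarrow> component D t \<in> M D"
    and s: "s \<in> DA {}" "\<And>D. D \<in> K \<Longrightarrow> component D s \<in> M D" and D: "D \<in> K"
  shows "component D (fmul s t) \<in> M D"
  using s
proof (induction "card (supp s)" arbitrary: s rule: less_induct)
  case less
  show ?case
  proof (cases "supp s = {}")
    case True
    then have "s = fzero" by (auto simp: family_support_def fzero_def)
    then show ?thesis using fmul_fzero[OF t(1)] comp_fzero M0 by simp
  next
    case False
    then obtain G where G: "G \<in> supp s" by blast
    have GK: "G \<in> K" using G DA_D(2)[OF less(2)] by blast
    note p = proj_DA[OF less(2), of G]
    have "G \<notin> supp (coproj G s)" unfolding p(4) using K0_zero by simp
    then have "supp (coproj G s) \<subset> supp s" unfolding p(4) using G by blast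
    then have card: "card (supp (coproj G s)) < card (supp s)" by (rule psubset_card_mono[OF DA_D(1)[OF less(2)]])
    have "component D (fmul (coproj G s) t) \<in> M D"
      by (rule less(1)[OF card p(2)]) (use comp_coproj[OF less(2)] less(3) M0 in simp)
    moreover have "component G s \<otimes>\<^bsub>FF\<^esub> component (D - G) t \<in> M (G + (D - G))"
      by (rule Mmult[OF GK K_diff[OF D GK] less(3)[OF GK] t(2)[OF K_diff[OF D GK]]])
    ultimately have "component D (fmul (fadd (proj G s) (coproj G s)) t) \<in> M D"
      using Madd unfolding fmul_fadd[OF p(1,2) t(1)] comp_fadd[OF DA_fmul[OF p(1) t(1)] DA_fmul[OF p(2) t(1)]]
        comp_proj_fmul[OF less(2) t(1)] by simp
    then show ?thesis by (simp only: p(3))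
  qed
qed

text \<open>It suffices to follow the stalk at one point \<open>x\<^sub>0\<close>.\<close>

lemma comp_generate_ring:
  assumes M0: "\<And>D. \<zero>\<^bsub>FF\<^esub> \<in> M D" and Madd: "\<And>D x y. x \<in> M D \<Longrightarrow> y \<in> M D \<Longrightarrow> x \<oplus>\<^bsub>FF\<^esub> y \<in> M D"
    and Mneg: "\<And>D x. x \<in> M D \<Longrightarrow> \<ominus>\<^bsub>FF\<^esub> x \<in> M D"
    and Mmult: "\<And>D E x y. D \<in> K \<Longrightarrow> E \<in> K \<Longrightarrow> x \<in> M D \<Longrightarrow> y \<in> M E \<Longrightarrow> x \<otimes>\<^bsub>FF\<^esub> y \<in> M (D + E)"
    and Mone: "\<And>D. D \<in> K \<Longrightarrow> component D (hmg 0 \<one>\<^bsub>FF\<^esub>) \<in> M D"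
    and x0: "x0 \<in> TX" and H: "generate_ring CR H = carrier CR"
    and gen: "\<And>\<sigma>. \<sigma> \<in> H \<Longrightarrow> \<exists>s\<in>DS x0. \<sigma> x0 = rcos x0 s \<and> (\<forall>D\<in>K. component D s \<in> M D)"
    and \<sigma>: "\<sigma> \<in> generate_ring CR H"
  shows "\<exists>s\<in>DS x0. \<sigma> x0 = rcos x0 s \<and> (\<forall>D\<in>K. component D s \<in> M D)"
  using \<sigma>
proof induction
  case one
  have "hmg 0 \<one>\<^bsub>FF\<^esub> \<in> DS x0" by (rule DS_I[OF openin_topspace x0 one_DA])
  then show ?case
    using rcos_hom(5)[OF x0] Mone x0 by (intro bexI[of _ "hmg 0 \<one>\<^bsub>FF\<^esub>"]) (auto simp: cox_ring_simps(3))
next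
  case (incl h)
  then show ?case by (rule gen)
next
  case (a_inv h)
  then obtain s where s: "s \<in> DS x0" "h x0 = rcos x0 s" "\<forall>D\<in>K. component D s \<in> M D" by blast
  have "h \<in> carrier CR" using a_inv(1) H by simp
  then have "(\<ominus>\<^bsub>CR\<^esub> h) x0 = rcos x0 (fneg s)"
    using cox_ring_uminus x0 rcos_hom(4)[OF x0 s(1) s(1)] s(2) by simp
  moreover have "fneg s \<in> DS x0" using s(1) DA_fneg by (auto simp: DS_def)
  moreover have "\<forall>D\<in>K. component D (fneg s) \<in> M D" using comp_fneg[OF DS_empty[OF s(1)]] Mneg s(3) by simp
  ultimately show ?case by blast
next
  case (eng_add h1 h2)
  then obtain s t where s: "s \<in> DS x0" "h1 x0 = rcos x0 s" "\<forall>D\<in>K. component D s \<in> M D"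
    and t: "t \<in> DS x0" "h2 x0 = rcos x0 t" "\<forall>D\<in>K. component D t \<in> M D" by blast
  have "(h1 \<oplus>\<^bsub>CR\<^esub> h2) x0 = rcos x0 (fadd s t)"
    using x0 rcos_hom(2)[OF x0 s(1) t(1)] s(2) t(2) by (simp add: cox_ring_simps(5))
  moreover have "fadd s t \<in> DS x0" by (rule DS_common[OF s(1) t(1)]) (use DA_fadd DS_I in blast)
  moreover have "\<forall>D\<in>K. component D (fadd s t) \<in> M D"
    using comp_fadd[OF DS_empty[OF s(1)] DS_empty[OF t(1)]] Madd s(3) t(3) by simp
  ultimately show ?case by blast
next
  case (eng_mult h1 h2)
  then obtain s t where s: "s \<in> DS x0" "h1 x0 = rcos x0 s" "\<forall>D\<in>K. component D s \<in> M D"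
    and t: "t \<in> DS x0" "h2 x0 = rcos x0 t" "\<forall>D\<in>K. component D t \<in> M D" by blast
  have "(h1 \<otimes>\<^bsub>CR\<^esub> h2) x0 = rcos x0 (fmul s t)"
    using x0 rcos_hom(3)[OF x0 s(1) t(1)] s(2) t(2) by (simp add: cox_ring_simps(2))
  moreover have "fmul s t \<in> DS x0" by (rule DS_common[OF s(1) t(1)]) (use DA_fmul DS_I in blast)
  moreover have "component D (fmul s t) \<in> M D" if "D \<in> K" for D
    by (rule comp_fmul_mem[where M = M, OF M0 Madd Mmult DS_empty[OF t(1)] _ DS_empty[OF s(1)] _ that])
      (use s(3) t(3) in auto)
  ultimately show ?case by blast
qed

end

section \<open>Homogeneous monomials and generators of the Cox ring\<close>

section \<open>Spans of homogeneous monomials\<close>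

context cox_space begin

text \<open>Each generator carries its degree, since one rational function can be a section of O(D)
  for many divisors D.\<close>

definition gens :: "(('x set \<Rightarrow>\<^sub>0 int) \<times> ('x, 'k) ratfun) set \<Rightarrow> bool" where
  "gens G \<longleftrightarrow> finite G \<and> (\<forall>g\<in>G. fst g \<in> K \<and> snd g \<in> carrier FF)"

definition degG :: "(('x set \<Rightarrow>\<^sub>0 int) \<times> ('x, 'k) ratfun) set \<Rightarrow>
    (('x set \<Rightarrow>\<^sub>0 int) \<times> ('x, 'k) ratfun \<Rightarrow> nat) \<Rightarrow> 'x set \<Rightarrow>\<^sub>0 int" where
  "degG G a = (\<Sum>g\<in>G. frag_cmul (int (a g)) (fst g))"

definition valG :: "(('x set \<Rightarrow>\<^sub>0 int) \<times> ('x, 'k) ratfun) set \<Rightarrow>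
    (('x set \<Rightarrow>\<^sub>0 int) \<times> ('x, 'k) ratfun \<Rightarrow> nat) \<Rightarrow> ('x, 'k) ratfun" where
  "valG G a = (\<Otimes>\<^bsub>FF\<^esub>g\<in>G. snd g [^]\<^bsub>FF\<^esub> a g)"

text \<open>Linear span of the monomials whose degree lies in the class of D, each moved to degree D
  by \<open>\<chi>\<close>. For D = 0 it is closed under products and so an algebra.\<close>

inductive_set Msp :: "(('x set \<Rightarrow>\<^sub>0 int) \<times> ('x, 'k) ratfun) set \<Rightarrow> ('x set \<Rightarrow>\<^sub>0 int) \<Rightarrow> ('x, 'k) ratfun set"
  for G D where
  zero: "\<zero>\<^bsub>FF\<^esub> \<in> Msp G D"
| add: "x \<in> Msp G D \<Longrightarrow> y \<in> Msp G D \<Longrightarrow> x \<oplus>\<^bsub>FF\<^esub> y \<in> Msp G D"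
| mono: "degG G a - D \<in> K0 \<Longrightarrow> rat_const X c \<otimes>\<^bsub>FF\<^esub> (valG G a \<otimes>\<^bsub>FF\<^esub> \<chi> (degG G a - D)) \<in> Msp G D"

lemma gensD: "gens G \<Longrightarrow> finite G" "gens G \<Longrightarrow> g \<in> G \<Longrightarrow> fst g \<in> K" "gens G \<Longrightarrow> g \<in> G \<Longrightarrow> snd g \<in> carrier FF"
  by (auto simp: gens_def)

lemma valG_carrier: "gens G \<Longrightarrow> valG G a \<in> carrier FF"
  unfolding valG_def using gensD(3) by (intro F.finprod_closed) auto

lemma degG_add: "degG G (\<lambda>g. a g + b g) = degG G a + degG G b"
  by (simp add: degG_def frag_cmul_distrib sum.distrib)

lemma degG_cong: "(\<And>g. g \<in> G \<Longrightarrow> a g = b g) \<Longrightarrow> degG G a = degG G b"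
  by (simp add: degG_def)

lemma valG_add:
  assumes "gens G"
  shows "valG G (\<lambda>g. a g + b g) = valG G a \<otimes>\<^bsub>FF\<^esub> valG G b"
proof -
  have "valG G (\<lambda>g. a g + b g) = (\<Otimes>\<^bsub>FF\<^esub>g\<in>G. snd g [^]\<^bsub>FF\<^esub> a g \<otimes>\<^bsub>FF\<^esub> snd g [^]\<^bsub>FF\<^esub> b g)"
    unfolding valG_def using gensD(3)[OF assms]
    by (intro F.finprod_cong' refl) (auto simp: F.nat_pow_mult)
  also have "\<dots> = valG G a \<otimes>\<^bsub>FF\<^esub> valG G b"
    unfolding valG_def using gensD(3)[OF assms] by (intro F.finprod_multf) auto
  finally show ?thesis .
qed

lemma valG_cong:
  assumes "gens G" "\<And>g. g \<in> G \<Longrightarrow> a g = b g"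
  shows "valG G a = valG G b"
  unfolding valG_def using gensD(3)[OF assms(1)] assms(2) by (intro F.finprod_cong' refl) auto

lemma rat_const_mult: "rat_const X c \<otimes>\<^bsub>FF\<^esub> rat_const X d = rat_const X (c * d)"
  unfolding rat_const_def using topspace_ne
  by (intro function_field_mult_same regular_on_const) auto

lemma Msp_carrier:
  assumes "gens G" "x \<in> Msp G D"
  shows "x \<in> carrier FF"
  using assms(2)
  by induction (simp_all add: rat_const_carrier valG_carrier[OF assms(1)] chi_carrier)

lemma Msp_mult:
  assumes G: "gens G" and x: "x \<in> Msp G D" and y: "y \<in> Msp G E"
  shows "x \<otimes>\<^bsub>FF\<^esub> y \<in> Msp G (D + E)"
  using x
proof induction
  case zero
  show ?case using Msp_carrier[OF G y] Msp.zero by simp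
next
  case (add u v)
  then show ?case using Msp_carrier[OF G] y Msp.add by (simp add: F.l_distr)
next
  case (mono a c)
  note va = valG_carrier[OF G] and ca = chi_carrier[OF mono]
  let ?u = "rat_const X c \<otimes>\<^bsub>FF\<^esub> (valG G a \<otimes>\<^bsub>FF\<^esub> \<chi> (degG G a - D))"
  have u: "?u \<in> carrier FF" using va ca rat_const_carrier by simp
  show ?case using y
  proof induction
    case zero
    show ?case using u Msp.zero by simp
  next
    case (add v w)
    then show ?case using Msp_carrier[OF G] u Msp.add by (simp add: F.r_distr)
  next
    case (mono b d)
    note cb = chi_carrier[OF mono]
    let ?ab = "\<lambda>g. a g + b g"
    have e: "(degG G a - D) + (degG G b - E) = degG G ?ab - (D + E)" by (simp add: degG_add)
    have k: "degG G ?ab - (D + E) \<in> K0" using K0_add[OF \<open>degG G a - D \<in> K0\<close> mono] unfolding e .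
    have "?u \<otimes>\<^bsub>FF\<^esub> (rat_const X d \<otimes>\<^bsub>FF\<^esub> (valG G b \<otimes>\<^bsub>FF\<^esub> \<chi> (degG G b - E))) =
      (rat_const X c \<otimes>\<^bsub>FF\<^esub> rat_const X d) \<otimes>\<^bsub>FF\<^esub> ((valG G a \<otimes>\<^bsub>FF\<^esub> valG G b) \<otimes>\<^bsub>FF\<^esub>
        (\<chi> (degG G a - D) \<otimes>\<^bsub>FF\<^esub> \<chi> (degG G b - E)))"
      using va ca cb rat_const_carrier by (simp add: F.m_ac)
    also have "\<dots> = rat_const X (c * d) \<otimes>\<^bsub>FF\<^esub> (valG G ?ab \<otimes>\<^bsub>FF\<^esub> \<chi> (degG G ?ab - (D + E)))"
      unfolding rat_const_mult valG_add[OF G] chi_add[OF \<open>degG G a - D \<in> K0\<close> mono, symmetric] e ..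
    finally show ?case using Msp.mono[OF k] by simp
  qed
qed

lemma Msp_shift:
  assumes G: "gens G" and x: "x \<in> Msp G D" and E: "E \<in> K0"
  shows "x \<otimes>\<^bsub>FF\<^esub> \<chi> E \<in> Msp G (D - E)"
  using x
proof induction
  case zero
  show ?case using chi_carrier[OF E] Msp.zero by simp
next
  case (add u v)
  then show ?case using Msp_carrier[OF G] chi_carrier[OF E] Msp.add by (simp add: F.l_distr)
next
  case (mono a c)
  have e: "(degG G a - D) + E = degG G a - (D - E)" by simp
  have k: "degG G a - (D - E) \<in> K0" using K0_add[OF mono E] unfolding e .
  have "rat_const X c \<otimes>\<^bsub>FF\<^esub> (valG G a \<otimes>\<^bsub>FF\<^esub> \<chi> (degG G a - D)) \<otimes>\<^bsub>FF\<^esub> \<chi> E =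
      rat_const X c \<otimes>\<^bsub>FF\<^esub> (valG G a \<otimes>\<^bsub>FF\<^esub> (\<chi> (degG G a - D) \<otimes>\<^bsub>FF\<^esub> \<chi> E))"
    using valG_carrier[OF G] chi_carrier[OF mono] chi_carrier[OF E] rat_const_carrier by (simp add: F.m_assoc)
  also have "\<dots> = rat_const X c \<otimes>\<^bsub>FF\<^esub> (valG G a \<otimes>\<^bsub>FF\<^esub> \<chi> (degG G a - (D - E)))"
    unfolding chi_add[OF mono E, symmetric] e ..
  finally show ?case using Msp.mono[OF k] by simp
qed

text \<open>The empty monomial: every principal degree D contains the constants, as multiples of
  \<open>\<chi> (- D)\<close>.\<close>

lemma Msp_const:
  assumes G: "gens G" and "- D \<in> K0"
  shows "rat_const X c \<otimes>\<^bsub>FF\<^esub> \<chi> (- D) \<in> Msp G D"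
proof -
  have d: "degG G (\<lambda>g. 0) = 0" by (simp add: degG_def)
  have v: "valG G (\<lambda>g. 0) = \<one>\<^bsub>FF\<^esub>" by (simp add: valG_def)
  show ?thesis
    using Msp.mono[of G "\<lambda>g. 0" D c] assms(2) chi_carrier[OF assms(2)] unfolding d v by simp
qed

lemma Msp_gen:
  assumes G: "gens G" and g: "g \<in> G"
  shows "snd g \<in> Msp G (fst g)"
proof -
  let ?a = "\<lambda>h. if g = h then 1 else 0 :: nat"
  have "degG G ?a = (\<Sum>h\<in>G. if g = h then fst h else 0)"
    unfolding degG_def by (intro sum.cong) auto
  then have d: "degG G ?a = fst g" using gensD(1)[OF G] g by simp
  have "valG G ?a = (\<Otimes>\<^bsub>FF\<^esub>h\<in>G. if g = h then snd h else \<one>\<^bsub>FF\<^esub>)"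
    unfolding valG_def using gensD(3)[OF G] by (intro F.finprod_cong' refl) auto
  also have "\<dots> = snd g" using gensD[OF G] g by (intro F.finprod_singleton) auto
  finally have v: "valG G ?a = snd g" .
  have "rat_const X 1 \<otimes>\<^bsub>FF\<^esub> (snd g \<otimes>\<^bsub>FF\<^esub> \<chi> 0) = snd g"
    using gensD(3)[OF G g] by (simp add: chi_zero function_field_one[symmetric])
  moreover have "rat_const X 1 \<otimes>\<^bsub>FF\<^esub> (snd g \<otimes>\<^bsub>FF\<^esub> \<chi> 0) \<in> Msp G (fst g)"
    using Msp.mono[of G ?a "fst g" 1] K0_zero unfolding d v by simp
  ultimately show ?thesis by simp
qed

lemma Msp_uminus:
  assumes G: "gens G" and x: "x \<in> Msp G D"
  shows "\<ominus>\<^bsub>FF\<^esub> x \<in> Msp G D"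
proof -
  have "rat_const X (- 1) \<otimes>\<^bsub>FF\<^esub> \<chi> (- 0) \<in> Msp G 0" by (rule Msp_const[OF G]) (simp add: K0_zero)
  then have m: "rat_const X (- 1) \<in> Msp G 0" using rat_const_carrier by (simp add: chi_zero)
  have "rat_const X (- 1) = \<ominus>\<^bsub>FF\<^esub> \<one>\<^bsub>FF\<^esub>"
    unfolding function_field_one rat_const_def
    by (rule function_field_uminus[symmetric]) (use topspace_ne in \<open>auto intro: regular_on_const\<close>)
  then have "rat_const X (- 1) \<otimes>\<^bsub>FF\<^esub> x = \<ominus>\<^bsub>FF\<^esub> x" using Msp_carrier[OF G x] by (simp add: F.l_minus)
  then show ?thesis using Msp_mult[OF G m x] by simp
qed

lemma Msp_pow:
  assumes G: "gens G" and x: "x \<in> Msp G D"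
  shows "x [^]\<^bsub>FF\<^esub> (n::nat) \<in> Msp G (frag_cmul (int n) D)"
proof (induction n)
  case 0
  have "rat_const X 1 \<otimes>\<^bsub>FF\<^esub> \<chi> (- 0) \<in> Msp G 0" by (rule Msp_const[OF G]) (simp add: K0_zero)
  then show ?case by (simp add: chi_zero function_field_one[symmetric])
next
  case (Suc n)
  have "x [^]\<^bsub>FF\<^esub> Suc n \<in> Msp G (frag_cmul (int n) D + D)" using Msp_mult[OF G Suc x] by simp
  moreover have "frag_cmul (int n) D + D = frag_cmul (int (Suc n)) D"
    using frag_cmul_distrib[of "int n" 1 D] by (simp add: add.commute)
  ultimately show ?case by simp
qed

lemma div_sections_pow:
  assumes "f \<in> div_sections X W D"
  shows "f [^]\<^bsub>FF\<^esub> (n::nat) \<in> div_sections X W (frag_cmul (int n) D)"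
proof (induction n)
  case 0
  show ?case using div_sections_const[of 1 W] by (simp add: function_field_one)
next
  case (Suc n)
  have "f [^]\<^bsub>FF\<^esub> Suc n \<in> div_sections X W (frag_cmul (int n) D + D)" using div_sections_mult[OF Suc assms] by simp
  moreover have "frag_cmul (int n) D + D = frag_cmul (int (Suc n)) D"
    using frag_cmul_distrib[of "int n" 1 D] by (simp add: add.commute)
  ultimately show ?case by simp
qed

lemma valG_div_sections:
  assumes G: "gens G" and s: "\<And>g. g \<in> G \<Longrightarrow> snd g \<in> div_sections X W (fst g)"
  shows "valG G a \<in> div_sections X W (degG G a)"
proof -
  have "finite H \<Longrightarrow> H \<subseteq> G \<Longrightarrow> valG H a \<in> div_sections X W (degG H a)" for H
  proof (induction H rule: finite_induct)
    case empty
    show ?case using div_sections_const[of 1 W] by (simp add: valG_def degG_def function_field_one)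
  next
    case (insert g H)
    have c: "snd h \<in> carrier FF" if "h \<in> insert g H" for h using gensD(3)[OF G] insert.prems that by blast
    have "valG (insert g H) a = snd g [^]\<^bsub>FF\<^esub> a g \<otimes>\<^bsub>FF\<^esub> valG H a"
      unfolding valG_def using insert.hyps c by (subst F.finprod_insert) auto
    moreover have "degG (insert g H) a = frag_cmul (int (a g)) (fst g) + degG H a"
      unfolding degG_def using insert.hyps by simp
    ultimately show ?case
      using div_sections_mult[OF div_sections_pow[OF s] insert.IH] insert.prems by simp
  qed
  then show ?thesis using gensD(1)[OF G] by blast
qed

section \<open>Generators of the Cox ring\<close>

text \<open>\<open>G\<close> collects the components, at one point, of germs representing the given
  generators, one for each degree in the support. Components in other degrees of the same classes
  differ from these by values of \<open>\<chi>\<close>, and in all remaining classes they vanish. A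
  section f of O(D) defines a section of the Cox sheaf whose D-component is f again, so f is a
  combination of monomials. The larger \<open>G'\<close> leaves room for one more generator.\<close>

lemma cox_span:
  assumes S: "finite S" "S \<subseteq> carrier CR"
    and H: "generate_ring CR (range (cox_const X K \<chi>) \<union> S) = carrier CR"
  obtains G where "gens G" "\<And>g. g \<in> G \<Longrightarrow> snd g \<in> div_sections X TX (fst g)"
    "\<And>G' D f. gens G' \<Longrightarrow> G \<subseteq> G' \<Longrightarrow> D \<in> K \<Longrightarrow> f \<in> div_sections X TX D \<Longrightarrow> f \<in> Msp G' D"
proof -
  obtain x0 where x0: "x0 \<in> TX" using topspace_ne by blast
  have "\<forall>\<sigma>\<in>S. \<exists>s. s \<in> DS x0 \<and> \<sigma> x0 = rcos x0 s"
  proof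
    fix \<sigma> assume "\<sigma> \<in> S"
    then have \<sigma>: "\<sigma> \<in> carrier CR" using S(2) by blast
    show "\<exists>s. s \<in> DS x0 \<and> \<sigma> x0 = rcos x0 s" by (rule cox_ring_stalk[OF \<sigma> x0]) blast
  qed
  then obtain ss where ss: "\<And>\<sigma>. \<sigma> \<in> S \<Longrightarrow> ss \<sigma> \<in> DS x0 \<and> \<sigma> x0 = rcos x0 (ss \<sigma>)" by metis
  have ssD: "ss \<sigma> \<in> DA {}" if "\<sigma> \<in> S" for \<sigma> using ss[OF that] DS_empty by blast
  define G where "G = (\<Union>\<sigma>\<in>S. (\<lambda>D. (D, component D (ss \<sigma>))) ` supp (ss \<sigma>))"
  have Gsec: "fst g \<in> K \<and> snd g \<in> div_sections X TX (fst g)" if "g \<in> G" for g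
  proof -
    obtain \<sigma> D where g: "\<sigma> \<in> S" "D \<in> supp (ss \<sigma>)" "g = (D, component D (ss \<sigma>))"
      using \<open>g \<in> G\<close> unfolding G_def by blast
    have D: "D \<in> K" using DA_D(2)[OF ssD[OF g(1)]] g(2) by blast
    have "\<sigma> \<in> carrier CR" using S(2) g(1) by blast
    then show ?thesis using comp_global[OF _ x0 _ _ D] ss[OF g(1)] D g(3) by simp
  qed
  have "finite G" unfolding G_def using S(1) DA_D(1)[OF ssD] by (intro finite_UN_I finite_imageI)
  then have gG: "gens G" unfolding gens_def using Gsec div_sections_carrier by blast
  have "f \<in> Msp G' D" if G': "gens G'" "G \<subseteq> G'" and D: "D \<in> K" and f: "f \<in> div_sections X TX D" for G' D f
  proof -
    let ?H = "range (cox_const X K \<chi>) \<union> S"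
    have const: "component E (hmg 0 (rat_const X c)) \<in> Msp G' E" for c E
      unfolding comp_hmg[OF rat_const_carrier K_zero] using Msp_const[OF G'(1), of E c] Msp.zero[of G' E] by simp
    have gen: "\<exists>s\<in>DS x0. \<sigma> x0 = rcos x0 s \<and> (\<forall>D\<in>K. component D s \<in> Msp G' D)" if \<sigma>: "\<sigma> \<in> ?H" for \<sigma>
    proof (cases "\<sigma> \<in> S")
      case True
      have "component E (ss \<sigma>) \<in> Msp G' E" if E: "E \<in> K" for E
      proof (cases "\<exists>B\<in>supp (ss \<sigma>). B - E \<in> K0")
        case True
        then obtain B where B: "B \<in> supp (ss \<sigma>)" "B - E \<in> K0" by blast
        have "(B, component B (ss \<sigma>)) \<in> G'" using G'(2) B(1) \<open>\<sigma> \<in> S\<close> unfolding G_def by blast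
        then have "component B (ss \<sigma>) \<in> Msp G' B" using Msp_gen[OF G'(1)] by force
        then have "component B (ss \<sigma>) \<otimes>\<^bsub>FF\<^esub> \<chi> (B - E) \<in> Msp G' (B - (B - E))" by (rule Msp_shift[OF G'(1) _ B(2)])
        then show ?thesis using comp_shift[OF ssD[OF \<open>\<sigma> \<in> S\<close>] B(2), of E] by simp
      next
        case False
        then have "component E (ss \<sigma>) = (\<Oplus>\<^bsub>FF\<^esub>B\<in>supp (ss \<sigma>). \<zero>\<^bsub>FF\<^esub>)"
          unfolding component_def by (intro F.finsum_cong' refl) auto
        then show ?thesis using Msp.zero by simp
      qed
      then show ?thesis using ss[OF True] by blast
    next
      case False
      then obtain c where c: "\<sigma> = cox_const X K \<chi> c" using \<sigma> by blast
      have "hmg 0 (rat_const X c) \<in> DS x0"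
        by (rule DS_I[OF openin_topspace x0 DA_hmg[OF K_zero div_sections_const]])
      moreover have "\<sigma> x0 = rcos x0 (hmg 0 (rat_const X c))"
        unfolding c cox_const_def using x0 by (simp add: rcos_def IS_def)
      ultimately show ?thesis using const by blast
    qed
    have one: "component E (hmg 0 \<one>\<^bsub>FF\<^esub>) \<in> Msp G' E" for E
      using const[of E 1] by (simp add: function_field_one)
    let ?\<sigma> = "restrict (\<lambda>x. rcos x (hmg D f)) TX"
    have "?\<sigma> \<in> generate_ring CR ?H" unfolding H by (rule homogeneous_section[OF D f])
    then have "\<exists>s\<in>DS x0. ?\<sigma> x0 = rcos x0 s \<and> (\<forall>D\<in>K. component D s \<in> Msp G' D)"
    proof (rule comp_generate_ring[where M = "Msp G'" and H = ?H, rotated -1])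
      show "\<zero>\<^bsub>FF\<^esub> \<in> Msp G' E" for E by (rule Msp.zero)
      show "x \<oplus>\<^bsub>FF\<^esub> y \<in> Msp G' E" if "x \<in> Msp G' E" "y \<in> Msp G' E" for E x y using that by (rule Msp.add)
      show "\<ominus>\<^bsub>FF\<^esub> x \<in> Msp G' E" if "x \<in> Msp G' E" for E x by (rule Msp_uminus[OF G'(1) that])
      show "x \<otimes>\<^bsub>FF\<^esub> y \<in> Msp G' (E + E')" if "x \<in> Msp G' E" "y \<in> Msp G' E'" for E E' x y
        by (rule Msp_mult[OF G'(1) that])
      show "component E (hmg 0 \<one>\<^bsub>FF\<^esub>) \<in> Msp G' E" for E by (rule one)
      show "x0 \<in> TX" by (rule x0)
      show "generate_ring CR ?H = carrier CR" by (rule H)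
      show "\<exists>s\<in>DS x0. \<sigma> x0 = rcos x0 s \<and> (\<forall>D\<in>K. component D s \<in> Msp G' D)" if "\<sigma> \<in> ?H" for \<sigma>
        by (rule gen[OF that])
    qed
    then obtain s where s: "s \<in> DS x0" "?\<sigma> x0 = rcos x0 s" "component D s \<in> Msp G' D" using D by blast
    have h: "hmg D f \<in> DS x0" by (rule DS_I[OF openin_topspace x0 DA_hmg[OF D f]])
    have fc: "f \<in> carrier FF" using f div_sections_carrier by blast
    have "component D s = component D (hmg D f)"
      by (rule rcos_eq_comp[OF x0 _ s(1) h D]) (use s(2) x0 in simp)
    also have "\<dots> = f" unfolding comp_hmg[OF fc D] using K0_zero fc by (simp add: chi_zero)
    finally show ?thesis using s(3) by simp
  qed
  then show thesis using that[OF gG] Gsec by blast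
qed

text \<open>The reduced divisor supported on the complement of U need not lie in K, but its class is
  represented there because K maps onto the class group; h accounts for the difference.\<close>

lemma divisor_of_complement:
  assumes U: "op U" "U \<noteq> {}"
  obtains D h where "D \<in> K" "h \<in> carrier FF" "h \<noteq> \<zero>\<^bsub>FF\<^esub>"
    "\<forall>Y. Poly_Mapping.lookup (principal_div X h + D) Y = (if Y \<in> prime_divisors X \<and> Y \<inter> U = {} then 1 else 0)"
proof -
  let ?f = "\<lambda>Y. if Y \<in> prime_divisors X \<and> Y \<inter> U = {} then 1 else 0 :: int"
  define DU where "DU = Abs_poly_mapping ?f"
  have "{Y. ?f Y \<noteq> 0} = {Y\<in>prime_divisors X. Y \<inter> U = {}}" by auto
  then have "finite {Y. ?f Y \<noteq> 0}" using finite_prime_divisors_missing[OF U] by simp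
  then have l: "Poly_Mapping.lookup DU = ?f" unfolding DU_def by (rule Poly_Mapping.lookup_Abs_poly_mapping)
  have "Poly_Mapping.keys DU \<subseteq> prime_divisors X"
    by (auto simp: in_keys_iff l split: if_splits)
  then have "DU \<in> carrier (WDiv X)" by (simp add: WDiv_def)
  then have "div_class X DU \<in> carrier (class_group X)"
    unfolding class_group_def carrier_FactGroup div_class_def by blast
  then have "div_class X DU \<in> div_class X ` K" using cox_data by (simp add: cox_data_def)
  then obtain D where D: "D \<in> K" "div_class X DU = div_class X D" by blast
  have "DU \<in> div_class X DU"
    unfolding div_class_eq using PDiv_closed(1) by (intro CollectI exI[of _ 0]) simp
  then have "DU \<in> div_class X D" by (simp only: D(2))
  then obtain P where P: "P \<in> PDiv X" "DU = P + D" unfolding div_class_eq by blast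
  then obtain h where "h \<in> carrier FF" "h \<noteq> \<zero>\<^bsub>FF\<^esub>" "P = principal_div X h" unfolding PDiv_def by blast
  then show thesis using that[OF D(1), of h] P(2) l by simp
qed

lemma principal_div_pow:
  assumes "f \<in> carrier FF" "f \<noteq> \<zero>\<^bsub>FF\<^esub>"
  shows "f [^]\<^bsub>FF\<^esub> (n::nat) \<noteq> \<zero>\<^bsub>FF\<^esub> \<and> principal_div X (f [^]\<^bsub>FF\<^esub> n) = frag_cmul (int n) (principal_div X f)"
proof (induction n)
  case 0
  show ?case by (simp add: principal_div_one)
next
  case (Suc n)
  have "principal_div X (f [^]\<^bsub>FF\<^esub> Suc n) = frag_cmul (int n) (principal_div X f) + principal_div X f"
    using principal_div_mult[of "f [^]\<^bsub>FF\<^esub> n" f] Suc assms by simp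
  also have "\<dots> = frag_cmul (int (Suc n)) (principal_div X f)"
    using frag_cmul_distrib[of "int n" 1 "principal_div X f"] by (simp add: add.commute)
  finally show ?case using F.field_mult_nonzero[of "f [^]\<^bsub>FF\<^esub> n" f] Suc assms by simp
qed

lemma finprod_zero_exp: "gens G \<Longrightarrow> (\<And>g. g \<in> G \<Longrightarrow> a g = 0) \<Longrightarrow> valG G a = \<one>\<^bsub>FF\<^esub> \<and> degG G a = 0"
  unfolding valG_def degG_def by (intro conjI F.finprod_one_eqI) simp_all

end

section \<open>Combinatorial finiteness in degree zero\<close>

section \<open>Finite generation\<close>

text \<open>Vectors with large entry at i are dominated by the finitely many vectors that work for
  the other indices. What remains are finitely many slices in which the entry at i is fixed, and
  each is covered by the induction hypothesis.\<close>

lemma dickson: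
  fixes A :: "('i \<Rightarrow> nat) set"
  assumes "finite I"
  shows "\<exists>B. B \<subseteq> A \<and> finite B \<and> (\<forall>a\<in>A. \<exists>b\<in>B. \<forall>i\<in>I. b i \<le> a i)"
  using assms
proof (induction I arbitrary: A rule: finite_induct)
  case empty
  show ?case
  proof (cases "A = {}")
    case False
    then obtain a where "a \<in> A" by blast
    then show ?thesis by (intro exI[of _ "{a}"]) auto
  qed auto
next
  case (insert i I)
  obtain B where B: "B \<subseteq> A" "finite B" "\<forall>a\<in>A. \<exists>b\<in>B. \<forall>j\<in>I. b j \<le> a j" using insert.IH[of A] by blast
  \<comment> \<open>From this bound on, \<open>B\<close> controls the coordinate i as well; the
    inserted 0 covers an empty \<open>B\<close>.\<close>
  define m where "m = Max (insert 0 ((\<lambda>b. b i) ` B))"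
  have m: "b i \<le> m" if "b \<in> B" for b unfolding m_def using B(2) that by (intro Max_ge) auto
  have "\<forall>k. \<exists>C. C \<subseteq> {a\<in>A. a i = k} \<and> finite C \<and> (\<forall>a\<in>{a\<in>A. a i = k}. \<exists>b\<in>C. \<forall>j\<in>I. b j \<le> a j)"
    by (rule allI) (rule insert.IH)
  from choice[OF this] obtain C where C: "\<And>k. C k \<subseteq> {a\<in>A. a i = k} \<and> finite (C k) \<and>
      (\<forall>a\<in>{a\<in>A. a i = k}. \<exists>b\<in>C k. \<forall>j\<in>I. b j \<le> a j)" by auto
  let ?B = "B \<union> (\<Union>k<m. C k)"
  have "\<exists>b\<in>?B. \<forall>j\<in>insert i I. b j \<le> a j" if a: "a \<in> A" for a
  proof (cases "a i < m")
    case True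
    obtain b where b: "b \<in> C (a i)" "\<forall>j\<in>I. b j \<le> a j" using C[of "a i"] a by blast
    moreover have "b i = a i" using C[of "a i"] b(1) by blast
    ultimately show ?thesis using True by (intro bexI[of _ b]) auto
  next
    case False
    obtain b where "b \<in> B" "\<forall>j\<in>I. b j \<le> a j" using B(3) a by blast
    then show ?thesis using m[of b] False by (intro bexI[of _ b]) auto
  qed
  moreover have "finite ?B" using B C by auto
  moreover have "?B \<subseteq> A" using B C by blast
  ultimately show ?case by blast
qed

context variety_space begin

lemma regular_ring_simps:
  "carrier (regular_ring X U) = reg X U"
  "monoid.mult (regular_ring X U) = (\<lambda>f g. restrict (\<lambda>x. f x * g x) U)"
  "\<one>\<^bsub>regular_ring X U\<^esub> = restrict (\<lambda>x. 1) U" "\<zero>\<^bsub>regular_ring X U\<^esub> = restrict (\<lambda>x. 0) U"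
  "add (regular_ring X U) = (\<lambda>f g. restrict (\<lambda>x. f x + g x) U)"
  by (simp_all add: regular_ring_def)

lemma ring_regular_ring:
  assumes U: "op U"
  shows "ring (regular_ring X U)"
proof -
  have e: "f \<in> extensional U" if "f \<in> reg X U" for f using reg_ext[OF U that] .
  have id: "restrict (\<lambda>x. f x) U = f" if "f \<in> reg X U" for f using extensional_restrict[OF e[OF that]] by simp
  have neg: "restrict (\<lambda>x. - f x) U \<in> reg X U" if "f \<in> reg X U" for f
  proof -
    have "restrict (\<lambda>x. restrict (\<lambda>x. - 1) U x * f x) U \<in> reg X U" by (rule reg_mult[OF U reg_const[OF U] that])
    moreover have "restrict (\<lambda>x. restrict (\<lambda>x. - 1) U x * f x) U = restrict (\<lambda>x. - f x) U"
      by (rule restrict_eqI, simp)+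
    ultimately show ?thesis by simp
  qed
  have "abelian_group (regular_ring X U)"
  proof (rule abelian_groupI, unfold regular_ring_simps)
    show "\<exists>g\<in>reg X U. restrict (\<lambda>x. g x + f x) U = restrict (\<lambda>x. 0) U" if "f \<in> reg X U" for f
      by (rule bexI[OF _ neg[OF that]]) ((rule restrict_eqI, simp)+)
    show "restrict (\<lambda>x. restrict (\<lambda>x. 0) U x + f x) U = f" if "f \<in> reg X U" for f
    proof -
      have "restrict (\<lambda>x. restrict (\<lambda>x. 0) U x + f x) U = restrict (\<lambda>x. f x) U" by (rule restrict_eqI, simp)+
      then show ?thesis using id[OF that] by simp
    qed
    show "restrict (\<lambda>x. restrict (\<lambda>x. f x + g x) U x + h x) U = restrict (\<lambda>x. f x + restrict (\<lambda>x. g x + h x) U x) U"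
      for f g h :: "'x \<Rightarrow> 'k" by (rule restrict_eqI) (simp add: add.assoc)
    show "restrict (\<lambda>x. f x + g x) U = restrict (\<lambda>x. g x + f x) U" for f g :: "'x \<Rightarrow> 'k"
      by (simp add: add.commute)
  qed (simp_all add: reg_add[OF U] reg_const[OF U])
  moreover have "Group.monoid (regular_ring X U)"
  proof (rule monoidI, unfold regular_ring_simps)
    fix f assume f: "f \<in> reg X U"
    have "restrict (\<lambda>x. restrict (\<lambda>x. 1) U x * f x) U = restrict (\<lambda>x. f x) U"
      "restrict (\<lambda>x. f x * restrict (\<lambda>x. 1) U x) U = restrict (\<lambda>x. f x) U" by (rule restrict_eqI, simp)+
    then show "restrict (\<lambda>x. restrict (\<lambda>x. 1) U x * f x) U = f" "restrict (\<lambda>x. f x * restrict (\<lambda>x. 1) U x) U = f"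
      using id[OF f] by simp_all
    show "restrict (\<lambda>x. restrict (\<lambda>x. f x * g x) U x * h x) U = restrict (\<lambda>x. f x * restrict (\<lambda>x. g x * h x) U x) U"
      for f g h :: "'x \<Rightarrow> 'k" by (rule restrict_eqI) (simp add: mult.assoc)
  qed (simp_all add: reg_mult[OF U] reg_const[OF U])
  ultimately show ?thesis
    by (rule ringI) (unfold regular_ring_simps, (rule restrict_eqI, simp add: algebra_simps)+)
qed

lemma rat_class_restrict: "rat_class X U (restrict f U) = rat_class X U f"
  by (simp add: rat_class_def)

end

context cox_space begin

theorem regular_functions_fin_gen:
  assumes fg: "fin_gen_algebra CR (cox_const X K \<chi>)" and U: "op U" "U \<noteq> {}"
  shows "fin_gen_algebra (regular_ring X U) (regular_const U)"
proof -
  obtain S where S: "finite S" "S \<subseteq> carrier CR" "generate_ring CR (range (cox_const X K \<chi>) \<union> S) = carrier CR"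
    using fg unfolding fin_gen_algebra_def by blast
  obtain G0 where G0: "gens G0" "\<And>g. g \<in> G0 \<Longrightarrow> snd g \<in> div_sections X TX (fst g)"
    and span: "\<And>G' D f. gens G' \<Longrightarrow> G0 \<subseteq> G' \<Longrightarrow> D \<in> K \<Longrightarrow> f \<in> div_sections X TX D \<Longrightarrow> f \<in> Msp G' D"
    using cox_span[OF S] by blast
  obtain D h where D: "D \<in> K" and h: "h \<in> carrier FF" "h \<noteq> \<zero>\<^bsub>FF\<^esub>"
    and dh: "\<forall>Y. Poly_Mapping.lookup (principal_div X h + D) Y = (if Y \<in> prime_divisors X \<and> Y \<inter> U = {} then 1 else 0)"
    by (rule divisor_of_complement[OF U])
  note hi = F.field_inv[OF h]
  \<comment> \<open>As a section of O(D), h is the canonical section of the reduced divisor of the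
    complement; its inverse is adjoined in degree -D.\<close>
  define G where "G = insert (- D, inv\<^bsub>FF\<^esub> h) G0"
  have G: "gens G" using G0(1) K_uminus[OF D] hi(1) by (auto simp: G_def gens_def)
  \<comment> \<open>Over U the divisors of h and -D agree, so the inverse of h is a section of O(-D)
    there.\<close>
  have "inv\<^bsub>FF\<^esub> h \<in> div_sections X U (- D)"
  proof (rule principal_in_div_sections[OF hi(1,4)])
    fix Y assume "Y \<in> prime_divisors X" "Y \<inter> U \<noteq> {}"
    then have "Poly_Mapping.lookup (principal_div X h + D) Y = 0" using dh[rule_format, of Y] by simp
    then show "0 \<le> Poly_Mapping.lookup (principal_div X (inv\<^bsub>FF\<^esub> h) + - D) Y"
      by (simp add: principal_div_inv[OF h] lookup_add lookup_minus)
  qed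
  moreover have "snd g \<in> div_sections X U (fst g)" if "g \<in> G0" for g
    using G0(2)[OF that] div_sections_mono[OF op_topspace[OF U(1)]] by blast
  ultimately have Gsec: "snd g \<in> div_sections X U (fst g)" if "g \<in> G" for g
    using that unfolding G_def by auto
  have reg_span: "rat_class X U f \<in> Msp G 0" if f: "f \<in> reg X U" for f
  proof (cases "rat_class X U f = \<zero>\<^bsub>FF\<^esub>")
    case True
    then show ?thesis using Msp.zero by simp
  next
    case nz: False
    let ?g = "rat_class X U f"
    have fr: "regular_on U f" by (rule regular_onI[OF U f])
    note gc = rat_class_carrier[OF fr]
    let ?P = "{Y\<in>prime_divisors X. Y \<inter> U = {}}"
    have P: "finite ?P" by (rule finite_prime_divisors_missing[OF U])
    let ?l = "\<lambda>Y. Poly_Mapping.lookup (principal_div X ?g) Y"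
    \<comment> \<open>A crude bound for the pole orders along the divisors outside U: the sum of the
      absolute values of the orders dominates each of them.\<close>
    define n where "n = (\<Sum>Y\<in>?P. nat \<bar>?l Y\<bar>)"
    have n: "- int n \<le> ?l Y" if "Y \<in> ?P" for Y
    proof -
      have "nat \<bar>?l Y\<bar> \<le> n" unfolding n_def by (rule member_le_sum[OF that _ P]) simp
      then show ?thesis by linarith
    qed
    let ?f = "?g \<otimes>\<^bsub>FF\<^esub> h [^]\<^bsub>FF\<^esub> n"
    note hp = principal_div_pow[OF h, of n]
    have hn: "h [^]\<^bsub>FF\<^esub> n \<in> carrier FF" using h by simp
    have "?f \<in> div_sections X TX (frag_cmul (int n) D)"
    proof (rule principal_in_div_sections)
      show "?f \<in> carrier FF" using gc hn by simp
      show "?f \<noteq> \<zero>\<^bsub>FF\<^esub>" using F.field_mult_nonzero[OF gc hn nz] hp by blast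
      fix Y assume Y: "Y \<in> prime_divisors X"
      \<comment> \<open>In O(n D), multiplication by h^n raises the order by n along the divisors
        missing U and changes nothing along the others.\<close>
      have "principal_div X ?f + frag_cmul (int n) D = principal_div X ?g + frag_cmul (int n) (principal_div X h + D)"
        using principal_div_mult[OF gc nz hn] hp by (simp add: frag_cmul_distrib2 add.assoc)
      then have e: "Poly_Mapping.lookup (principal_div X ?f + frag_cmul (int n) D) Y =
          ?l Y + int n * (if Y \<inter> U = {} then 1 else 0)"
        using dh[rule_format, of Y] Y by (simp add: lookup_add)
      show "0 \<le> Poly_Mapping.lookup (principal_div X ?f + frag_cmul (int n) D) Y"
      proof (cases "Y \<inter> U = {}")
        case True
        then show ?thesis unfolding e using n[of Y] Y by simp
      next
        case False
        then show ?thesis unfolding e using lookup_principal_div_regular[OF fr nz Y] by simp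
      qed
    qed
    moreover have nD: "frag_cmul (int n) D \<in> K"
    proof (induction n)
      case (Suc n)
      then show ?case using K_add[OF Suc D] frag_cmul_distrib[of "int n" 1 D] by (simp add: add.commute)
    qed (simp add: K_zero)
    ultimately have "?f \<in> Msp G (frag_cmul (int n) D)" by (intro span[OF G]) (auto simp: G_def)
    moreover have "inv\<^bsub>FF\<^esub> h [^]\<^bsub>FF\<^esub> n \<in> Msp G (frag_cmul (int n) (- D))"
      using Msp_pow[OF G Msp_gen[OF G, of "(- D, inv\<^bsub>FF\<^esub> h)"], of n] by (simp add: G_def)
    ultimately have "?f \<otimes>\<^bsub>FF\<^esub> inv\<^bsub>FF\<^esub> h [^]\<^bsub>FF\<^esub> n \<in> Msp G (frag_cmul (int n) D + frag_cmul (int n) (- D))"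
      by (rule Msp_mult[OF G])
    moreover have "frag_cmul (int n) D + frag_cmul (int n) (- D) = 0"
      using frag_cmul_distrib2[of "int n" D "- D"] by simp
    moreover have "?f \<otimes>\<^bsub>FF\<^esub> inv\<^bsub>FF\<^esub> h [^]\<^bsub>FF\<^esub> n = ?g"
    proof -
      have "?f \<otimes>\<^bsub>FF\<^esub> inv\<^bsub>FF\<^esub> h [^]\<^bsub>FF\<^esub> n = ?g \<otimes>\<^bsub>FF\<^esub> (h [^]\<^bsub>FF\<^esub> n \<otimes>\<^bsub>FF\<^esub> inv\<^bsub>FF\<^esub> h [^]\<^bsub>FF\<^esub> n)"
        using gc h(1) hi(1) by (simp add: F.m_assoc)
      also have "h [^]\<^bsub>FF\<^esub> n \<otimes>\<^bsub>FF\<^esub> inv\<^bsub>FF\<^esub> h [^]\<^bsub>FF\<^esub> n = \<one>\<^bsub>FF\<^esub>"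
        unfolding F.nat_pow_distrib[OF h(1) hi(1), symmetric] hi(2) by simp
      finally show ?thesis using gc by simp
    qed
    ultimately show ?thesis by simp
  qed
  \<comment> \<open>The monomial with exponents a moved to degree zero; this has a meaning when its
    degree is principal.\<close>
  define w where "w a = valG G a \<otimes>\<^bsub>FF\<^esub> \<chi> (degG G a)" for a
  have w_reg: "\<exists>f. f \<in> reg X U \<and> w a = rat_class X U f" if a: "degG G a \<in> K0" for a
  proof -
    have "w a \<in> div_sections X U (degG G a + - degG G a)"
      unfolding w_def by (rule div_sections_mult[OF valG_div_sections[OF G Gsec] chi_div_sections[OF a]])
    then have "w a \<in> div_sections X U 0" by simp
    then show ?thesis by (rule div_sections_zero_regular[OF U]) blast
  qed
  \<comment> \<open>The zero vector is excluded: it lies below every vector, and subtracting it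
    would make no progress in the reduction of \<open>w a\<close>.\<close>
  obtain B where B: "B \<subseteq> {a. degG G a \<in> K0 \<and> (\<exists>g\<in>G. a g \<noteq> 0)}" "finite B"
    "\<And>a. degG G a \<in> K0 \<Longrightarrow> \<exists>g\<in>G. a g \<noteq> 0 \<Longrightarrow> \<exists>b\<in>B. \<forall>g\<in>G. b g \<le> a g"
    using dickson[OF gensD(1)[OF G], of "{a. degG G a \<in> K0 \<and> (\<exists>g\<in>G. a g \<noteq> 0)}"] by auto
  have "\<forall>b\<in>B. \<exists>f. f \<in> reg X U \<and> w b = rat_class X U f" using w_reg B(1) by blast
  then obtain F where F: "\<And>b. b \<in> B \<Longrightarrow> F b \<in> reg X U \<and> w b = rat_class X U (F b)" by metis
  let ?R = "regular_ring X U"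
  let ?H = "range (regular_const U) \<union> F ` B"
  interpret R: ring ?R by (rule ring_regular_ring[OF U(1)])
  have Hsub: "?H \<subseteq> carrier ?R"
    using F reg_const[OF U(1)] by (auto simp: regular_ring_simps regular_const_def)
  have gsub: "generate_ring ?R ?H \<subseteq> reg X U"
    using R.generate_ring_incl[OF Hsub] by (simp add: regular_ring_simps)
  \<comment> \<open>The generated subring is compared with \<open>Msp G 0\<close> inside the
    function field, where restriction to U is injective on classes.\<close>
  define Q where "Q = {rat_class X U f | f. f \<in> generate_ring ?R ?H}"
  have ro: "regular_on U f" if "f \<in> generate_ring ?R ?H" for f using gsub that regular_onI[OF U] by blast
  have Qadd: "x \<oplus>\<^bsub>FF\<^esub> y \<in> Q" if xy: "x \<in> Q" "y \<in> Q" for x y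
  proof -
    obtain f g where fg: "f \<in> generate_ring ?R ?H" "x = rat_class X U f" "g \<in> generate_ring ?R ?H" "y = rat_class X U g"
      using xy unfolding Q_def by blast
    have "x \<oplus>\<^bsub>FF\<^esub> y = rat_class X U (f \<oplus>\<^bsub>?R\<^esub> g)"
      using function_field_add_same[OF ro ro, OF fg(1,3)] fg(2,4) by (simp add: regular_ring_simps rat_class_restrict)
    then show ?thesis unfolding Q_def using generate_ring.eng_add[OF fg(1,3)] by blast
  qed
  have Qmult: "x \<otimes>\<^bsub>FF\<^esub> y \<in> Q" if xy: "x \<in> Q" "y \<in> Q" for x y
  proof -
    obtain f g where fg: "f \<in> generate_ring ?R ?H" "x = rat_class X U f" "g \<in> generate_ring ?R ?H" "y = rat_class X U g"
      using xy unfolding Q_def by blast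
    have "x \<otimes>\<^bsub>FF\<^esub> y = rat_class X U (f \<otimes>\<^bsub>?R\<^esub> g)"
      using function_field_mult_same[OF ro ro, OF fg(1,3)] fg(2,4) by (simp add: regular_ring_simps rat_class_restrict)
    then show ?thesis unfolding Q_def using generate_ring.eng_mult[OF fg(1,3)] by blast
  qed
  have Qconst: "rat_const X c \<in> Q" for c
  proof -
    have "regular_const U c \<in> generate_ring ?R ?H" by (rule generate_ring.incl) blast
    moreover have "rat_const X c = rat_class X U (regular_const U c)"
      using rat_const_eq[OF U] by (simp add: regular_const_def rat_class_restrict)
    ultimately show ?thesis unfolding Q_def by blast
  qed
  have QB: "w b \<in> Q" if "b \<in> B" for b
  proof -
    have "F b \<in> generate_ring ?R ?H" by (rule generate_ring.incl) (use that in blast)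
    then show ?thesis unfolding Q_def using F[OF that] by blast
  qed
  have Qw: "w a \<in> Q" if "degG G a \<in> K0" for a
    using that
  proof (induction "\<Sum>g\<in>G. a g" arbitrary: a rule: less_induct)
    case less
    show ?case
    proof (cases "\<exists>g\<in>G. a g \<noteq> 0")
      case False
      then have "w a = rat_const X 1"
        unfolding w_def using finprod_zero_exp[OF G, of a] by (simp add: chi_zero function_field_one[symmetric])
      then show ?thesis using Qconst by simp
    next
      case True
      obtain b where b: "b \<in> B" "\<forall>g\<in>G. b g \<le> a g" using B(3)[OF less(2) True] by blast
      have bK: "degG G b \<in> K0" and "\<exists>g\<in>G. b g \<noteq> 0" using B(1) b(1) by auto
      then obtain g0 where g0: "g0 \<in> G" "b g0 \<noteq> 0" by blast
      let ?c = "\<lambda>g. a g - b g"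
      have ab: "a g = ?c g + b g" if "g \<in> G" for g using b(2) that by simp
      have d: "degG G a = degG G ?c + degG G b"
        using degG_cong[of G a "\<lambda>g. ?c g + b g"] ab degG_add[of G ?c b] by simp
      have v: "valG G a = valG G ?c \<otimes>\<^bsub>FF\<^esub> valG G b"
        using valG_cong[OF G, of a "\<lambda>g. ?c g + b g"] ab valG_add[OF G, of ?c b] by simp
      \<comment> \<open>The principal divisors in K form a group, so the quotient of two monomials
        of principal degree again has principal degree and is reduced further by induction.\<close>
      have cK: "degG G ?c \<in> K0" using K0_diff[OF less(2) bK] d by simp
      have "(\<Sum>g\<in>G. ?c g) < (\<Sum>g\<in>G. a g)"
      proof (rule sum_strict_mono_ex1[OF gensD(1)[OF G]])
        show "\<exists>g\<in>G. ?c g < a g" using g0 b(2) by (intro bexI[OF _ g0(1)]) force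
      qed simp
      then have "w ?c \<in> Q" using less(1) cK by blast
      then have "w ?c \<otimes>\<^bsub>FF\<^esub> w b \<in> Q" by (rule Qmult[OF _ QB[OF b(1)]])
      moreover have "w a = w ?c \<otimes>\<^bsub>FF\<^esub> w b"
        unfolding w_def d v chi_add[OF cK bK]
        using valG_carrier[OF G] chi_carrier[OF cK] chi_carrier[OF bK] by (simp add: F.m_ac)
      ultimately show ?thesis by simp
    qed
  qed
  have MQ: "x \<in> Q" if "x \<in> Msp G 0" for x
    using that
  proof induction
    case zero
    show ?case using Qconst[of 0] by (simp add: function_field_zero)
  next
    case (add x y)
    then show ?case using Qadd by blast
  next
    case (mono a c)
    then have "degG G a \<in> K0" by simp
    then show ?case using Qmult[OF Qconst Qw] by (simp add: w_def)
  qed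
  have "generate_ring ?R ?H = carrier ?R"
  proof
    show "generate_ring ?R ?H \<subseteq> carrier ?R" using gsub by (simp add: regular_ring_simps)
    show "carrier ?R \<subseteq> generate_ring ?R ?H"
    proof
      fix f assume "f \<in> carrier ?R"
      then have f: "f \<in> reg X U" by (simp add: regular_ring_simps)
      have "rat_class X U f \<in> Q" by (rule MQ[OF reg_span[OF f]])
      then obtain g where g: "g \<in> generate_ring ?R ?H" "rat_class X U f = rat_class X U g" unfolding Q_def by blast
      have "\<forall>x\<in>U. f x = g x"
        using g(2) unfolding rat_class_eq_iff[OF regular_onI[OF U f] ro[OF g(1)]] by simp
      moreover have "f \<in> extensional U" "g \<in> extensional U" using reg_ext[OF U(1)] f gsub g(1) by blast+
      ultimately have "f = g" by (intro extensionalityI[of _ U]) auto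
      then show "f \<in> generate_ring ?R ?H" using g(1) by simp
    qed
  qed
  moreover have "finite (F ` B)" "F ` B \<subseteq> carrier ?R" using B(2) Hsub by auto
  ultimately show ?thesis unfolding fin_gen_algebra_def by blast
qed

end

theorem corollary2p1:
  fixes X :: "('x, 'k::{alg_closed_field, field_char_0}) fun_space"
  assumes "normal_variety X"
    and "has_fin_gen_cox_ring X"
    and "openin (pts X) U"
  shows "fin_gen_algebra (regular_ring X U) (regular_const U)"
proof -
  obtain K \<chi> where K: "cox_data X K \<chi>" "fin_gen_algebra (cox_ring X K \<chi>) (cox_const X K \<chi>)"
    using assms(2) unfolding has_fin_gen_cox_ring_def by blast
  interpret cox_space X K \<chi>
    by unfold_locales (use assms(1) K(1) in \<open>auto simp: normal_variety_def\<close>)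
  show ?thesis
  proof (cases "U = {}")
    \<comment> \<open>Over the empty set there is a single section, so the constants generate. The
      case is separate because U must be nonempty to define classes of rational functions.\<close>
    case True
    interpret R: ring "regular_ring X U" by (rule ring_regular_ring[OF assms(3)])
    have "carrier (regular_ring X U) \<subseteq> {\<one>\<^bsub>regular_ring X U\<^esub>}"
      using reg_ext[OF assms(3)] True by (auto simp: regular_ring_simps restrict_def)
    moreover have "range (regular_const U) \<subseteq> carrier (regular_ring X U)"
      using reg_const[OF assms(3)] by (auto simp: regular_ring_simps regular_const_def)
    ultimately have "generate_ring (regular_ring X U) (range (regular_const U)) = carrier (regular_ring X U)"
      using R.generate_ring_incl[of "range (regular_const U)"] generate_ring.one[of "regular_ring X U"] by blast
    then show ?thesis unfolding fin_gen_algebra_def by (intro exI[of _ "{}"]) simp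
  next
    case False
    then show ?thesis by (rule regular_functions_fin_gen[OF K(2) assms(3)])
  qed
qed

end
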